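(* Let $Q(x)=\frac{\sqrt2}{x+i}$ and fix $c>0$. For every $\epsilon>0$ there exists $\delta>0$ such that if $u_0\in H^1_+$ satisfies $\|u_0-Q\|_{H^1}<\delta$ and the corresponding maximal lifespan solution $u$ of $$iu_t+u_{xx}-2iu\,\Pi^+\partial_x(|u|^2)=0,\qquad u(0)=u_0,$$ satisfies $\|u(t)\|_{\dot H^1}\ge c$ for all times of existence $t$, then $$\inf_{\lambda>0;\ \theta,y\in\mathbb{R}}\big\|e^{i\theta}\lambda^{1/2}u(t,\lambda\,\cdot+y)-Q\big\|_{H^1}<\epsilon$$ for all times of existence $t$.
   Context: Fourier transform: $\widehat f(\xi)=\frac{1}{\sqrt{2\pi}}\int e^{-i\xi x}f(x)\,dx$. $\Pi^+$ is the Cauchy--Szegő projection $[\Pi^+f](x)=\frac{1}{\sqrt{2\pi}}\int_0^\infty e^{ix\xi}\widehat f(\xi)\,d\xi$. $H^s$ has norm $\|f\|^2_{H^s}=\int(1+|\xi|^2)^s|\widehat f|^2$, $\dot H^s$ has norm $\|f\|_{\dot H^s}^2=\int|\xi|^{2s}|\widehat f|^2$, and $H^s_+=\{f\in H^s:\widehat f=0\text{ on }(-\infty,0)\}$. The equation is locally well-posed in $H^s_+$ for $s>1/2$, and "maximal lifespan solution" refers to the solution on its maximal interval of existence. *)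

theory Defs
  imports "HOL-Analysis.Analysis"
begin

definition L2 :: "(real \<Rightarrow> complex) \<Rightarrow> bool" where
  "L2 f \<longleftrightarrow> f \<in> borel_measurable lborel \<and> integrable lborel (\<lambda>x. (cmod (f x))\<^sup>2)"

definition fourier_trunc :: "real \<Rightarrow> (real \<Rightarrow> complex) \<Rightarrow> real \<Rightarrow> complex" where
  "fourier_trunc R f \<xi> =
     complex_of_real (1 / sqrt (2 * pi)) *
     (LINT x|lborel. indicator {-R..R} x *\<^sub>R (exp (- \<i> * complex_of_real (\<xi> * x)) * f x))"

definition fourier_L2 :: "(real \<Rightarrow> complex) \<Rightarrow> (real \<Rightarrow> complex) \<Rightarrow> bool" where
  "fourier_L2 f g \<longleftrightarrow> L2 f \<and> L2 g \<and>
     ((\<lambda>R. LINT \<xi>|lborel. (cmod (fourier_trunc R f \<xi> - g \<xi>))\<^sup>2) \<longlongrightarrow> 0) at_top"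

definition FT :: "(real \<Rightarrow> complex) \<Rightarrow> real \<Rightarrow> complex" where
  "FT f = (SOME g. fourier_L2 f g)"

definition in_Hs :: "real \<Rightarrow> (real \<Rightarrow> complex) \<Rightarrow> bool" where
  "in_Hs s f \<longleftrightarrow> (\<exists>g. fourier_L2 f g) \<and>
     integrable lborel (\<lambda>\<xi>. (1 + \<xi>\<^sup>2) powr s * (cmod (FT f \<xi>))\<^sup>2)"

definition Hs_norm :: "real \<Rightarrow> (real \<Rightarrow> complex) \<Rightarrow> real" where
  "Hs_norm s f = sqrt (LINT \<xi>|lborel. (1 + \<xi>\<^sup>2) powr s * (cmod (FT f \<xi>))\<^sup>2)"

definition Hdot_norm :: "real \<Rightarrow> (real \<Rightarrow> complex) \<Rightarrow> real" where
  "Hdot_norm s f = sqrt (LINT \<xi>|lborel. \<bar>\<xi>\<bar> powr (2 * s) * (cmod (FT f \<xi>))\<^sup>2)"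

definition in_Hs_plus :: "real \<Rightarrow> (real \<Rightarrow> complex) \<Rightarrow> bool" where
  "in_Hs_plus s f \<longleftrightarrow> in_Hs s f \<and> (AE \<xi> in lborel. \<xi> < 0 \<longrightarrow> FT f \<xi> = 0)"

definition Pi_plus_dx :: "(real \<Rightarrow> complex) \<Rightarrow> real \<Rightarrow> complex" where
  "Pi_plus_dx g = (SOME h. fourier_L2 h (\<lambda>\<xi>. if 0 < \<xi> then \<i> * complex_of_real \<xi> * FT g \<xi> else 0))"

definition pairing :: "(real \<Rightarrow> complex) \<Rightarrow> (real \<Rightarrow> complex) \<Rightarrow> complex" where
  "pairing f \<phi> = (LINT x|lborel. f x * \<phi> x)"

definition test_derivs :: "(nat \<Rightarrow> real \<Rightarrow> complex) \<Rightarrow> bool" where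
  "test_derivs D \<longleftrightarrow> (\<forall>k x. (D k has_vector_derivative D (Suc k) x) (at x))
      \<and> bounded {x. D 0 x \<noteq> 0}"

text \<open>u is an H^1_+ solution on the open interval I (containing 0) of
  i u_t + u_xx - 2 i u Pi^+ d_x(|u|^2) = 0, i.e. u_t = i u_xx + 2 u Pi^+ d_x(|u|^2),
  in the (time-integrated) weak sense, with u in C(I; H^1).\<close>
definition is_solution :: "real set \<Rightarrow> (real \<Rightarrow> real \<Rightarrow> complex) \<Rightarrow> bool" where
  "is_solution I u \<longleftrightarrow> is_interval I \<and> open I \<and> 0 \<in> I \<and>
     (\<forall>t\<in>I. in_Hs_plus 1 (u t)) \<and>
     (\<forall>t\<in>I. ((\<lambda>s. Hs_norm 1 (\<lambda>x. u s x - u t x)) \<longlongrightarrow> 0) (at t within I)) \<and>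
     (\<forall>D. test_derivs D \<longrightarrow> (\<forall>t\<in>I.
        pairing (u t) (D 0) - pairing (u 0) (D 0) =
        (LBINT s=0..t. \<i> * pairing (u s) (D 2) +
            2 * pairing (\<lambda>x. u s x * Pi_plus_dx (\<lambda>y. complex_of_real ((cmod (u s y))\<^sup>2)) x) (D 0))))"

definition max_solution :: "real set \<Rightarrow> (real \<Rightarrow> real \<Rightarrow> complex) \<Rightarrow> bool" where
  "max_solution I u \<longleftrightarrow> is_solution I u \<and>
     \<not> (\<exists>J v. is_solution J v \<and> I \<subset> J \<and> (\<forall>t\<in>I. v t = u t))"

definition Q :: "real \<Rightarrow> complex" where
  "Q x = complex_of_real (sqrt 2) / (complex_of_real x + \<i>)"

end

theory Submission
  imports Defs "HOL-Probability.Probability"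
begin

text \<open>For \<^term>\<open>u\<close> in the Hardy space let \<^term>\<open>g\<close> be the Szego projection of \<^term>\<open>u * cnj u\<close> and
  \<^term>\<open>r = u' - \<i> * g * u\<close>. Up to the factor \<^term>\<open>- \<i>\<close>, \<^term>\<open>r\<close> is the Lax operator of \<^term>\<open>u\<close> 
  applied to \<^term>\<open>u\<close>, and it vanishes at \<^term>\<open>Q\<close>.

  Conservation laws. For large \<^term>\<open>k\<close> the matrix element at \<^term>\<open>u\<close> of the resolvent of the Lax operator is a 
  supremum of expressions that are affine or positive quadratic in \<^term>\<open>u\<close>. This bounds its increments in time from below, 
  and by the Lax structure these bounds have vanishing derivative along a weak solution, so the matrix element is constant. 
  Its expansion as \<^term>\<open>k\<close> tends to infinity shows that the mass is constant and that the norm of \<^term>\<open>r\<close> at time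
  \<open>t\<close> is at most its value at time \<open>0\<close>.

  Stability. If \<^term>\<open>r\<close> is small then \<^term>\<open>(u, g)\<close> almost solves \<^term>\<open>u' = \<i> * g * u\<close>, 
  \<^term>\<open>g' = \<i> * g * g\<close>. The lower bound on the derivative bounds the length scale of \<^term>\<open>u\<close>, and a symmetry of the 
  equation makes the pair agree at one point with that of \<^term>\<open>Q\<close>. Gronwall's inequality then gives closeness on bounded 
  intervals, and no mass is left for the tails because the mass of \<^term>\<open>u\<close> is nearly that of \<^term>\<open>Q\<close>.\<close>

subsection \<open>The space of square-integrable functions\<close>

text \<open>The solution is only continuous in time with values in H1 and solves the equation
  weakly, so what can be differentiated in time is its pairing with a fixed H1 function. The
  supremum supplies that function: the optimiser at one time is an admissible competitor at every
  other time, and freezing it leaves a lower bound linear in the increment of the solution. Such a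
  bound holds on both sides of every time, which is why a lower bound alone yields constancy. The
  parameter \<open>k\<close> must be large because the potential part of the Lax operator is bounded
  only by the squared sup norm of \<open>u\<close>; the derivative part is nonnegative on Hardy
  functions, so the shifted form becomes positive. In the stability part a Hardy function is
  orthogonal to its own conjugate and is therefore controlled by its real part. This is how the
  nonlocal function \<open>g\<close>, its derivative and its Riccati equation are estimated through
  the local quantity \<open>u * cnj u\<close>. Most explicit constants there descend from one bound:
  the mass stays below \<open>2 * pi + 1\<close>, which is less than 9, so that \<open>nrm u\<close>
  is at most 3.\<close>

definition ip :: "(real \<Rightarrow> complex) \<Rightarrow> (real \<Rightarrow> complex) \<Rightarrow> complex" where
  "ip f g = (LINT x|lborel. f x * cnj (g x))"

definition nrm :: "(real \<Rightarrow> complex) \<Rightarrow> real" where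
  "nrm f = sqrt (LINT x|lborel. (cmod (f x))\<^sup>2)"

lemma borel_measurable_cnj[measurable (raw)]:
  "f \<in> borel_measurable M \<Longrightarrow> (\<lambda>x. cnj (f x)) \<in> borel_measurable M"
  by (rule borel_measurable_continuous_on[where f=cnj]) (auto intro: continuous_intros)

lemma L2_measurable[measurable_dest]: "L2 f \<Longrightarrow> f \<in> borel_measurable borel"
  by (auto simp: L2_def)

lemma L2_integrable: "L2 f \<Longrightarrow> integrable lborel (\<lambda>x. (cmod (f x))\<^sup>2)"
  by (auto simp: L2_def)

lemma L2_dominated:
  assumes "integrable lborel h" "f \<in> borel_measurable borel" "AE x in lborel. (cmod (f x))\<^sup>2 \<le> h x"
  shows "L2 f"
proof -
  have "integrable lborel (\<lambda>x. (cmod (f x))\<^sup>2)"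
    by (rule Bochner_Integration.integrable_bound[OF assms(1)]) (use assms in auto)
  then show ?thesis using assms(2) by (auto simp: L2_def)
qed

lemma L2_prod_norm_integrable:
  assumes "L2 f" "L2 g"
  shows "integrable lborel (\<lambda>x. cmod (f x) * cmod (g x))"
proof (rule Bochner_Integration.integrable_bound)
  show "integrable lborel (\<lambda>x. (cmod (f x))\<^sup>2 + (cmod (g x))\<^sup>2)"
    using assms by (auto simp: L2_def)
  show "(\<lambda>x. cmod (f x) * cmod (g x)) \<in> borel_measurable lborel"
    using assms by (auto simp: L2_def)
  have "\<bar>a * b\<bar> \<le> \<bar>a\<^sup>2 + b\<^sup>2\<bar>" for a b :: real
  proof -
    have "2 * (\<bar>a\<bar> * \<bar>b\<bar>) \<le> a\<^sup>2 + b\<^sup>2" using sum_squares_bound[of "\<bar>a\<bar>" "\<bar>b\<bar>"] by simp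
    moreover have "0 \<le> \<bar>a\<bar> * \<bar>b\<bar>" by simp
    ultimately show ?thesis unfolding abs_mult by linarith
  qed
  then show "AE x in lborel. norm (cmod (f x) * cmod (g x)) \<le> norm ((cmod (f x))\<^sup>2 + (cmod (g x))\<^sup>2)"
    unfolding real_norm_def by (intro AE_I2)
qed

lemma L2_prod_integrable[intro]:
  assumes "L2 f" "L2 g"
  shows "integrable lborel (\<lambda>x. f x * g x)"
  by (rule Bochner_Integration.integrable_bound[OF L2_prod_norm_integrable[OF assms]])
     (use assms in \<open>auto simp: L2_def norm_mult\<close>)

lemma L2_cnj[intro, simp]: "L2 f \<Longrightarrow> L2 (\<lambda>x. cnj (f x))"
  by (auto simp: L2_def)

lemma L2_ip_integrable[intro]: "L2 f \<Longrightarrow> L2 g \<Longrightarrow> integrable lborel (\<lambda>x. f x * cnj (g x))"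
  by (rule L2_prod_integrable) auto

lemma L2_zero[intro, simp]: "L2 (\<lambda>x. 0)"
  by (auto simp: L2_def)

lemma L2_cmult[intro, simp]: "L2 f \<Longrightarrow> L2 (\<lambda>x. c * f x)"
  by (auto simp: L2_def norm_mult power_mult_distrib)

lemma L2_add[intro, simp]:
  assumes "L2 f" "L2 g" shows "L2 (\<lambda>x. f x + g x)"
proof (rule L2_dominated)
  show "integrable lborel (\<lambda>x. 2 * (cmod (f x))\<^sup>2 + 2 * (cmod (g x))\<^sup>2)"
    using assms by (auto simp: L2_def)
  have "(cmod (a + b))\<^sup>2 \<le> 2 * (cmod a)\<^sup>2 + 2 * (cmod b)\<^sup>2" for a b
  proof -
    have "(cmod (a + b))\<^sup>2 \<le> (cmod a + cmod b)\<^sup>2"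
      by (simp add: norm_triangle_ineq power_mono)
    also have "\<dots> \<le> 2 * (cmod a)\<^sup>2 + 2 * (cmod b)\<^sup>2"
      using sum_squares_bound[of "cmod a" "cmod b"] by (simp add: power2_sum)
    finally show ?thesis .
  qed
  then show "AE x in lborel. (cmod (f x + g x))\<^sup>2 \<le> 2 * (cmod (f x))\<^sup>2 + 2 * (cmod (g x))\<^sup>2"
    by auto
qed (use assms in \<open>auto simp: L2_def\<close>)

lemma L2_uminus[intro, simp]: "L2 f \<Longrightarrow> L2 (\<lambda>x. - f x)"
  by (auto simp: L2_def)

lemma L2_diff[intro, simp]: "L2 f \<Longrightarrow> L2 g \<Longrightarrow> L2 (\<lambda>x. f x - g x)"
  using L2_add[of f "\<lambda>x. - g x"] by auto

lemma L2_bounded_mult: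
  assumes "L2 f" "h \<in> borel_measurable borel" "\<And>x. cmod (h x) \<le> B"
  shows "L2 (\<lambda>x. h x * f x)" "L2 (\<lambda>x. f x * h x)"
proof -
  show "L2 (\<lambda>x. h x * f x)"
  proof (rule L2_dominated)
    show "integrable lborel (\<lambda>x. B\<^sup>2 * (cmod (f x))\<^sup>2)" using assms by (auto simp: L2_def)
    have "(cmod (h x * f x))\<^sup>2 \<le> B\<^sup>2 * (cmod (f x))\<^sup>2" for x
      unfolding norm_mult power_mult_distrib
      by (intro mult_right_mono power_mono) (use assms in auto)
    then show "AE x in lborel. (cmod (h x * f x))\<^sup>2 \<le> B\<^sup>2 * (cmod (f x))\<^sup>2" by auto
  qed (use assms in \<open>auto simp: L2_def\<close>)
  then show "L2 (\<lambda>x. f x * h x)" by (simp add: mult.commute)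
qed

lemma L2_cong_AE: "L2 f \<Longrightarrow> g \<in> borel_measurable borel \<Longrightarrow> AE x in lborel. f x = g x \<Longrightarrow> L2 g"
  by (rule L2_dominated[of "\<lambda>x. (cmod (f x))\<^sup>2"]) (auto simp: L2_def)

lemma nrm_nonneg[simp]: "0 \<le> nrm f"
  by (simp add: nrm_def)

lemma nrm_sq: "(nrm f)\<^sup>2 = (LINT x|lborel. (cmod (f x))\<^sup>2)"
  by (simp add: nrm_def)

lemma nrm_cong_AE:
  assumes "f \<in> borel_measurable borel" "g \<in> borel_measurable borel" "AE x in lborel. f x = g x"
  shows "nrm f = nrm g"
  unfolding nrm_def by (intro arg_cong[where f=sqrt] integral_cong_AE) (use assms in auto)

lemma ip_cong_AE:
  assumes "f \<in> borel_measurable borel" "f' \<in> borel_measurable borel" "AE x in lborel. f x = f' x"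
    "g \<in> borel_measurable borel" "g' \<in> borel_measurable borel" "AE x in lborel. g x = g' x"
  shows "ip f g = ip f' g'"
  unfolding ip_def by (intro integral_cong_AE) (use assms in auto)

lemma ip_self: "ip f f = complex_of_real ((nrm f)\<^sup>2)"
proof -
  have "ip f f = (LINT x|lborel. complex_of_real ((cmod (f x))\<^sup>2))"
    unfolding ip_def by (simp only: complex_norm_square)
  then show ?thesis unfolding nrm_sq by (simp only: integral_complex_of_real)
qed

lemma Re_ip_self: "Re (ip f f) = (nrm f)\<^sup>2"
  by (simp add: ip_self)

lemma nrm_scale: "nrm (\<lambda>x. c * f x) = cmod c * nrm f"
  unfolding nrm_def by (simp add: norm_mult power_mult_distrib real_sqrt_mult)

lemma nrm_uminus[simp]: "nrm (\<lambda>x. - f x) = nrm f"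
  unfolding nrm_def by simp

lemma nrm_cnj[simp]: "nrm (\<lambda>x. cnj (f x)) = nrm f"
  unfolding nrm_def by simp

lemma nrm_zero[simp]: "nrm (\<lambda>x. 0) = 0"
  unfolding nrm_def by simp

lemma nrm_minus_commute: "nrm (\<lambda>x. f x - g x) = nrm (\<lambda>x. g x - f x)"
  unfolding nrm_def by (simp add: norm_minus_commute)

lemma nrm_mono:
  assumes "L2 g" "f \<in> borel_measurable borel" "AE x in lborel. cmod (f x) \<le> C * cmod (g x)" "0 \<le> C"
  shows "nrm f \<le> C * nrm g"
proof -
  have "(LINT x|lborel. (cmod (f x))\<^sup>2) \<le> (LINT x|lborel. C\<^sup>2 * (cmod (g x))\<^sup>2)"
  proof (rule integral_mono_AE)
    show i: "integrable lborel (\<lambda>x. C\<^sup>2 * (cmod (g x))\<^sup>2)" using assms by (auto simp: L2_def)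
    show a: "AE x in lborel. (cmod (f x))\<^sup>2 \<le> C\<^sup>2 * (cmod (g x))\<^sup>2"
      using assms(3)
    proof eventually_elim
      case (elim x) then have "(cmod (f x))\<^sup>2 \<le> (C * cmod (g x))\<^sup>2"
        by (intro power_mono) auto
      then show ?case by (simp add: power_mult_distrib)
    qed
    show "integrable lborel (\<lambda>x. (cmod (f x))\<^sup>2)"
      using L2_dominated[OF i assms(2) a] by (simp add: L2_def)
  qed
  then have "(nrm f)\<^sup>2 \<le> (C * nrm g)\<^sup>2"
    by (simp add: nrm_sq power_mult_distrib)
  then show ?thesis by (rule power2_le_imp_le) (simp add: assms(4))
qed

lemma ip_add_left[simp]:
  "L2 f \<Longrightarrow> L2 g \<Longrightarrow> L2 h \<Longrightarrow> ip (\<lambda>x. f x + g x) h = ip f h + ip g h"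
  unfolding ip_def by (simp add: distrib_right L2_ip_integrable)

lemma ip_add_right[simp]:
  "L2 f \<Longrightarrow> L2 g \<Longrightarrow> L2 h \<Longrightarrow> ip h (\<lambda>x. f x + g x) = ip h f + ip h g"
  unfolding ip_def by (simp add: distrib_left L2_ip_integrable)

lemma ip_diff_left[simp]:
  "L2 f \<Longrightarrow> L2 g \<Longrightarrow> L2 h \<Longrightarrow> ip (\<lambda>x. f x - g x) h = ip f h - ip g h"
  unfolding ip_def by (simp add: left_diff_distrib L2_ip_integrable)

lemma ip_diff_right[simp]:
  "L2 f \<Longrightarrow> L2 g \<Longrightarrow> L2 h \<Longrightarrow> ip h (\<lambda>x. f x - g x) = ip h f - ip h g"
  unfolding ip_def by (simp add: right_diff_distrib L2_ip_integrable)

lemma ip_cmult_left[simp]: "ip (\<lambda>x. c * f x) h = c * ip f h"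
  unfolding ip_def by (simp add: mult.assoc)

lemma ip_cmult_right[simp]: "ip f (\<lambda>x. c * h x) = cnj c * ip f h"
  unfolding ip_def by (simp add: mult.left_commute)

lemma ip_uminus_left[simp]: "ip (\<lambda>x. - f x) h = - ip f h"
  unfolding ip_def by simp

lemma ip_uminus_right[simp]: "ip f (\<lambda>x. - h x) = - ip f h"
  unfolding ip_def by simp

lemma ip_cnj: "cnj (ip f g) = ip g f"
proof -
  have "cnj (ip f g) = (LINT x|lborel. cnj (f x * cnj (g x)))" unfolding ip_def by (simp only: Bochner_Integration.integral_cnj)
  then show ?thesis by (simp add: ip_def mult.commute)
qed

lemma Re_ip_commute: "Re (ip f g) = Re (ip g f)"
  by (metis ip_cnj cnj.sel(1))

lemma cauchy_schwarz_norm: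
  assumes "L2 f" "L2 g"
  shows "(LINT x|lborel. cmod (f x) * cmod (g x)) \<le> nrm f * nrm g"
proof -
  let ?A = "LINT x|lborel. (cmod (f x))\<^sup>2" and ?B = "LINT x|lborel. (cmod (g x))\<^sup>2"
    and ?C = "LINT x|lborel. cmod (f x) * cmod (g x)"
  note [simp] = L2_integrable[OF assms(1)] L2_integrable[OF assms(2)] L2_prod_norm_integrable[OF assms]
  \<comment> \<open>Discriminant argument: a quadratic in \<open>s\<close> that is nonnegative
    everywhere. The degenerate case of a vanishing leading coefficient is treated separately
    below.\<close>
  have q: "0 \<le> s\<^sup>2 * ?A - 2 * s * ?C + ?B" for s :: real
  proof -
    have "0 \<le> (LINT x|lborel. (s * cmod (f x) - cmod (g x))\<^sup>2)" by simp
    also have "\<dots> = (LINT x|lborel. s\<^sup>2 * (cmod (f x))\<^sup>2 - (2 * s) * (cmod (f x) * cmod (g x)) + (cmod (g x))\<^sup>2)"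
      by (intro Bochner_Integration.integral_cong) (auto simp: power2_diff power_mult_distrib)
    also have "\<dots> = s\<^sup>2 * ?A - 2 * s * ?C + ?B"
      by (simp del: mult_minus_left)
    finally show ?thesis .
  qed
  have A: "0 \<le> ?A" "0 \<le> ?B" "0 \<le> ?C" by auto
  have "?C\<^sup>2 \<le> ?A * ?B"
  proof (cases "?A = 0")
    case True
    have "?C = 0"
    proof (rule ccontr)
      assume "?C \<noteq> 0"
      then have "?C > 0" using A by linarith
      \<comment> \<open>With \<open>?A = 0\<close> this value of \<open>s\<close> turns the
        quadratic into \<open>- 1\<close>.\<close>
      then show False using q[of "(?B + 1) / (2 * ?C)"] True by (simp add: field_simps)
    qed
    then show ?thesis using True by simp
  next
    case False
    then have p: "?A > 0" using A by linarith
    have "0 \<le> ?A * ((?C / ?A)\<^sup>2 * ?A - 2 * (?C / ?A) * ?C + ?B)"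
      using q[of "?C / ?A"] p by (intro mult_nonneg_nonneg) auto
    also have "\<dots> = ?A * ?B - ?C\<^sup>2"
      using p by (simp add: field_simps power2_eq_square)
    finally show ?thesis by simp
  qed
  then have "?C\<^sup>2 \<le> (nrm f * nrm g)\<^sup>2" by (simp add: power_mult_distrib nrm_sq)
  then show ?thesis by (rule power2_le_imp_le) simp
qed

lemma cauchy_schwarz:
  assumes "L2 f" "L2 g"
  shows "cmod (ip f g) \<le> nrm f * nrm g"
proof -
  have "cmod (ip f g) \<le> (LINT x|lborel. cmod (f x * cnj (g x)))"
    unfolding ip_def by (rule integral_norm_bound)
  also have "\<dots> \<le> nrm f * nrm g" using cauchy_schwarz_norm[OF assms] by (simp add: norm_mult)
  finally show ?thesis .
qed

lemma nrm_add_sq: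
  assumes "L2 f" "L2 g"
  shows "(nrm (\<lambda>x. f x + g x))\<^sup>2 = (nrm f)\<^sup>2 + 2 * Re (ip f g) + (nrm g)\<^sup>2"
proof -
  have "(nrm (\<lambda>x. f x + g x))\<^sup>2 = Re (ip (\<lambda>x. f x + g x) (\<lambda>x. f x + g x))" by (simp add: ip_self)
  also have "\<dots> = (nrm f)\<^sup>2 + 2 * Re (ip f g) + (nrm g)\<^sup>2"
    using assms by (simp add: Re_ip_commute[of g f] Re_ip_self)
  finally show ?thesis .
qed

lemma nrm_diff_sq:
  assumes "L2 f" "L2 g"
  shows "(nrm (\<lambda>x. f x - g x))\<^sup>2 = (nrm f)\<^sup>2 - 2 * Re (ip f g) + (nrm g)\<^sup>2"
  using nrm_add_sq[of f "\<lambda>x. - g x"] assms by simp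

lemma nrm_triangle:
  assumes "L2 f" "L2 g"
  shows "nrm (\<lambda>x. f x + g x) \<le> nrm f + nrm g"
proof -
  have "Re (ip f g) \<le> nrm f * nrm g"
    using cauchy_schwarz[OF assms] complex_Re_le_cmod order_trans by blast
  then have "(nrm (\<lambda>x. f x + g x))\<^sup>2 \<le> (nrm f + nrm g)\<^sup>2"
    using nrm_add_sq[OF assms] by (simp add: power2_sum)
  then show ?thesis by (rule power2_le_imp_le) simp
qed

lemma nrm_triangle_diff:
  assumes "L2 f" "L2 g" shows "nrm (\<lambda>x. f x - g x) \<le> nrm f + nrm g"
  using nrm_triangle[of f "\<lambda>x. - g x"] assms by simp

lemma nrm_triangle3:
  assumes "L2 f" "L2 g" "L2 h"
  shows "nrm (\<lambda>x. f x - h x) \<le> nrm (\<lambda>x. f x - g x) + nrm (\<lambda>x. g x - h x)"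
  using nrm_triangle[of "\<lambda>x. f x - g x" "\<lambda>x. g x - h x"] assms by simp

lemma nrm_triangle_rev:
  assumes "L2 f" "L2 g" shows "\<bar>nrm f - nrm g\<bar> \<le> nrm (\<lambda>x. f x - g x)"
  using nrm_triangle[of "\<lambda>x. f x - g x" g] nrm_triangle[of "\<lambda>x. g x - f x" f] assms
  by (simp add: nrm_minus_commute[of g f])

lemma nrm_zero_AE:
  assumes "L2 f" "nrm f = 0" shows "AE x in lborel. f x = 0"
proof -
  have "(LINT x|lborel. (cmod (f x))\<^sup>2) = 0" using assms(2) nrm_sq[of f] by simp
  then have "AE x in lborel. (cmod (f x))\<^sup>2 = 0"
    using integral_nonneg_eq_0_iff_AE[OF L2_integrable[OF assms(1)]] by auto
  then show ?thesis by auto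
qed

lemma nrm_bounded_mult:
  assumes "L2 f" "h \<in> borel_measurable borel" "\<And>x. cmod (h x) \<le> B"
  shows "nrm (\<lambda>x. h x * f x) \<le> B * nrm f" "nrm (\<lambda>x. f x * h x) \<le> B * nrm f"
proof -
  have B: "0 \<le> B" using assms(3)[of 0] norm_ge_zero order_trans by blast
  have "f \<in> borel_measurable borel" using assms(1) by (rule L2_measurable)
  then show "nrm (\<lambda>x. h x * f x) \<le> B * nrm f"
    by (intro nrm_mono) (use assms B in \<open>auto simp: norm_mult intro!: mult_right_mono\<close>)
  then show "nrm (\<lambda>x. f x * h x) \<le> B * nrm f" by (simp add: mult.commute)
qed

section \<open>Convergence in norm, Fatou and completeness\<close>

lemma integral_norm_sq_liminf:
  fixes f :: "nat \<Rightarrow> real \<Rightarrow> complex"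
  assumes m: "\<And>n. L2 (f n)" "g \<in> borel_measurable borel" 
    and lim: "AE x in lborel. (\<lambda>n. f n x) \<longlonglongrightarrow> g x"
    and b: "\<And>n. nrm (f n) \<le> B n" "B \<longlonglongrightarrow> b"
  shows "L2 g" "nrm g \<le> b"
proof -
  have [measurable]: "f n \<in> borel_measurable borel" for n using m(1) by (rule L2_measurable)
  note [measurable] = m(2)
  have b0: "b \<ge> 0" using b LIMSEQ_le_const[of B b 0] by (meson nrm_nonneg order_trans)
  \<comment> \<open>Fatou's lemma is run in extended nonnegative integrals because integrability of
    the limit is part of the claim.\<close>
  have eq: "(\<integral>\<^sup>+x. ennreal ((cmod (f n x))\<^sup>2) \<partial>lborel) = ennreal ((nrm (f n))\<^sup>2)" for n
    unfolding nrm_sq by (rule nn_integral_eq_integral) (auto simp: L2_integrable[OF m(1)])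
  have "(\<integral>\<^sup>+x. ennreal ((cmod (g x))\<^sup>2) \<partial>lborel) = (\<integral>\<^sup>+x. liminf (\<lambda>n. ennreal ((cmod (f n x))\<^sup>2)) \<partial>lborel)"
  proof (rule nn_integral_cong_AE)
    show "AE x in lborel. ennreal ((cmod (g x))\<^sup>2) = liminf (\<lambda>n. ennreal ((cmod (f n x))\<^sup>2))"
      using lim
    proof eventually_elim
      case (elim x)
      then have "(\<lambda>n. ennreal ((cmod (f n x))\<^sup>2)) \<longlonglongrightarrow> ennreal ((cmod (g x))\<^sup>2)"
        by (intro tendsto_ennrealI tendsto_power tendsto_norm)
      then show ?case by (intro lim_imp_Liminf[symmetric]) simp
    qed
  qed
  also have "\<dots> \<le> liminf (\<lambda>n. \<integral>\<^sup>+x. ennreal ((cmod (f n x))\<^sup>2) \<partial>lborel)"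
    by (rule nn_integral_liminf) auto
  also have "\<dots> \<le> liminf (\<lambda>n. ennreal ((B n)\<^sup>2))"
    unfolding eq by (rule Liminf_mono) (auto intro!: always_eventually ennreal_leI power_mono b(1))
  also have "\<dots> = ennreal (b\<^sup>2)"
    by (rule lim_imp_Liminf) (auto intro!: tendsto_intros b(2))
  finally have le: "(\<integral>\<^sup>+x. ennreal ((cmod (g x))\<^sup>2) \<partial>lborel) \<le> ennreal (b\<^sup>2)" .
  have "integrable lborel (\<lambda>x. (cmod (g x))\<^sup>2)"
  proof (rule integrableI_bounded)
    have "(\<integral>\<^sup>+x. ennreal (norm ((cmod (g x))\<^sup>2)) \<partial>lborel) \<le> ennreal (b\<^sup>2)" using le by simp
    also have "\<dots> < \<infinity>" by simp
    finally show "(\<integral>\<^sup>+x. ennreal (norm ((cmod (g x))\<^sup>2)) \<partial>lborel) < \<infinity>" .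
  qed measurable
  then show L: "L2 g" by (auto simp: L2_def)
  have "ennreal ((nrm g)\<^sup>2) \<le> ennreal (b\<^sup>2)"
    using le nn_integral_eq_integral[OF L2_integrable[OF L]] by (simp add: nrm_sq)
  then have "(nrm g)\<^sup>2 \<le> b\<^sup>2" by (simp add: ennreal_le_iff)
  then show "nrm g \<le> b" by (rule power2_le_imp_le) (rule b0)
qed

text \<open>Over the whole line a bound on L2 norms does not bound the integrals of the moduli, so
  squares have to be summed. Weighting them by \<open>(3/2)^n\<close> still gives a summable series
  with terms \<open>(3/8)^n\<close>, and Young's inequality recovers the moduli themselves at the
  summable cost \<open>(2/3)^n\<close>.\<close>

lemma L2_norm_increments_converge:
  assumes L: "\<And>n::nat. L2 (f n)" and d: "\<And>n. nrm (\<lambda>x. f (Suc n) x - f n x) \<le> (1/2)^n"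
  shows "AE x in lborel. convergent (\<lambda>n. f n x)"
proof -
  have [measurable]: "f n \<in> borel_measurable borel" for n using L by (rule L2_measurable)
  define d where "d n x = cmod (f (Suc n) x - f n x)" for n x
  \<comment> \<open>weight the increments so that the sum of the weighted squares has finite integral\<close>
  have nn: "(\<integral>\<^sup>+x. ennreal ((3/2)^n * (d n x)\<^sup>2) \<partial>lborel) \<le> ennreal ((3/8)^n)" for n
  proof -
    have i: "integrable lborel (\<lambda>x. (d n x)\<^sup>2)" unfolding d_def using L2_diff[OF L L] by (auto simp: L2_def)
    have "(\<integral>\<^sup>+x. ennreal ((3/2)^n * (d n x)\<^sup>2) \<partial>lborel) = ennreal (LINT x|lborel. (3/2)^n * (d n x)\<^sup>2)"
      by (rule nn_integral_eq_integral) (use i in auto)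
    also have "(LINT x|lborel. (3/2)^n * (d n x)\<^sup>2) = (3/2)^n * (nrm (\<lambda>x. f (Suc n) x - f n x))\<^sup>2"
      unfolding nrm_sq d_def by simp
    also have "\<dots> \<le> (3/2)^n * ((1/2)^n)\<^sup>2"
      using assms(2)[of n] by (intro mult_left_mono power_mono) auto
    also have "\<dots> = (3/8)^n" by (simp add: power2_eq_square flip: power_mult_distrib)
    finally show ?thesis by (simp add: ennreal_leI)
  qed
  have "(\<integral>\<^sup>+x. (\<Sum>n. ennreal ((3/2)^n * (d n x)\<^sup>2)) \<partial>lborel) = (\<Sum>n. \<integral>\<^sup>+x. ennreal ((3/2)^n * (d n x)\<^sup>2) \<partial>lborel)"
    by (rule nn_integral_suminf) (auto simp: d_def)
  also have "\<dots> \<le> (\<Sum>n. ennreal ((3/8)^n))"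
    by (intro suminf_le nn) auto
  also have "\<dots> = ennreal (\<Sum>n. (3/8)^n)"
    by (rule suminf_ennreal2) auto
  also have "\<dots> < \<infinity>" by simp
  finally have fin: "(\<integral>\<^sup>+x. (\<Sum>n. ennreal ((3/2)^n * (d n x)\<^sup>2)) \<partial>lborel) < \<infinity>" .
  have "AE x in lborel. (\<Sum>n. ennreal ((3/2)^n * (d n x)\<^sup>2)) \<noteq> \<infinity>"
    by (rule nn_integral_PInf_AE) (use fin in \<open>auto simp: d_def\<close>)
  then show ?thesis
  proof eventually_elim
    case (elim x)
    have s1: "summable (\<lambda>n. (3/2)^n * (d n x)\<^sup>2)"
      by (rule summable_suminf_not_top) (use elim in auto)
    have s2: "summable (\<lambda>n. (2/3::real)^n)" by simp
    have "summable (\<lambda>n. d n x)"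
    proof (rule summable_comparison_test')
      show "summable (\<lambda>n. (3/2)^n * (d n x)\<^sup>2 + (2/3::real)^n)" by (intro summable_add s1 s2)
      fix n :: nat
      define p :: real where "p = sqrt ((3/2)^n)"
      have p: "p > 0" "p\<^sup>2 = (3/2)^n" by (auto simp: p_def)
      have p2: "(1/p)\<^sup>2 = (2/3)^n" using p(2) by (simp add: power_divide)
      have "d n x = (p * d n x) * (1/p)" using p(1) by simp
      also have "\<dots> \<le> (p * d n x)\<^sup>2 + (1/p)\<^sup>2"
      proof -
        have "2 * ((p * d n x) * (1/p)) \<le> (p * d n x)\<^sup>2 + (1/p)\<^sup>2"
          using sum_squares_bound[of "p * d n x" "1/p"] by (simp only: mult.assoc)
        moreover have "0 \<le> (p * d n x) * (1/p)" using p(1) by (simp add: d_def)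
        moreover have "a \<le> b" if "2 * a \<le> b" "0 \<le> a" for a b :: real using that by simp
        ultimately show ?thesis by blast
      qed
      finally show "norm (d n x) \<le> (3/2)^n * (d n x)\<^sup>2 + (2/3::real)^n"
        using p2 p(2) by (simp add: power_mult_distrib d_def)
    qed
    then have "summable (\<lambda>n. f (Suc n) x - f n x)" 
      unfolding d_def by (rule summable_norm_cancel)
    then have "convergent (\<lambda>n. \<Sum>i<n. f (Suc i) x - f i x)" by (simp add: summable_iff_convergent)
    then have "convergent (\<lambda>n. f n x - f 0 x)" 
      using sum_lessThan_telescope[of "\<lambda>n. f n x"] by simp
    then have "convergent (\<lambda>n. (f n x - f 0 x) + f 0 x)" by (intro convergent_add convergent_const)
    then show ?case by simp
  qed
qed

text \<open>Riesz-Fischer. A rapidly converging subsequence has an almost everywhere limit; applying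
  Fatou to the differences with a fixed member turns the Cauchy bound into a bound for the distance
  of the whole sequence to that limit.\<close>

lemma L2_complete:
  assumes L: "\<And>n::nat. L2 (f n)"
    and C: "\<And>e. e > 0 \<Longrightarrow> \<exists>N. \<forall>m\<ge>N. \<forall>n\<ge>N. nrm (\<lambda>x. f m x - f n x) < e"
  obtains g where "L2 g" "(\<lambda>n. nrm (\<lambda>x. f n x - g x)) \<longlonglongrightarrow> 0"
proof -
  have "\<exists>r. strict_mono r \<and> (\<forall>k m n. m \<ge> r k \<longrightarrow> n \<ge> r k \<longrightarrow> nrm (\<lambda>x. f m x - f n x) \<le> (1/2)^k)"
  proof -
    have "\<exists>N. \<forall>m\<ge>N. \<forall>n\<ge>N. nrm (\<lambda>x. f m x - f n x) \<le> (1/2)^k" for k :: nat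
    proof -
      have "(0::real) < (1/2)^k" by simp
      from C[OF this] obtain N where "\<forall>m\<ge>N. \<forall>n\<ge>N. nrm (\<lambda>x. f m x - f n x) < (1/2)^k" by blast
      then show ?thesis by (intro exI[of _ N]) (simp add: less_imp_le)
    qed
    then have "\<forall>k. \<exists>N. \<forall>m\<ge>N. \<forall>n\<ge>N. nrm (\<lambda>x. f m x - f n x) \<le> (1/2)^k" by blast
    from choice[OF this] obtain N where N: "\<And>k m n. m \<ge> N k \<Longrightarrow> n \<ge> N k \<Longrightarrow> nrm (\<lambda>x. f m x - f n x) \<le> (1/2)^k"
      by blast
    \<comment> \<open>The maximum with \<open>Suc q\<close> makes the selection strictly increasing
      while it stays beyond the thresholds \<open>N k\<close>.\<close>
    define r where "r = rec_nat (N 0) (\<lambda>k q. max (Suc q) (N (Suc k)))"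
    have r: "r 0 = N 0" "r (Suc k) = max (Suc (r k)) (N (Suc k))" for k by (auto simp: r_def)
    have "strict_mono r" by (rule strict_monoI_Suc) (auto simp: r)
    moreover have rN: "r k \<ge> N k" for k by (cases k) (auto simp: r)
    have "nrm (\<lambda>x. f m x - f n x) \<le> (1/2)^k" if "m \<ge> r k" "n \<ge> r k" for k m n
      by (rule N) (use that rN[of k] in auto)
    ultimately show ?thesis by blast
  qed
  then obtain r where r: "strict_mono r" 
    "\<And>k m n. m \<ge> r k \<Longrightarrow> n \<ge> r k \<Longrightarrow> nrm (\<lambda>x. f m x - f n x) \<le> (1/2)^k" by blast
  have [measurable]: "f n \<in> borel_measurable borel" for n using L by (rule L2_measurable)
  have conv: "AE x in lborel. convergent (\<lambda>n. f (r n) x)"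
  proof (rule L2_norm_increments_converge[OF L])
    fix n show "nrm (\<lambda>x. f (r (Suc n)) x - f (r n) x) \<le> (1/2)^n"
      by (rule r(2)) (use r(1) in \<open>auto simp: strict_mono_less_eq\<close>)
  qed
  define g where "g x = lim (\<lambda>n. f (r n) x)" for x
  have gm[measurable]: "g \<in> borel_measurable borel" unfolding g_def by measurable
  have gl: "AE x in lborel. (\<lambda>n. f (r n) x) \<longlonglongrightarrow> g x"
    using conv by eventually_elim (simp add: g_def convergent_LIMSEQ_iff)
  have key: "L2 (\<lambda>x. g x - f m x) \<and> nrm (\<lambda>x. g x - f m x) \<le> (1/2)^k" if "m \<ge> r k" for m k
  proof -
    have *: "AE x in lborel. (\<lambda>n. f (r (n + k)) x - f m x) \<longlonglongrightarrow> g x - f m x"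
      using gl
    proof eventually_elim
      case (elim x) then show ?case by (intro tendsto_intros LIMSEQ_ignore_initial_segment)
    qed
    have **: "nrm (\<lambda>x. f (r (n + k)) x - f m x) \<le> (1/2)^k" for n
      by (rule r(2)) (use that r(1) in \<open>auto simp: strict_mono_less_eq\<close>)
    show ?thesis
      using integral_norm_sq_liminf[of "\<lambda>n x. f (r (n + k)) x - f m x" "\<lambda>x. g x - f m x" "\<lambda>_. (1/2)^k" "(1/2)^k"]
        L * ** by auto
  qed
  have "L2 (\<lambda>x. (g x - f (r 0) x) + f (r 0) x)" by (intro L2_add L) (use key in auto)
  then have Lg: "L2 g" by simp
  have "(\<lambda>n. nrm (\<lambda>x. f n x - g x)) \<longlonglongrightarrow> 0"
  proof (rule LIMSEQ_I)
    fix e :: real assume "e > 0"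
    then obtain k where k: "(1/2)^k < e" using real_arch_pow_inv[of e "1/2"] by auto
    have "norm (nrm (\<lambda>x. f n x - g x) - 0) < e" if "n \<ge> r k" for n
      using key[OF that] k by (simp add: nrm_minus_commute[of "f n" g])
    then show "\<exists>no. \<forall>n\<ge>no. norm (nrm (\<lambda>x. f n x - g x) - 0) < e" by blast
  qed
  then show ?thesis using Lg that by blast
qed

lemma nrm_dominated_convergence:
  assumes w: "L2 w" and f: "\<And>n::nat. f n \<in> borel_measurable borel" and g: "g \<in> borel_measurable borel"
    and b: "\<And>n. AE x in lborel. cmod (f n x) \<le> cmod (w x)"
    and lim: "AE x in lborel. (\<lambda>n. f n x) \<longlonglongrightarrow> g x"
  shows "(\<lambda>n. nrm (\<lambda>x. f n x - g x)) \<longlonglongrightarrow> 0" "L2 g" "\<And>n. L2 (f n)"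
proof -
  note [measurable] = f g L2_measurable[OF w]
  have b': "AE x in lborel. \<forall>n. cmod (f n x) \<le> cmod (w x)" using b by (simp add: AE_all_countable)
  have gb: "AE x in lborel. cmod (g x) \<le> cmod (w x)"
    using b' lim
  proof eventually_elim
    case (elim x) then show ?case by (intro LIMSEQ_le_const2[OF tendsto_norm]) auto
  qed
  have sq: "(cmod z)\<^sup>2 \<le> (cmod v)\<^sup>2" if "cmod z \<le> cmod v" for z v by (rule power_mono[OF that]) simp
  show "L2 g" by (rule L2_dominated[OF L2_integrable[OF w]]) (use gb sq in auto)
  show "\<And>n. L2 (f n)" by (rule L2_dominated[OF L2_integrable[OF w]]) (use b sq in auto)
  have "(\<lambda>n. LINT x|lborel. (cmod (f n x - g x))\<^sup>2) \<longlonglongrightarrow> integral\<^sup>L lborel (\<lambda>x::real. 0 :: real)"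
  \<comment> \<open>The factor 4 is the square of 2: both \<open>f n\<close> and its limit are
    dominated by \<open>w\<close>.\<close>
  proof (rule integral_dominated_convergence[where w="\<lambda>x. 4 * (cmod (w x))\<^sup>2"])
    show "integrable lborel (\<lambda>x. 4 * (cmod (w x))\<^sup>2)" using L2_integrable[OF w] by simp
    show "AE x in lborel. (\<lambda>n. (cmod (f n x - g x))\<^sup>2) \<longlonglongrightarrow> 0"
      using lim
    proof eventually_elim
      case (elim x)
      then have "(\<lambda>n. (cmod (f n x - g x))\<^sup>2) \<longlonglongrightarrow> (cmod (g x - g x))\<^sup>2"
        by (intro tendsto_power tendsto_norm tendsto_diff tendsto_const)
      then show ?case by simp
    qed
    show "AE x in lborel. norm ((cmod (f n x - g x))\<^sup>2) \<le> 4 * (cmod (w x))\<^sup>2" for n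
      using b' gb
    proof eventually_elim
      case (elim x)
      have "cmod (f n x - g x) \<le> 2 * cmod (w x)"
        using norm_triangle_ineq4[of "f n x" "g x"] elim by (smt (verit))
      then have "(cmod (f n x - g x))\<^sup>2 \<le> (2 * cmod (w x))\<^sup>2" by (rule power_mono) simp
      then show ?case by (simp add: power_mult_distrib)
    qed
  qed measurable
  then have "(\<lambda>n. sqrt (LINT x|lborel. (cmod (f n x - g x))\<^sup>2)) \<longlonglongrightarrow> sqrt 0"
    by (intro tendsto_real_sqrt) simp
  then show "(\<lambda>n. nrm (\<lambda>x. f n x - g x)) \<longlonglongrightarrow> 0" by (simp add: nrm_def)
qed

section \<open>Truncation, continuous approximation and continuity of translations\<close>

lemma L2_const_on_interval: "L2 (\<lambda>x. c * indicator {a..b} x)"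
proof (rule L2_dominated[of "\<lambda>x. (cmod c)\<^sup>2 * indicator {a..b} x"])
  show "integrable lborel (\<lambda>x. (cmod c)\<^sup>2 * indicator {a..b} x)"
    by (intro integrable_mult_right integrable_real_indicator) (auto simp: emeasure_lborel_Icc_eq)
qed (auto simp: indicator_def)

lemma L2_trunc: "L2 f \<Longrightarrow> L2 (\<lambda>x. indicator {a..b} x * f x)"
  by (rule L2_bounded_mult(1)[where B=1]) (auto simp: indicator_def)

lemma L2_trunc_tendsto:
  assumes "L2 f" "filterlim R at_top sequentially"
  shows "(\<lambda>n. nrm (\<lambda>x. indicator {-R n..R n} x * f x - f x)) \<longlonglongrightarrow> 0"
proof (rule nrm_dominated_convergence(1)[OF assms(1)])
  show "AE x in lborel. (\<lambda>n. indicator {- R n..R n} x * f x) \<longlonglongrightarrow> f x"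
  proof (rule AE_I2)
    fix x
    have "eventually (\<lambda>n. R n \<ge> \<bar>x\<bar>) sequentially" using assms(2) by (simp add: filterlim_at_top)
    then have "eventually (\<lambda>n. indicator {- R n..R n} x * f x = f x) sequentially"
      by eventually_elim (auto simp: indicator_def)
    then show "(\<lambda>n. indicator {- R n..R n} x * f x) \<longlonglongrightarrow> f x" by (rule tendsto_eventually)
  qed
qed (use assms(1) L2_measurable in \<open>auto simp: indicator_def\<close>)

text \<open>A measurable function is an almost everywhere limit of continuous ones, but without any
  uniform control. Composing with the radial retraction \<open>c\<close> onto the disc of radius
  \<open>k\<close> and multiplying by the cutoff \<open>\<theta>\<close> supplies a common
  dominating function, and leaves the limit alone because both act as the identity where
  \<open>f\<close> lives.\<close>

lemma L2_Cc_approx_bounded: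
  assumes f: "f \<in> borel_measurable borel" and k: "\<And>x. cmod (f x) \<le> k" "\<And>x. \<bar>x\<bar> > k \<Longrightarrow> f x = 0" "k > 0"
    and e: "e > 0"
  obtains g where "continuous_on UNIV g" "\<And>x. \<bar>x\<bar> > k + 1 \<Longrightarrow> g x = 0" "\<And>x. cmod (g x) \<le> k" "nrm (\<lambda>x. g x - f x) < e" "L2 g"
proof -
  have "f \<in> borel_measurable (lebesgue_on UNIV)" using f by (simp add: lebesgue_on_UNIV_eq measurable_completion)
  then have "f measurable_on UNIV" by (intro lebesgue_measurable_imp_measurable_on) auto
  then obtain N G where N: "negligible N" and G: "\<And>n. continuous_on UNIV (G n)" 
      "\<And>x. x \<notin> N \<Longrightarrow> (\<lambda>n. G n x) \<longlonglongrightarrow> f x"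
    unfolding measurable_on_def by auto
  have AE: "AE x in lborel. x \<notin> N"
  proof -
    have "AE x in lebesgue. x \<notin> N" using N by (intro AE_not_in) (simp add: negligible_iff_null_sets)
    then show ?thesis by (simp add: AE_completion_iff)
  qed
  define c where "c z = z / complex_of_real (max 1 (cmod z / k))" for z
  define \<theta> where "\<theta> x = max 0 (min 1 (k + 1 - \<bar>x\<bar>))" for x :: real
  have cc: "continuous_on UNIV c" unfolding c_def 
    by (intro continuous_intros) (use k(3) in \<open>auto simp: max_def\<close>)
  have cb: "cmod (c z) \<le> k" for z
    using k(3) by (auto simp: c_def norm_divide max_def field_simps split: if_splits)
  have cid: "c z = z" if "cmod z \<le> k" for z
    using that k(3) by (auto simp: c_def max_def)
  have \<theta>: "\<theta> x \<ge> 0" "\<theta> x \<le> 1" "\<bar>x\<bar> > k + 1 \<Longrightarrow> \<theta> x = 0" "\<bar>x\<bar> \<le> k \<Longrightarrow> \<theta> x = 1" for x by (auto simp: \<theta>_def)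
  define H where "H n x = complex_of_real (\<theta> x) * c (G n x)" for n x
  have Hc: "continuous_on UNIV (H n)" for n
    unfolding H_def \<theta>_def
    by (intro continuous_intros continuous_on_compose2[OF cc G(1)]) auto
  have Hm[measurable]: "H n \<in> borel_measurable borel" for n 
    using Hc by (rule borel_measurable_continuous_onI)
  have Hb: "cmod (H n x) \<le> k" for n x
  proof -
    have "cmod (H n x) \<le> 1 * k" unfolding H_def norm_mult 
      by (intro mult_mono) (use \<theta>[of x] cb in auto)
    then show ?thesis by simp
  qed
  have Hz: "H n x = 0" if "\<bar>x\<bar> > k + 1" for n x using \<theta>(3)[OF that] by (simp add: H_def)
  have conv: "(\<lambda>n. nrm (\<lambda>x. H n x - f x)) \<longlonglongrightarrow> 0" and HL: "\<And>n. L2 (H n)"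
  proof -
    have b: "AE x in lborel. cmod (H n x) \<le> cmod (complex_of_real k * indicator {-(k+1)..k+1} x)" for n
      using Hb[of n] Hz[of _ n] k(3) by (auto simp: indicator_def)
    have l: "AE x in lborel. (\<lambda>n. H n x) \<longlonglongrightarrow> f x"
      using AE
    proof eventually_elim
      case (elim x)
      have "continuous (at (f x)) c" using cc by (simp add: continuous_on_eq_continuous_at)
      then have "(\<lambda>n. c (G n x)) \<longlonglongrightarrow> c (f x)" using G(2)[OF elim] 
        by (rule isCont_tendsto_compose)
      then have "(\<lambda>n. H n x) \<longlonglongrightarrow> complex_of_real (\<theta> x) * c (f x)"
        unfolding H_def by (intro tendsto_mult tendsto_const)
      also have "complex_of_real (\<theta> x) * c (f x) = f x"
        using k(2)[of x] \<theta>(4)[of x] cid[OF k(1)[of x]] by (cases "\<bar>x\<bar> > k") auto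
      finally show ?case .
    qed
    show "(\<lambda>n. nrm (\<lambda>x. H n x - f x)) \<longlonglongrightarrow> 0" 
      by (rule nrm_dominated_convergence(1)[OF L2_const_on_interval _ _ b l]) (use f in auto)
    show "\<And>n. L2 (H n)" 
      by (rule nrm_dominated_convergence(3)[OF L2_const_on_interval _ _ b l]) (use f in auto)
  qed
  have "eventually (\<lambda>n. nrm (\<lambda>x. H n x - f x) < e) sequentially"
    using conv e by (rule order_tendstoD)
  then obtain n where "nrm (\<lambda>x. H n x - f x) < e" by (auto simp: eventually_sequentially)
  then show ?thesis using that[of "H n"] Hc Hz Hb HL by auto
qed

lemma L2_Cc_approx:
  assumes f: "L2 f" and e: "e > 0"
  obtains g k where "continuous_on UNIV g" "\<And>x. \<bar>x\<bar> > k \<Longrightarrow> g x = 0" "\<And>x. cmod (g x) \<le> k" "nrm (\<lambda>x. g x - f x) < e" "L2 g"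
proof -
  \<comment> \<open>Argument and value are truncated together; the added 1 keeps the level positive,
    as the bounded case demands.\<close>
  define T where "T n x = (if \<bar>x\<bar> \<le> real n + 1 \<and> cmod (f x) \<le> real n + 1 then f x else 0)" for n x
  have [measurable]: "f \<in> borel_measurable borel" using f by (rule L2_measurable)
  have Tm[measurable]: "T n \<in> borel_measurable borel" for n unfolding T_def by measurable
  have b: "AE x in lborel. cmod (T n x) \<le> cmod (f x)" for n by (auto simp: T_def)
  have l: "AE x in lborel. (\<lambda>n. T n x) \<longlonglongrightarrow> f x"
  proof (rule AE_I2)
    fix x
    obtain N where N: "real N \<ge> max \<bar>x\<bar> (cmod (f x))" using real_arch_simple by blast
    have "eventually (\<lambda>n. T n x = f x) sequentially"
      using eventually_ge_at_top[of N] by eventually_elim (use N in \<open>auto simp: T_def\<close>)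
    then show "(\<lambda>n. T n x) \<longlonglongrightarrow> f x" by (rule tendsto_eventually)
  qed
  have conv: "(\<lambda>n. nrm (\<lambda>x. T n x - f x)) \<longlonglongrightarrow> 0" and TL: "\<And>n. L2 (T n)"
    using nrm_dominated_convergence(1,3)[OF f Tm _ b l] by auto
  have "eventually (\<lambda>n. nrm (\<lambda>x. T n x - f x) < e/2) sequentially"
    using conv e by (intro order_tendstoD) auto
  then obtain n where n: "nrm (\<lambda>x. T n x - f x) < e/2" by (auto simp: eventually_sequentially)
  have Tb: "cmod (T n x) \<le> real n + 1" "\<bar>x\<bar> > real n + 1 \<Longrightarrow> T n x = 0" for x by (auto simp: T_def)
  have e2: "e/2 > 0" using e by simp
  from L2_Cc_approx_bounded[OF Tm Tb _ e2] obtain g where g: "continuous_on UNIV g" "\<And>x. \<bar>x\<bar> > real n + 2 \<Longrightarrow> g x = 0" 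
      "\<And>x. cmod (g x) \<le> real n + 1" "nrm (\<lambda>x. g x - T n x) < e/2" "L2 g" by (auto simp: add.assoc)
  have "nrm (\<lambda>x. g x - f x) \<le> nrm (\<lambda>x. g x - T n x) + nrm (\<lambda>x. T n x - f x)"
    by (rule nrm_triangle3[OF g(5) TL f])
  also have "\<dots> < e" using n g(4) by simp
  finally show ?thesis using that[of g "real n + 2"] g by (smt (verit))
qed

lemma L2_shift[intro]: "L2 f \<Longrightarrow> L2 (\<lambda>x. f (x + z))"
  using lborel_integrable_real_affine[of "\<lambda>x. (cmod (f x))\<^sup>2" 1 z] by (auto simp: L2_def add.commute)

lemma nrm_shift[simp]: "nrm (\<lambda>x. f (x + z)) = nrm f"
  using lborel_integral_real_affine[of 1 "\<lambda>x. (cmod (f x))\<^sup>2" z] by (simp add: nrm_def add.commute)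

lemma L2_translation_continuous_Cc:
  assumes g: "continuous_on UNIV g" "\<And>x. \<bar>x\<bar> > k \<Longrightarrow> g x = 0" "\<And>x. cmod (g x) \<le> k" and z: "z \<longlonglongrightarrow> 0"
  shows "(\<lambda>n. nrm (\<lambda>x. g (x + z n) - g x)) \<longlonglongrightarrow> 0"
proof -
  have "Bseq z" using z by (rule convergent_imp_Bseq[OF convergentI])
  then obtain Z where Z: "\<And>n. \<bar>z n\<bar> \<le> Z" by (auto simp: Bseq_def)
  have Z0: "Z \<ge> 0" using Z[of 0] by auto
  have [measurable]: "g \<in> borel_measurable borel" using g(1) by (rule borel_measurable_continuous_onI)
  have k0: "k \<ge> 0" using g(3)[of 0] norm_ge_zero order_trans by blast
  show ?thesis
  proof (rule nrm_dominated_convergence(1)[OF L2_const_on_interval[of "complex_of_real k" "-(k + Z)" "k + Z"]])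
    show "AE x in lborel. cmod (g (x + z n)) \<le> cmod (complex_of_real k * indicator {- (k + Z)..k + Z} x)" for n
    proof (rule AE_I2)
      fix x show "cmod (g (x + z n)) \<le> cmod (complex_of_real k * indicator {- (k + Z)..k + Z} x)"
      proof (cases "\<bar>x\<bar> \<le> k + Z")
        case True then show ?thesis using g(3)[of "x + z n"] k0 by (auto simp: indicator_def)
      next
        case False
        then have "g (x + z n) = 0" using Z[of n] by (intro g(2)) auto
        then show ?thesis by simp
      qed
    qed
    show "AE x in lborel. (\<lambda>n. g (x + z n)) \<longlonglongrightarrow> g x"
    proof (rule AE_I2)
      fix x
      have "isCont g x" using g(1) by (simp add: continuous_on_eq_continuous_at)
      moreover have "(\<lambda>n. x + z n) \<longlonglongrightarrow> x" using tendsto_add[OF tendsto_const z, of x] by simp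
      ultimately show "(\<lambda>n. g (x + z n)) \<longlonglongrightarrow> g x" by (rule isCont_tendsto_compose)
    qed
  qed measurable
qed

text \<open>Translation is an isometry, so a single approximation error serves both for
  \<open>f\<close> and for its translate, and the question reduces to continuous functions of
  compact support.\<close>

lemma L2_translation_continuous:
  assumes f: "L2 f" and z: "z \<longlonglongrightarrow> 0"
  shows "(\<lambda>n. nrm (\<lambda>x. f (x + z n) - f x)) \<longlonglongrightarrow> 0"
proof (rule LIMSEQ_I)
  fix e :: real assume e: "e > 0"
  then have "e/4 > 0" by simp
  from L2_Cc_approx[OF f this] obtain g k where g: "continuous_on UNIV g" "\<And>x. \<bar>x\<bar> > k \<Longrightarrow> g x = 0" "\<And>x. cmod (g x) \<le> k" 
      and gf: "nrm (\<lambda>x. g x - f x) < e/4" and gL: "L2 g" by blast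
  have "eventually (\<lambda>n. nrm (\<lambda>x. g (x + z n) - g x) < e/4) sequentially"
    using L2_translation_continuous_Cc[OF g z] e by (intro order_tendstoD) auto
  then obtain N where N: "\<And>n. n \<ge> N \<Longrightarrow> nrm (\<lambda>x. g (x + z n) - g x) < e/4" by (auto simp: eventually_sequentially)
  have "norm (nrm (\<lambda>x. f (x + z n) - f x) - 0) < e" if "n \<ge> N" for n
  proof -
    have "nrm (\<lambda>x. f (x + z n) - f x) \<le> nrm (\<lambda>x. f (x + z n) - g (x + z n)) + nrm (\<lambda>x. g (x + z n) - f x)"
      by (rule nrm_triangle3) (use f gL in auto)
    also have "nrm (\<lambda>x. g (x + z n) - f x) \<le> nrm (\<lambda>x. g (x + z n) - g x) + nrm (\<lambda>x. g x - f x)"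
      by (rule nrm_triangle3) (use f gL in auto)
    also have "nrm (\<lambda>x. f (x + z n) - g (x + z n)) = nrm (\<lambda>x. g x - f x)"
      using nrm_shift[of "\<lambda>x. f x - g x" "z n"] by (simp add: nrm_minus_commute[of f g])
    finally show ?thesis using N[OF that] gf e by simp
  qed
  then show "\<exists>no. \<forall>n\<ge>no. norm (nrm (\<lambda>x. f (x + z n) - f x) - 0) < e" by blast
qed

subsection \<open>The Plancherel theorem\<close>

text \<open>The transform as an absolutely convergent integral, in the normalisation of
  \<open>fourier_trunc\<close>; \<open>FT\<close> is its extension to square-integrable
  functions.\<close>

definition Fhat :: "(real \<Rightarrow> complex) \<Rightarrow> real \<Rightarrow> complex" where
  "Fhat f \<xi> = complex_of_real (1 / sqrt (2 * pi)) * (LINT x|lborel. exp (- \<i> * complex_of_real (\<xi> * x)) * f x)"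

lemma cmod_exp_i[simp]: "cmod (exp (- \<i> * complex_of_real t)) = 1" "cmod (exp (\<i> * complex_of_real t)) = 1"
  "cmod (exp (- (\<i> * complex_of_real t))) = 1"
  by (auto simp: norm_exp_eq_Re)

lemma exp_i_measurable[measurable (raw)]:
  "g \<in> borel_measurable M \<Longrightarrow> (\<lambda>x. exp (- \<i> * complex_of_real (g x))) \<in> borel_measurable M"
  "g \<in> borel_measurable M \<Longrightarrow> (\<lambda>x. exp (\<i> * complex_of_real (g x))) \<in> borel_measurable M"
  by (rule borel_measurable_continuous_on[where f="\<lambda>t. exp (- \<i> * complex_of_real t)"]; (intro continuous_intros)?; simp)
     (rule borel_measurable_continuous_on[where f="\<lambda>t. exp (\<i> * complex_of_real t)"]; (intro continuous_intros)?; simp)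

lemma integrable_exp_mult:
  assumes "integrable lborel f"
  shows "integrable lborel (\<lambda>x. exp (- \<i> * complex_of_real (\<xi> * x)) * f x)"
proof (rule Bochner_Integration.integrable_bound[OF assms])
  have [measurable]: "f \<in> borel_measurable borel" using assms by (auto dest: borel_measurable_integrable)
  show "(\<lambda>x. exp (- \<i> * complex_of_real (\<xi> * x)) * f x) \<in> borel_measurable lborel" by measurable
qed (auto simp: norm_mult)

lemma Fhat_measurable[measurable]: 
  assumes [measurable]: "f \<in> borel_measurable borel" shows "Fhat f \<in> borel_measurable borel"
  unfolding Fhat_def by measurable

lemma Fhat_bound: "cmod (Fhat f \<xi>) \<le> (LINT x|lborel. cmod (f x))"
proof -
  have "cmod (LINT x|lborel. exp (- \<i> * complex_of_real (\<xi> * x)) * f x) \<le> (LINT x|lborel. cmod (exp (- \<i> * complex_of_real (\<xi> * x)) * f x))"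
    by (rule integral_norm_bound)
  also have "\<dots> = (LINT x|lborel. cmod (f x))" by (simp add: norm_mult)
  finally have *: "cmod (LINT x|lborel. exp (- \<i> * complex_of_real (\<xi> * x)) * f x) \<le> (LINT x|lborel. cmod (f x))" .
  have s: "sqrt (2 * pi) \<ge> 1" using pi_ge_two by simp
  have "cmod (Fhat f \<xi>) = (1 / sqrt (2 * pi)) * cmod (LINT x|lborel. exp (- \<i> * complex_of_real (\<xi> * x)) * f x)"
    unfolding Fhat_def norm_mult norm_of_real using s by simp
  also have "\<dots> \<le> 1 * (LINT x|lborel. cmod (f x))"
    using s * by (intro mult_mono) auto
  finally show ?thesis by simp
qed

lemma Fhat_add: "integrable lborel f \<Longrightarrow> integrable lborel g \<Longrightarrow> Fhat (\<lambda>x. f x + g x) \<xi> = Fhat f \<xi> + Fhat g \<xi>"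
  unfolding Fhat_def using integrable_exp_mult[of f \<xi>] integrable_exp_mult[of g \<xi>]
  by (simp add: distrib_left)

lemma Fhat_diff: "integrable lborel f \<Longrightarrow> integrable lborel g \<Longrightarrow> Fhat (\<lambda>x. f x - g x) \<xi> = Fhat f \<xi> - Fhat g \<xi>"
  unfolding Fhat_def using integrable_exp_mult[of f \<xi>] integrable_exp_mult[of g \<xi>]
  by (simp add: right_diff_distrib)

lemma Fhat_cmult: "Fhat (\<lambda>x. c * f x) \<xi> = c * Fhat f \<xi>"
  unfolding Fhat_def by (simp add: mult.left_commute)

lemma pair_integrable_mult:
  fixes f :: "real \<Rightarrow> complex" and k :: "real \<times> real \<Rightarrow> complex"
  assumes f: "integrable lborel f" and g: "integrable lborel g"
    and k: "k \<in> borel_measurable (lborel \<Otimes>\<^sub>M lborel)" "\<And>p. cmod (k p) \<le> 1"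
  shows "integrable (lborel \<Otimes>\<^sub>M lborel) (\<lambda>(x, y). k (x, y) * (f x * g y))"
proof -
  have [measurable]: "f \<in> borel_measurable borel" "g \<in> borel_measurable borel" 
    using f g by (auto dest: borel_measurable_integrable)
  note [measurable] = k(1)
  have "integrable (lborel \<Otimes>\<^sub>M lborel) (\<lambda>(x, y). f x * g y)"
    by (rule lborel_pair.Fubini_integrable)
       (use f g in \<open>auto simp: norm_mult integrable_mult_left integrable_mult_right\<close>)
  then show ?thesis
  proof (rule Bochner_Integration.integrable_bound)
    show "AE p in lborel \<Otimes>\<^sub>M lborel. norm (case p of (x, y) \<Rightarrow> k (x, y) * (f x * g y)) \<le> norm (case p of (x, y) \<Rightarrow> f x * g y)"
      using k(2) by (intro AE_I2) (auto simp: norm_mult intro!: mult_left_le_one_le)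
  qed measurable
qed

text \<open>Fubini for a kernel of modulus one that is symmetric in its two arguments. It drives
  Plancherel here and, after extension to L2, the inversion theorem.\<close>

lemma Fhat_multiplication_formula:
  assumes f: "integrable lborel f" and g: "integrable lborel g"
  shows "(LINT \<xi>|lborel. Fhat f \<xi> * g \<xi>) = (LINT x|lborel. f x * Fhat g x)"
proof -
  let ?k = "\<lambda>p. exp (- \<i> * complex_of_real (snd p * fst p))"
  have i: "integrable (lborel \<Otimes>\<^sub>M lborel) (\<lambda>(x, y). ?k (x, y) * (f x * g y))"
    by (rule pair_integrable_mult[OF f g]) auto
  have "(LINT y|lborel. LINT x|lborel. ?k (x, y) * (f x * g y)) = (LINT x|lborel. LINT y|lborel. ?k (x, y) * (f x * g y))"
    using lborel_pair.Fubini_integral[OF i] .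
  moreover have "(LINT x|lborel. ?k (x, y) * (f x * g y)) = (LINT x|lborel. exp (- \<i> * complex_of_real (y * x)) * f x) * g y" for y
    by (simp flip: Bochner_Integration.integral_mult_left_zero add: mult.assoc)
  moreover have "(LINT y|lborel. ?k (x, y) * (f x * g y)) = f x * (LINT y|lborel. exp (- \<i> * complex_of_real (x * y)) * g y)" for x
  proof -
    have "(LINT y|lborel. ?k (x, y) * (f x * g y)) = (LINT y|lborel. f x * (exp (- \<i> * complex_of_real (x * y)) * g y))"
      by (simp add: mult_ac)
    then show ?thesis by (simp only: Bochner_Integration.integral_mult_right_zero)
  qed
  ultimately have "(LINT y|lborel. (LINT x|lborel. exp (- \<i> * complex_of_real (y * x)) * f x) * g y) 
     = (LINT x|lborel. f x * (LINT y|lborel. exp (- \<i> * complex_of_real (x * y)) * g y))"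
    by simp
  then show ?thesis
    unfolding Fhat_def by (simp add: mult.assoc mult.left_commute[of _ "complex_of_real _"])
qed

text \<open>Its value at 0 is the squared norm of \<open>f\<close>, and its transform is a multiple
  of the squared modulus of \<open>Fhat f\<close>. Plancherel is thus the inversion formula for this
  one function at the single point 0.\<close>

definition autocorr :: "(real \<Rightarrow> complex) \<Rightarrow> real \<Rightarrow> complex" where
  "autocorr f z = ip (\<lambda>x. f (x + z)) f"

lemma autocorr_measurable[measurable]: 
  assumes [measurable]: "f \<in> borel_measurable borel" shows "autocorr f \<in> borel_measurable borel"
  unfolding autocorr_def ip_def by measurable

lemma autocorr_bound: "L2 f \<Longrightarrow> cmod (autocorr f z) \<le> (nrm f)\<^sup>2"
  unfolding autocorr_def using cauchy_schwarz[of "\<lambda>x. f (x + z)" f] by (simp add: power2_eq_square L2_shift)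

lemma autocorr_tendsto:
  assumes "L2 f" "z \<longlonglongrightarrow> 0" shows "(\<lambda>n. autocorr f (z n)) \<longlonglongrightarrow> complex_of_real ((nrm f)\<^sup>2)"
proof -
  have "(\<lambda>n. nrm (\<lambda>x. f (x + z n) - f x) * nrm f) \<longlonglongrightarrow> 0 * nrm f"
    by (intro tendsto_mult L2_translation_continuous assms tendsto_const)
  then have l: "(\<lambda>n. nrm (\<lambda>x. f (x + z n) - f x) * nrm f) \<longlonglongrightarrow> 0" by simp
  have "(\<lambda>n. autocorr f (z n) - complex_of_real ((nrm f)\<^sup>2)) \<longlonglongrightarrow> 0"
  proof (rule Lim_null_comparison[OF always_eventually l], rule allI)
    fix n
    have "autocorr f (z n) - complex_of_real ((nrm f)\<^sup>2) = ip (\<lambda>x. f (x + z n) - f x) f"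
      using assms(1) by (simp add: autocorr_def ip_self L2_shift)
    then show "cmod (autocorr f (z n) - complex_of_real ((nrm f)\<^sup>2)) \<le> nrm (\<lambda>x. f (x + z n) - f x) * nrm f"
      using cauchy_schwarz[of "\<lambda>x. f (x + z n) - f x" f] assms(1) by (simp add: L2_shift)
  qed
  then show ?thesis by (simp add: LIM_zero_iff)
qed

lemma lborel_shift_integrable: "integrable lborel f \<Longrightarrow> integrable lborel (\<lambda>x. f (x + t :: real) :: complex)"
  using lborel_integrable_real_affine[of f 1 t] by (simp add: add.commute)

lemma lborel_shift_integral: "(LINT x|lborel. f (x + t :: real) :: complex) = integral\<^sup>L lborel f"
  using lborel_integral_real_affine[of 1 f t] by (simp add: add.commute)

lemma lborel_shift_integral_real: "(LINT x|lborel. f (x + t :: real) :: real) = integral\<^sup>L lborel f"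
  using lborel_integral_real_affine[of 1 f t] by (simp add: add.commute)

lemma autocorr_pair_integrable:
  assumes f: "integrable lborel f" 
  shows "integrable (lborel \<Otimes>\<^sub>M lborel) (\<lambda>(x, z). exp (- \<i> * complex_of_real (\<xi> * z)) * (f (x + z) * cnj (f x)))"
proof (rule lborel_pair.Fubini_integrable)
  have [measurable]: "f \<in> borel_measurable borel" using f by (auto dest: borel_measurable_integrable)
  show "(\<lambda>(x, z). exp (- \<i> * complex_of_real (\<xi> * z)) * (f (x + z) * cnj (f x))) \<in> borel_measurable (lborel \<Otimes>\<^sub>M lborel)"
    by measurable
  have "(LINT z|lborel. norm (exp (- \<i> * complex_of_real (\<xi> * z)) * (f (x + z) * cnj (f x)))) = cmod (f x) * (LINT z|lborel. cmod (f z))" for x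
    using lborel_shift_integral_real[of "\<lambda>z. cmod (f z)" x] by (simp add: norm_mult add.commute)
  then show "integrable lborel (\<lambda>x. LINT z|lborel. norm (case (x, z) of (x, z) \<Rightarrow> exp (- \<i> * complex_of_real (\<xi> * z)) * (f (x + z) * cnj (f x))))"
    using f by simp
  show "AE x in lborel. integrable lborel (\<lambda>z. case (x, z) of (x, z) \<Rightarrow> exp (- \<i> * complex_of_real (\<xi> * z)) * (f (x + z) * cnj (f x)))"
  proof (rule AE_I2)
    fix x
    have "integrable lborel (\<lambda>z. f (x + z) * cnj (f x))"
      using lborel_shift_integrable[OF f, of x] by (simp add: add.commute)
    from integrable_exp_mult[OF this]
    show "integrable lborel (\<lambda>z. case (x, z) of (x, z) \<Rightarrow> exp (- \<i> * complex_of_real (\<xi> * z)) * (f (x + z) * cnj (f x)))" by simp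
  qed
qed

lemma autocorr_integrable: "integrable lborel f \<Longrightarrow> integrable lborel (autocorr f)"
  using lborel_pair.integrable_snd[OF autocorr_pair_integrable[of f 0]]
  by (simp add: autocorr_def[abs_def] ip_def)

lemma Fhat_autocorr:
  assumes f: "integrable lborel f" 
  shows "complex_of_real (1 / sqrt (2 * pi)) * Fhat (autocorr f) \<xi> = complex_of_real ((cmod (Fhat f \<xi>))\<^sup>2)"
proof -
  let ?E = "\<lambda>t. exp (- \<i> * complex_of_real t)"
  have "(LINT z|lborel. ?E (\<xi> * z) * autocorr f z) = (LINT z|lborel. LINT x|lborel. ?E (\<xi> * z) * (f (x + z) * cnj (f x)))"
    by (simp add: autocorr_def ip_def)
  also have "\<dots> = (LINT x|lborel. LINT z|lborel. ?E (\<xi> * z) * (f (x + z) * cnj (f x)))"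
    using lborel_pair.Fubini_integral[OF autocorr_pair_integrable[OF f, of \<xi>]] by simp
  also have "(\<lambda>x. LINT z|lborel. ?E (\<xi> * z) * (f (x + z) * cnj (f x))) = (\<lambda>x. cnj (?E (\<xi> * x) * f x) * (LINT z|lborel. ?E (\<xi> * z) * f z))"
  proof
    fix x
    \<comment> \<open>Substituting \<open>z + x\<close> for \<open>z\<close> splits the exponential
      into a factor in \<open>x\<close> and a factor in \<open>z\<close>, so the double integral
      becomes a product.\<close>
    have "(LINT z|lborel. ?E (\<xi> * z) * (f (x + z) * cnj (f x))) = (LINT z|lborel. cnj (?E (\<xi> * x) * f x) * (?E (\<xi> * (z + x)) * f (z + x)))"
    proof (rule Bochner_Integration.integral_cong)
      fix z
      have "cnj (?E (\<xi> * x)) * ?E (\<xi> * (z + x)) = ?E (\<xi> * z)"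
        by (simp add: exp_cnj flip: exp_add) (simp add: algebra_simps)
      then show "?E (\<xi> * z) * (f (x + z) * cnj (f x)) = cnj (?E (\<xi> * x) * f x) * (?E (\<xi> * (z + x)) * f (z + x))"
      proof -
        have m: "(a * b) * (c * d) = (a * c) * (d * b)" for a b c d :: complex by (simp add: mult_ac)
        assume e: "cnj (?E (\<xi> * x)) * ?E (\<xi> * (z + x)) = ?E (\<xi> * z)"
        have "cnj (?E (\<xi> * x) * f x) * (?E (\<xi> * (z + x)) * f (z + x)) = ?E (\<xi> * z) * (f (z + x) * cnj (f x))"
          unfolding complex_cnj_mult e[symmetric] by (rule m)
        then show ?thesis by (simp only: add.commute)
      qed
    qed simp
    also have "\<dots> = cnj (?E (\<xi> * x) * f x) * (LINT z|lborel. ?E (\<xi> * (z + x)) * f (z + x))"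
      by (rule Bochner_Integration.integral_mult_right_zero)
    also have "(LINT z|lborel. ?E (\<xi> * (z + x)) * f (z + x)) = (LINT z|lborel. ?E (\<xi> * z) * f z)"
      by (rule lborel_shift_integral)
    finally show "(LINT z|lborel. ?E (\<xi> * z) * (f (x + z) * cnj (f x))) = cnj (?E (\<xi> * x) * f x) * (LINT z|lborel. ?E (\<xi> * z) * f z)" .
  qed
  also have "(LINT x|lborel. cnj (?E (\<xi> * x) * f x) * (LINT z|lborel. ?E (\<xi> * z) * f z)) 
     = (LINT x|lborel. cnj (?E (\<xi> * x) * f x)) * (LINT z|lborel. ?E (\<xi> * z) * f z)"
    by (rule Bochner_Integration.integral_mult_left_zero)
  also have "(LINT x|lborel. cnj (?E (\<xi> * x) * f x)) = cnj (LINT x|lborel. ?E (\<xi> * x) * f x)"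
    by (rule Bochner_Integration.integral_cnj)
  finally have "(LINT z|lborel. ?E (\<xi> * z) * autocorr f z) 
      = (LINT x|lborel. ?E (\<xi> * x) * f x) * cnj (LINT x|lborel. ?E (\<xi> * x) * f x)" by (simp only: mult.commute)
  then show ?thesis unfolding Fhat_def complex_norm_square by (simp add: mult_ac)
qed

text \<open>The characteristic function of the standard normal distribution, after
  rescaling.\<close>

lemma Fhat_gaussian:
  assumes s: "s > 0"
  shows "Fhat (\<lambda>\<xi>. complex_of_real (exp (- (s * \<xi>)\<^sup>2 / 2))) z = complex_of_real (1 / s * exp (- (z / s)\<^sup>2 / 2))"
proof -
  let ?n = "std_normal_density"
  have char: "(LINT y|lborel. ?n y *\<^sub>R exp (\<i> * complex_of_real (t * y))) = complex_of_real (exp (- t\<^sup>2 / 2))" for t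
  proof -
    have "char std_normal_distribution t = (LINT y|lborel. ?n y *\<^sub>R exp (\<i> * complex_of_real (t * y)))"
      unfolding char_def by (subst integral_density) auto
    then show ?thesis by (simp only: char_std_normal_distribution)
  qed
  have "(LINT \<xi>|lborel. exp (- \<i> * complex_of_real (z * \<xi>)) * complex_of_real (exp (- (s * \<xi>)\<^sup>2 / 2)))
     = (LINT \<xi>|lborel. complex_of_real (sqrt (2 * pi)) * (?n (0 + s * \<xi>) *\<^sub>R exp (\<i> * complex_of_real ((- z / s) * (0 + s * \<xi>)))))"
  proof (intro Bochner_Integration.integral_cong refl)
    fix \<xi>
    have 1: "- \<i> * complex_of_real (z * \<xi>) = \<i> * complex_of_real ((- z / s) * (0 + s * \<xi>))" using s by simp
    have "exp (- (s * \<xi>)\<^sup>2 / 2) = sqrt (2 * pi) * ?n (0 + s * \<xi>)" by (simp add: std_normal_density_def)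
    then have 2: "complex_of_real (exp (- (s * \<xi>)\<^sup>2 / 2)) = complex_of_real (sqrt (2 * pi)) * complex_of_real (?n (0 + s * \<xi>))"
      by (metis of_real_mult)
    show "exp (- \<i> * complex_of_real (z * \<xi>)) * complex_of_real (exp (- (s * \<xi>)\<^sup>2 / 2)) =
      complex_of_real (sqrt (2 * pi)) * (?n (0 + s * \<xi>) *\<^sub>R exp (\<i> * complex_of_real ((- z / s) * (0 + s * \<xi>))))"
      unfolding 1 2 scaleR_conv_of_real by (simp only: mult_ac)
  qed
  also have "\<dots> = complex_of_real (sqrt (2 * pi)) * (LINT \<xi>|lborel. ?n (0 + s * \<xi>) *\<^sub>R exp (\<i> * complex_of_real ((- z / s) * (0 + s * \<xi>))))"
    by (rule Bochner_Integration.integral_mult_right_zero)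
  also have "(LINT \<xi>|lborel. ?n (0 + s * \<xi>) *\<^sub>R exp (\<i> * complex_of_real ((- z / s) * (0 + s * \<xi>)))) = (1 / s) *\<^sub>R (LINT y|lborel. ?n y *\<^sub>R exp (\<i> * complex_of_real ((- z / s) * y)))"
    using lborel_integral_real_affine[of s "\<lambda>y. ?n y *\<^sub>R exp (\<i> * complex_of_real ((- z / s) * y))" 0] s by simp
  also have "(LINT y|lborel. ?n y *\<^sub>R exp (\<i> * complex_of_real ((- z / s) * y))) = complex_of_real (exp (- (- z / s)\<^sup>2 / 2))"
    by (rule char)
  finally show ?thesis unfolding Fhat_def by (simp add: scaleR_conv_of_real)
qed

lemma gaussian_integrable:
  assumes "s > 0" shows "integrable lborel (\<lambda>\<xi>. complex_of_real (exp (- (s * \<xi>)\<^sup>2 / 2)))"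
proof -
  have "integrable lborel (\<lambda>y. sqrt (2 * pi) * std_normal_density y)"
    by (intro integrable_mult_right) simp
  then have "integrable lborel (\<lambda>y. exp (- y\<^sup>2 / 2 :: real))" by (simp add: std_normal_density_def)
  from lborel_integrable_real_affine[OF this, of s 0] assms 
  show ?thesis by (intro integrable_of_real) simp
qed

text \<open>The Gaussian makes the left integral converge before \<open>Fhat f\<close> is known to
  be square-integrable. The multiplication formula turns it into an average of the autocorrelation
  over a normal distribution of scale \<open>s\<close>, which concentrates at 0 as \<open>s\<close>
  tends to 0.\<close>

lemma Plancherel_regularized:
  assumes f: "integrable lborel f" and s: "s > 0"
  shows "complex_of_real (LINT \<xi>|lborel. (cmod (Fhat f \<xi>))\<^sup>2 * exp (- (s * \<xi>)\<^sup>2 / 2)) = (LINT y|lborel. autocorr f (s * y) * complex_of_real (std_normal_density y))"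
proof -
  let ?G = "\<lambda>\<xi>. complex_of_real (exp (- (s * \<xi>)\<^sup>2 / 2))"
  have "complex_of_real (LINT \<xi>|lborel. (cmod (Fhat f \<xi>))\<^sup>2 * exp (- (s * \<xi>)\<^sup>2 / 2)) 
    = (LINT \<xi>|lborel. complex_of_real ((cmod (Fhat f \<xi>))\<^sup>2 * exp (- (s * \<xi>)\<^sup>2 / 2)))" by (rule integral_complex_of_real[symmetric])
  also have "\<dots> = (LINT \<xi>|lborel. complex_of_real (1 / sqrt (2 * pi)) * (Fhat (autocorr f) \<xi> * ?G \<xi>))"
    unfolding of_real_mult Fhat_autocorr[OF f, symmetric] by (simp only: mult.assoc)
  also have "\<dots> = complex_of_real (1 / sqrt (2 * pi)) * (LINT \<xi>|lborel. Fhat (autocorr f) \<xi> * ?G \<xi>)"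
    by (rule Bochner_Integration.integral_mult_right_zero)
  also have "(LINT \<xi>|lborel. Fhat (autocorr f) \<xi> * ?G \<xi>) = (LINT z|lborel. autocorr f z * Fhat ?G z)"
    by (rule Fhat_multiplication_formula[OF autocorr_integrable[OF f] gaussian_integrable[OF s]])
  also have "\<dots> = (LINT z|lborel. autocorr f z * complex_of_real (1 / s * exp (- (z / s)\<^sup>2 / 2)))"
    by (simp only: Fhat_gaussian[OF s])
  also have "\<dots> = \<bar>s\<bar> *\<^sub>R (LINT y|lborel. autocorr f (0 + s * y) * complex_of_real (1 / s * exp (- ((0 + s * y) / s)\<^sup>2 / 2)))"
    by (rule lborel_integral_real_affine) (use s in simp)
  also have "complex_of_real (1 / sqrt (2 * pi)) * \<dots> = (LINT y|lborel. autocorr f (s * y) * complex_of_real (std_normal_density y))"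
    unfolding scaleR_conv_of_real Bochner_Integration.integral_mult_right_zero[symmetric]
  proof (rule Bochner_Integration.integral_cong)
    fix y
    have "1 / sqrt (2 * pi) * (s * (1 / s * exp (- ((0 + s * y) / s)\<^sup>2 / 2))) = std_normal_density y"
      using s by (simp add: std_normal_density_def)
    then have "complex_of_real (1 / sqrt (2 * pi)) * (complex_of_real s * complex_of_real (1 / s * exp (- ((0 + s * y) / s)\<^sup>2 / 2))) = complex_of_real (std_normal_density y)"
      by (metis of_real_mult)
    then show "complex_of_real (1 / sqrt (2 * pi)) * (complex_of_real \<bar>s\<bar> * (autocorr f (0 + s * y) * complex_of_real (1 / s * exp (- ((0 + s * y) / s)\<^sup>2 / 2))))
      = autocorr f (s * y) * complex_of_real (std_normal_density y)"
      using s by (simp add: mult.left_commute)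
  qed simp
  finally show ?thesis .
qed

text \<open>When the regularisation is removed the averages tend to the autocorrelation at 0, while
  the weighted integrals increase. Monotone convergence therefore delivers integrability and the
  value at the same time.\<close>

theorem Plancherel_L1_L2:
  assumes f: "integrable lborel f" "L2 f"
  shows "L2 (Fhat f)" "nrm (Fhat f) = nrm f"
proof -
  have [measurable]: "f \<in> borel_measurable borel" using f(2) by (rule L2_measurable)
  define s where "s n = 1 / (real n + 1)" for n
  have s: "s n > 0" for n by (simp add: s_def)
  have s0: "s \<longlonglongrightarrow> 0" unfolding s_def using LIMSEQ_inverse_real_of_nat by (simp add: inverse_eq_divide add.commute)
  let ?h = "\<lambda>n \<xi>. (cmod (Fhat f \<xi>))\<^sup>2 * exp (- (s n * \<xi>)\<^sup>2 / 2)"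
  have hi: "integrable lborel (?h n)" for n
  proof (rule Bochner_Integration.integrable_bound)
    let ?C = "LINT x|lborel. cmod (f x)"
    show "integrable lborel (\<lambda>\<xi>. ?C\<^sup>2 *\<^sub>R complex_of_real (exp (- (s n * \<xi>)\<^sup>2 / 2)))"
      using gaussian_integrable[OF s, of n] by (intro integrable_scaleR_right) simp
    have "(cmod (Fhat f \<xi>))\<^sup>2 \<le> ?C\<^sup>2" for \<xi> by (intro power_mono Fhat_bound) simp
    then show "AE \<xi> in lborel. norm (?h n \<xi>) \<le> norm (?C\<^sup>2 *\<^sub>R complex_of_real (exp (- (s n * \<xi>)\<^sup>2 / 2)))"
      by (intro AE_I2) (auto simp: norm_mult intro!: mult_right_mono)
  qed measurable
  have lim: "(\<lambda>n. integral\<^sup>L lborel (?h n)) \<longlonglongrightarrow> (nrm f)\<^sup>2"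
  proof -
    have "(\<lambda>n. LINT y|lborel. autocorr f (s n * y) * complex_of_real (std_normal_density y)) 
       \<longlonglongrightarrow> (LINT y|lborel. complex_of_real ((nrm f)\<^sup>2) * complex_of_real (std_normal_density y))"
    proof (rule integral_dominated_convergence[where w="\<lambda>y. (nrm f)\<^sup>2 * std_normal_density y"])
      show "integrable lborel (\<lambda>y. (nrm f)\<^sup>2 * std_normal_density y)" by simp
      show "AE y in lborel. (\<lambda>n. autocorr f (s n * y) * complex_of_real (std_normal_density y)) \<longlonglongrightarrow> complex_of_real ((nrm f)\<^sup>2) * complex_of_real (std_normal_density y)"
      proof (rule AE_I2)
        fix y
        have "(\<lambda>n. s n * y) \<longlonglongrightarrow> 0 * y" by (intro tendsto_mult s0 tendsto_const)
        then show "(\<lambda>n. autocorr f (s n * y) * complex_of_real (std_normal_density y)) \<longlonglongrightarrow> complex_of_real ((nrm f)\<^sup>2) * complex_of_real (std_normal_density y)"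
          by (intro tendsto_mult tendsto_const autocorr_tendsto[OF f(2)]) simp
      qed
      show "AE y in lborel. norm (autocorr f (s n * y) * complex_of_real (std_normal_density y)) \<le> (nrm f)\<^sup>2 * std_normal_density y" for n
        using autocorr_bound[OF f(2)] by (intro AE_I2) (auto simp: norm_mult intro!: mult_right_mono)
    qed measurable
    also have "(LINT y|lborel. complex_of_real ((nrm f)\<^sup>2) * complex_of_real (std_normal_density y)) = complex_of_real ((nrm f)\<^sup>2)"
      by (subst Bochner_Integration.integral_mult_right_zero) (simp only: integral_complex_of_real, simp)
    finally have "(\<lambda>n. complex_of_real (integral\<^sup>L lborel (?h n))) \<longlonglongrightarrow> complex_of_real ((nrm f)\<^sup>2)"
      by (simp only: Plancherel_regularized[OF f(1) s])
    then show ?thesis by (simp only: tendsto_of_real_iff)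
  qed
  have mono: "AE \<xi> in lborel. mono (\<lambda>n. ?h n \<xi>)"
  proof (intro AE_I2 monoI mult_left_mono)
    fix \<xi> :: real and m n :: nat assume "m \<le> n"
    then have "s n \<le> s m" by (simp add: s_def frac_le)
    then have "(s n)\<^sup>2 \<le> (s m)\<^sup>2" using s[of n] by (intro power_mono) auto
    then have "(s n * \<xi>)\<^sup>2 \<le> (s m * \<xi>)\<^sup>2" by (simp add: power_mult_distrib mult_right_mono)
    then show "exp (- (s m * \<xi>)\<^sup>2 / 2) \<le> exp (- (s n * \<xi>)\<^sup>2 / 2)" by simp
  qed simp
  have pw: "AE \<xi> in lborel. (\<lambda>n. ?h n \<xi>) \<longlonglongrightarrow> (cmod (Fhat f \<xi>))\<^sup>2"
  proof (rule AE_I2)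
    fix \<xi>
    have "(\<lambda>n. ?h n \<xi>) \<longlonglongrightarrow> (cmod (Fhat f \<xi>))\<^sup>2 * exp (- (0 * \<xi>)\<^sup>2 / 2)"
      by (intro tendsto_intros s0) auto
    then show "(\<lambda>n. ?h n \<xi>) \<longlonglongrightarrow> (cmod (Fhat f \<xi>))\<^sup>2" by simp
  qed
  have "(\<lambda>\<xi>. (cmod (Fhat f \<xi>))\<^sup>2) \<in> borel_measurable lborel" by measurable
  note h = hi mono pw lim this
  have "integrable lborel (\<lambda>\<xi>. (cmod (Fhat f \<xi>))\<^sup>2)" by (rule integrable_monotone_convergence[OF h])
  then show "L2 (Fhat f)" by (auto simp: L2_def)
  have "(LINT \<xi>|lborel. (cmod (Fhat f \<xi>))\<^sup>2) = (nrm f)\<^sup>2" by (rule integral_monotone_convergence[OF h])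
  then show "nrm (Fhat f) = nrm f" by (simp add: nrm_def)
qed

subsection \<open>The Fourier transform on square-integrable functions\<close>

lemma trunc_integrable: "L2 f \<Longrightarrow> integrable lborel (\<lambda>x. indicator {a..b} x * f x)"
  using L2_prod_integrable[OF L2_const_on_interval[of 1 a b], of f] by simp

lemma fourier_trunc_eq: "fourier_trunc R f = Fhat (\<lambda>x. indicator {-R..R} x * f x)"
  unfolding fourier_trunc_def Fhat_def
  by (intro ext arg_cong2[where f="(*)"] refl Bochner_Integration.integral_cong) (auto simp: indicator_def)

lemma fourier_L2_iff:
  "fourier_L2 f g \<longleftrightarrow> L2 f \<and> L2 g \<and> ((\<lambda>R. nrm (\<lambda>\<xi>. Fhat (\<lambda>x. indicator {-R..R} x * f x) \<xi> - g \<xi>)) \<longlongrightarrow> 0) at_top"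
proof -
  have "((\<lambda>R. h R) \<longlongrightarrow> 0) at_top \<longleftrightarrow> ((\<lambda>R. sqrt (h R)) \<longlongrightarrow> 0) at_top" if "\<And>R. h R \<ge> 0" for h :: "real \<Rightarrow> real"
  proof
    assume "((\<lambda>R. h R) \<longlongrightarrow> 0) at_top"
    then have "((\<lambda>R. sqrt (h R)) \<longlongrightarrow> sqrt 0) at_top" by (rule tendsto_real_sqrt)
    then show "((\<lambda>R. sqrt (h R)) \<longlongrightarrow> 0) at_top" by simp
  next
    assume "((\<lambda>R. sqrt (h R)) \<longlongrightarrow> 0) at_top"
    then have "((\<lambda>R. (sqrt (h R))\<^sup>2) \<longlongrightarrow> 0\<^sup>2) at_top" by (rule tendsto_power)
    then show "((\<lambda>R. h R) \<longlongrightarrow> 0) at_top" using that by simp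
  qed
  from this[of "\<lambda>R. LINT \<xi>|lborel. (cmod (fourier_trunc R f \<xi> - g \<xi>))\<^sup>2"]
  show ?thesis unfolding fourier_L2_def by (simp add: fourier_trunc_eq nrm_def)
qed

text \<open>The definition prescribes symmetric truncations, which dilations for instance do not
  respect. By Plancherel any approximating sequence of integrable L2 functions may replace them; the
  symmetry rules below rest on this freedom.\<close>

lemma fourier_L2I:
  assumes f: "L2 f" "L2 g" and fn: "\<And>n::nat. integrable lborel (f' n)" "\<And>n. L2 (f' n)"
    and l: "(\<lambda>n. nrm (\<lambda>x. f' n x - f x)) \<longlonglongrightarrow> 0" "(\<lambda>n. nrm (\<lambda>\<xi>. Fhat (f' n) \<xi> - g \<xi>)) \<longlonglongrightarrow> 0"
  shows "fourier_L2 f g"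
  unfolding fourier_L2_iff
proof (intro conjI f tendsto_at_topI_sequentially)
  fix R :: "nat \<Rightarrow> real" assume R: "filterlim R at_top sequentially"
  let ?t = "\<lambda>n x. indicator {- R n..R n} x * f x"
  have t: "integrable lborel (?t n)" "L2 (?t n)" for n by (auto intro: trunc_integrable L2_trunc f)
  have z: "(\<lambda>n. nrm (\<lambda>x. ?t n x - f x) + nrm (\<lambda>x. f' n x - f x) + nrm (\<lambda>\<xi>. Fhat (f' n) \<xi> - g \<xi>)) \<longlonglongrightarrow> 0"
    using tendsto_add[OF tendsto_add[OF L2_trunc_tendsto[OF f(1) R] l(1)] l(2)] by simp
  show "(\<lambda>n. nrm (\<lambda>\<xi>. Fhat (?t n) \<xi> - g \<xi>)) \<longlonglongrightarrow> 0"
  proof (rule Lim_null_comparison[OF always_eventually z], rule allI)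
    fix n
    have "nrm (\<lambda>\<xi>. Fhat (?t n) \<xi> - g \<xi>) \<le> nrm (\<lambda>\<xi>. Fhat (?t n) \<xi> - Fhat (f' n) \<xi>) + nrm (\<lambda>\<xi>. Fhat (f' n) \<xi> - g \<xi>)"
      by (intro nrm_triangle3 Plancherel_L1_L2 t fn f)
    also have "nrm (\<lambda>\<xi>. Fhat (?t n) \<xi> - Fhat (f' n) \<xi>) = nrm (Fhat (\<lambda>x. ?t n x - f' n x))"
      by (simp add: Fhat_diff[OF t(1) fn(1), abs_def])
    also have "\<dots> = nrm (\<lambda>x. ?t n x - f' n x)"
      by (intro Plancherel_L1_L2 Bochner_Integration.integrable_diff L2_diff t fn)
    also have "\<dots> \<le> nrm (\<lambda>x. ?t n x - f x) + nrm (\<lambda>x. f x - f' n x)"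
      by (intro nrm_triangle3 t fn f)
    finally show "norm (nrm (\<lambda>\<xi>. Fhat (?t n) \<xi> - g \<xi>)) \<le> nrm (\<lambda>x. ?t n x - f x) + nrm (\<lambda>x. f' n x - f x) + nrm (\<lambda>\<xi>. Fhat (f' n) \<xi> - g \<xi>)"
      by (simp add: nrm_minus_commute[of f])
  qed
qed

definition trunc :: "nat \<Rightarrow> (real \<Rightarrow> complex) \<Rightarrow> real \<Rightarrow> complex" where
  "trunc n f x = indicator {-real n..real n} x * f x"

lemma trunc[simp, intro]: 
  assumes "L2 f" shows "integrable lborel (trunc n f)" "L2 (trunc n f)"
  using trunc_integrable[OF assms] L2_trunc[OF assms] by (auto simp: trunc_def[abs_def])

lemma trunc_tendsto: "L2 f \<Longrightarrow> (\<lambda>n. nrm (\<lambda>x. trunc n f x - f x)) \<longlonglongrightarrow> 0"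
  unfolding trunc_def by (rule L2_trunc_tendsto[OF _ filterlim_real_sequentially])

lemma fourier_L2_seq:
  assumes "fourier_L2 f g" shows "(\<lambda>n. nrm (\<lambda>\<xi>. Fhat (trunc n f) \<xi> - g \<xi>)) \<longlonglongrightarrow> 0"
  using filterlim_compose[OF _ filterlim_real_sequentially, of _ "nhds 0"] assms
  unfolding fourier_L2_iff by (auto simp: trunc_def[abs_def])

lemma fourier_L2_L2: "fourier_L2 f g \<Longrightarrow> L2 f" "fourier_L2 f g \<Longrightarrow> L2 g"
  by (auto simp: fourier_L2_iff)

lemma fourier_L2_exists:
  assumes f: "L2 f" shows "\<exists>g. fourier_L2 f g"
proof -
  have L: "L2 (Fhat (trunc n f))" for n by (intro Plancherel_L1_L2 trunc f)
  have C: "\<exists>N. \<forall>m\<ge>N. \<forall>n\<ge>N. nrm (\<lambda>\<xi>. Fhat (trunc m f) \<xi> - Fhat (trunc n f) \<xi>) < e" if e: "e > 0" for e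
  proof -
    have "eventually (\<lambda>n. nrm (\<lambda>x. trunc n f x - f x) < e / 2) sequentially"
      by (rule order_tendstoD(2)[OF trunc_tendsto[OF f]]) (use e in simp)
    then obtain N where N: "\<And>n. n \<ge> N \<Longrightarrow> nrm (\<lambda>x. trunc n f x - f x) < e / 2" by (auto simp: eventually_sequentially)
    have "nrm (\<lambda>\<xi>. Fhat (trunc m f) \<xi> - Fhat (trunc n f) \<xi>) < e" if "m \<ge> N" "n \<ge> N" for m n
    proof -
      have "nrm (\<lambda>\<xi>. Fhat (trunc m f) \<xi> - Fhat (trunc n f) \<xi>) = nrm (Fhat (\<lambda>x. trunc m f x - trunc n f x))"
        by (simp add: Fhat_diff[OF trunc(1)[OF f] trunc(1)[OF f], abs_def])
      also have "\<dots> = nrm (\<lambda>x. trunc m f x - trunc n f x)"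
        by (intro Plancherel_L1_L2 Bochner_Integration.integrable_diff L2_diff trunc f)
      also have "\<dots> \<le> nrm (\<lambda>x. trunc m f x - f x) + nrm (\<lambda>x. f x - trunc n f x)"
        by (intro nrm_triangle3 trunc f)
      also have "\<dots> < e" using N[OF that(1)] N[OF that(2)] by (simp add: nrm_minus_commute[of f])
      finally show ?thesis .
    qed
    then show ?thesis by blast
  qed
  from L2_complete[of "\<lambda>n. Fhat (trunc n f)", OF L C] obtain g where g: "L2 g" "(\<lambda>n. nrm (\<lambda>\<xi>. Fhat (trunc n f) \<xi> - g \<xi>)) \<longlonglongrightarrow> 0" by blast
  then have "fourier_L2 f g" by (intro fourier_L2I[OF f _ _ _ trunc_tendsto] trunc f) auto
  then show ?thesis by blast
qed

lemma FT: "L2 f \<Longrightarrow> fourier_L2 f (FT f)"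
  unfolding FT_def using fourier_L2_exists by (metis someI_ex)

lemma FT_L2[simp, intro]: "L2 f \<Longrightarrow> L2 (FT f)"
  by (rule fourier_L2_L2(2)[OF FT])

lemma nrm_tendsto:
  assumes "\<And>n::nat. L2 (f n)" "L2 g" "(\<lambda>n. nrm (\<lambda>x. f n x - g x)) \<longlonglongrightarrow> 0"
  shows "(\<lambda>n. nrm (f n)) \<longlonglongrightarrow> nrm g"
proof -
  have "(\<lambda>n. nrm (f n) - nrm g) \<longlonglongrightarrow> 0"
    by (rule Lim_null_comparison[OF always_eventually assms(3)]) (use nrm_triangle_rev[OF assms(1,2)] in auto)
  then show ?thesis by (simp add: LIM_zero_iff)
qed

lemma ip_tendsto:
  assumes f: "\<And>n::nat. L2 (f n)" "L2 f'" "(\<lambda>n. nrm (\<lambda>x. f n x - f' x)) \<longlonglongrightarrow> 0"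
    and g: "\<And>n::nat. L2 (g n)" "L2 g'" "(\<lambda>n. nrm (\<lambda>x. g n x - g' x)) \<longlonglongrightarrow> 0"
  shows "(\<lambda>n. ip (f n) (g n)) \<longlonglongrightarrow> ip f' g'"
proof -
  have "(\<lambda>n. nrm (\<lambda>x. f n x - f' x) * nrm (g n) + nrm f' * nrm (\<lambda>x. g n x - g' x)) \<longlonglongrightarrow> 0 * nrm g' + nrm f' * 0"
    by (intro tendsto_intros f g nrm_tendsto)
  then have z: "(\<lambda>n. nrm (\<lambda>x. f n x - f' x) * nrm (g n) + nrm f' * nrm (\<lambda>x. g n x - g' x)) \<longlonglongrightarrow> 0" by simp
  have "(\<lambda>n. ip (f n) (g n) - ip f' g') \<longlonglongrightarrow> 0"
  proof (rule Lim_null_comparison[OF always_eventually z], rule allI)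
    fix n
    have "ip (f n) (g n) - ip f' g' = ip (\<lambda>x. f n x - f' x) (g n) + ip f' (\<lambda>x. g n x - g' x)"
      using f g by simp
    also have "cmod \<dots> \<le> cmod (ip (\<lambda>x. f n x - f' x) (g n)) + cmod (ip f' (\<lambda>x. g n x - g' x))" by (rule norm_triangle_ineq)
    also have "\<dots> \<le> nrm (\<lambda>x. f n x - f' x) * nrm (g n) + nrm f' * nrm (\<lambda>x. g n x - g' x)"
      by (intro add_mono cauchy_schwarz L2_diff f g)
    finally show "cmod (ip (f n) (g n) - ip f' g') \<le> nrm (\<lambda>x. f n x - f' x) * nrm (g n) + nrm f' * nrm (\<lambda>x. g n x - g' x)" .
  qed
  then show ?thesis by (simp add: LIM_zero_iff)
qed

lemma fourier_L2_nrm: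
  assumes "fourier_L2 f g" shows "nrm g = nrm f"
proof -
  note L = fourier_L2_L2[OF assms]
  have "(\<lambda>n. nrm (Fhat (trunc n f))) \<longlonglongrightarrow> nrm g"
    by (intro nrm_tendsto fourier_L2_seq assms L Plancherel_L1_L2 trunc)
  moreover have "(\<lambda>n. nrm (Fhat (trunc n f))) \<longlonglongrightarrow> nrm f"
    using nrm_tendsto[OF trunc(2)[OF L(1)] L(1) trunc_tendsto[OF L(1)]] Plancherel_L1_L2(2)[OF trunc[OF L(1)]] by simp
  ultimately show ?thesis by (rule LIMSEQ_unique)
qed

lemma fourier_L2_unique:
  assumes "fourier_L2 f g" "fourier_L2 f h" shows "AE \<xi> in lborel. g \<xi> = h \<xi>"
proof -
  note L = fourier_L2_L2[OF assms(1)] fourier_L2_L2[OF assms(2)]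
  have z: "(\<lambda>n. nrm (\<lambda>\<xi>. Fhat (trunc n f) \<xi> - g \<xi>) + nrm (\<lambda>\<xi>. Fhat (trunc n f) \<xi> - h \<xi>)) \<longlonglongrightarrow> 0"
    using tendsto_add[OF fourier_L2_seq[OF assms(1)] fourier_L2_seq[OF assms(2)]] by simp
  have "nrm (\<lambda>\<xi>. g \<xi> - h \<xi>) \<le> nrm (\<lambda>\<xi>. Fhat (trunc n f) \<xi> - g \<xi>) + nrm (\<lambda>\<xi>. Fhat (trunc n f) \<xi> - h \<xi>)" for n
    using nrm_triangle3[of g "Fhat (trunc n f)" h] L Plancherel_L1_L2(1)[OF trunc[OF L(1)]] 
    by (simp add: nrm_minus_commute[of g])
  then have "nrm (\<lambda>\<xi>. g \<xi> - h \<xi>) \<le> 0" by (intro LIMSEQ_le_const[OF z]) auto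
  then have "nrm (\<lambda>\<xi>. g \<xi> - h \<xi>) = 0" using nrm_nonneg by (metis order_antisym)
  then have "AE \<xi> in lborel. g \<xi> - h \<xi> = 0" by (intro nrm_zero_AE) (use L in auto)
  then show ?thesis by auto
qed

lemma FT_eqI: "fourier_L2 f g \<Longrightarrow> AE \<xi> in lborel. FT f \<xi> = g \<xi>"
  by (rule fourier_L2_unique[OF FT]) (auto dest: fourier_L2_L2)

lemma fourier_L2_cong_AE:
  assumes "fourier_L2 f g" "f' \<in> borel_measurable borel" "AE x in lborel. f x = f' x" 
    "g' \<in> borel_measurable borel" "AE x in lborel. g x = g' x"
  shows "fourier_L2 f' g'"
proof (rule fourier_L2I)
  note L = fourier_L2_L2[OF assms(1)]
  have [measurable]: "f \<in> borel_measurable borel" "g \<in> borel_measurable borel" using L by (auto dest: L2_measurable)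
  note [measurable] = assms(2,4)
  show L': "L2 f'" "L2 g'" using L2_cong_AE L assms by blast+
  show "integrable lborel (trunc n f)" "L2 (trunc n f)" for n using L by auto
  have "nrm (\<lambda>x. trunc n f x - f' x) = nrm (\<lambda>x. trunc n f x - f x)" for n
    by (rule nrm_cong_AE) (use assms(3) in \<open>auto simp: trunc_def\<close>)
  then show "(\<lambda>n. nrm (\<lambda>x. trunc n f x - f' x)) \<longlonglongrightarrow> 0" using trunc_tendsto[OF L(1)] by simp
  have "Fhat (trunc n f) \<in> borel_measurable borel" for n
    using Plancherel_L1_L2(1)[OF trunc[OF L(1)]] by (rule L2_measurable)
  then have "nrm (\<lambda>x. Fhat (trunc n f) x - g' x) = nrm (\<lambda>x. Fhat (trunc n f) x - g x)" for n
    by (intro nrm_cong_AE) (use assms(5) in auto)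
  then show "(\<lambda>n. nrm (\<lambda>x. Fhat (trunc n f) x - g' x)) \<longlonglongrightarrow> 0" using fourier_L2_seq[OF assms(1)] by simp
qed

lemma FT_cong_AE:
  assumes "L2 f" "L2 f'" "AE x in lborel. f x = f' x" 
  shows "AE \<xi> in lborel. FT f \<xi> = FT f' \<xi>"
  by (rule FT_eqI, rule fourier_L2_cong_AE[OF FT[OF assms(2)]]) (use assms L2_measurable[OF FT_L2[OF assms(2)]] in \<open>auto dest: L2_measurable\<close>)

lemma fourier_L2_Fhat:
  assumes "integrable lborel f" "L2 f" shows "fourier_L2 f (Fhat f)"
  by (rule fourier_L2I[where f'="\<lambda>n. f"]) (use assms Plancherel_L1_L2 in auto)

lemma fourier_L2_add:
  assumes "fourier_L2 f F" "fourier_L2 g G" shows "fourier_L2 (\<lambda>x. f x + g x) (\<lambda>\<xi>. F \<xi> + G \<xi>)"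
proof (rule fourier_L2I)
  note L = fourier_L2_L2[OF assms(1)] fourier_L2_L2[OF assms(2)]
  show "L2 (\<lambda>x. f x + g x)" "L2 (\<lambda>\<xi>. F \<xi> + G \<xi>)" using L by auto
  show "integrable lborel (\<lambda>x. trunc n f x + trunc n g x)" "L2 (\<lambda>x. trunc n f x + trunc n g x)" for n using L by auto
  have z: "(\<lambda>n. nrm (\<lambda>x. trunc n f x - f x) + nrm (\<lambda>x. trunc n g x - g x)) \<longlonglongrightarrow> 0"
    using tendsto_add[OF trunc_tendsto[OF L(1)] trunc_tendsto[OF L(3)]] by simp
  show "(\<lambda>n. nrm (\<lambda>x. trunc n f x + trunc n g x - (f x + g x))) \<longlonglongrightarrow> 0"
  proof (rule Lim_null_comparison[OF always_eventually z], rule allI)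
    fix n show "norm (nrm (\<lambda>x. trunc n f x + trunc n g x - (f x + g x))) \<le> nrm (\<lambda>x. trunc n f x - f x) + nrm (\<lambda>x. trunc n g x - g x)"
      using nrm_triangle[of "\<lambda>x. trunc n f x - f x" "\<lambda>x. trunc n g x - g x"] L by (simp add: algebra_simps)
  qed
  have z: "(\<lambda>n. nrm (\<lambda>x. Fhat (trunc n f) x - F x) + nrm (\<lambda>x. Fhat (trunc n g) x - G x)) \<longlonglongrightarrow> 0"
    using tendsto_add[OF fourier_L2_seq[OF assms(1)] fourier_L2_seq[OF assms(2)]] by simp
  show "(\<lambda>n. nrm (\<lambda>\<xi>. Fhat (\<lambda>x. trunc n f x + trunc n g x) \<xi> - (F \<xi> + G \<xi>))) \<longlonglongrightarrow> 0"
  proof (rule Lim_null_comparison[OF always_eventually z], rule allI)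
    fix n 
    have eq: "Fhat (\<lambda>x. trunc n f x + trunc n g x) \<xi> - (F \<xi> + G \<xi>) = (Fhat (trunc n f) \<xi> - F \<xi>) + (Fhat (trunc n g) \<xi> - G \<xi>)" for \<xi>
      using L by (simp add: Fhat_add)
    show "norm (nrm (\<lambda>\<xi>. Fhat (\<lambda>x. trunc n f x + trunc n g x) \<xi> - (F \<xi> + G \<xi>))) \<le> nrm (\<lambda>x. Fhat (trunc n f) x - F x) + nrm (\<lambda>x. Fhat (trunc n g) x - G x)"
      unfolding eq using nrm_triangle[of "\<lambda>x. Fhat (trunc n f) x - F x" "\<lambda>x. Fhat (trunc n g) x - G x"] L Plancherel_L1_L2(1)[OF trunc] by simp
  qed
qed

lemma fourier_L2_cmult:
  assumes "fourier_L2 f F" shows "fourier_L2 (\<lambda>x. c * f x) (\<lambda>\<xi>. c * F \<xi>)"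
proof (rule fourier_L2I)
  note L = fourier_L2_L2[OF assms(1)] 
  show "L2 (\<lambda>x. c * f x)" "L2 (\<lambda>\<xi>. c * F \<xi>)" using L by auto
  show "integrable lborel (\<lambda>x. c * trunc n f x)" "L2 (\<lambda>x. c * trunc n f x)" for n using L by auto
  show "(\<lambda>n. nrm (\<lambda>x. c * trunc n f x - c * f x)) \<longlonglongrightarrow> 0"
    using tendsto_mult[OF tendsto_const[of "cmod c"] trunc_tendsto[OF L(1)]] by (simp add: nrm_scale flip: right_diff_distrib)
  show "(\<lambda>n. nrm (\<lambda>\<xi>. Fhat (\<lambda>x. c * trunc n f x) \<xi> - c * F \<xi>)) \<longlonglongrightarrow> 0"
    using tendsto_mult[OF tendsto_const[of "cmod c"] fourier_L2_seq[OF assms]] by (simp add: nrm_scale Fhat_cmult flip: right_diff_distrib)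
qed

lemma fourier_L2_diff:
  assumes "fourier_L2 f F" "fourier_L2 g G" shows "fourier_L2 (\<lambda>x. f x - g x) (\<lambda>\<xi>. F \<xi> - G \<xi>)"
  using fourier_L2_add[OF assms(1) fourier_L2_cmult[OF assms(2), of "-1"]] by simp

section \<open>Reflection, dilation and conjugation\<close>

lemma fourier_L2_reflect_measure:
  "L2 f \<Longrightarrow> L2 (\<lambda>x. f (- x))" "nrm (\<lambda>x. f (- x)) = nrm f"
  using lborel_integrable_real_affine[of "\<lambda>x. (cmod (f x))\<^sup>2" "-1" 0] lborel_integral_real_affine[of "-1" "\<lambda>x. (cmod (f x))\<^sup>2" 0]
  by (auto simp: L2_def nrm_def)

lemma L2_dilate:
  assumes "m > 0"
  shows "L2 f \<Longrightarrow> L2 (\<lambda>x. f (m * x))" "nrm (\<lambda>x. f (m * x)) = nrm f / sqrt m"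
proof -
  show "L2 f \<Longrightarrow> L2 (\<lambda>x. f (m * x))"
    using lborel_integrable_real_affine[of "\<lambda>x. (cmod (f x))\<^sup>2" m 0] assms by (auto simp: L2_def)
  show "nrm (\<lambda>x. f (m * x)) = nrm f / sqrt m"
    using lborel_integral_real_affine[of m "\<lambda>x. (cmod (f x))\<^sup>2" 0] assms by (simp add: nrm_def real_sqrt_mult)
qed

lemma lborel_integral_reflect: "(LINT x|lborel. f (- x) :: complex) = integral\<^sup>L lborel (f :: real \<Rightarrow> complex)"
  using lborel_integral_real_affine[of "-1" f 0] by simp

lemma Fhat_cnj: "Fhat (\<lambda>x. cnj (f x)) \<xi> = cnj (Fhat f (- \<xi>))"
proof -
  have "cnj (LINT x|lborel. exp (- \<i> * complex_of_real (- \<xi> * x)) * f x) = (LINT x|lborel. cnj (exp (- \<i> * complex_of_real (- \<xi> * x)) * f x))"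
    by (rule Bochner_Integration.integral_cnj[symmetric])
  also have "\<dots> = (LINT x|lborel. exp (- \<i> * complex_of_real (\<xi> * x)) * cnj (f x))"
    by (simp add: exp_cnj)
  finally show ?thesis by (simp add: Fhat_def)
qed

lemma Fhat_reflect: "Fhat (\<lambda>x. f (- x)) \<xi> = Fhat f (- \<xi>)"
  unfolding Fhat_def using lborel_integral_reflect[of "\<lambda>x. exp (- \<i> * complex_of_real (\<xi> * - x)) * f x"] by simp

lemma Fhat_dilate: 
  assumes "m > 0" shows "Fhat (\<lambda>x. f (m * x)) \<xi> = complex_of_real (1 / m) * Fhat f (\<xi> / m)"
proof -
  have "(LINT x|lborel. exp (- \<i> * complex_of_real (\<xi> / m * x)) * f x) = \<bar>m\<bar> *\<^sub>R (LINT x|lborel. exp (- \<i> * complex_of_real (\<xi> / m * (0 + m * x))) * f (0 + m * x))"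
    by (rule lborel_integral_real_affine) (use assms in auto)
  then show ?thesis unfolding Fhat_def using assms by (simp add: scaleR_conv_of_real)
qed

lemma fourier_L2_cnj:
  assumes "fourier_L2 f F" shows "fourier_L2 (\<lambda>x. cnj (f x)) (\<lambda>\<xi>. cnj (F (- \<xi>)))"
proof (rule fourier_L2I)
  note L = fourier_L2_L2[OF assms(1)] 
  show "L2 (\<lambda>x. cnj (f x))" "L2 (\<lambda>\<xi>. cnj (F (- \<xi>)))" using L fourier_L2_reflect_measure by auto
  show "integrable lborel (\<lambda>x. cnj (trunc n f x))" "L2 (\<lambda>x. cnj (trunc n f x))" for n using L by auto
  show "(\<lambda>n. nrm (\<lambda>x. cnj (trunc n f x) - cnj (f x))) \<longlonglongrightarrow> 0"
    using trunc_tendsto[OF L(1)] by (simp flip: complex_cnj_diff)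
  show "(\<lambda>n. nrm (\<lambda>\<xi>. Fhat (\<lambda>x. cnj (trunc n f x)) \<xi> - cnj (F (- \<xi>)))) \<longlonglongrightarrow> 0"
    using fourier_L2_seq[OF assms] fourier_L2_reflect_measure(2)[of "\<lambda>\<xi>. Fhat (trunc _ f) \<xi> - F \<xi>"]
    by (simp add: Fhat_cnj flip: complex_cnj_diff)
qed

lemma fourier_L2_reflect:
  assumes "fourier_L2 f F" shows "fourier_L2 (\<lambda>x. f (- x)) (\<lambda>\<xi>. F (- \<xi>))"
proof (rule fourier_L2I)
  note L = fourier_L2_L2[OF assms(1)] 
  show "L2 (\<lambda>x. f (- x))" "L2 (\<lambda>\<xi>. F (- \<xi>))" using L fourier_L2_reflect_measure by auto
  show "L2 (\<lambda>x. trunc n f (- x))" for n using L fourier_L2_reflect_measure by auto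
  show "integrable lborel (\<lambda>x. trunc n f (- x))" for n 
    using lborel_integrable_real_affine[of "trunc n f" "-1" 0] L by auto
  show "(\<lambda>n. nrm (\<lambda>x. trunc n f (- x) - f (- x))) \<longlonglongrightarrow> 0"
    using trunc_tendsto[OF L(1)] fourier_L2_reflect_measure(2)[of "\<lambda>\<xi>. trunc _ f \<xi> - f \<xi>"] by simp
  show "(\<lambda>n. nrm (\<lambda>\<xi>. Fhat (\<lambda>x. trunc n f (- x)) \<xi> - F (- \<xi>))) \<longlonglongrightarrow> 0"
    using fourier_L2_seq[OF assms] fourier_L2_reflect_measure(2)[of "\<lambda>\<xi>. Fhat (trunc _ f) \<xi> - F \<xi>"]
    by (simp add: Fhat_reflect)
qed

lemma fourier_L2_dilate:
  assumes "fourier_L2 f F" "m > 0" shows "fourier_L2 (\<lambda>x. f (m * x)) (\<lambda>\<xi>. complex_of_real (1 / m) * F (\<xi> / m))"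
proof (rule fourier_L2I)
  note L = fourier_L2_L2[OF assms(1)] 
  have m: "1 / m > 0" using assms(2) by simp
  show "L2 (\<lambda>x. f (m * x))" using L L2_dilate[OF assms(2)] by auto
  show "L2 (\<lambda>\<xi>. complex_of_real (1 / m) * F (\<xi> / m))" using L2_cmult[OF L2_dilate(1)[OF m L(2)], of "complex_of_real (1 / m)"] by simp
  show "L2 (\<lambda>x. trunc n f (m * x))" for n using L L2_dilate[OF assms(2)] by auto
  show "integrable lborel (\<lambda>x. trunc n f (m * x))" for n 
    using lborel_integrable_real_affine[of "trunc n f" m 0] L assms(2) by auto
  have "(\<lambda>n. nrm (\<lambda>x. trunc n f x - f x) / sqrt m) \<longlonglongrightarrow> 0 / sqrt m"
    by (intro tendsto_intros trunc_tendsto L) (use assms(2) in auto)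
  then show "(\<lambda>n. nrm (\<lambda>x. trunc n f (m * x) - f (m * x))) \<longlonglongrightarrow> 0"
    using L2_dilate(2)[OF assms(2), of "\<lambda>x. trunc _ f x - f x"] by simp
  have eq: "nrm (\<lambda>\<xi>. Fhat (\<lambda>x. trunc n f (m * x)) \<xi> - complex_of_real (1 / m) * F (\<xi> / m)) = 1 / m * (nrm (\<lambda>\<xi>. Fhat (trunc n f) \<xi> - F \<xi>) / sqrt (1 / m))" for n
  proof -
    have "(\<lambda>\<xi>. Fhat (\<lambda>x. trunc n f (m * x)) \<xi> - complex_of_real (1 / m) * F (\<xi> / m)) = (\<lambda>\<xi>. complex_of_real (1 / m) * (Fhat (trunc n f) (1 / m * \<xi>) - F (1 / m * \<xi>)))"
      by (simp add: Fhat_dilate[OF assms(2)] right_diff_distrib)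
    then show ?thesis using L2_dilate(2)[OF m, of "\<lambda>x. Fhat (trunc n f) x - F x"] assms(2) by (simp only: nrm_scale norm_of_real) simp
  qed
  have "(\<lambda>n. 1 / m * (nrm (\<lambda>\<xi>. Fhat (trunc n f) \<xi> - F \<xi>) / sqrt (1 / m))) \<longlonglongrightarrow> 1 / m * (0 / sqrt (1 / m))"
    by (intro tendsto_intros fourier_L2_seq assms) (use assms(2) in auto)
  then show "(\<lambda>n. nrm (\<lambda>\<xi>. Fhat (\<lambda>x. trunc n f (m * x)) \<xi> - complex_of_real (1 / m) * F (\<xi> / m))) \<longlonglongrightarrow> 0"
    unfolding eq by simp
qed

text \<open>Polarisation: the norm of a sum gives the real part, and replacing \<open>f\<close> by
  \<open>\<i> * f\<close> gives the imaginary part.\<close>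

lemma Parseval:
  assumes "fourier_L2 f F" "fourier_L2 g G" shows "ip F G = ip f g"
proof -
  have re: "Re (ip F G) = Re (ip f g)" if "fourier_L2 f F" "fourier_L2 g G" for f F g G
    using nrm_add_sq[OF fourier_L2_L2(1)[OF that(1)] fourier_L2_L2(1)[OF that(2)]]
      nrm_add_sq[OF fourier_L2_L2(2)[OF that(1)] fourier_L2_L2(2)[OF that(2)]]
      fourier_L2_nrm[OF fourier_L2_add[OF that]] fourier_L2_nrm[OF that(1)] fourier_L2_nrm[OF that(2)] by simp
  have "Re (ip (\<lambda>\<xi>. \<i> * F \<xi>) G) = Re (ip (\<lambda>x. \<i> * f x) g)"
    by (rule re[OF fourier_L2_cmult[OF assms(1)] assms(2)])
  then show ?thesis using re[OF assms] by (simp add: complex_eq_iff)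
qed

lemma FT_multiplication_formula:
  assumes "fourier_L2 f F" "fourier_L2 g G" 
  shows "(LINT x|lborel. F x * g x) = (LINT x|lborel. f x * G x)"
proof -
  note L = fourier_L2_L2[OF assms(1)] fourier_L2_L2[OF assms(2)]
  have c: "L2 (\<lambda>x. cnj (Fhat (trunc n g) x))" for n using Plancherel_L1_L2(1)[OF trunc[OF L(3)]] by simp
  have "(\<lambda>n. ip (Fhat (trunc n f)) (\<lambda>x. cnj (trunc n g x))) \<longlonglongrightarrow> ip F (\<lambda>x. cnj (g x))"
    by (intro ip_tendsto fourier_L2_seq assms L L2_cnj Plancherel_L1_L2 trunc)
       (use trunc_tendsto[OF L(3)] in \<open>simp flip: complex_cnj_diff\<close>)
  moreover have "(\<lambda>n. ip (trunc n f) (\<lambda>x. cnj (Fhat (trunc n g) x))) \<longlonglongrightarrow> ip f (\<lambda>x. cnj (G x))"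
    by (intro ip_tendsto trunc_tendsto L L2_cnj trunc c)
       (use fourier_L2_seq[OF assms(2)] in \<open>simp flip: complex_cnj_diff\<close>)
  moreover have "ip (Fhat (trunc n f)) (\<lambda>x. cnj (trunc n g x)) = ip (trunc n f) (\<lambda>x. cnj (Fhat (trunc n g) x))" for n
    unfolding ip_def using Fhat_multiplication_formula[OF trunc(1)[OF L(1)] trunc(1)[OF L(3)]] by simp
  ultimately have "ip F (\<lambda>x. cnj (g x)) = ip f (\<lambda>x. cnj (G x))" using LIMSEQ_unique by auto
  then show ?thesis by (simp add: ip_def)
qed

text \<open>The candidate \<open>f\<close> has the norm of \<open>G\<close>, hence so does
  \<open>FT f\<close>. The multiplication formula gives
  \<open>ip (FT f) (FT f) = ip G (FT f)\<close>. Expanding the squared norm of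
  \<open>G - FT f\<close>, these two facts make it vanish.\<close>

theorem Fourier_inversion:
  assumes G: "L2 G" shows "fourier_L2 (\<lambda>x. FT G (- x)) G"
proof -
  define f where "f x = FT G (- x)" for x
  have f: "L2 f" unfolding f_def using FT_L2[OF G] fourier_L2_reflect_measure by auto
  note F = FT[OF f] and L = f FT_L2[OF f]
  have "ip (FT f) (FT f) = ip f f" by (rule Parseval[OF F F])
  also have "\<dots> = (LINT x|lborel. FT G (- x) * cnj (f (- (- x))))" by (simp add: ip_def f_def)
  also have "\<dots> = (LINT x|lborel. FT G x * cnj (f (- x)))"
    by (rule lborel_integral_reflect[of "\<lambda>x. FT G x * cnj (f (- x))"])
  also have "\<dots> = (LINT x|lborel. G x * cnj (FT f (- (- x))))"
    by (rule FT_multiplication_formula[OF FT[OF G] fourier_L2_cnj[OF fourier_L2_reflect[OF F]]])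
  also have "\<dots> = ip G (FT f)" by (simp add: ip_def)
  finally have 1: "ip (FT f) (FT f) = ip G (FT f)" .
  have "nrm f = nrm (FT G)" unfolding f_def by (rule fourier_L2_reflect_measure(2))
  then have 2: "nrm (FT f) = nrm G" using fourier_L2_nrm[OF F] fourier_L2_nrm[OF FT[OF G]] by simp
  have "(nrm (\<lambda>x. G x - FT f x))\<^sup>2 = 0"
    using nrm_diff_sq[OF G L(2)] 2 by (simp add: 1[symmetric] Re_ip_self)
  then have "AE x in lborel. G x - FT f x = 0" by (intro nrm_zero_AE) (use G L in auto)
  then have "AE x in lborel. FT f x = G x" by eventually_elim simp
  then have "fourier_L2 f G" using F f G by (intro fourier_L2_cong_AE[OF F]) (auto dest: L2_measurable)
  moreover have "f = (\<lambda>x. FT G (- x))" by (rule ext) (rule f_def)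
  ultimately show ?thesis by simp
qed

subsection \<open>Functions with a square-integrable weak derivative\<close>

text \<open>Functions recovered from a square-integrable derivative by integration. The first
  argument is thereby the continuous representative and has genuine point values, while the second
  is determined only almost everywhere.\<close>

definition H1 :: "(real \<Rightarrow> complex) \<Rightarrow> (real \<Rightarrow> complex) \<Rightarrow> bool" where
  "H1 f f' \<longleftrightarrow> L2 f \<and> L2 f' \<and> (\<forall>a b. a \<le> b \<longrightarrow> f b - f a = (LINT x:{a..b}|lborel. f' x))"

lemma H1_L2: "H1 f f' \<Longrightarrow> L2 f" "H1 f f' \<Longrightarrow> L2 f'" 
  by (auto simp: H1_def)

lemma H1_diff_eq: "H1 f f' \<Longrightarrow> a \<le> b \<Longrightarrow> f b - f a = (LINT x:{a..b}|lborel. f' x)"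
  by (auto simp: H1_def)

lemma indicator_scaleR_complex: "indicator A x *\<^sub>R (z :: complex) = indicator A x * z"
  by (auto simp: indicator_def)

lemma AE_lborel_affine:
  fixes c t :: real
  assumes "AE x in lborel. P x" "c \<noteq> 0" shows "AE x in lborel. P (t + c * x)"
proof -
  from AE_E[OF assms(1)] obtain N where N: "{x. \<not> P x} \<subseteq> N" "emeasure lborel N = 0" "N \<in> sets lborel" 
    by auto
  have [measurable]: "N \<in> sets borel" using N by simp
  have "ennreal \<bar>c\<bar> * (\<integral>\<^sup>+x. indicator N (t + c * x) \<partial>lborel) = (\<integral>\<^sup>+x. indicator N x \<partial>lborel)"
    by (rule nn_integral_real_affine[symmetric]) (use assms in auto)
  also have "\<dots> = 0" using N by simp
  finally have "(\<integral>\<^sup>+x. indicator N (t + c * x) \<partial>lborel) = 0" using assms(2) by simp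
  then have "AE x in lborel. (indicator N (t + c * x) :: ennreal) = 0"
    by (subst (asm) nn_integral_0_iff_AE) auto
  then show ?thesis by eventually_elim (use N(1) in \<open>auto simp: indicator_def split: if_splits\<close>)
qed

lemma L2_set_integrable: "L2 f \<Longrightarrow> set_integrable lborel {a..b} f"
  using trunc_integrable[of f a b] by (simp add: set_integrable_def indicator_scaleR_complex)

lemma L2_set_integral_bound:
  assumes "L2 f" "a \<le> b" 
  shows "cmod (LINT x:{a..b}|lborel. f x) \<le> sqrt (b - a) * nrm f"
    "(LINT x:{a..b}|lborel. cmod (f x)) \<le> sqrt (b - a) * nrm f"
proof -
  let ?i = "\<lambda>x. (1::complex) * indicator {a..b} x"
  have ni: "nrm ?i = sqrt (b - a)"
  proof -
    have "(LINT x|lborel. (cmod (?i x))\<^sup>2) = (LINT x|lborel. indicator {a..b} x)"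
      by (intro Bochner_Integration.integral_cong) (auto simp: indicator_def)
    then show ?thesis using assms(2) by (simp add: nrm_def)
  qed
  have "(LINT x|lborel. cmod (?i x) * cmod (f x)) \<le> sqrt (b - a) * nrm f"
    using cauchy_schwarz_norm[OF L2_const_on_interval[of 1 a b] assms(1)] ni by simp
  moreover have "(LINT x|lborel. cmod (?i x) * cmod (f x)) = (LINT x:{a..b}|lborel. cmod (f x))"
    unfolding set_lebesgue_integral_def by (intro Bochner_Integration.integral_cong) (auto simp: indicator_def)
  ultimately show 1: "(LINT x:{a..b}|lborel. cmod (f x)) \<le> sqrt (b - a) * nrm f" by simp
  have "cmod (LINT x:{a..b}|lborel. f x) \<le> (LINT x:{a..b}|lborel. cmod (f x))"
    by (rule set_integral_norm_bound[OF L2_set_integrable[OF assms(1)]])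
  with 1 show "cmod (LINT x:{a..b}|lborel. f x) \<le> sqrt (b - a) * nrm f" by simp
qed

lemma H1_holder:
  assumes "H1 f f'" shows "cmod (f b - f a) \<le> sqrt \<bar>b - a\<bar> * nrm f'"
proof -
  have *: "cmod (f b - f a) \<le> sqrt (b - a) * nrm f'" if "a \<le> b" for a b
    using H1_diff_eq[OF assms that] L2_set_integral_bound(1)[OF H1_L2(2)[OF assms] that] by simp
  show ?thesis using *[of a b] *[of b a] by (cases "a \<le> b") (auto simp: norm_minus_commute)
qed

lemma H1_isCont:
  assumes "H1 f f'" shows "isCont f a"
proof -
  have l: "((\<lambda>x. sqrt \<bar>x - a\<bar> * nrm f') \<longlongrightarrow> sqrt \<bar>a - a\<bar> * nrm f') (at a)"
    by (intro tendsto_intros)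
  then have l: "((\<lambda>x. sqrt \<bar>x - a\<bar> * nrm f') \<longlongrightarrow> 0) (at a)" by simp
  have "((\<lambda>x. f x - f a) \<longlongrightarrow> 0) (at a)"
    by (rule Lim_null_comparison[OF always_eventually l]) (use H1_holder[OF assms] in auto)
  then show ?thesis by (simp add: isCont_def LIM_zero_iff)
qed

lemma H1_continuous_on: "H1 f f' \<Longrightarrow> continuous_on S f"
  by (simp add: continuous_at_imp_continuous_on H1_isCont)

lemma H1_cmult: "H1 f f' \<Longrightarrow> H1 (\<lambda>x. c * f x) (\<lambda>x. c * f' x)"
  unfolding H1_def by (auto simp flip: right_diff_distrib)

lemma H1_add:
  assumes "H1 f f'" "H1 g g'" shows "H1 (\<lambda>x. f x + g x) (\<lambda>x. f' x + g' x)"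
  unfolding H1_def
proof (intro conjI allI impI)
  note L = H1_L2[OF assms(1)] H1_L2[OF assms(2)]
  show "L2 (\<lambda>x. f x + g x)" "L2 (\<lambda>x. f' x + g' x)" using L by auto
  fix a b :: real assume ab: "a \<le> b"
  show "f b + g b - (f a + g a) = (LINT x:{a..b}|lborel. f' x + g' x)"
    using H1_diff_eq[OF assms(1) ab] H1_diff_eq[OF assms(2) ab]
      set_integral_add(2)[OF L2_set_integrable[OF L(2), of a b] L2_set_integrable[OF L(4), of a b]]
    by (simp add: algebra_simps)
qed

lemma H1_diff: "H1 f f' \<Longrightarrow> H1 g g' \<Longrightarrow> H1 (\<lambda>x. f x - g x) (\<lambda>x. f' x - g' x)"
  using H1_add[of f f' "\<lambda>x. -1 * g x" "\<lambda>x. -1 * g' x"] H1_cmult[of g g' "-1"] by simp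

lemma H1_cnj:
  assumes "H1 f f'" shows "H1 (\<lambda>x. cnj (f x)) (\<lambda>x. cnj (f' x))"
  unfolding H1_def
proof (intro conjI allI impI)
  show "L2 (\<lambda>x. cnj (f x))" "L2 (\<lambda>x. cnj (f' x))" using H1_L2[OF assms] by auto
  fix a b :: real assume ab: "a \<le> b"
  have "cnj (LINT x:{a..b}|lborel. f' x) = (LINT x:{a..b}|lborel. cnj (f' x))"
    unfolding set_lebesgue_integral_def Bochner_Integration.integral_cnj[symmetric] by simp
  then show "cnj (f b) - cnj (f a) = (LINT x:{a..b}|lborel. cnj (f' x))"
    using H1_diff_eq[OF assms(1) ab] by (simp flip: complex_cnj_diff)
qed

text \<open>The integral of \<open>f' x * g' y\<close> over the triangle of points with
  \<open>y \<le> x\<close> is computed in both orders. One order produces the increment of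
  \<open>g\<close> against \<open>f'\<close>, the other the increment of \<open>f\<close> against
  \<open>g'\<close>; the product rule is the resulting equality rearranged.\<close>

lemma H1_product_rule:
  assumes f: "H1 f f'" and g: "H1 g g'" and ab: "a \<le> b"
  shows "f b * g b - f a * g a = (LINT x:{a..b}|lborel. f' x * g x + f x * g' x)"
    "set_integrable lborel {a..b} (\<lambda>x. f' x * g x)" "set_integrable lborel {a..b} (\<lambda>x. f x * g' x)"
proof -
  note L = H1_L2[OF f] H1_L2[OF g]
  have [measurable]: "f \<in> borel_measurable borel" "g \<in> borel_measurable borel" "f' \<in> borel_measurable borel" "g' \<in> borel_measurable borel"
    using L by (auto dest: L2_measurable)
  let ?F = "\<lambda>x. indicator {a..b} x *\<^sub>R f' x" and ?G = "\<lambda>x. indicator {a..b} x *\<^sub>R g' x"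
  let ?k = "\<lambda>p. if snd p \<le> fst p then 1 else (0::complex)"
  have FG: "integrable lborel ?F" "integrable lborel ?G" 
    using L2_set_integrable L by (auto simp: set_integrable_def)
  have i: "integrable (lborel \<Otimes>\<^sub>M lborel) (\<lambda>(x, y). ?k (x, y) * (?F x * ?G y))"
    by (rule pair_integrable_mult[OF FG]) (auto simp: )
  have inner1: "(LINT y|lborel. ?k (x, y) * (?F x * ?G y)) = ?F x * (g x - g a)" for x
  proof (cases "x \<in> {a..b}")
    case True
    have "(LINT y|lborel. ?k (x, y) * (?F x * ?G y)) = (LINT y|lborel. ?F x * (indicator {a..x} y *\<^sub>R g' y))"
      by (intro Bochner_Integration.integral_cong) (use True in \<open>auto simp: indicator_def\<close>)
    also have "\<dots> = ?F x * (LINT y:{a..x}|lborel. g' y)" unfolding set_lebesgue_integral_def 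
      by (rule Bochner_Integration.integral_mult_right_zero)
    also have "(LINT y:{a..x}|lborel. g' y) = g x - g a" using H1_diff_eq[OF g, of a x] True by simp
    finally show ?thesis .
  qed (auto simp: indicator_def)
  have inner2: "(LINT x|lborel. ?k (x, y) * (?F x * ?G y)) = ?G y * (f b - f y)" for y
  proof (cases "y \<in> {a..b}")
    case True
    have "(LINT x|lborel. ?k (x, y) * (?F x * ?G y)) = (LINT x|lborel. ?G y * (indicator {y..b} x *\<^sub>R f' x))"
      by (intro Bochner_Integration.integral_cong) (use True in \<open>auto simp: indicator_def\<close>)
    also have "\<dots> = ?G y * (LINT x:{y..b}|lborel. f' x)" unfolding set_lebesgue_integral_def 
      by (rule Bochner_Integration.integral_mult_right_zero)
    also have "(LINT x:{y..b}|lborel. f' x) = f b - f y" using H1_diff_eq[OF f, of y b] True by simp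
    finally show ?thesis .
  qed (auto simp: indicator_def)
  have "(LINT y|lborel. LINT x|lborel. ?k (x, y) * (?F x * ?G y)) = (LINT x|lborel. LINT y|lborel. ?k (x, y) * (?F x * ?G y))"
    using lborel_pair.Fubini_integral[OF i] .
  then have eq: "(LINT y|lborel. ?G y * (f b - f y)) = (LINT x|lborel. ?F x * (g x - g a))"
    by (simp only: inner1 inner2)
  have s1: "set_integrable lborel {a..b} (\<lambda>x. f' x * g x)" and s2: "set_integrable lborel {a..b} (\<lambda>x. f x * g' x)"
    unfolding set_integrable_def indicator_scaleR_complex
    using L2_prod_integrable[OF L2_trunc[OF L(2)] L(3), of a b] L2_prod_integrable[OF L2_trunc[OF L(1)] L(4), of a b]
    by (simp_all add: mult.assoc)
  show "set_integrable lborel {a..b} (\<lambda>x. f' x * g x)" "set_integrable lborel {a..b} (\<lambda>x. f x * g' x)" by fact+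
  have s1': "integrable lborel (\<lambda>x. ?F x * g x)" and s2': "integrable lborel (\<lambda>x. ?G x * f x)"
    using s1 s2 unfolding set_integrable_def by (simp_all add: mult.commute)
  have lin: "(LINT y|lborel. H y * (c - k y)) = integral\<^sup>L lborel H * c - (LINT y|lborel. H y * k y)" 
    if "integrable lborel H" "integrable lborel (\<lambda>y. H y * k y)" for H k :: "real \<Rightarrow> complex" and c
    using that by (simp add: right_diff_distrib)
  have lhs: "(LINT y|lborel. ?G y * (f b - f y)) = (g b - g a) * f b - (LINT y|lborel. ?G y * f y)"
    using lin[OF FG(2) s2', of "f b"] H1_diff_eq[OF g ab] unfolding set_lebesgue_integral_def by (simp only:)
  have "(LINT x|lborel. ?F x * (g a - g x)) = (f b - f a) * g a - (LINT x|lborel. ?F x * g x)"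
    using lin[OF FG(1) s1', of "g a"] H1_diff_eq[OF f ab] unfolding set_lebesgue_integral_def by (simp only:)
  moreover have "(LINT x|lborel. ?F x * (g a - g x)) = - (LINT x|lborel. ?F x * (g x - g a))"
    unfolding Bochner_Integration.integral_minus[symmetric] by (simp add: algebra_simps)
  ultimately have rhs: "(LINT x|lborel. ?F x * (g x - g a)) = (LINT x|lborel. ?F x * g x) - (f b - f a) * g a"
    by (simp add: algebra_simps)
  have "(LINT x:{a..b}|lborel. f' x * g x + f x * g' x) = (LINT x|lborel. ?F x * g x) + (LINT y|lborel. ?G y * f y)"
    using set_integral_add(2)[OF s1 s2] unfolding set_lebesgue_integral_def by (simp add: mult.commute)
  moreover have "fb * gb - fa * ga = A + B" if "(gb - ga) * fb - B = A - (fb - fa) * ga" for fb gb fa ga A B :: complex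
    using that by (simp add: algebra_simps)
  note this[OF eq[unfolded lhs rhs]]
  ultimately show "f b * g b - f a * g a = (LINT x:{a..b}|lborel. f' x * g x + f x * g' x)" by simp
qed

text \<open>Supplies a base point to the left of \<open>x\<close> at which \<open>f\<close> nearly
  vanishes, as a substitute for the value at minus infinity.\<close>

lemma L2_small_somewhere:
  assumes "L2 f" "e > 0" shows "\<exists>a\<le>x. (cmod (f a))\<^sup>2 < e"
proof (rule ccontr)
  assume "\<not> ?thesis"
  then have ge: "\<And>a. a \<le> x \<Longrightarrow> (cmod (f a))\<^sup>2 \<ge> e" by force
  \<comment> \<open>The length is chosen so that a lower bound \<open>e\<close> on an interval of
    length \<open>T\<close> contributes one more than the squared norm.\<close>
  define T where "T = ((nrm f)\<^sup>2 + 1) / e"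
  have T: "T > 0" unfolding T_def using assms(2) by (intro divide_pos_pos add_nonneg_pos) auto
  have "e * T = (LINT y|lborel. e * indicator {x-T..x} y)" using T by simp
  also have "\<dots> \<le> (LINT y|lborel. (cmod (f y))\<^sup>2)"
  proof (rule integral_mono)
    show "integrable lborel (\<lambda>y. e * indicator {x-T..x} y)"
      by (intro integrable_mult_right integrable_real_indicator) (auto simp: emeasure_lborel_Icc_eq)
    show "e * indicator {x-T..x} y \<le> (cmod (f y))\<^sup>2" for y
      using ge[of y] by (auto simp: indicator_def)
  qed (rule L2_integrable[OF assms(1)])
  also have "\<dots> = (nrm f)\<^sup>2" by (simp add: nrm_sq)
  finally show False using assms(2) by (simp add: T_def)
qed

text \<open>The fundamental theorem for \<open>f * cnj f\<close>, started where it is nearly zero.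
  The product form, unlike the sum in the next bound, behaves correctly under rescaling and is what
  fixes the length scale of the solution later.\<close>

lemma H1_sup_bound_sq:
  assumes f: "H1 f f'" shows "(cmod (f x))\<^sup>2 \<le> 2 * nrm f * nrm f'"
proof (rule field_le_epsilon)
  fix e :: real assume "e > 0"
  from L2_small_somewhere[OF H1_L2(1)[OF f] this] obtain a where a: "a \<le> x" "(cmod (f a))\<^sup>2 < e" by blast
  note L = H1_L2[OF f]
  let ?h = "\<lambda>y. f' y * cnj (f y) + f y * cnj (f' y)"
  have "complex_of_real ((cmod (f x))\<^sup>2) - complex_of_real ((cmod (f a))\<^sup>2) = (LINT y:{a..x}|lborel. ?h y)"
    using H1_product_rule(1)[OF f H1_cnj[OF f] a(1)] by (simp only: complex_norm_square)
  then have "(cmod (f x))\<^sup>2 - (cmod (f a))\<^sup>2 = Re (LINT y:{a..x}|lborel. ?h y)"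
    by (metis Re_complex_of_real of_real_diff)
  also have "\<dots> \<le> cmod (LINT y:{a..x}|lborel. ?h y)" by (rule complex_Re_le_cmod)
  also have "\<dots> \<le> (LINT y|lborel. cmod (indicator {a..x} y *\<^sub>R ?h y))" 
    unfolding set_lebesgue_integral_def by (rule integral_norm_bound)
  also have "\<dots> \<le> (LINT y|lborel. 2 * (cmod (f y) * cmod (f' y)))"
  proof (rule integral_mono')
    show "integrable lborel (\<lambda>y. 2 * (cmod (f y) * cmod (f' y)))"
      using L2_prod_norm_integrable[OF L] by simp
    show "cmod (indicator {a..x} y *\<^sub>R ?h y) \<le> 2 * (cmod (f y) * cmod (f' y))" for y
      using norm_triangle_ineq[of "f' y * cnj (f y)" "f y * cnj (f' y)"] 
      by (auto simp: indicator_def norm_mult mult.commute)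
  qed auto
  also have "\<dots> \<le> 2 * (nrm f * nrm f')" using cauchy_schwarz_norm[OF L] by simp
  finally show "(cmod (f x))\<^sup>2 \<le> 2 * nrm f * nrm f' + e" using a(2) by simp
qed

lemma H1_sup_bound:
  assumes f: "H1 f f'" shows "cmod (f x) \<le> nrm f + nrm f'"
proof (rule power2_le_imp_le)
  show "(cmod (f x))\<^sup>2 \<le> (nrm f + nrm f')\<^sup>2"
    using H1_sup_bound_sq[OF f, of x] zero_le_power2[of "nrm f"] zero_le_power2[of "nrm f'"] unfolding power2_sum by linarith
qed simp

lemma H1_measurable: "H1 f f' \<Longrightarrow> f \<in> borel_measurable borel" "H1 f f' \<Longrightarrow> f' \<in> borel_measurable borel"
  by (auto dest: H1_L2 L2_measurable)

lemma L2_mult_H1: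
  assumes "H1 f f'" "L2 g" shows "L2 (\<lambda>x. f x * g x)" "L2 (\<lambda>x. g x * f x)"
  using L2_bounded_mult[OF assms(2) H1_measurable(1)[OF assms(1)] H1_sup_bound[OF assms(1)]] by auto

lemma H1_mult:
  assumes f: "H1 f f'" and g: "H1 g g'" shows "H1 (\<lambda>x. f x * g x) (\<lambda>x. f' x * g x + f x * g' x)"
  unfolding H1_def 
  by (intro conjI allI impI H1_product_rule(1)[OF f g] L2_add L2_mult_H1[OF f] L2_mult_H1[OF g] H1_L2[OF f] H1_L2[OF g])

text \<open>Handles boundary terms: in an integration by parts they converge because the integrals
  do, and as functions of the endpoint they are integrable, so the limit is 0.\<close>

lemma integrable_limit_zero:
  fixes k :: "real \<Rightarrow> complex"
  assumes k: "integrable lborel k" "(k \<longlongrightarrow> c) at_top" shows "c = 0"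
proof (rule ccontr)
  assume c: "c \<noteq> 0"
  define e where "e = cmod c / 2"
  have e: "e > 0" using c by (simp add: e_def)
  have "((\<lambda>x. cmod (k x)) \<longlongrightarrow> cmod c) at_top" by (intro tendsto_norm k)
  then have "eventually (\<lambda>x. cmod (k x) > e) at_top" by (rule order_tendstoD) (use c in \<open>simp add: e_def\<close>)
  then obtain x where x: "\<And>y. y \<ge> x \<Longrightarrow> cmod (k y) > e" by (auto simp: eventually_at_top_linorder)
  define I where "I = (LINT y|lborel. cmod (k y))"
  define T where "T = (I + 1) / e"
  have I: "I \<ge> 0" by (simp add: I_def)
  have T: "T > 0" unfolding T_def using e I by (intro divide_pos_pos add_nonneg_pos) auto
  have "e * T = (LINT y|lborel. e * indicator {x..x+T} y)" using T by simp
  also have "\<dots> \<le> I" unfolding I_def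
  proof (rule integral_mono)
    show "integrable lborel (\<lambda>y. e * indicator {x..x+T} y)"
      by (intro integrable_mult_right integrable_real_indicator) (auto simp: emeasure_lborel_Icc_eq)
    show "e * indicator {x..x+T} y \<le> cmod (k y)" for y
      using x[of y] by (auto simp: indicator_def)
  qed (use k in auto)
  finally show False using e by (simp add: T_def)
qed

lemma set_integral_tendsto_whole:
  fixes h :: "real \<Rightarrow> complex"
  assumes "integrable lborel h"
  shows "((\<lambda>T. LINT x:{-T..T}|lborel. h x) \<longlongrightarrow> (LINT x|lborel. h x)) at_top"
  unfolding set_lebesgue_integral_def
proof (rule integral_dominated_convergence_at_top[where w="\<lambda>x. cmod (h x)"])
  show "AE x in lborel. ((\<lambda>T. indicator {-T..T} x *\<^sub>R h x) \<longlongrightarrow> h x) at_top"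
  proof (rule AE_I2)
    fix x :: real
    have "eventually (\<lambda>T. T \<ge> \<bar>x\<bar>) at_top" by (rule eventually_ge_at_top)
    then have "eventually (\<lambda>T. indicator {-T..T} x *\<^sub>R h x = h x) at_top"
      by eventually_elim (auto simp: indicator_def)
    then show "((\<lambda>T. indicator {-T..T} x *\<^sub>R h x) \<longlongrightarrow> h x) at_top" by (rule tendsto_eventually)
  qed
  show "\<forall>\<^sub>F T in at_top. AE x in lborel. norm (indicator {-T..T} x *\<^sub>R h x) \<le> cmod (h x)"
    by (intro always_eventually allI AE_I2) (auto simp: indicator_def)
qed (use assms in \<open>auto dest: borel_measurable_integrable\<close>)

lemma H1_integration_by_parts:
  assumes f: "H1 f f'" and g: "H1 g g'" 
  shows "(LINT x|lborel. f' x * g x) = - (LINT x|lborel. f x * g' x)"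
proof -
  note L = H1_L2[OF f] H1_L2[OF g]
  let ?h = "\<lambda>x. f' x * g x + f x * g' x"
  have i: "integrable lborel (\<lambda>x. f' x * g x)" "integrable lborel (\<lambda>x. f x * g' x)" using L by auto
  have l: "((\<lambda>T. f T * g T - f (-T) * g (-T)) \<longlongrightarrow> (LINT x|lborel. ?h x)) at_top"
  proof (rule Lim_transform_eventually[OF set_integral_tendsto_whole])
    show "\<forall>\<^sub>F T in at_top. (LINT x:{-T..T}|lborel. ?h x) = f T * g T - f (-T) * g (-T)"
      using eventually_ge_at_top[of 0] by eventually_elim (subst H1_product_rule(1)[OF f g], auto)
  qed (use i in auto)
  have fg: "integrable lborel (\<lambda>x. f x * g x)" using L by auto
  have "integrable lborel (\<lambda>x. f (- x) * g (- x))" 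
    using lborel_integrable_real_affine[OF fg, of "-1" 0] by simp
  then have "integrable lborel (\<lambda>T. f T * g T - f (-T) * g (-T))" using fg by auto
  from integrable_limit_zero[OF this l] have "(LINT x|lborel. ?h x) = 0" .
  then show ?thesis using i by (simp add: eq_neg_iff_add_eq_0)
qed

lemma ip_H1: "H1 f f' \<Longrightarrow> H1 g g' \<Longrightarrow> ip f' g = - ip f g'"
  unfolding ip_def by (rule H1_integration_by_parts[OF _ H1_cnj])

text \<open>Promotes almost everywhere identities between H1 functions to identities at every point,
  where point values matter.\<close>

lemma continuous_AE_eq:
  fixes f g :: "real \<Rightarrow> complex"
  assumes "\<And>x. isCont f x" "\<And>x. isCont g x" "AE x in lborel. f x = g x" shows "f = g"
proof (rule ext, rule ccontr)
  fix x assume "f x \<noteq> g x"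
  have "open {x. f x \<noteq> g x}" by (intro open_Collect_neq continuous_at_imp_continuous_on) (use assms in auto)
  then obtain d where d: "d > 0" "ball x d \<subseteq> {x. f x \<noteq> g x}" 
    using \<open>f x \<noteq> g x\<close> by (auto elim!: openE)
  have "AE y in lborel. y \<notin> ball x d" using assms(3) by eventually_elim (use d in auto)
  then have "ball x d \<in> null_sets lborel" by (subst AE_iff_null_sets) auto
  then have "emeasure lborel (ball x d) = 0" by auto
  moreover have "ball x d = {x-d<..<x+d}" by (auto simp: dist_real_def)
  ultimately show False using d(1) by simp
qed

section \<open>H1 on the Fourier side\<close>

lemma exp_i_interval_integral:
  assumes "a \<le> b"
  shows "complex_of_real \<xi> * \<i> * (LINT x:{a..b}|lborel. exp (\<i> * complex_of_real (\<xi> * x))) = exp (\<i> * complex_of_real (\<xi> * b)) - exp (\<i> * complex_of_real (\<xi> * a))"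
proof -
  have "(LINT x|lborel. indicator {a..b} x *\<^sub>R (complex_of_real \<xi> * \<i> * exp (\<i> * complex_of_real (\<xi> * x)))) 
    = exp (\<i> * complex_of_real (\<xi> * b)) - exp (\<i> * complex_of_real (\<xi> * a))"
  proof (rule integral_FTC_atLeastAtMost[OF assms])
    fix x
    have "((\<lambda>z. exp (\<i> * (of_real \<xi> * z))) has_field_derivative (exp (\<i> * (of_real \<xi> * of_real x)) * (\<i> * of_real \<xi>))) (at (of_real x))"
      by (auto intro!: derivative_eq_intros)
    from has_vector_derivative_real_field[OF this, of "{a..b}"]
    show "((\<lambda>x. exp (\<i> * complex_of_real (\<xi> * x))) has_vector_derivative complex_of_real \<xi> * \<i> * exp (\<i> * complex_of_real (\<xi> * x))) (at x within {a..b})"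
      by (simp only: of_real_mult mult.commute mult.left_commute)
  qed (intro continuous_intros)
  moreover have "(\<lambda>x. indicator {a..b} x *\<^sub>R (complex_of_real \<xi> * \<i> * exp (\<i> * complex_of_real (\<xi> * x)))) 
     = (\<lambda>x. complex_of_real \<xi> * \<i> * (indicator {a..b} x *\<^sub>R exp (\<i> * complex_of_real (\<xi> * x))))"
    by (auto simp: indicator_def)
  ultimately show ?thesis unfolding set_lebesgue_integral_def
    by (simp only: Bochner_Integration.integral_mult_right_zero)
qed

lemma integrable_inverse_1_plus_square': "integrable lborel (\<lambda>x::real. inverse (1 + x\<^sup>2))"
  using integrable_inverse_1_plus_square by (simp add: set_integrable_def)

text \<open>Pointwise form of Cauchy-Schwarz with weight \<open>w = 1 + \<xi>\<^sup>2\<close>: twice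
  \<open>c\<close> is at most \<open>1 / w + w * c\<^sup>2\<close>.\<close>

lemma weighted_L2_integrable:
  assumes "L2 F" "L2 (\<lambda>\<xi>. complex_of_real \<xi> * F \<xi>)" shows "integrable lborel F"
proof (rule Bochner_Integration.integrable_bound)
  show "integrable lborel (\<lambda>\<xi>. inverse (1 + \<xi>\<^sup>2) + ((cmod (F \<xi>))\<^sup>2 + (cmod (complex_of_real \<xi> * F \<xi>))\<^sup>2))"
    using integrable_inverse_1_plus_square' assms by (auto simp: L2_def)
  show "F \<in> borel_measurable lborel" using assms by (auto simp: L2_def)
  have "cmod (F \<xi>) \<le> inverse (1 + \<xi>\<^sup>2) + ((cmod (F \<xi>))\<^sup>2 + (cmod (complex_of_real \<xi> * F \<xi>))\<^sup>2)" for \<xi>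
  proof -
    define w where "w = 1 + \<xi>\<^sup>2"
    define c where "c = cmod (F \<xi>)"
    have w: "w > 0" unfolding w_def by (intro add_pos_nonneg) auto
    have "0 \<le> (sqrt w * c - 1 / sqrt w)\<^sup>2" by simp
    also have "\<dots> = w * c\<^sup>2 - 2 * c + 1 / w"
      using w by (simp add: power2_diff power_mult_distrib power_divide)
    finally have "2 * c \<le> inverse w + w * c\<^sup>2" by (simp add: inverse_eq_divide)
    moreover have "c \<ge> 0" by (simp add: c_def)
    ultimately have "c \<le> inverse w + w * c\<^sup>2" by simp
    then show ?thesis by (simp add: w_def c_def norm_mult power_mult_distrib algebra_simps)
  qed
  then show "AE \<xi> in lborel. norm (F \<xi>) \<le> norm (inverse (1 + \<xi>\<^sup>2) + ((cmod (F \<xi>))\<^sup>2 + (cmod (complex_of_real \<xi> * F \<xi>))\<^sup>2))"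
    by (intro AE_I2) (simp add: order_trans[OF _ abs_ge_self])
qed

lemma fourier_L2_of_integrable_transform:
  assumes "integrable lborel F" "L2 F" shows "fourier_L2 (\<lambda>x. Fhat F (- x)) F"
proof -
  have "AE x in lborel. FT F x = Fhat F x" by (rule FT_eqI[OF fourier_L2_Fhat[OF assms]])
  then have "AE x in lborel. FT F (- x) = Fhat F (- x)"
    using AE_lborel_affine[of "\<lambda>x. FT F x = Fhat F x" "-1" 0] by simp
  then show ?thesis
    by (intro fourier_L2_cong_AE[OF Fourier_inversion[OF assms(2)]])
      (use assms L2_measurable[OF assms(2)] L2_measurable[OF fourier_L2_reflect_measure(1)[OF Plancherel_L1_L2(1)[OF assms]]] in auto)
qed

text \<open>The integral of \<open>f'\<close> over an interval is its pairing with an indicator.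
  Parseval moves this to the frequency side, where the factor \<open>\<i> * \<xi>\<close> cancels
  the denominator in the transform of the indicator and leaves a difference of two inversion
  integrals.\<close>

lemma H1_of_transform:
  assumes F: "L2 F" and F': "L2 (\<lambda>\<xi>. \<i> * complex_of_real \<xi> * F \<xi>)"
    and f': "fourier_L2 f' (\<lambda>\<xi>. \<i> * complex_of_real \<xi> * F \<xi>)"
  shows "H1 (\<lambda>x. Fhat F (- x)) f'"
proof -
  have "L2 (\<lambda>\<xi>. complex_of_real \<xi> * F \<xi>)" using L2_cmult[OF F', of "-\<i>"] by (simp add: mult.assoc[symmetric])
  note Fi = weighted_L2_integrable[OF F this]
  define f where "f x = Fhat F (- x)" for x
  have fF: "fourier_L2 f F" unfolding f_def by (rule fourier_L2_of_integrable_transform[OF Fi F])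
  show ?thesis unfolding H1_def f_def[symmetric]
  proof (intro conjI allI impI)
    show "L2 f" "L2 f'" using fF f' fourier_L2_L2 by blast+
    fix a b :: real assume ab: "a \<le> b"
    let ?i = "\<lambda>x. (1::complex) * indicator {a..b} x" and ?E = "\<lambda>t. exp (\<i> * complex_of_real t)"
    let ?s = "complex_of_real (1 / sqrt (2 * pi))"
    have ii: "integrable lborel ?i" using trunc_integrable[OF L2_const_on_interval[of 1 a b], of a b] 
      by (simp flip: indicator_inter_arith)
    have iF: "Fhat ?i \<xi> = ?s * cnj (LINT x:{a..b}|lborel. ?E (\<xi> * x))" for \<xi>
    proof -
      have "cnj (LINT x:{a..b}|lborel. ?E (\<xi> * x)) = (LINT x|lborel. exp (- \<i> * complex_of_real (\<xi> * x)) * ?i x)"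
        unfolding set_lebesgue_integral_def Bochner_Integration.integral_cnj[symmetric]
        by (intro Bochner_Integration.integral_cong) (auto simp: exp_cnj indicator_def)
      then show ?thesis by (simp add: Fhat_def)
    qed
    have "(LINT x:{a..b}|lborel. f' x) = ip f' ?i"
      unfolding set_lebesgue_integral_def ip_def by (intro Bochner_Integration.integral_cong) (auto simp: indicator_def)
    also have "\<dots> = ip (\<lambda>\<xi>. \<i> * complex_of_real \<xi> * F \<xi>) (Fhat ?i)"
      by (rule Parseval[OF f' fourier_L2_Fhat[OF ii L2_const_on_interval], symmetric])
    also have "\<dots> = (LINT \<xi>|lborel. ?s * (?E (\<xi> * b) * F \<xi> - ?E (\<xi> * a) * F \<xi>))"
      unfolding ip_def
    proof (rule Bochner_Integration.integral_cong[OF refl])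
      fix \<xi>
      have "\<i> * complex_of_real \<xi> * F \<xi> * cnj (Fhat ?i \<xi>) = ?s * F \<xi> * (complex_of_real \<xi> * \<i> * (LINT x:{a..b}|lborel. ?E (\<xi> * x)))"
        unfolding iF by simp
      also have "\<dots> = ?s * (?E (\<xi> * b) * F \<xi> - ?E (\<xi> * a) * F \<xi>)"
        unfolding exp_i_interval_integral[OF ab] by (simp add: algebra_simps)
      finally show "\<i> * complex_of_real \<xi> * F \<xi> * cnj (Fhat ?i \<xi>) = ?s * (?E (\<xi> * b) * F \<xi> - ?E (\<xi> * a) * F \<xi>)" .
    qed
    also have "\<dots> = ?s * (LINT \<xi>|lborel. ?E (\<xi> * b) * F \<xi> - ?E (\<xi> * a) * F \<xi>)"
      by (rule Bochner_Integration.integral_mult_right_zero)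
    also have "(LINT \<xi>|lborel. ?E (\<xi> * b) * F \<xi> - ?E (\<xi> * a) * F \<xi>) = (LINT \<xi>|lborel. ?E (\<xi> * b) * F \<xi>) - (LINT \<xi>|lborel. ?E (\<xi> * a) * F \<xi>)"
      using integrable_exp_mult[OF Fi, of "-b"] integrable_exp_mult[OF Fi, of "-a"] 
      by (intro Bochner_Integration.integral_diff) (simp_all add: mult.commute[of a] mult.commute[of b])
    finally show "f b - f a = (LINT x:{a..b}|lborel. f' x)"
      by (simp add: f_def Fhat_def right_diff_distrib mult.commute[of a] mult.commute[of b])
  qed
qed

text \<open>The discrepancy between \<open>FT f'\<close> and the expected transform is tested
  against its own truncations \<open>\<Phi>\<close>. A truncation is band limited, hence the
  transform of an H1 function, so integration by parts applies and gives
  \<open>ip \<Phi> \<Phi> = 0\<close>.\<close>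

theorem H1_FT:
  assumes f: "H1 f f'" and F: "fourier_L2 f F" 
  shows "fourier_L2 f' (\<lambda>\<xi>. \<i> * complex_of_real \<xi> * F \<xi>)"
proof -
  note L = H1_L2[OF f] fourier_L2_L2(2)[OF F]
  note F' = FT[OF L(2)]
  have [measurable]: "F \<in> borel_measurable borel" "FT f' \<in> borel_measurable borel" 
    using L by (auto intro!: L2_measurable)
  let ?d = "\<lambda>\<xi>. FT f' \<xi> - \<i> * complex_of_real \<xi> * F \<xi>"
  have mb: "L2 (\<lambda>\<xi>. \<i> * complex_of_real \<xi> * trunc n h \<xi>)" if "L2 h" for n h
  proof -
    have "L2 (\<lambda>\<xi>. (\<i> * complex_of_real \<xi> * indicator {-real n..real n} \<xi>) * h \<xi>)"
    proof (rule L2_bounded_mult(1)[OF that])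
      show "cmod (\<i> * complex_of_real \<xi> * indicator {-real n..real n} \<xi>) \<le> real n" for \<xi>
        by (auto simp: indicator_def norm_mult)
    qed measurable
    then show ?thesis by (simp add: trunc_def mult.assoc)
  qed
  have tn: "AE \<xi> in lborel. trunc n ?d \<xi> = 0" for n
  proof -
    define \<Phi> where "\<Phi> = trunc n ?d"
    have \<Phi>t: "trunc n \<Phi> = \<Phi>" by (auto simp: \<Phi>_def trunc_def indicator_def)
    have "L2 (\<lambda>\<xi>. trunc n (FT f') \<xi> - \<i> * complex_of_real \<xi> * trunc n F \<xi>)"
      using mb[OF L(3)] L by auto
    moreover have "(\<lambda>\<xi>. trunc n (FT f') \<xi> - \<i> * complex_of_real \<xi> * trunc n F \<xi>) = \<Phi>"
      by (auto simp: \<Phi>_def trunc_def algebra_simps)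
    ultimately have \<Phi>L: "L2 \<Phi>" by simp
    have \<Phi>'L: "L2 (\<lambda>\<xi>. \<i> * complex_of_real \<xi> * \<Phi> \<xi>)" using mb[OF \<Phi>L, of n] by (simp add: \<Phi>t)
    note \<phi>' = Fourier_inversion[OF \<Phi>'L]
    have "L2 (\<lambda>\<xi>. complex_of_real \<xi> * \<Phi> \<xi>)" using L2_cmult[OF \<Phi>'L, of "-\<i>"] by (simp add: mult.assoc[symmetric])
    note \<phi> = fourier_L2_of_integrable_transform[OF weighted_L2_integrable[OF \<Phi>L this] \<Phi>L]
    have "ip (FT f') \<Phi> = ip f' (\<lambda>x. Fhat \<Phi> (- x))" by (rule Parseval[OF F' \<phi>])
    also have "\<dots> = - ip f (\<lambda>x. FT (\<lambda>\<xi>. \<i> * complex_of_real \<xi> * \<Phi> \<xi>) (- x))"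
      by (rule ip_H1[OF f H1_of_transform[OF \<Phi>L \<Phi>'L \<phi>']])
    also have "\<dots> = - ip F (\<lambda>\<xi>. \<i> * complex_of_real \<xi> * \<Phi> \<xi>)"
      by (simp add: Parseval[OF F \<phi>'])
    finally have eq: "ip (FT f') \<Phi> = - ip F (\<lambda>\<xi>. \<i> * complex_of_real \<xi> * \<Phi> \<xi>)" .
    have i1: "integrable lborel (\<lambda>\<xi>. FT f' \<xi> * cnj (\<Phi> \<xi>))" "integrable lborel (\<lambda>\<xi>. F \<xi> * cnj (\<i> * complex_of_real \<xi> * \<Phi> \<xi>))"
      by (rule L2_ip_integrable[OF FT_L2[OF L(2)] \<Phi>L], rule L2_ip_integrable[OF L(3) \<Phi>'L])
    have "ip \<Phi> \<Phi> = (LINT \<xi>|lborel. FT f' \<xi> * cnj (\<Phi> \<xi>) + F \<xi> * cnj (\<i> * complex_of_real \<xi> * \<Phi> \<xi>))"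
      unfolding ip_def by (intro Bochner_Integration.integral_cong) (auto simp: \<Phi>_def trunc_def indicator_def algebra_simps)
    also have "\<dots> = ip (FT f') \<Phi> + ip F (\<lambda>\<xi>. \<i> * complex_of_real \<xi> * \<Phi> \<xi>)"
      unfolding ip_def by (rule Bochner_Integration.integral_add[OF i1])
    also have "\<dots> = 0" by (simp add: eq)
    finally have "nrm \<Phi> = 0" by (simp add: ip_self)
    from nrm_zero_AE[OF \<Phi>L this] show ?thesis by (simp add: \<Phi>_def)
  qed
  have "AE \<xi> in lborel. \<forall>n. trunc n ?d \<xi> = 0" using tn by (simp add: AE_all_countable)
  then have "AE \<xi> in lborel. FT f' \<xi> = \<i> * complex_of_real \<xi> * F \<xi>"
  proof eventually_elim
    case (elim \<xi>)
    obtain n where "real n \<ge> \<bar>\<xi>\<bar>" using real_arch_simple by blast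
    then have "trunc n ?d \<xi> = ?d \<xi>" by (auto simp: trunc_def indicator_def)
    then show ?case using elim by simp
  qed
  then show ?thesis by (intro fourier_L2_cong_AE[OF F']) (use L2_measurable[OF L(2)] in auto)
qed

subsection \<open>Hardy space and the Szego projection\<close>

definition hardy :: "(real \<Rightarrow> complex) \<Rightarrow> bool" where
  "hardy f \<longleftrightarrow> L2 f \<and> (AE \<xi> in lborel. \<xi> < 0 \<longrightarrow> FT f \<xi> = 0)"

text \<open>The Szego projection, with the inverse transform written as a forward transform at
  \<open>- x\<close>. Since \<open>FT\<close> is a choice, values are meaningful only almost
  everywhere; H1 representatives are extracted whenever point values are wanted.\<close>

definition Pr :: "(real \<Rightarrow> complex) \<Rightarrow> real \<Rightarrow> complex" where
  "Pr f x = FT (\<lambda>\<xi>. if 0 < \<xi> then FT f \<xi> else 0) (- x)"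

lemma hardy_L2[simp, dest]: "hardy f \<Longrightarrow> L2 f" by (simp add: hardy_def)

lemma hardy_iff: 
  assumes "fourier_L2 f F" shows "hardy f \<longleftrightarrow> (AE \<xi> in lborel. \<xi> < 0 \<longrightarrow> F \<xi> = 0)"
proof -
  note e = FT_eqI[OF assms] and L = fourier_L2_L2[OF assms]
  have "(AE \<xi> in lborel. \<xi> < 0 \<longrightarrow> FT f \<xi> = 0) \<longleftrightarrow> (AE \<xi> in lborel. \<xi> < 0 \<longrightarrow> F \<xi> = 0)"
  proof
    assume "AE \<xi> in lborel. \<xi> < 0 \<longrightarrow> FT f \<xi> = 0"
    with e show "AE \<xi> in lborel. \<xi> < 0 \<longrightarrow> F \<xi> = 0" by eventually_elim auto
  next
    assume "AE \<xi> in lborel. \<xi> < 0 \<longrightarrow> F \<xi> = 0"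
    with e show "AE \<xi> in lborel. \<xi> < 0 \<longrightarrow> FT f \<xi> = 0" by eventually_elim auto
  qed
  then show ?thesis using L by (simp add: hardy_def)
qed

lemma hardyI: "fourier_L2 f F \<Longrightarrow> (AE \<xi> in lborel. \<xi> < 0 \<longrightarrow> F \<xi> = 0) \<Longrightarrow> hardy f"
  using hardy_iff by blast

lemma hardy_FT: "hardy f \<Longrightarrow> AE \<xi> in lborel. \<xi> < 0 \<longrightarrow> FT f \<xi> = 0"
  by (simp add: hardy_def)

lemma hardy_add[intro]:
  assumes "hardy f" "hardy g" shows "hardy (\<lambda>x. f x + g x)"
proof (rule hardyI[OF fourier_L2_add[OF FT FT]])
  show "AE \<xi> in lborel. \<xi> < 0 \<longrightarrow> FT f \<xi> + FT g \<xi> = 0"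
    using hardy_FT[OF assms(1)] hardy_FT[OF assms(2)] by eventually_elim auto
qed (use assms in auto)

lemma hardy_diff[intro]:
  assumes "hardy f" "hardy g" shows "hardy (\<lambda>x. f x - g x)"
proof (rule hardyI[OF fourier_L2_diff[OF FT FT]])
  show "AE \<xi> in lborel. \<xi> < 0 \<longrightarrow> FT f \<xi> - FT g \<xi> = 0"
    using hardy_FT[OF assms(1)] hardy_FT[OF assms(2)] by eventually_elim auto
qed (use assms in auto)

lemma hardy_cmult[intro]:
  assumes "hardy f" shows "hardy (\<lambda>x. c * f x)"
proof (rule hardyI[OF fourier_L2_cmult[OF FT]])
  show "AE \<xi> in lborel. \<xi> < 0 \<longrightarrow> c * FT f \<xi> = 0"
    using hardy_FT[OF assms(1)] by eventually_elim auto
qed (use assms in auto)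

lemma hardy_cong_AE:
  assumes "hardy f" "g \<in> borel_measurable borel" "AE x in lborel. f x = g x" shows "hardy g"
proof -
  have "L2 f" using assms by simp
  have "fourier_L2 g (FT f)"
    using L2_measurable[OF FT_L2[OF \<open>L2 f\<close>]] by (intro fourier_L2_cong_AE[OF FT[OF \<open>L2 f\<close>] assms(2,3)]) auto
  then show ?thesis by (rule hardyI[OF _ hardy_FT[OF assms(1)]])
qed

lemma L2_eq_of_transform_eq:
  assumes "fourier_L2 f F" "fourier_L2 g G" "AE \<xi> in lborel. F \<xi> = G \<xi>"
  shows "AE x in lborel. f x = g x"
proof -
  note L = fourier_L2_L2[OF assms(1)] fourier_L2_L2[OF assms(2)]
  have "nrm (\<lambda>x. f x - g x) = nrm (\<lambda>\<xi>. F \<xi> - G \<xi>)"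
    using fourier_L2_nrm[OF fourier_L2_diff[OF assms(1,2)]] by simp
  also have "\<dots> = nrm (\<lambda>\<xi>. 0)"
    by (rule nrm_cong_AE) (use assms(3) L2_measurable[OF L2_diff[OF L(2) L(4)]] in auto)
  finally have "AE x in lborel. f x - g x = 0" by (intro nrm_zero_AE) (use L in auto)
  then show ?thesis by eventually_elim simp
qed

lemma AE_lborel_ne_0: "AE \<xi> in lborel. \<xi> \<noteq> (0::real)"
  by (rule AE_lborel_singleton)

lemma AE_lborel_reflect:
  fixes P :: "real \<Rightarrow> bool" 
  shows "AE x in lborel. P x \<Longrightarrow> AE x in lborel. P (- x)"
  using AE_lborel_affine[of P "-1" 0] by simp

text \<open>The spectra of \<open>f\<close> and of \<open>cnj g\<close> can meet only at frequency
  0. This cancellation underlies both the Lax identity and the orthogonality of a Hardy function to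
  its conjugate.\<close>

lemma hardy_integral_mult:
  assumes "hardy f" "hardy g" shows "(LINT x|lborel. f x * g x) = 0"
proof -
  have L: "L2 f" "L2 g" using assms by auto
  have "(LINT x|lborel. f x * g x) = ip f (\<lambda>x. cnj (g x))" by (simp add: ip_def)
  also have "\<dots> = ip (FT f) (\<lambda>\<xi>. cnj (FT g (- \<xi>)))"
    by (rule Parseval[OF FT[OF L(1)] fourier_L2_cnj[OF FT[OF L(2)]], symmetric])
  also have "\<dots> = (LINT \<xi>|lborel. FT f \<xi> * FT g (- \<xi>))" by (simp add: ip_def)
  also have "\<dots> = (LINT \<xi>::real|lborel. 0)"
  proof (rule integral_cong_AE)
    have "L2 (\<lambda>\<xi>. FT g (- \<xi>))" using L by (auto intro: fourier_L2_reflect_measure)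
    then show "(\<lambda>\<xi>. FT f \<xi> * FT g (- \<xi>)) \<in> borel_measurable lborel"
      using L2_prod_integrable[OF FT_L2[OF L(1)]] by (blast dest: borel_measurable_integrable)
    show "AE \<xi> in lborel. FT f \<xi> * FT g (- \<xi>) = 0"
      using hardy_FT[OF assms(1)] AE_lborel_reflect[OF hardy_FT[OF assms(2)]] AE_lborel_ne_0 by eventually_elim auto
  qed simp
  finally show ?thesis by simp
qed

lemma hardy_ip_cnj: "hardy f \<Longrightarrow> hardy g \<Longrightarrow> ip f (\<lambda>x. cnj (g x)) = 0"
  using hardy_integral_mult[of f g] by (simp add: ip_def)

lemma L2_modulate: "L2 f \<Longrightarrow> L2 (\<lambda>x. exp (\<i> * complex_of_real (s * x)) * f x)"
  by (rule L2_bounded_mult(1)[where B=1]) (auto simp del: of_real_mult)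

lemma Fhat_modulate: "Fhat (\<lambda>x. exp (\<i> * complex_of_real (s * x)) * f x) \<xi> = Fhat f (\<xi> - s)"
proof -
  have "exp (- \<i> * complex_of_real (\<xi> * x)) * (exp (\<i> * complex_of_real (s * x)) * f x) = exp (- \<i> * complex_of_real ((\<xi> - s) * x)) * f x" for x
    by (simp add: mult.assoc[symmetric] exp_add[symmetric]) (simp add: algebra_simps)
  then show ?thesis by (simp only: Fhat_def)
qed

lemma fourier_L2_modulate:
  assumes "fourier_L2 f F" shows "fourier_L2 (\<lambda>x. exp (\<i> * complex_of_real (s * x)) * f x) (\<lambda>\<xi>. F (\<xi> - s))"
proof (rule fourier_L2I)
  note L = fourier_L2_L2[OF assms]
  let ?e = "\<lambda>x. exp (\<i> * complex_of_real (s * x))"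
  show "L2 (\<lambda>x. ?e x * f x)" "L2 (\<lambda>x. ?e x * trunc n f x)" for n using L by (auto intro: L2_modulate simp del: of_real_mult)
  show "L2 (\<lambda>\<xi>. F (\<xi> - s))" using L2_shift[OF L(2), of "-s"] by simp
  show "integrable lborel (\<lambda>x. ?e x * trunc n f x)" for n
    using integrable_exp_mult[OF trunc(1)[OF L(1)], of "-s"] by simp
  have "nrm (\<lambda>x. ?e x * trunc n f x - ?e x * f x) = nrm (\<lambda>x. trunc n f x - f x)" for n
    unfolding nrm_def right_diff_distrib[symmetric] norm_mult cmod_exp_i by simp
  then show "(\<lambda>n. nrm (\<lambda>x. ?e x * trunc n f x - ?e x * f x)) \<longlonglongrightarrow> 0" using trunc_tendsto[OF L(1)] by simp
  have "nrm (\<lambda>\<xi>. Fhat (\<lambda>x. ?e x * trunc n f x) \<xi> - F (\<xi> - s)) = nrm (\<lambda>\<xi>. Fhat (trunc n f) \<xi> - F \<xi>)" for n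
    using nrm_shift[of "\<lambda>\<xi>. Fhat (trunc n f) \<xi> - F \<xi>" "-s"] by (simp only: Fhat_modulate) simp
  then show "(\<lambda>n. nrm (\<lambda>\<xi>. Fhat (\<lambda>x. ?e x * trunc n f x) \<xi> - F (\<xi> - s))) \<longlonglongrightarrow> 0"
    using fourier_L2_seq[OF assms] by simp
qed

lemma hardy_modulate:
  assumes "hardy f" "s \<ge> 0" shows "hardy (\<lambda>x. exp (\<i> * complex_of_real (s * x)) * f x)"
proof (rule hardyI[OF fourier_L2_modulate[OF FT]])
  show "L2 f" using assms by auto
  have "AE \<xi> in lborel. - s + 1 * \<xi> < 0 \<longrightarrow> FT f (- s + 1 * \<xi>) = 0"
    by (rule AE_lborel_affine[OF hardy_FT[OF assms(1)]]) simp
  then show "AE \<xi> in lborel. \<xi> < 0 \<longrightarrow> FT f (\<xi> - s) = 0"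
    by eventually_elim (use assms(2) in auto)
qed

text \<open>The coefficient of a product at a negative frequency is the integral of a product of two
  Hardy functions, one of them modulated towards larger frequencies, and so vanishes.\<close>

theorem hardy_mult:
  assumes f: "hardy f" and g: "hardy g" and fg: "L2 (\<lambda>x. f x * g x)"
  shows "hardy (\<lambda>x. f x * g x)"
proof (rule hardyI[OF fourier_L2_Fhat])
  show "integrable lborel (\<lambda>x. f x * g x)" using f g by auto
  show "AE \<xi> in lborel. \<xi> < 0 \<longrightarrow> Fhat (\<lambda>x. f x * g x) \<xi> = 0"
  proof (intro AE_I2 impI)
    fix \<xi> :: real assume "\<xi> < 0"
    then have "hardy (\<lambda>x. exp (\<i> * complex_of_real (- \<xi> * x)) * f x)" by (intro hardy_modulate f) simp
    from hardy_integral_mult[OF this g] show "Fhat (\<lambda>x. f x * g x) \<xi> = 0"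
      by (simp add: Fhat_def mult.assoc)
  qed
qed fact

lemma hardy_mult_H1:
  assumes "hardy f" "hardy g" "H1 g g'" shows "hardy (\<lambda>x. f x * g x)" "hardy (\<lambda>x. g x * f x)"
  using hardy_mult[OF assms(1,2)] L2_mult_H1[OF assms(3), of f] assms(1) by (auto simp: mult.commute)

lemma hardy_deriv:
  assumes "hardy f" "H1 f f'" shows "hardy f'"
proof (rule hardyI[OF H1_FT[OF assms(2) FT]])
  show "AE \<xi> in lborel. \<xi> < 0 \<longrightarrow> \<i> * complex_of_real \<xi> * FT f \<xi> = 0"
    using hardy_FT[OF assms(1)] by eventually_elim auto
qed (use assms in auto)

text \<open>On the Fourier side the form is multiplication by the frequency, which is nonnegative on
  the spectrum. This is the positivity that bounds the Lax operator from below.\<close>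

lemma ip_deriv_hardy_nonneg:
  assumes "hardy f" "H1 f f'" shows "Re (ip (\<lambda>x. - \<i> * f' x) f) \<ge> 0"
proof -
  have L: "L2 f" using assms by auto
  have "ip (\<lambda>x. - \<i> * f' x) f = ip (\<lambda>\<xi>. - \<i> * (\<i> * complex_of_real \<xi> * FT f \<xi>)) (FT f)"
    by (rule Parseval[OF fourier_L2_cmult[OF H1_FT[OF assms(2) FT[OF L]]] FT[OF L], symmetric])
  also have "\<dots> = (LINT \<xi>|lborel. complex_of_real (\<xi> * (cmod (FT f \<xi>))\<^sup>2))"
    unfolding ip_def by (intro Bochner_Integration.integral_cong) (auto simp: complex_norm_square[symmetric] mult.assoc)
  also have "\<dots> = complex_of_real (LINT \<xi>|lborel. \<xi> * (cmod (FT f \<xi>))\<^sup>2)" by (rule integral_complex_of_real)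
  finally have "Re (ip (\<lambda>x. - \<i> * f' x) f) = (LINT \<xi>|lborel. \<xi> * (cmod (FT f \<xi>))\<^sup>2)" by simp
  also have "\<dots> \<ge> 0"
  proof (rule integral_nonneg_AE)
    show "AE \<xi> in lborel. 0 \<le> \<xi> * (cmod (FT f \<xi>))\<^sup>2"
      using hardy_FT[OF assms(1)] 
    proof eventually_elim
      case (elim \<xi>) then show ?case by (cases "\<xi> < 0") auto
    qed
  qed
  finally show ?thesis .
qed

lemma L2_half_line:
  assumes "L2 F" shows "L2 (\<lambda>\<xi>. if 0 < \<xi> then F \<xi> else 0)"
proof (rule L2_dominated[OF L2_integrable[OF assms]])
  have [measurable]: "F \<in> borel_measurable borel" using assms by (rule L2_measurable)
  show "(\<lambda>\<xi>. if 0 < \<xi> then F \<xi> else 0) \<in> borel_measurable borel" by measurable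
qed auto

section \<open>The Szego projection\<close>

lemma Pr_FT: 
  assumes "fourier_L2 f F" shows "fourier_L2 (Pr f) (\<lambda>\<xi>. if 0 < \<xi> then F \<xi> else 0)"
proof -
  note L = fourier_L2_L2[OF assms]
  have "fourier_L2 (\<lambda>x. Pr f x) (\<lambda>\<xi>. if 0 < \<xi> then FT f \<xi> else 0)"
    unfolding Pr_def by (rule Fourier_inversion[OF L2_half_line[OF FT_L2[OF L(1)]]])
  then show ?thesis
  proof (rule fourier_L2_cong_AE)
    show "AE \<xi> in lborel. (if 0 < \<xi> then FT f \<xi> else 0) = (if 0 < \<xi> then F \<xi> else 0)"
      using FT_eqI[OF assms] by eventually_elim auto
    show "Pr f \<in> borel_measurable borel" using fourier_L2_L2(1)[OF \<open>fourier_L2 (\<lambda>x. Pr f x) _\<close>] by (auto dest: L2_measurable)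
  qed (use L2_measurable[OF L2_half_line[OF L(2)]] in auto)
qed

lemma Pr_L2[simp, intro]: "L2 f \<Longrightarrow> L2 (Pr f)"
  using fourier_L2_L2(1)[OF Pr_FT[OF FT]] .

lemma Pr_hardy[simp, intro]: "L2 f \<Longrightarrow> hardy (Pr f)"
  by (rule hardyI[OF Pr_FT[OF FT]]) auto

lemma Pr_diff: "L2 f \<Longrightarrow> L2 g \<Longrightarrow> AE x in lborel. Pr (\<lambda>x. f x - g x) x = Pr f x - Pr g x"
  by (rule L2_eq_of_transform_eq[OF Pr_FT[OF fourier_L2_diff[OF FT FT]] fourier_L2_diff[OF Pr_FT[OF FT] Pr_FT[OF FT]]]) auto

lemma Pr_cmult: "L2 f \<Longrightarrow> AE x in lborel. Pr (\<lambda>x. c * f x) x = c * Pr f x"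
  by (rule L2_eq_of_transform_eq[OF Pr_FT[OF fourier_L2_cmult[OF FT]] fourier_L2_cmult[OF Pr_FT[OF FT]]]) auto

lemma Pr_cong_AE:
  assumes "L2 f" "L2 g" "AE x in lborel. f x = g x" shows "AE x in lborel. Pr f x = Pr g x"
proof (rule L2_eq_of_transform_eq[OF Pr_FT[OF FT] Pr_FT[OF FT]])
  show "AE \<xi> in lborel. (if 0 < \<xi> then FT f \<xi> else 0) = (if 0 < \<xi> then FT g \<xi> else 0)"
    using FT_cong_AE[OF assms] by eventually_elim auto
qed (use assms in auto)

lemma Pr_remainder_antihardy: 
  assumes "L2 f" shows "hardy (\<lambda>x. cnj (f x - Pr f x))"
proof (rule hardyI[OF fourier_L2_cnj[OF fourier_L2_diff[OF FT[OF assms] Pr_FT[OF FT[OF assms]]]]])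
qed auto

lemma ip_Pr:
  assumes "L2 f" "hardy h" shows "ip (Pr f) h = ip f h"
proof -
  have L: "L2 h" "L2 (\<lambda>x. f x - Pr f x)" using assms by auto
  have "ip h (\<lambda>x. cnj (cnj (f x - Pr f x))) = 0"
    by (rule hardy_ip_cnj[OF assms(2) Pr_remainder_antihardy[OF assms(1)]])
  then have "ip h (\<lambda>x. f x - Pr f x) = 0" by simp
  then have "ip (\<lambda>x. f x - Pr f x) h = 0" using ip_cnj[of h "\<lambda>x. f x - Pr f x"] by simp
  then show ?thesis using assms by simp
qed

lemma nrm_Pr:
  assumes "L2 f" shows "nrm (Pr f) \<le> nrm f"
proof -
  have "nrm (Pr f) = nrm (\<lambda>\<xi>. if 0 < \<xi> then FT f \<xi> else 0)"
    using fourier_L2_nrm[OF Pr_FT[OF FT[OF assms]]] by simp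
  also have "\<dots> \<le> 1 * nrm (FT f)"
    by (rule nrm_mono) (use assms L2_half_line[OF FT_L2[OF assms]] L2_measurable in auto)
  also have "\<dots> = nrm f" using fourier_L2_nrm[OF FT[OF assms]] by simp
  finally show ?thesis .
qed

text \<open>Reality makes the negative half of the spectrum the reflected conjugate of the positive
  half; frequency 0 is a null set and may be assigned to neither.\<close>

lemma Pr_real_decomposition:
  assumes "L2 f" "\<And>x. cnj (f x) = f x" shows "AE x in lborel. f x = Pr f x + cnj (Pr f x)"
proof -
  note F = FT[OF assms(1)]
  have "fourier_L2 (\<lambda>x. cnj (f x)) (\<lambda>\<xi>. cnj (FT f (- \<xi>)))" by (rule fourier_L2_cnj[OF F])
  then have "fourier_L2 f (\<lambda>\<xi>. cnj (FT f (- \<xi>)))" by (simp add: assms(2))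
  from FT_eqI[OF this] have s: "AE \<xi> in lborel. FT f \<xi> = cnj (FT f (- \<xi>))" .
  show ?thesis
  proof (rule L2_eq_of_transform_eq[OF F fourier_L2_add[OF Pr_FT[OF F] fourier_L2_cnj[OF Pr_FT[OF F]]]])
    show "AE \<xi> in lborel. FT f \<xi> = (if 0 < \<xi> then FT f \<xi> else 0) + cnj (if 0 < - \<xi> then FT f (- \<xi>) else 0)"
      using s AE_lborel_ne_0 by eventually_elim auto
  qed
qed

lemma H1_rep_of_transform:
  assumes f: "fourier_L2 f F" and F': "L2 (\<lambda>\<xi>. \<i> * complex_of_real \<xi> * F \<xi>)"
    and f': "fourier_L2 f' (\<lambda>\<xi>. \<i> * complex_of_real \<xi> * F \<xi>)"
  obtains g where "H1 g f'" "AE x in lborel. f x = g x"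
proof -
  note L = fourier_L2_L2[OF f]
  have "L2 (\<lambda>\<xi>. complex_of_real \<xi> * F \<xi>)" using L2_cmult[OF F', of "-\<i>"] by (simp add: mult.assoc[symmetric])
  note \<phi> = fourier_L2_of_integrable_transform[OF weighted_L2_integrable[OF L(2) this] L(2)]
  have "AE x in lborel. f x = Fhat F (- x)"
    by (rule L2_eq_of_transform_eq[OF f \<phi>]) auto
  then show ?thesis using that[OF H1_of_transform[OF L(2) F' f']] by blast
qed

lemma Pr_H1:
  assumes "H1 f f'" obtains p where "H1 p (Pr f')" "AE x in lborel. Pr f x = p x" "hardy p"
proof -
  note L = H1_L2[OF assms]
  note F' = H1_FT[OF assms FT[OF L(1)]]
  have e: "(\<lambda>\<xi>. if 0 < \<xi> then \<i> * complex_of_real \<xi> * FT f \<xi> else 0) = (\<lambda>\<xi>. \<i> * complex_of_real \<xi> * (if 0 < \<xi> then FT f \<xi> else 0))"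
    by auto
  note p = Pr_FT[OF F', unfolded e]
  from H1_rep_of_transform[OF Pr_FT[OF FT[OF L(1)]] fourier_L2_L2(2)[OF p] p]
  obtain p where p: "H1 p (Pr f')" "AE x in lborel. Pr f x = p x" .
  have "hardy p" by (rule hardy_cong_AE[OF Pr_hardy[OF L(1)] H1_measurable(1)[OF p(1)] p(2)])
  with p that show ?thesis by blast
qed

subsection \<open>Sobolev norms\<close>

lemma in_Hs_1_rep:
  assumes "in_Hs 1 f" obtains g g' where "L2 f" "H1 g g'" "AE x in lborel. f x = g x"
proof -
  from assms have L: "L2 f" and i: "integrable lborel (\<lambda>\<xi>. (1 + \<xi>\<^sup>2) powr 1 * (cmod (FT f \<xi>))\<^sup>2)"
    unfolding in_Hs_def using fourier_L2_L2(1) by auto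
  note F = FT[OF L]
  have "L2 (\<lambda>\<xi>. \<i> * complex_of_real \<xi> * FT f \<xi>)"
  proof (rule L2_dominated[OF i])
    have [measurable]: "FT f \<in> borel_measurable borel" using L2_measurable[OF FT_L2[OF L]] .
    show "(\<lambda>\<xi>. \<i> * complex_of_real \<xi> * FT f \<xi>) \<in> borel_measurable borel" by measurable
    have "\<xi>\<^sup>2 \<le> (1 + \<xi>\<^sup>2) powr 1" for \<xi> :: real
      using zero_le_power2[of \<xi>] by (subst powr_one) (auto intro: add_nonneg_nonneg)
    then show "AE \<xi> in lborel. (cmod (\<i> * complex_of_real \<xi> * FT f \<xi>))\<^sup>2 \<le> (1 + \<xi>\<^sup>2) powr 1 * (cmod (FT f \<xi>))\<^sup>2"
      by (intro AE_I2) (simp add: norm_mult power_mult_distrib mult_right_mono del: powr_one)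
  qed
  from H1_rep_of_transform[OF F this Fourier_inversion[OF this]] L that show ?thesis by blast
qed

lemma Hs_norm_H1:
  assumes "L2 f" "H1 g g'" "AE x in lborel. f x = g x"
  shows "(Hs_norm 1 f)\<^sup>2 = (nrm g)\<^sup>2 + (nrm g')\<^sup>2" "Hdot_norm 1 f = nrm g'" "in_Hs 1 f"
proof -
  note L = H1_L2[OF assms(2)]
  have [measurable]: "g \<in> borel_measurable borel" "FT f \<in> borel_measurable borel" "FT g \<in> borel_measurable borel"
    using L assms(1) by (auto intro!: L2_measurable)
  have e: "AE \<xi> in lborel. FT f \<xi> = FT g \<xi>" by (rule FT_cong_AE[OF assms(1) L(1) assms(3)])
  note G' = H1_FT[OF assms(2) FT[OF L(1)]]
  have G'L: "L2 (\<lambda>\<xi>. \<i> * complex_of_real \<xi> * FT g \<xi>)" using fourier_L2_L2(2)[OF G'] .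
  let ?d = "\<lambda>\<xi>. (cmod (\<i> * complex_of_real \<xi> * FT g \<xi>))\<^sup>2"
  have i: "integrable lborel (\<lambda>\<xi>. (cmod (FT g \<xi>))\<^sup>2)" "integrable lborel ?d"
    using L2_integrable[OF FT_L2[OF L(1)]] L2_integrable[OF G'L] by auto
  have p1: "(1 + \<xi>\<^sup>2) powr 1 = 1 + \<xi>\<^sup>2" for \<xi> :: real
    by (subst powr_one) (auto intro: add_nonneg_nonneg)
  \<comment> \<open>Frequency 0 is separate because \<open>powr\<close> with base 0 is 0 by
    convention, which here agrees with the square.\<close>
  have p2: "\<bar>\<xi>\<bar> powr (2 * 1) = \<xi>\<^sup>2" for \<xi> :: real by (cases "\<xi> = 0") auto
  have e1: "AE \<xi> in lborel. (1 + \<xi>\<^sup>2) powr 1 * (cmod (FT f \<xi>))\<^sup>2 = (cmod (FT g \<xi>))\<^sup>2 + ?d \<xi>"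
    using e by eventually_elim (simp add: p1 norm_mult power_mult_distrib distrib_right)
  have e2: "AE \<xi> in lborel. \<bar>\<xi>\<bar> powr (2 * 1) * (cmod (FT f \<xi>))\<^sup>2 = ?d \<xi>"
    using e by eventually_elim (simp only: p2, simp add: norm_mult power_mult_distrib)
  have m1: "(\<lambda>\<xi>. (1 + \<xi>\<^sup>2) powr 1 * (cmod (FT f \<xi>))\<^sup>2) \<in> borel_measurable lborel" unfolding p1 by measurable
  have m2: "(\<lambda>\<xi>. \<bar>\<xi>\<bar> powr (2 * 1) * (cmod (FT f \<xi>))\<^sup>2) \<in> borel_measurable lborel" unfolding p2 by measurable
  have n1: "(LINT \<xi>|lborel. (cmod (FT g \<xi>))\<^sup>2) = (nrm g)\<^sup>2" "(LINT \<xi>|lborel. ?d \<xi>) = (nrm g')\<^sup>2"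
    using fourier_L2_nrm[OF FT[OF L(1)]] fourier_L2_nrm[OF G'] by (metis nrm_sq)+
  have "(LINT \<xi>|lborel. (1 + \<xi>\<^sup>2) powr 1 * (cmod (FT f \<xi>))\<^sup>2) = (LINT \<xi>|lborel. (cmod (FT g \<xi>))\<^sup>2 + ?d \<xi>)"
    by (rule integral_cong_AE[OF m1 _ e1]) measurable
  also have "\<dots> = (nrm g)\<^sup>2 + (nrm g')\<^sup>2" using i n1 by simp
  finally show "(Hs_norm 1 f)\<^sup>2 = (nrm g)\<^sup>2 + (nrm g')\<^sup>2" unfolding Hs_norm_def by simp
  have "(LINT \<xi>|lborel. \<bar>\<xi>\<bar> powr (2 * 1) * (cmod (FT f \<xi>))\<^sup>2) = (LINT \<xi>|lborel. ?d \<xi>)"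
    by (rule integral_cong_AE[OF m2 _ e2]) measurable
  then show "Hdot_norm 1 f = nrm g'" unfolding Hdot_norm_def n1 by simp
  have "integrable lborel (\<lambda>\<xi>. (cmod (FT g \<xi>))\<^sup>2 + ?d \<xi>)" using i by simp
  then have "integrable lborel (\<lambda>\<xi>. (1 + \<xi>\<^sup>2) powr 1 * (cmod (FT f \<xi>))\<^sup>2)"
    by (subst integrable_cong_AE[OF m1 _ e1]) measurable
  then show "in_Hs 1 f" unfolding in_Hs_def using fourier_L2_exists[OF assms(1)] by blast
qed

lemma Hs_norm_nonneg[simp]: "0 \<le> Hs_norm s f"
  unfolding Hs_norm_def by (intro real_sqrt_ge_zero integral_nonneg_AE) auto

text \<open>\<open>Pi_plus_dx\<close> chooses a function with a prescribed transform.
  \<open>Pr g'\<close> has that transform, so the choice is a proper one and agrees with it up to a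
  null set.\<close>

lemma Pi_plus_dx_eq:
  assumes "L2 f" "H1 g g'" "AE x in lborel. f x = g x" 
  shows "L2 (Pi_plus_dx f)" "AE x in lborel. Pi_plus_dx f x = Pr g' x"
proof -
  note L = H1_L2[OF assms(2)]
  let ?h = "\<lambda>\<xi>. if 0 < \<xi> then \<i> * complex_of_real \<xi> * FT f \<xi> else 0"
  have [measurable]: "FT f \<in> borel_measurable borel" using assms(1) by (auto intro!: L2_measurable)
  have G: "fourier_L2 (Pr g') (\<lambda>\<xi>. if 0 < \<xi> then \<i> * complex_of_real \<xi> * FT g \<xi> else 0)"
    by (rule Pr_FT[OF H1_FT[OF assms(2) FT[OF L(1)]]])
  have "AE \<xi> in lborel. (if 0 < \<xi> then \<i> * complex_of_real \<xi> * FT g \<xi> else 0) = ?h \<xi>"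
    using FT_cong_AE[OF assms(1) L(1) assms(3)] by eventually_elim auto
  then have G': "fourier_L2 (Pr g') ?h"
    using L2_measurable[OF Pr_L2[OF L(2)]] by (intro fourier_L2_cong_AE[OF G]) auto
  have P: "fourier_L2 (Pi_plus_dx f) ?h"
    unfolding Pi_plus_dx_def by (rule someI[where P="\<lambda>h. fourier_L2 h ?h", OF G'])
  show "L2 (Pi_plus_dx f)" using fourier_L2_L2(1)[OF P] .
  show "AE x in lborel. Pi_plus_dx f x = Pr g' x" by (rule L2_eq_of_transform_eq[OF P G']) auto
qed

subsection \<open>The resolvent of the Lax operator\<close>

text \<open>The potential part of the Lax operator, which sends \<open>f\<close> to
  \<open>- \<i> * f' - Tu u f\<close>.\<close>

definition Tu :: "(real \<Rightarrow> complex) \<Rightarrow> (real \<Rightarrow> complex) \<Rightarrow> real \<Rightarrow> complex" where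
  "Tu u f x = u x * Pr (\<lambda>y. cnj (u y) * f y) x"

text \<open>The equation \<open>(L + k) w = f\<close> for the Lax operator \<open>L\<close>. It is a
  relation rather than a function: solutions come from an existence theorem, and only their matrix
  elements are compared.\<close>

definition Lres :: "(real \<Rightarrow> complex) \<Rightarrow> real \<Rightarrow> (real \<Rightarrow> complex) \<Rightarrow> (real \<Rightarrow> complex) \<Rightarrow> (real \<Rightarrow> complex) \<Rightarrow> bool" where
  "Lres u k w w' f \<longleftrightarrow> H1 w w' \<and> hardy w \<and> L2 f \<and> (AE x in lborel. - \<i> * w' x + complex_of_real k * w x - Tu u w x = f x)"

text \<open>The quadratic form at \<open>w\<close> of the Lax operator plus
  \<open>k\<close>.\<close>

definition qform :: "(real \<Rightarrow> complex) \<Rightarrow> real \<Rightarrow> (real \<Rightarrow> complex) \<Rightarrow> (real \<Rightarrow> complex) \<Rightarrow> real" where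
  "qform u k w w' = Re (ip (\<lambda>x. - \<i> * w' x) w) + k * (nrm w)\<^sup>2 - (nrm (Pr (\<lambda>y. cnj (u y) * w y)))\<^sup>2"

lemma L2_cnj_mult_H1: "H1 u u' \<Longrightarrow> L2 f \<Longrightarrow> L2 (\<lambda>y. cnj (u y) * f y)"
  using L2_mult_H1(1)[OF H1_cnj] by blast

lemma Tu_L2: "H1 u u' \<Longrightarrow> L2 f \<Longrightarrow> L2 (Tu u f)"
  unfolding Tu_def[abs_def] by (intro L2_mult_H1 Pr_L2 L2_cnj_mult_H1)

lemma Tu_hardy: "H1 u u' \<Longrightarrow> hardy u \<Longrightarrow> L2 f \<Longrightarrow> hardy (Tu u f)"
  unfolding Tu_def[abs_def] by (intro hardy_mult_H1(2)[OF Pr_hardy] L2_cnj_mult_H1)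

lemma nrm_cnj_mult_H1:
  assumes "H1 u u'" "\<And>x. cmod (u x) \<le> B" "L2 f" shows "nrm (\<lambda>y. cnj (u y) * f y) \<le> B * nrm f"
  by (rule nrm_bounded_mult[OF assms(3)]) (use assms(2) H1_measurable(1)[OF H1_cnj[OF assms(1)]] in auto)

lemma nrm_Pr_cnj_mult:
  assumes "H1 u u'" "\<And>x. cmod (u x) \<le> B" "L2 f" shows "nrm (Pr (\<lambda>y. cnj (u y) * f y)) \<le> B * nrm f"
  using nrm_Pr[OF L2_cnj_mult_H1[OF assms(1,3)]] nrm_cnj_mult_H1[OF assms] by (rule order_trans)

lemma nrm_Tu:
  assumes "H1 u u'" "\<And>x. cmod (u x) \<le> B" "L2 f" shows "nrm (Tu u f) \<le> B\<^sup>2 * nrm f"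
proof -
  have B: "B \<ge> 0" using assms(2)[of 0] norm_ge_zero order_trans by blast
  have "nrm (Tu u f) \<le> B * nrm (Pr (\<lambda>y. cnj (u y) * f y))" unfolding Tu_def[abs_def]
    by (rule nrm_bounded_mult(1)) (use assms H1_measurable(1)[OF assms(1)] L2_cnj_mult_H1[OF assms(1,3)] in auto)
  also have "\<dots> \<le> B * (B * nrm f)" using nrm_Pr_cnj_mult[OF assms] B by (rule mult_left_mono)
  finally show ?thesis by (simp add: power2_eq_square mult.assoc)
qed

lemma Tu_diff:
  assumes "H1 u u'" "L2 f" "L2 h" shows "AE x in lborel. Tu u (\<lambda>x. f x - h x) x = Tu u f x - Tu u h x"
  using Pr_diff[OF L2_cnj_mult_H1[OF assms(1,2)] L2_cnj_mult_H1[OF assms(1,3)]]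
  by eventually_elim (simp add: Tu_def right_diff_distrib)

lemma Tu_cmult:
  assumes "H1 u u'" "L2 f" shows "AE x in lborel. Tu u (\<lambda>x. c * f x) x = c * Tu u f x"
  using Pr_cmult[OF L2_cnj_mult_H1[OF assms(1,2)], of c]
  by eventually_elim (simp add: Tu_def mult.left_commute)

lemma Tu_cong_AE:
  assumes "H1 u u'" "L2 f" "L2 h" "AE x in lborel. f x = h x" shows "AE x in lborel. Tu u f x = Tu u h x"
proof -
  have "AE x in lborel. cnj (u x) * f x = cnj (u x) * h x" using assms(4) by eventually_elim simp
  from Pr_cong_AE[OF L2_cnj_mult_H1[OF assms(1,2)] L2_cnj_mult_H1[OF assms(1,3)] this]
  show ?thesis by eventually_elim (simp add: Tu_def)
qed

text \<open>\<open>Tu u\<close> is the adjoint of the map \<open>f\<close> to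
  \<open>Pr (cnj u * f)\<close> composed with that map, because the projection may be inserted next
  to a Hardy factor. In particular the potential enters the form as a negative square.\<close>

lemma ip_Tu:
  assumes "H1 u u'" "L2 f" "L2 h" 
  shows "ip (Tu u f) h = ip (Pr (\<lambda>y. cnj (u y) * f y)) (Pr (\<lambda>y. cnj (u y) * h y))"
proof -
  note L = L2_cnj_mult_H1[OF assms(1,2)] L2_cnj_mult_H1[OF assms(1,3)]
  have "ip (Tu u f) h = ip (Pr (\<lambda>y. cnj (u y) * f y)) (\<lambda>y. cnj (u y) * h y)"
    unfolding ip_def by (intro Bochner_Integration.integral_cong) (auto simp: Tu_def)
  also have "\<dots> = cnj (ip (\<lambda>y. cnj (u y) * h y) (Pr (\<lambda>y. cnj (u y) * f y)))" by (rule ip_cnj[symmetric])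
  also have "\<dots> = cnj (ip (Pr (\<lambda>y. cnj (u y) * h y)) (Pr (\<lambda>y. cnj (u y) * f y)))" 
    using ip_Pr[OF L(2) Pr_hardy[OF L(1)]] by simp
  finally show ?thesis by (simp add: ip_cnj)
qed

lemma ip_D_symmetric:
  assumes "H1 f f'" "H1 h h'" shows "ip (\<lambda>x. - \<i> * f' x) h = cnj (ip (\<lambda>x. - \<i> * h' x) f)"
proof -
  have "cnj (ip (\<lambda>x. - \<i> * h' x) f) = \<i> * ip f h'"
    unfolding ip_cmult_left complex_cnj_mult ip_cnj by simp
  then show ?thesis using ip_H1[OF assms] by (simp only: ip_cmult_left) simp
qed

lemma Lres_ip:
  assumes u: "H1 u u'" and w: "Lres u k w w' f" and v: "H1 v v'"
  shows "Re (ip f v) = Re (ip (\<lambda>x. - \<i> * w' x) v) + k * Re (ip w v) 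
    - Re (ip (Pr (\<lambda>y. cnj (u y) * w y)) (Pr (\<lambda>y. cnj (u y) * v y)))"
proof -
  have w': "H1 w w'" "L2 f" "AE x in lborel. - \<i> * w' x + complex_of_real k * w x - Tu u w x = f x" using w by (auto simp: Lres_def)
  note L = H1_L2[OF w'(1)] H1_L2[OF v]
  note T = Tu_L2[OF u L(1)]
  have m: "L2 (\<lambda>x. - \<i> * w' x + complex_of_real k * w x - Tu u w x)" using L T by auto
  have "ip f v = ip (\<lambda>x. - \<i> * w' x + complex_of_real k * w x - Tu u w x) v"
    by (rule ip_cong_AE) (use w'(2,3) L(3) m in \<open>auto dest!: L2_measurable\<close>)
  also have "\<dots> = ip (\<lambda>x. - \<i> * w' x) v + complex_of_real k * ip w v - ip (Tu u w) v"
    using L T by (subst ip_diff_left ip_add_left; (simp only: ip_cmult_left)?; auto)+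
  also have "ip (Tu u w) v = ip (Pr (\<lambda>y. cnj (u y) * w y)) (Pr (\<lambda>y. cnj (u y) * v y))"
    by (rule ip_Tu[OF u L(1,3)])
  finally show ?thesis by simp
qed

lemma Lres_qform: "H1 u u' \<Longrightarrow> Lres u k w w' f \<Longrightarrow> qform u k w w' = Re (ip f w)"
  using Lres_ip[of u u' k w w' f w w'] by (auto simp: qform_def Lres_def Re_ip_self)

lemma qform_coercive:
  assumes u: "H1 u u'" "\<And>x. cmod (u x) \<le> B" and w: "H1 w w'" "hardy w"
  shows "(k - B\<^sup>2) * (nrm w)\<^sup>2 \<le> qform u k w w'"
proof -
  have B: "B \<ge> 0" using u(2)[of 0] norm_ge_zero order_trans by blast
  have "(nrm (Pr (\<lambda>y. cnj (u y) * w y)))\<^sup>2 \<le> (B * nrm w)\<^sup>2"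
    by (intro power_mono nrm_Pr_cnj_mult[OF u]) (use H1_L2[OF w(1)] in auto)
  then show ?thesis using ip_deriv_hardy_nonneg[OF w(2,1)] unfolding qform_def
    by (simp add: power_mult_distrib left_diff_distrib)
qed

lemma qform_upper:
  assumes "H1 w w'" shows "qform u k w w' \<le> nrm w' * nrm w + k * (nrm w)\<^sup>2"
proof -
  note L = H1_L2[OF assms]
  have "Re (ip (\<lambda>x. - \<i> * w' x) w) \<le> cmod (ip (\<lambda>x. - \<i> * w' x) w)" by (rule complex_Re_le_cmod)
  also have "\<dots> \<le> nrm (\<lambda>x. - \<i> * w' x) * nrm w" by (rule cauchy_schwarz) (use L in auto)
  also have "nrm (\<lambda>x. - \<i> * w' x) = nrm w'" by (simp only: nrm_scale) simp
  finally show ?thesis using zero_le_power2[of "nrm (Pr (\<lambda>y. cnj (u y) * w y))"] unfolding qform_def by linarith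
qed

lemma qform_diff:
  assumes u: "H1 u u'" and w: "H1 w w'" and v: "H1 v v'"
  shows "qform u k (\<lambda>x. w x - v x) (\<lambda>x. w' x - v' x) = qform u k w w' + qform u k v v'
     - 2 * (Re (ip (\<lambda>x. - \<i> * w' x) v) + k * Re (ip w v) - Re (ip (Pr (\<lambda>y. cnj (u y) * w y)) (Pr (\<lambda>y. cnj (u y) * v y))))"
proof -
  note L = H1_L2[OF w] H1_L2[OF v]
  note C = L2_cnj_mult_H1[OF u L(1)] L2_cnj_mult_H1[OF u L(3)]
  have 1: "Re (ip (\<lambda>x. - \<i> * (w' x - v' x)) (\<lambda>x. w x - v x)) = Re (ip (\<lambda>x. - \<i> * w' x) w) + Re (ip (\<lambda>x. - \<i> * v' x) v)
      - 2 * Re (ip (\<lambda>x. - \<i> * w' x) v)"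
  proof -
    have e: "ip (\<lambda>x. - \<i> * (w' x - v' x)) (\<lambda>x. w x - v x) = - \<i> * (ip w' w - ip w' v - (ip v' w - ip v' v))"
      using L by (simp only: ip_cmult_left ip_diff_left ip_diff_right L2_diff)
    have "Re (ip (\<lambda>x. - \<i> * v' x) w) = Re (ip (\<lambda>x. - \<i> * w' x) v)" 
      by (subst ip_D_symmetric[OF v w]) (simp only: cnj.sel(1))
    then show ?thesis unfolding e unfolding ip_cmult_left by simp
  qed
  have 2: "(nrm (\<lambda>x. w x - v x))\<^sup>2 = (nrm w)\<^sup>2 - 2 * Re (ip w v) + (nrm v)\<^sup>2"
    by (rule nrm_diff_sq[OF L(1,3)])
  have "nrm (Pr (\<lambda>y. cnj (u y) * (w y - v y))) = nrm (\<lambda>y. Pr (\<lambda>y. cnj (u y) * w y) y - Pr (\<lambda>y. cnj (u y) * v y) y)"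
  proof (rule nrm_cong_AE)
    show "AE x in lborel. Pr (\<lambda>y. cnj (u y) * (w y - v y)) x = Pr (\<lambda>y. cnj (u y) * w y) x - Pr (\<lambda>y. cnj (u y) * v y) x"
      using Pr_diff[OF C] by (simp only: right_diff_distrib)
    show "Pr (\<lambda>y. cnj (u y) * (w y - v y)) \<in> borel_measurable borel"
      by (intro L2_measurable Pr_L2 L2_cnj_mult_H1[OF u] L2_diff L)
    show "(\<lambda>y. Pr (\<lambda>y. cnj (u y) * w y) y - Pr (\<lambda>y. cnj (u y) * v y) y) \<in> borel_measurable borel"
      by (intro L2_measurable L2_diff Pr_L2 C)
  qed
  then have 3: "(nrm (Pr (\<lambda>y. cnj (u y) * (w y - v y))))\<^sup>2 = (nrm (Pr (\<lambda>y. cnj (u y) * w y)))\<^sup>2 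
     - 2 * Re (ip (Pr (\<lambda>y. cnj (u y) * w y)) (Pr (\<lambda>y. cnj (u y) * v y))) + (nrm (Pr (\<lambda>y. cnj (u y) * v y)))\<^sup>2"
    by (simp only: nrm_diff_sq[OF Pr_L2[OF C(1)] Pr_L2[OF C(2)]])
  show ?thesis unfolding qform_def 1 2 3 by (simp add: algebra_simps)
qed

text \<open>The quadratic form is dual to the resolvent, so that matrix elements of the resolvent are
  suprema; this yields lower bounds on their increments without differentiating the resolvent.\<close>

lemma Lres_variational:
  assumes u: "H1 u u'" "\<And>x. cmod (u x) \<le> B" and k: "k \<ge> B\<^sup>2" and w: "Lres u k w w' f" and v: "H1 v v'" "hardy v"
  shows "2 * Re (ip f v) - qform u k v v' \<le> Re (ip f w)"
proof -
  have w': "H1 w w'" "hardy w" using w by (auto simp: Lres_def)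
  \<comment> \<open>Completing the square: the form at \<open>w - v\<close> is nonnegative, and the
    resolvent equation identifies the cross term as \<open>Re (ip f v)\<close>.\<close>
  have "0 \<le> (k - B\<^sup>2) * (nrm (\<lambda>x. w x - v x))\<^sup>2" using k by simp
  also have "\<dots> \<le> qform u k (\<lambda>x. w x - v x) (\<lambda>x. w' x - v' x)"
    by (rule qform_coercive[OF u H1_diff[OF w'(1) v(1)] hardy_diff[OF w'(2) v(2)]])
  also have "\<dots> = Re (ip f w) + qform u k v v' - 2 * Re (ip f v)"
    unfolding qform_diff[OF u(1) w'(1) v(1)] Lres_ip[OF u(1) w v(1)] Lres_qform[OF u(1) w] by simp
  finally show ?thesis by simp
qed

lemma Lres_bound:
  assumes u: "H1 u u'" "\<And>x. cmod (u x) \<le> B" and k: "k > B\<^sup>2" and w: "Lres u k w w' f"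
  shows "(k - B\<^sup>2) * nrm w \<le> nrm f"
proof -
  have w': "H1 w w'" "hardy w" "L2 f" using w by (auto simp: Lres_def)
  have "(k - B\<^sup>2) * (nrm w)\<^sup>2 \<le> Re (ip f w)"
    using qform_coercive[OF u w'(1,2), of k] Lres_qform[OF u(1) w] by simp
  also have "\<dots> \<le> cmod (ip f w)" by (rule complex_Re_le_cmod)
  also have "\<dots> \<le> nrm f * nrm w" by (rule cauchy_schwarz) (use w' in auto)
  finally have *: "(k - B\<^sup>2) * nrm w * nrm w \<le> nrm f * nrm w" by (simp add: power2_eq_square mult.assoc)
  show ?thesis
  proof (cases "nrm w = 0")
    case False
    then have "nrm w > 0" using nrm_nonneg[of w] by linarith
    with * show ?thesis by (rule mult_right_le_imp_le)
  qed simp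
qed

section \<open>Existence of the resolvent by contraction\<close>

lemma D_resolvent:
  assumes f: "hardy f" and k: "k > 0"
  shows "\<exists>r r'. H1 r r' \<and> hardy r \<and> (AE x in lborel. - \<i> * r' x + complex_of_real k * r x = f x)"
proof -
  have L: "L2 f" using f by auto
  note F = FT[OF L] and FL = FT_L2[OF L]
  have [measurable]: "FT f \<in> borel_measurable borel" using FL by (rule L2_measurable)
  \<comment> \<open>The free resolvent divides by \<open>\<xi> + k\<close>. The multiplier is at
    most \<open>1 / k\<close>, and after multiplication by \<open>\<xi>\<close> at most 1, so the
    solution and its derivative are both square-integrable.\<close>
  define R where "R \<xi> = (if 0 < \<xi> then FT f \<xi> / complex_of_real (\<xi> + k) else 0)" for \<xi>
  have [measurable]: "R \<in> borel_measurable borel" unfolding R_def by measurable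
  have R: "cmod (R \<xi>) = (if 0 < \<xi> then cmod (FT f \<xi>) / (\<xi> + k) else 0)" for \<xi>
    using k by (simp add: R_def norm_divide del: of_real_add)
  have b1: "cmod (R \<xi>) \<le> 1 / k * cmod (FT f \<xi>)" for \<xi>
    using k divide_left_mono[of k "\<xi> + k" "cmod (FT f \<xi>)"] by (auto simp: R)
  have b2: "cmod (\<i> * complex_of_real \<xi> * R \<xi>) \<le> cmod (FT f \<xi>)" for \<xi>
    using k mult_right_mono[of \<xi> "\<xi> + k" "cmod (FT f \<xi>)"] by (auto simp: R norm_mult field_simps)
  have RL: "L2 R"
  proof (rule L2_dominated)
    show "integrable lborel (\<lambda>\<xi>. (1/k)\<^sup>2 * (cmod (FT f \<xi>))\<^sup>2)" using L2_integrable[OF FL] by simp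
    show "AE \<xi> in lborel. (cmod (R \<xi>))\<^sup>2 \<le> (1/k)\<^sup>2 * (cmod (FT f \<xi>))\<^sup>2"
      unfolding power_mult_distrib[symmetric] by (intro AE_I2 power_mono b1) auto
  qed measurable
  have R'L: "L2 (\<lambda>\<xi>. \<i> * complex_of_real \<xi> * R \<xi>)"
    by (rule L2_dominated[OF L2_integrable[OF FL]]) (auto intro!: power_mono b2)
  note r' = Fourier_inversion[OF R'L]
  from H1_rep_of_transform[OF Fourier_inversion[OF RL] R'L r'] obtain r where
    r: "H1 r (\<lambda>x. FT (\<lambda>\<xi>. \<i> * complex_of_real \<xi> * R \<xi>) (- x))" "AE x in lborel. FT R (- x) = r x" .
  have rF: "fourier_L2 r R"
    by (rule fourier_L2_cong_AE[OF Fourier_inversion[OF RL] H1_measurable(1)[OF r(1)] r(2)]) auto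
  have "hardy r" by (rule hardyI[OF rF]) (auto simp: R_def)
  moreover have "AE x in lborel. - \<i> * FT (\<lambda>\<xi>. \<i> * complex_of_real \<xi> * R \<xi>) (- x) + complex_of_real k * r x = f x"
  proof (rule L2_eq_of_transform_eq[OF fourier_L2_add[OF fourier_L2_cmult[OF r'] fourier_L2_cmult[OF rF]] F])
    show "AE \<xi> in lborel. - \<i> * (\<i> * complex_of_real \<xi> * R \<xi>) + complex_of_real k * R \<xi> = FT f \<xi>"
      using hardy_FT[OF f] AE_lborel_ne_0
    proof eventually_elim
      case (elim \<xi>)
      show ?case
      proof (cases "0 < \<xi>")
        case True
        then have "complex_of_real (\<xi> + k) \<noteq> 0" using k by (simp del: of_real_add)
        moreover have "- \<i> * (\<i> * complex_of_real \<xi> * R \<xi>) + complex_of_real k * R \<xi> = complex_of_real (\<xi> + k) * R \<xi>"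
          by (simp add: algebra_simps)
        ultimately show ?thesis using True by (simp add: R_def)
      qed (use elim in \<open>auto simp: R_def\<close>)
    qed
  qed
  ultimately show ?thesis using r(1) by blast
qed

lemma D_resolvent_bound:
  assumes "H1 r r'" "hardy r" "k > 0" "L2 f" "AE x in lborel. - \<i> * r' x + complex_of_real k * r x = f x"
  shows "k * nrm r \<le> nrm f"
proof -
  have z: "H1 (\<lambda>x. 0) (\<lambda>x. 0)" by (auto simp: H1_def)
  \<comment> \<open>The free equation is the resolvent equation with zero potential, so the general
    bound applies with \<open>B = 0\<close>.\<close>
  have "Lres (\<lambda>x. 0) k r r' f" unfolding Lres_def using assms by (auto simp: Tu_def)
  from Lres_bound[OF z _ _ this, of 0] assms(3) show ?thesis by simp
qed

lemma L2_Cauchy_of_contraction: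
  assumes L: "\<And>n::nat. L2 (w n)" and d: "\<And>n. nrm (\<lambda>x. w (Suc n) x - w n x) \<le> c * (1/2)^n"
  obtains g where "L2 g" "(\<lambda>n. nrm (\<lambda>x. w n x - g x)) \<longlonglongrightarrow> 0"
proof (rule L2_complete[of w, OF L])
  have "nrm (\<lambda>x. w (Suc 0) x - w 0 x) \<le> c" using d[of 0] by simp
  then have c: "c \<ge> 0" by (rule order_trans[OF nrm_nonneg])
  have tail: "nrm (\<lambda>x. w (n + j) x - w n x) \<le> 2 * c * (1/2)^n - c * 2 * (1/2)^(n + j)" for n j
  proof (induction j)
    case 0 then show ?case by simp
  next
    case (Suc j)
    have "nrm (\<lambda>x. w (n + Suc j) x - w n x) \<le> nrm (\<lambda>x. w (n + Suc j) x - w (n + j) x) + nrm (\<lambda>x. w (n + j) x - w n x)"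
      by (rule nrm_triangle3[OF L L L])
    also have "\<dots> \<le> c * (1/2)^(n + j) + (2 * c * (1/2)^n - c * 2 * (1/2)^(n + j))"
      using d[of "n + j"] Suc by simp
    also have "\<dots> = 2 * c * (1/2)^n - c * 2 * (1/2)^(n + Suc j)" by simp
    finally show ?case .
  qed
  fix e :: real assume e: "e > 0"
  have "(\<lambda>N. 4 * c * (1/2)^N) \<longlonglongrightarrow> 4 * c * 0" by (intro tendsto_mult tendsto_const LIMSEQ_power_zero) simp
  then have "eventually (\<lambda>N. 4 * c * (1/2)^N < e) sequentially" by (rule order_tendstoD) (use e in simp)
  then obtain N where N: "4 * c * (1/2)^N < e" by (auto simp: eventually_sequentially)
  have t: "nrm (\<lambda>x. w m x - w N x) \<le> 2 * c * (1/2)^N" if "m \<ge> N" for m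
  proof -
    have "0 \<le> c * 2 * (1/2)^m" using c by simp
    then show ?thesis using tail[of N "m - N"] that by simp
  qed
  show "\<exists>N. \<forall>m\<ge>N. \<forall>n\<ge>N. nrm (\<lambda>x. w m x - w n x) < e"
  proof (intro exI[of _ N] allI impI)
    fix m n assume mn: "m \<ge> N" "n \<ge> N"
    have "nrm (\<lambda>x. w m x - w n x) \<le> nrm (\<lambda>x. w m x - w N x) + nrm (\<lambda>x. w N x - w n x)" by (rule nrm_triangle3[OF L L L])
    also have "\<dots> \<le> 4 * c * (1/2)^N" using t[OF mn(1)] t[OF mn(2)] by (simp add: nrm_minus_commute[of "w N"])
    finally show "nrm (\<lambda>x. w m x - w n x) < e" using N by simp
  qed
qed (use that in blast)

text \<open>Fixed point of the map that sends \<open>h\<close> to the free resolvent of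
  \<open>f + Tu u h\<close>. The free resolvent has norm at most \<open>1 / k\<close> and the
  potential at most \<open>B\<^sup>2\<close>, so \<open>k \<ge> 2 * B\<^sup>2\<close> makes the map
  contract by a factor of one half.\<close>

theorem Lres_exists:
  assumes u: "H1 u u'" "hardy u" "\<And>x. cmod (u x) \<le> B" and k: "k \<ge> 2 * B\<^sup>2" "k > 0" and f: "hardy f"
  obtains w w' where "Lres u k w w' f"
proof -
  have uL: "L2 u" and fL: "L2 f" using u f by auto
  define P where "P h r \<longleftrightarrow> H1 (fst r) (snd r) \<and> hardy (fst r) \<and> (AE x in lborel. - \<i> * snd r x + complex_of_real k * fst r x = f x + Tu u h x)" for h r
  have ex: "\<exists>r. P h r" if "L2 h" for h
    using D_resolvent[OF hardy_add[OF f Tu_hardy[OF u(1,2) that]] k(2)] unfolding P_def by (metis fst_conv snd_conv)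
  define S where "S h = (SOME r. P h r)" for h
  have S: "P h (S h)" if "L2 h" for h unfolding S_def using ex[OF that] by (rule someI_ex)
  have contr: "nrm (\<lambda>x. fst (S h) x - fst (S h') x) \<le> nrm (\<lambda>x. h x - h' x) / 2" if h: "L2 h" "L2 h'" for h h'
  proof -
    note p = S[OF h(1), unfolded P_def] S[OF h(2), unfolded P_def]
    have "k * nrm (\<lambda>x. fst (S h) x - fst (S h') x) \<le> nrm (Tu u (\<lambda>x. h x - h' x))"
    proof (rule D_resolvent_bound[OF H1_diff hardy_diff k(2) Tu_L2[OF u(1)]])
      show "AE x in lborel. - \<i> * (snd (S h) x - snd (S h') x) + complex_of_real k * (fst (S h) x - fst (S h') x) = Tu u (\<lambda>x. h x - h' x) x"
        using p(1)[THEN conjunct2, THEN conjunct2] p(2)[THEN conjunct2, THEN conjunct2] Tu_diff[OF u(1) h]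
      proof eventually_elim
        case (elim x)
        have "- \<i> * (snd (S h) x - snd (S h') x) + complex_of_real k * (fst (S h) x - fst (S h') x) 
          = (- \<i> * snd (S h) x + complex_of_real k * fst (S h) x) - (- \<i> * snd (S h') x + complex_of_real k * fst (S h') x)" by (simp add: algebra_simps)
        then show ?case using elim by simp
      qed
    qed (use p h in auto)
    also have "\<dots> \<le> B\<^sup>2 * nrm (\<lambda>x. h x - h' x)" by (rule nrm_Tu[OF u(1,3)]) (use h in auto)
    also have "\<dots> \<le> (k / 2) * nrm (\<lambda>x. h x - h' x)" by (rule mult_right_mono) (use k in auto)
    finally show ?thesis using k(2) by (simp add: field_simps)
  qed
  define w where "w = rec_nat (\<lambda>x. 0) (\<lambda>n h. fst (S h))"
  have w0: "w 0 = (\<lambda>x. 0)" and wS: "w (Suc n) = fst (S (w n))" for n by (simp_all add: w_def)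
  have wL: "L2 (w n)" for n
  proof (induction n)
    case (Suc n) then show ?case using S[OF Suc] by (auto simp: wS P_def H1_def)
  qed (simp add: w0)
  have dec: "nrm (\<lambda>x. w (Suc n) x - w n x) \<le> nrm (w 1) * (1/2)^n" for n
  proof (induction n)
    case 0 then show ?case by (simp add: w0)
  next
    case (Suc n)
    have "nrm (\<lambda>x. w (Suc (Suc n)) x - w (Suc n) x) \<le> nrm (\<lambda>x. w (Suc n) x - w n x) / 2"
      using contr[OF wL[of "Suc n"] wL[of n]] by (simp add: wS)
    then show ?case using Suc by simp
  qed
  from L2_Cauchy_of_contraction[OF wL dec] obtain g where g: "L2 g" "(\<lambda>n. nrm (\<lambda>x. w n x - g x)) \<longlonglongrightarrow> 0" by blast
  \<comment> \<open>The limit \<open>g\<close> is known only as an L2 function. Its image under the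
    iteration is an H1 solution equal to \<open>g\<close> almost everywhere, and is used in its
    place.\<close>
  define r where "r = fst (S g)"
  define r' where "r' = snd (S g)"
  have r: "H1 r r'" "hardy r" "AE x in lborel. - \<i> * r' x + complex_of_real k * r x = f x + Tu u g x"
    using S[OF g(1)] by (auto simp: P_def r_def r'_def)
  have rL: "L2 r" using r by auto
  have "nrm (\<lambda>x. r x - g x) \<le> 0"
  proof (rule LIMSEQ_le_const)
    have "(\<lambda>n. nrm (\<lambda>x. w n x - g x) / 2 + nrm (\<lambda>x. w (Suc n) x - g x)) \<longlonglongrightarrow> 0 / 2 + 0"
      by (intro tendsto_add tendsto_divide tendsto_const g LIMSEQ_Suc) auto
    then show "(\<lambda>n. nrm (\<lambda>x. w n x - g x) / 2 + nrm (\<lambda>x. w (Suc n) x - g x)) \<longlonglongrightarrow> 0" by simp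
    have "nrm (\<lambda>x. r x - g x) \<le> nrm (\<lambda>x. w n x - g x) / 2 + nrm (\<lambda>x. w (Suc n) x - g x)" for n
    proof -
      have "nrm (\<lambda>x. r x - g x) \<le> nrm (\<lambda>x. r x - w (Suc n) x) + nrm (\<lambda>x. w (Suc n) x - g x)"
        by (rule nrm_triangle3[OF rL wL g(1)])
      also have "nrm (\<lambda>x. r x - w (Suc n) x) \<le> nrm (\<lambda>x. g x - w n x) / 2"
        using contr[OF g(1) wL[of n]] by (simp add: wS r_def)
      finally show ?thesis by (simp add: nrm_minus_commute[of g])
    qed
    then show "\<exists>N. \<forall>n\<ge>N. nrm (\<lambda>x. r x - g x) \<le> nrm (\<lambda>x. w n x - g x) / 2 + nrm (\<lambda>x. w (Suc n) x - g x)" by blast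
  qed
  then have "nrm (\<lambda>x. r x - g x) = 0" using nrm_nonneg order_antisym by metis
  then have "AE x in lborel. r x - g x = 0" by (intro nrm_zero_AE) (use rL g in auto)
  then have "AE x in lborel. r x = g x" by eventually_elim simp
  from Tu_cong_AE[OF u(1) rL g(1) this] r(3)
  have "AE x in lborel. - \<i> * r' x + complex_of_real k * r x - Tu u r x = f x" by eventually_elim simp
  then have "Lres u k r r' f" using r fL by (auto simp: Lres_def)
  then show ?thesis by (rule that)
qed

lemma H1_deriv_unique:
  assumes "H1 f f'" "H1 f f''" shows "AE x in lborel. f' x = f'' x"
  using H1_FT[OF assms(1) FT] H1_FT[OF assms(2) FT] H1_L2(1)[OF assms(1)]
  by (intro L2_eq_of_transform_eq[of f' _ f'']) auto

text \<open>\<open>v, z, h, t\<close> stand for the conjugates of \<open>u, w, g, s\<close>, and a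
  suffix 1 for a derivative. Each group on the right is the derivative of a product, a product of
  Hardy functions, or a conjugate of the latter, so that it integrates to zero. \<open>m\<close> and
  \<open>mb\<close> separate the part of \<open>cnj u * w\<close> that the projection
  removes.\<close>

lemma Lax_identity_pointwise:
  fixes u u1 v v1 w w1 z z1 g g1 h h1 s s1 t t1 k m mb m1 n1 p p1 pb pb1 X Xb :: complex
  assumes w1: "w1 = \<i> * u * (1 + g) - \<i> * k * w" and z1: "z1 = - \<i> * v * (1 + h) + \<i> * k * z"
    and st: "s + t = u * v" "s1 + t1 = u1 * v + u * v1"
    and m: "m = u * z - h" "mb = v * w - g" "m1 = u1 * z + u * z1 - h1" "n1 = v1 * w + v * w1 - g1"
    and p: "p = u + u * g" "p1 = u1 + (u1 * g + u * g1)" "pb = v + v * h" "pb1 = v1 + (v1 * h + v * h1)"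
    and X: "X = - \<i> * (u1 * (z1 + (z1 * g + z * g1))) + 2 * (u * s1 * (z + z * g))"
    and Xb: "Xb = \<i> * (v1 * (w1 + (w1 * h + w * h1))) + 2 * (v * t1 * (w + w * h))"
  shows "X + Xb = - (u1 * v + u * v1) - s1 * g - t1 * h + k * (p1 * z + p * z1) + k * (pb1 * w + pb * w1)
     - k\<^sup>2 * (w1 * z + w * z1) - 2 * k * (g1 * h + g * h1) - 2 * k * (m * g1) - 2 * k * (mb * h1) - \<i> * (m1 * g1) + \<i> * (n1 * h1)
     + s * g1 + t * h1 + (t1 * g + t * g1) + (s1 * h + s * h1) + ((s1 + t1) * (g * h) + (s + t) * (g1 * h + g * h1))
     + 2 * (s1 * m) + 2 * (t1 * mb) + 2 * (s1 * (m * g)) + 2 * (t1 * (mb * h))"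
proof -
  \<comment> \<open>Eliminating \<open>t\<close> and the derivatives of \<open>w\<close> and
    \<open>z\<close> leaves a polynomial identity.\<close>
  have s: "t = u * v - s" "t1 = u1 * v + u * v1 - s1" using st by (auto simp: algebra_simps)
  have ii: "\<i> * (\<i> * a) = - a" for a :: complex by (simp flip: mult.assoc)
  show ?thesis unfolding X Xb m p s w1 z1 by (simp add: algebra_simps power2_eq_square ii)
qed

text \<open>Integrability is bundled with the vanishing integral so that the long sum in the Lax
  identity can be taken apart term by term without separate integrability arguments.\<close>

definition null_int :: "(real \<Rightarrow> complex) \<Rightarrow> bool" where
  "null_int f \<longleftrightarrow> integrable lborel f \<and> integral\<^sup>L lborel f = 0"

lemma null_int_add: "null_int f \<Longrightarrow> null_int g \<Longrightarrow> null_int (\<lambda>x. f x + g x)"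
  and null_int_diff: "null_int f \<Longrightarrow> null_int g \<Longrightarrow> null_int (\<lambda>x. f x - g x)"
  and null_int_cmult: "null_int f \<Longrightarrow> null_int (\<lambda>x. c * f x)"
  and null_int_uminus: "null_int f \<Longrightarrow> null_int (\<lambda>x. - f x)"
  by (auto simp: null_int_def)

lemma null_int_cnj: "null_int f \<Longrightarrow> null_int (\<lambda>x. cnj (f x))"
  unfolding null_int_def Bochner_Integration.integral_cnj by auto

lemma null_int_hardy: "hardy f \<Longrightarrow> hardy g \<Longrightarrow> null_int (\<lambda>x. f x * g x)"
  unfolding null_int_def using hardy_integral_mult by auto

lemma null_int_parts:
  assumes f: "H1 f f'" and g: "H1 g g'" shows "null_int (\<lambda>x. f' x * g x + f x * g' x)"
proof -
  have "integrable lborel (\<lambda>x. f' x * g x)" "integrable lborel (\<lambda>x. f x * g' x)" 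
    using H1_L2[OF f] H1_L2[OF g] by auto
  then show ?thesis unfolding null_int_def using H1_integration_by_parts[OF f g] by simp
qed

text \<open>The expression is the flux of the equation tested against \<open>w + w * cnj g\<close>,
  which is half the gradient of the resolvent matrix element; its vanishing is conservation in
  infinitesimal form. Twice the real part is the integral of an integrand plus its conjugate, to
  which the pointwise identity applies.\<close>

theorem Lax_identity:
  fixes k :: real
  assumes u: "H1 u u'" and w: "H1 w w'" and g: "H1 g g'" "hardy g" and s: "H1 s s'" "hardy s"
    and m: "hardy (\<lambda>x. cnj (cnj (u x) * w x - g x))"
    and weq: "AE x in lborel. w' x = \<i> * u x * (1 + g x) - \<i> * complex_of_real k * w x"
    and seq: "AE x in lborel. s x + cnj (s x) = u x * cnj (u x)"
      "AE x in lborel. s' x + cnj (s' x) = u' x * cnj (u x) + u x * cnj (u' x)"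
  shows "Re (- \<i> * ip u' (\<lambda>x. w' x + (w' x * cnj (g x) + w x * cnj (g' x))) + 2 * ip (\<lambda>x. u x * s' x) (\<lambda>x. w x + w x * cnj (g x))) = 0"
proof -
  note L = H1_L2[OF u] H1_L2[OF w] H1_L2[OF g(1)] H1_L2[OF s(1)]
  note uc = H1_cnj[OF u] and wc = H1_cnj[OF w] and gc = H1_cnj[OF g(1)] and sc = H1_cnj[OF s(1)]
  \<comment> \<open>The conjugate of the part of \<open>cnj u * w\<close> discarded by the
    projection, which is therefore Hardy.\<close>
  define mm where "mm = (\<lambda>x. u x * cnj (w x) - cnj (g x))"
  define mm' where "mm' = (\<lambda>x. u' x * cnj (w x) + u x * cnj (w' x) - cnj (g' x))"
  have mH: "H1 mm mm'" unfolding mm_def mm'_def by (intro H1_diff H1_mult u wc gc)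
  have mh: "hardy mm" using m by (simp add: mm_def mult.commute)
  have m'h: "hardy mm'" by (rule hardy_deriv[OF mh mH])
  have g'h: "hardy g'" and s'h: "hardy s'" using hardy_deriv g s by auto
  note mc = H1_cnj[OF mH]
  define p where "p = (\<lambda>x. u x + u x * g x)"
  define p' where "p' = (\<lambda>x. u' x + (u' x * g x + u x * g' x))"
  have pH: "H1 p p'" unfolding p_def p'_def by (intro H1_add H1_mult u g)
  note pc = H1_cnj[OF pH]
  let ?X = "\<lambda>x. - \<i> * (u' x * (cnj (w' x) + (cnj (w' x) * g x + cnj (w x) * g' x))) + 2 * (u x * s' x * (cnj (w x) + cnj (w x) * g x))"
  let ?N = "\<lambda>x. - (u' x * cnj (u x) + u x * cnj (u' x)) - s' x * g x - cnj (s' x) * cnj (g x) + complex_of_real k * (p' x * cnj (w x) + p x * cnj (w' x)) 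
     + complex_of_real k * (cnj (p' x) * w x + cnj (p x) * w' x)
     - (complex_of_real k)\<^sup>2 * (w' x * cnj (w x) + w x * cnj (w' x)) - 2 * complex_of_real k * (g' x * cnj (g x) + g x * cnj (g' x)) 
     - 2 * complex_of_real k * (mm x * g' x) - 2 * complex_of_real k * (cnj (mm x) * cnj (g' x)) - \<i> * (mm' x * g' x) + \<i> * (cnj (mm' x) * cnj (g' x))
     + s x * g' x + cnj (s x) * cnj (g' x) + (cnj (s' x) * g x + cnj (s x) * g' x) + (s' x * cnj (g x) + s x * cnj (g' x)) 
     + ((s' x + cnj (s' x)) * (g x * cnj (g x)) + (s x + cnj (s x)) * (g' x * cnj (g x) + g x * cnj (g' x)))
     + 2 * (s' x * mm x) + 2 * (cnj (s' x) * cnj (mm x)) + 2 * (s' x * (mm x * g x)) + 2 * (cnj (s' x) * (cnj (mm x) * cnj (g x)))"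
  have c2: "null_int (\<lambda>x. cnj (a x) * cnj (b x))" if "null_int (\<lambda>x. a x * b x)" for a b
    using null_int_cnj[OF that] by simp
  have mg: "hardy (\<lambda>x. mm x * g x)" by (rule hardy_mult_H1(1)[OF mh g(2,1)])
  have c3: "null_int (\<lambda>x. cnj (s' x) * (cnj (mm x) * cnj (g x)))"
    using null_int_cnj[OF null_int_hardy[OF s'h mg]] by simp
  have N: "null_int ?N"
    by (intro null_int_add null_int_diff null_int_cmult null_int_uminus c2 c3
        null_int_parts[OF u uc] null_int_parts[OF pH wc] null_int_parts[OF pc w] null_int_parts[OF w wc] null_int_parts[OF g(1) gc] 
        null_int_parts[OF sc g(1)] null_int_parts[OF s(1) gc] null_int_parts[OF H1_add[OF s(1) sc] H1_mult[OF g(1) gc]]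
        null_int_hardy[OF s'h g(2)] null_int_hardy[OF s'h mh] null_int_hardy[OF s'h mg] null_int_hardy[OF s(2) g'h]
        null_int_hardy[OF mh g'h] null_int_hardy[OF m'h g'h])
  have \<psi>': "L2 (\<lambda>x. w' x + (w' x * cnj (g x) + w x * cnj (g' x)))" by (rule H1_L2(2)[OF H1_add[OF w H1_mult[OF w gc]]])
  have \<psi>: "L2 (\<lambda>x. w x + w x * cnj (g x))" by (rule H1_L2(1)[OF H1_add[OF w H1_mult[OF w gc]]])
  have us: "L2 (\<lambda>x. u x * s' x)" by (rule L2_mult_H1(1)[OF u L(8)])
  have i: "integrable lborel (\<lambda>x. u' x * cnj (w' x + (w' x * cnj (g x) + w x * cnj (g' x))))"
     "integrable lborel (\<lambda>x. u x * s' x * cnj (w x + w x * cnj (g x)))"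
    by (rule L2_ip_integrable[OF L(2) \<psi>'], rule L2_ip_integrable[OF us \<psi>])
  let ?E = "- \<i> * ip u' (\<lambda>x. w' x + (w' x * cnj (g x) + w x * cnj (g' x))) + 2 * ip (\<lambda>x. u x * s' x) (\<lambda>x. w x + w x * cnj (g x))"
  have Xi: "integrable lborel ?X" using i by simp
  have XE: "integral\<^sup>L lborel ?X = ?E" using i unfolding ip_def by simp
  have "AE x in lborel. ?X x + cnj (?X x) = ?N x"
    using weq seq
  proof eventually_elim
    case (elim x)
    show ?case
    proof (rule Lax_identity_pointwise)
      show "w' x = \<i> * u x * (1 + g x) - \<i> * complex_of_real k * w x" by (rule elim(1))
      show "cnj (w' x) = - \<i> * cnj (u x) * (1 + cnj (g x)) + \<i> * complex_of_real k * cnj (w x)"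
        using elim(1) by simp
    qed (use elim in \<open>auto simp: mm_def mm'_def p_def p'_def\<close>)
  qed
  then have "(LINT x|lborel. ?X x + cnj (?X x)) = integral\<^sup>L lborel ?N"
    using N by (intro integral_cong_AE borel_measurable_integrable[OF Bochner_Integration.integrable_add[OF Xi integrable_cnj[OF Xi]]])
      (auto simp only: null_int_def dest: borel_measurable_integrable)
  also have "\<dots> = 0" using N by (simp add: null_int_def)
  also have "(LINT x|lborel. ?X x + cnj (?X x)) = ?E + cnj ?E"
    unfolding XE[symmetric] Bochner_Integration.integral_cnj[symmetric] by (rule Bochner_Integration.integral_add[OF Xi integrable_cnj[OF Xi]])
  finally have "?E + cnj ?E = 0" .
  then have "Re (?E + cnj ?E) = 0" by (simp only: zero_complex.sel)
  then show ?thesis unfolding plus_complex.sel cnj.sel by linarith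
qed

section \<open>The density and increments of the resolvent matrix element\<close>

definition rho_deriv :: "(real \<Rightarrow> complex) \<Rightarrow> (real \<Rightarrow> complex) \<Rightarrow> real \<Rightarrow> complex" where
  "rho_deriv u u' x = u' x * cnj (u x) + u x * cnj (u' x)"

lemma rho_H1: "H1 u u' \<Longrightarrow> H1 (\<lambda>x. u x * cnj (u x)) (rho_deriv u u')"
  unfolding rho_deriv_def[abs_def] by (intro H1_mult H1_cnj)

lemma rho_rep:
  assumes u: "H1 u u'"
  obtains s where "H1 s (Pr (rho_deriv u u'))" "hardy s" "AE x in lborel. Pr (\<lambda>x. u x * cnj (u x)) x = s x"
    "\<And>x. s x + cnj (s x) = u x * cnj (u x)"
    "AE x in lborel. Pr (rho_deriv u u') x + cnj (Pr (rho_deriv u u') x) = rho_deriv u u' x"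
proof -
  note r = rho_H1[OF u]
  note L = H1_L2[OF r]
  from Pr_H1[OF r] obtain s where s: "H1 s (Pr (rho_deriv u u'))" "AE x in lborel. Pr (\<lambda>x. u x * cnj (u x)) x = s x" "hardy s" .
  have "AE x in lborel. u x * cnj (u x) = Pr (\<lambda>x. u x * cnj (u x)) x + cnj (Pr (\<lambda>x. u x * cnj (u x)) x)"
    by (rule Pr_real_decomposition[OF L(1)]) (simp add: mult.commute)
  with s(2) have "AE x in lborel. s x + cnj (s x) = u x * cnj (u x)" by eventually_elim simp
  then have "(\<lambda>x. s x + cnj (s x)) = (\<lambda>x. u x * cnj (u x))"
    by (intro continuous_AE_eq H1_isCont[OF H1_add[OF s(1) H1_cnj[OF s(1)]]] H1_isCont[OF r])
  then have 1: "s x + cnj (s x) = u x * cnj (u x)" for x by (rule fun_cong)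
  have "AE x in lborel. rho_deriv u u' x = Pr (rho_deriv u u') x + cnj (Pr (rho_deriv u u') x)"
    by (rule Pr_real_decomposition[OF L(2)]) (simp add: rho_deriv_def mult.commute add.commute)
  then have "AE x in lborel. Pr (rho_deriv u u') x + cnj (Pr (rho_deriv u u') x) = rho_deriv u u' x" by eventually_elim simp
  with that s 1 show ?thesis by blast
qed

text \<open>The pairing of the right-hand side of the evolution equation with a test function, one
  derivative having been moved onto the test function; it therefore makes sense for every H1 test
  function.\<close>

definition flux :: "(real \<Rightarrow> complex) \<Rightarrow> (real \<Rightarrow> complex) \<Rightarrow> (real \<Rightarrow> complex) \<Rightarrow> (real \<Rightarrow> complex) \<Rightarrow> complex" where
  "flux u u' \<psi> \<psi>' = - \<i> * ip u' \<psi>' + 2 * ip (\<lambda>x. u x * Pr (rho_deriv u u') x) \<psi>"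

text \<open>In the variational formula for \<open>v\<close> the optimiser \<open>w\<close> belonging
  to \<open>u\<close> is a competitor. Besides a linear term this leaves a difference of the squares
  of \<open>Pr (cnj v * w)\<close> and \<open>Pr (cnj u * w)\<close>, and convexity bounds it below
  by its linearisation at \<open>u\<close>. The two linear terms combine to
  \<open>\<psi> = w + w * cnj g\<close>. The bound on \<open>\<psi>\<close> depends only on
  \<open>B\<close>, \<open>k\<close> and \<open>M\<close>, hence is uniform in time.\<close>

theorem resolvent_increment:
  assumes u: "H1 u u'" "hardy u" "\<And>x. cmod (u x) \<le> B" and k: "k \<ge> B\<^sup>2 + 1" and w: "Lres u k w w' u"
    and M: "nrm u \<le> M"
  obtains \<psi> \<psi>' where "H1 \<psi> \<psi>'" "Re (flux u u' \<psi> \<psi>') = 0" 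
    "nrm \<psi> \<le> M + (2 + k + B\<^sup>2) * M * (B * M)"
    "\<And>v v' z z'. H1 v v' \<Longrightarrow> (\<And>x. cmod (v x) \<le> B) \<Longrightarrow> Lres v k z z' v \<Longrightarrow>
       Re (ip v z) - Re (ip u w) \<ge> 2 * Re (ip (\<lambda>x. v x - u x) \<psi>)"
proof -
  have B0: "B \<ge> 0" using u(3)[of 0] norm_ge_zero order_trans by blast
  have k0: "k > B\<^sup>2" using k by simp
  have w': "H1 w w'" "hardy w" and weq: "AE x in lborel. - \<i> * w' x + complex_of_real k * w x - Tu u w x = u x" 
    using w by (auto simp: Lres_def)
  note L = H1_L2[OF u(1)] H1_L2[OF w'(1)]
  note cw = H1_mult[OF H1_cnj[OF u(1)] w'(1)]
  from Pr_H1[OF cw] obtain g g' where g: "H1 g g'" "AE x in lborel. Pr (\<lambda>x. cnj (u x) * w x) x = g x" "hardy g" by blast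
  note gL = H1_L2[OF g(1)] and cwL = H1_L2(1)[OF cw]
  from rho_rep[OF u(1)] obtain s where s: "H1 s (Pr (rho_deriv u u'))" "hardy s" 
    "\<And>x. s x + cnj (s x) = u x * cnj (u x)"
    "AE x in lborel. Pr (rho_deriv u u') x + cnj (Pr (rho_deriv u u') x) = rho_deriv u u' x" by blast
  define \<psi> where "\<psi> = (\<lambda>x. w x + w x * cnj (g x))"
  define \<psi>' where "\<psi>' = (\<lambda>x. w' x + (w' x * cnj (g x) + w x * cnj (g' x)))"
  have \<psi>H: "H1 \<psi> \<psi>'" unfolding \<psi>_def \<psi>'_def by (intro H1_add H1_mult H1_cnj w' g)
  have m: "hardy (\<lambda>x. cnj (cnj (u x) * w x - g x))"
  proof (rule hardy_cong_AE[OF Pr_remainder_antihardy[OF cwL]])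
    show "(\<lambda>x. cnj (cnj (u x) * w x - g x)) \<in> borel_measurable borel"
      by (rule L2_measurable[OF L2_cnj[OF L2_diff[OF cwL gL(1)]]])
    show "AE x in lborel. cnj (cnj (u x) * w x - Pr (\<lambda>x. cnj (u x) * w x) x) = cnj (cnj (u x) * w x - g x)"
      using g(2) by eventually_elim simp
  qed
  have weq': "AE x in lborel. w' x = \<i> * u x * (1 + g x) - \<i> * complex_of_real k * w x"
    using weq g(2)
  proof eventually_elim
    case (elim x)
    have "- \<i> * w' x = u x * (1 + g x) - complex_of_real k * w x" using elim by (simp add: Tu_def algebra_simps)
    then have "\<i> * (- \<i> * w' x) = \<i> * (u x * (1 + g x) - complex_of_real k * w x)" by (rule arg_cong)
    then show ?case by (simp add: algebra_simps)
  qed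
  have fl: "Re (flux u u' \<psi> \<psi>') = 0"
    unfolding flux_def \<psi>_def \<psi>'_def
  proof (rule Lax_identity[OF u(1) w'(1) g(1,3) s(1,2) m weq'])
    show "AE x in lborel. Pr (rho_deriv u u') x + cnj (Pr (rho_deriv u u') x) = u' x * cnj (u x) + u x * cnj (u' x)"
      using s(4)
    proof eventually_elim
      case (elim x) then show ?case by (rule trans[OF _ rho_deriv_def])
    qed
  qed (use s(3) in simp)
  have wb: "nrm w \<le> M"
  proof -
    \<comment> \<open>The extra 1 in \<open>k \<ge> B\<^sup>2 + 1\<close> makes the resolvent bound
      at most 1.\<close>
    have "1 * nrm w \<le> (k - B\<^sup>2) * nrm w" using k by (intro mult_right_mono) auto
    also have "\<dots> \<le> nrm u" by (rule Lres_bound[OF u(1,3) k0 w])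
    finally show ?thesis using M by simp
  qed
  have M0: "M \<ge> 0" using M nrm_nonneg order_trans by blast
  have gb: "nrm g \<le> B * M"
  proof -
    have "nrm g = nrm (Pr (\<lambda>x. cnj (u x) * w x))"
      by (rule nrm_cong_AE) (use g(2) L2_measurable[OF gL(1)] L2_measurable[OF Pr_L2[OF cwL]] in auto)
    also have "\<dots> \<le> B * nrm w" by (rule nrm_Pr_cnj_mult[OF u(1,3) L(3)])
    also have "\<dots> \<le> B * M" using wb B0 by (rule mult_left_mono)
    finally show ?thesis .
  qed
  have w'b: "nrm w' \<le> M + (k + B\<^sup>2) * M"
  proof -
    have T: "L2 (Tu u w)" by (rule Tu_L2[OF u(1) L(3)])
    have k00: "k \<ge> 0" using k0 zero_le_power2[of B] by linarith
    have "nrm w' = nrm (\<lambda>x. \<i> * ((u x + Tu u w x) - complex_of_real k * w x))"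
    proof (rule nrm_cong_AE)
      show "AE x in lborel. w' x = \<i> * ((u x + Tu u w x) - complex_of_real k * w x)"
        using weq
      proof eventually_elim
        case (elim x)
        have "- \<i> * w' x = (u x + Tu u w x) - complex_of_real k * w x" using elim by (simp add: algebra_simps)
        then have "\<i> * (- \<i> * w' x) = \<i> * ((u x + Tu u w x) - complex_of_real k * w x)" by (rule arg_cong)
        then show ?case by simp
      qed
      show "w' \<in> borel_measurable borel" using L by (auto dest: L2_measurable)
      show "(\<lambda>x. \<i> * ((u x + Tu u w x) - complex_of_real k * w x)) \<in> borel_measurable borel"
        using L T by (intro L2_measurable L2_cmult L2_diff L2_add)
    qed
    also have "\<dots> = nrm (\<lambda>x. (u x + Tu u w x) - complex_of_real k * w x)" by (simp only: nrm_scale) simp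
    also have "\<dots> \<le> nrm (\<lambda>x. u x + Tu u w x) + nrm (\<lambda>x. complex_of_real k * w x)" 
      by (rule nrm_triangle_diff) (use L T in auto)
    also have "nrm (\<lambda>x. complex_of_real k * w x) = k * nrm w" using k00 by (simp only: nrm_scale) simp
    also have "nrm (\<lambda>x. u x + Tu u w x) \<le> nrm u + nrm (Tu u w)" by (rule nrm_triangle[OF L(1) T])
    also have "nrm (Tu u w) \<le> B\<^sup>2 * nrm w" by (rule nrm_Tu[OF u(1,3) L(3)])
    finally have "nrm w' \<le> nrm u + (k + B\<^sup>2) * nrm w" by (simp add: distrib_right)
    also have "\<dots> \<le> M + (k + B\<^sup>2) * M" using M wb k00 by (intro add_mono mult_left_mono) auto
    finally show ?thesis .
  qed
  have \<psi>b: "nrm \<psi> \<le> M + (2 + k + B\<^sup>2) * M * (B * M)"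
  proof -
    have gc: "L2 (\<lambda>x. cnj (g x))" using gL by simp
    have "nrm \<psi> \<le> nrm w + nrm (\<lambda>x. w x * cnj (g x))" unfolding \<psi>_def
      by (rule nrm_triangle[OF L(3) L2_mult_H1(1)[OF w'(1) gc]])
    also have "nrm (\<lambda>x. w x * cnj (g x)) \<le> (nrm w + nrm w') * nrm (\<lambda>x. cnj (g x))"
      by (rule nrm_bounded_mult(1)[OF gc H1_measurable(1)[OF w'(1)] H1_sup_bound[OF w'(1)]])
    also have "\<dots> \<le> ((2 + k + B\<^sup>2) * M) * (B * M)"
    proof (rule mult_mono)
      \<comment> \<open>The sup norm of \<open>w\<close> is bounded by
        \<open>nrm w + nrm w'\<close>; one \<open>M\<close> comes from \<open>w\<close>, the
        remaining terms from solving the resolvent equation for \<open>w'\<close>.\<close>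
      show "nrm w + nrm w' \<le> (2 + k + B\<^sup>2) * M" using wb w'b by (simp add: algebra_simps)
      have "k \<ge> 0" using k0 zero_le_power2[of B] by linarith
      then show "0 \<le> (2 + k + B\<^sup>2) * M" using M0 by auto
    qed (use gb in auto)
    finally show ?thesis using wb by simp
  qed
  have inc: "Re (ip v z) - Re (ip u w) \<ge> 2 * Re (ip (\<lambda>x. v x - u x) \<psi>)"
    if v: "H1 v v'" "\<And>x. cmod (v x) \<le> B" and z: "Lres v k z z' v" for v v' z z'
  proof -
    note vL = H1_L2[OF v(1)]
    have kB: "k \<ge> B\<^sup>2" using k by simp
    let ?a = "\<lambda>y. cnj (v y) * w y" and ?b = "\<lambda>y. cnj (u y) * w y"
    have aL: "L2 ?a" and bL: "L2 ?b" using L2_cnj_mult_H1[OF v(1) L(3)] L2_cnj_mult_H1[OF u(1) L(3)] by auto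
    have "2 * Re (ip v w) - qform v k w w' \<le> Re (ip v z)" by (rule Lres_variational[OF v kB z w'])
    moreover have "qform u k w w' = Re (ip u w)" by (rule Lres_qform[OF u(1) w])
    moreover have "qform v k w w' = qform u k w w' + (nrm (Pr ?b))\<^sup>2 - (nrm (Pr ?a))\<^sup>2" by (simp add: qform_def)
    moreover have "2 * (A - uw) + a - b \<le> z - uw" if "2 * A - q2 \<le> z" "q1 = uw" "q2 = q1 + b - a" for A q1 q2 a b z uw :: real
      using that by simp
    ultimately have 1: "2 * (Re (ip v w) - Re (ip u w)) + (nrm (Pr ?a))\<^sup>2 - (nrm (Pr ?b))\<^sup>2 \<le> Re (ip v z) - Re (ip u w)" by blast
    have PL: "L2 (\<lambda>x. Pr ?a x - Pr ?b x)" using Pr_L2[OF aL] Pr_L2[OF bL] by auto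
    have "(nrm (\<lambda>x. (Pr ?a x - Pr ?b x) + Pr ?b x))\<^sup>2 = (nrm (\<lambda>x. Pr ?a x - Pr ?b x))\<^sup>2 + 2 * Re (ip (\<lambda>x. Pr ?a x - Pr ?b x) (Pr ?b)) + (nrm (Pr ?b))\<^sup>2"
      by (rule nrm_add_sq[OF PL Pr_L2[OF bL]])
    then have "(nrm (Pr ?a))\<^sup>2 = (nrm (\<lambda>x. Pr ?a x - Pr ?b x))\<^sup>2 + 2 * Re (ip (\<lambda>x. Pr ?a x - Pr ?b x) (Pr ?b)) + (nrm (Pr ?b))\<^sup>2"
      by simp
    \<comment> \<open>Discarding the square of the difference is the convexity step; it is also why
      only a lower bound results.\<close>
    then have 2: "(nrm (Pr ?a))\<^sup>2 - (nrm (Pr ?b))\<^sup>2 \<ge> 2 * Re (ip (\<lambda>x. Pr ?a x - Pr ?b x) (Pr ?b))"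
      using zero_le_power2[of "nrm (\<lambda>x. Pr ?a x - Pr ?b x)"] by linarith
    have "ip (\<lambda>x. Pr ?a x - Pr ?b x) (Pr ?b) = ip ?a (Pr ?b) - ip ?b (Pr ?b)"
      using ip_Pr[OF aL Pr_hardy[OF bL]] ip_Pr[OF bL Pr_hardy[OF bL]] Pr_L2[OF aL] Pr_L2[OF bL] by simp
    also have "\<dots> = ip (\<lambda>x. ?a x - ?b x) (Pr ?b)" using aL bL Pr_L2[OF bL] by simp
    also have "\<dots> = ip (\<lambda>x. ?a x - ?b x) g"
      by (rule ip_cong_AE) (use g(2) L2_measurable[OF gL(1)] L2_measurable[OF Pr_L2[OF bL]] L2_measurable[OF L2_diff[OF aL bL]] in auto)
    also have "\<dots> = cnj (ip (\<lambda>x. v x - u x) (\<lambda>x. w x * cnj (g x)))"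
      unfolding ip_def Bochner_Integration.integral_cnj[symmetric]
      by (intro Bochner_Integration.integral_cong) (auto simp: algebra_simps)
    finally have 3: "Re (ip (\<lambda>x. Pr ?a x - Pr ?b x) (Pr ?b)) = Re (ip (\<lambda>x. v x - u x) (\<lambda>x. w x * cnj (g x)))" by simp
    have wg: "L2 (\<lambda>x. w x * cnj (g x))" using L2_mult_H1(1)[OF w'(1)] gL by auto
    have "ip (\<lambda>x. v x - u x) \<psi> = ip v w - ip u w + ip (\<lambda>x. v x - u x) (\<lambda>x. w x * cnj (g x))"
      unfolding \<psi>_def using vL L wg by (subst ip_add_right) auto
    then have "Re (ip (\<lambda>x. v x - u x) \<psi>) = Re (ip v w) - Re (ip u w) + Re (ip (\<lambda>x. v x - u x) (\<lambda>x. w x * cnj (g x)))" by simp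
    moreover have "2 * q \<le> d" if "2 * D + a - b \<le> d" "2 * r \<le> a - b" "r = t" "q = D + t" for D a b d r t q :: real
      using that by simp
    ultimately show ?thesis using 1 2 3 by blast
  qed
  show ?thesis by (rule that[OF \<psi>H fl \<psi>b inc])
qed

subsection \<open>Conservation of mass and energy\<close>

text \<open>The last time up to which \<open>f\<close> stays above a line of slope
  \<open>- e\<close> from its initial value belongs to a closed set. If it lay before
  \<open>b\<close>, the hypothesis at that time would carry the inequality further.\<close>

lemma Dini_nondecreasing:
  fixes f :: "real \<Rightarrow> real"
  assumes ab: "a \<le> b" and c: "continuous_on {a..b} f"
    and D: "\<And>s e. s \<in> {a..b} \<Longrightarrow> e > 0 \<Longrightarrow> \<exists>d>0. \<forall>t\<in>{a..b}. \<bar>t - s\<bar> < d \<longrightarrow> f t - f s \<ge> - e * \<bar>t - s\<bar>"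
  shows "f a \<le> f b"
proof (rule field_le_epsilon)
  fix e' :: real assume e': "e' > 0"
  \<comment> \<open>The added 1 keeps the denominator positive when \<open>a = b\<close>.\<close>
  define e where "e = e' / (b - a + 1)"
  have e: "e > 0" "e * (b - a) \<le> e'" using e' ab by (auto simp: e_def field_simps)
  define S where "S = {t\<in>{a..b}. f t \<ge> f a - e * (t - a)}"
  have S: "a \<in> S" "S \<subseteq> {a..b}" using ab by (auto simp: S_def)
  have bdd: "bdd_above S" using S(2) by (meson bdd_above_Icc bdd_above_mono)
  have cl: "closed S"
  proof -
    have "closed ({a..b} \<inter> (\<lambda>t. f t + e * (t - a)) -` {f a..})"
      by (intro continuous_closed_preimage continuous_intros c)
    also have "{a..b} \<inter> (\<lambda>t. f t + e * (t - a)) -` {f a..} = S" by (auto simp: S_def algebra_simps)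
    finally show ?thesis .
  qed
  define m where "m = Sup S"
  have mS: "m \<in> S" unfolding m_def using closed_contains_Sup[OF _ bdd cl] S(1) by auto
  have "m = b"
  proof (rule ccontr)
    assume "m \<noteq> b"
    then have mb: "a \<le> m" "m < b" using mS S(2) by force+
    then have "m \<in> {a..b}" by simp
    from D[OF this e(1)] obtain d where d: "d > 0" "\<And>t. t \<in> {a..b} \<Longrightarrow> \<bar>t - m\<bar> < d \<Longrightarrow> f t - f m \<ge> - e * \<bar>t - m\<bar>" by blast
    define t where "t = min b (m + d / 2)"
    have t: "t \<in> {a..b}" "\<bar>t - m\<bar> < d" "t > m" using mb d(1) by (auto simp: t_def min_def)
    have "f t \<ge> f m - e * (t - m)" using d(2)[OF t(1,2)] t(3) by simp
    moreover have "f m \<ge> f a - e * (m - a)" using mS by (simp add: S_def)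
    ultimately have "f t \<ge> f a - e * (t - a)" by (simp add: algebra_simps)
    then have "t \<in> S" using t(1) by (simp add: S_def)
    then have "t \<le> m" unfolding m_def by (rule cSup_upper[OF _ bdd])
    then show False using t(3) by simp
  qed
  then have "f b \<ge> f a - e * (b - a)" using mS by (simp add: S_def)
  then show "f a \<le> f b + e'" using e(2) by simp
qed

text \<open>The hypothesis controls increments on both sides of \<open>s\<close> and so is invariant
  under time reversal; monotonicity of the reflected function gives the other inequality.\<close>

lemma Dini_constant:
  fixes f :: "real \<Rightarrow> real"
  assumes ab: "a \<le> b" and c: "continuous_on {a..b} f"
    and D: "\<And>s e. s \<in> {a..b} \<Longrightarrow> e > 0 \<Longrightarrow> \<exists>d>0. \<forall>t\<in>{a..b}. \<bar>t - s\<bar> < d \<longrightarrow> f t - f s \<ge> - e * \<bar>t - s\<bar>"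
  shows "f a = f b"
proof (rule antisym)
  show "f a \<le> f b" by (rule Dini_nondecreasing[OF assms])
  have "(\<lambda>t. f (a + b - t)) a \<le> (\<lambda>t. f (a + b - t)) b"
  proof (rule Dini_nondecreasing[OF ab])
    show "continuous_on {a..b} (\<lambda>t. f (a + b - t))"
      by (intro continuous_on_compose2[OF c] continuous_intros) auto
    fix s e :: real assume s: "s \<in> {a..b}" and e: "e > 0"
    then have "a + b - s \<in> {a..b}" by auto
    from D[OF this e] obtain d where d: "d > 0" "\<And>t. t \<in> {a..b} \<Longrightarrow> \<bar>t - (a + b - s)\<bar> < d \<Longrightarrow> f t - f (a + b - s) \<ge> - e * \<bar>t - (a + b - s)\<bar>" by blast
    show "\<exists>d>0. \<forall>t\<in>{a..b}. \<bar>t - s\<bar> < d \<longrightarrow> f (a + b - t) - f (a + b - s) \<ge> - e * \<bar>t - s\<bar>"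
    proof (intro exI[of _ d] conjI ballI impI d(1))
      fix t assume t: "t \<in> {a..b}" "\<bar>t - s\<bar> < d"
      have "\<bar>(a + b - t) - (a + b - s)\<bar> = \<bar>t - s\<bar>" by simp
      then show "f (a + b - t) - f (a + b - s) \<ge> - e * \<bar>t - s\<bar>"
        using d(2)[of "a + b - t"] t by auto
    qed
  qed
  then show "f b \<le> f a" by simp
qed

section \<open>The Lax operator applied to the solution, and the limit of large
  \<open>k\<close>\<close>

definition Lax :: "(real \<Rightarrow> complex) \<Rightarrow> (real \<Rightarrow> complex) \<Rightarrow> real \<Rightarrow> complex" where
  "Lax u u' x = - \<i> * u' x - Tu u u x"

lemma Lax_hardy: 
  assumes "H1 u u'" "hardy u" shows "hardy (Lax u u')"
  unfolding Lax_def[abs_def] 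
  by (rule hardy_diff[OF hardy_cmult[OF hardy_deriv[OF assms(2,1)]] Tu_hardy[OF assms H1_L2(1)[OF assms(1)]]])

lemma Lax_L2: 
  assumes "H1 u u'" shows "L2 (Lax u u')"
  unfolding Lax_def[abs_def] 
  by (rule L2_diff[OF L2_cmult[OF H1_L2(2)[OF assms]] Tu_L2[OF assms H1_L2(1)[OF assms]]])

text \<open>With \<open>L\<close> the Lax operator and \<open>w\<close> the resolvent of
  \<open>u\<close>, the function \<open>u - k * w\<close> is the resolvent of \<open>L u\<close>.
  Resolvent bounds and the variational formula thereby become available for
  \<open>L u\<close>.\<close>

lemma Lax_Lres:
  assumes u: "H1 u u'" "hardy u" and w: "Lres u k w w' u"
  shows "Lres u k (\<lambda>x. u x - complex_of_real k * w x) (\<lambda>x. u' x - complex_of_real k * w' x) (Lax u u')"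
  unfolding Lres_def
proof (intro conjI)
  have w': "H1 w w'" "hardy w" "AE x in lborel. - \<i> * w' x + complex_of_real k * w x - Tu u w x = u x" using w by (auto simp: Lres_def)
  note L = H1_L2[OF u(1)] H1_L2[OF w'(1)]
  show "H1 (\<lambda>x. u x - complex_of_real k * w x) (\<lambda>x. u' x - complex_of_real k * w' x)" by (intro H1_diff H1_cmult u w')
  show "hardy (\<lambda>x. u x - complex_of_real k * w x)" by (intro hardy_diff hardy_cmult u w')
  show "L2 (Lax u u')" by (rule Lax_L2[OF u(1)])
  have kw: "L2 (\<lambda>x. complex_of_real k * w x)" using L by auto
  show "AE x in lborel. - \<i> * (u' x - complex_of_real k * w' x) + complex_of_real k * (u x - complex_of_real k * w x) -
        Tu u (\<lambda>x. u x - complex_of_real k * w x) x = Lax u u' x"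
    using w'(3) Tu_diff[OF u(1) L(1) kw] Tu_cmult[OF u(1) L(3), of "complex_of_real k"]
  proof eventually_elim
    case (elim x)
    have "complex_of_real k * u x = complex_of_real k * (- \<i> * w' x + complex_of_real k * w x - Tu u w x)" using elim(1) by simp
    then have "complex_of_real k * u x - complex_of_real k * (- \<i> * w' x + complex_of_real k * w x) + complex_of_real k * Tu u w x = 0"
      by (simp add: algebra_simps)
    moreover have "Tu u (\<lambda>x. u x - complex_of_real k * w x) x = Tu u u x - complex_of_real k * Tu u w x"
      using elim(2,3) by simp
    moreover have "- \<i> * (a' - c * b') + c * (a - c * b) - (T - c * S) = - \<i> * a' - T" if "c * a - c * (- \<i> * b' + c * b) + c * S = 0" 
      for a a' b b' c S T :: complex using that by (simp add: algebra_simps)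
    ultimately show ?case unfolding Lax_def by simp
  qed
qed

text \<open>Symmetry of \<open>L\<close> moves it onto \<open>w\<close>, where the resolvent
  equation reads \<open>L w = u - k * w\<close>.\<close>

lemma Lax_matrix_element:
  assumes u: "H1 u u'" "hardy u" and w: "Lres u k w w' u"
  shows "Re (ip (Lax u u') w) = (nrm u)\<^sup>2 - k * Re (ip u w)"
proof -
  have w': "H1 w w'" using w by (auto simp: Lres_def)
  note L = H1_L2[OF u(1)] H1_L2[OF w']
  note T = Tu_L2[OF u(1) L(1)]
  have "ip (Lax u u') w = ip (\<lambda>x. - \<i> * u' x) w - ip (Tu u u) w"
    unfolding Lax_def[abs_def] by (rule ip_diff_left) (use L T in auto)
  also have "ip (Tu u u) w = ip (Pr (\<lambda>y. cnj (u y) * u y)) (Pr (\<lambda>y. cnj (u y) * w y))" by (rule ip_Tu[OF u(1) L(1,3)])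
  finally have "Re (ip (Lax u u') w) = Re (ip (\<lambda>x. - \<i> * u' x) w) - Re (ip (Pr (\<lambda>y. cnj (u y) * u y)) (Pr (\<lambda>y. cnj (u y) * w y)))" by simp
  moreover have "Re (ip (\<lambda>x. - \<i> * u' x) w) = Re (ip (\<lambda>x. - \<i> * w' x) u)"
    by (subst ip_D_symmetric[OF u(1) w']) (simp only: cnj.sel(1))
  moreover have "Re (ip (Pr (\<lambda>y. cnj (u y) * u y)) (Pr (\<lambda>y. cnj (u y) * w y))) = Re (ip (Pr (\<lambda>y. cnj (u y) * w y)) (Pr (\<lambda>y. cnj (u y) * u y)))"
    by (rule Re_ip_commute)
  moreover have "Re (ip u u) = Re (ip (\<lambda>x. - \<i> * w' x) u) + k * Re (ip w u) - Re (ip (Pr (\<lambda>y. cnj (u y) * w y)) (Pr (\<lambda>y. cnj (u y) * u y)))"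
    by (rule Lres_ip[OF u(1) w u(1)])
  moreover have "Re (ip w u) = Re (ip u w)" by (rule Re_ip_commute)
  ultimately show ?thesis by (simp add: Re_ip_self)
qed

text \<open>The large \<open>k\<close> expansion of the matrix element at \<open>u\<close>, read as
  an exact identity. The left side stays bounded in \<open>k\<close> and tends to the squared norm
  of \<open>Lax u u'\<close>, while the right side exhibits the coefficients of growing powers of
  \<open>k\<close>.\<close>

lemma Lax_resolvent_expansion:
  assumes u: "H1 u u'" "hardy u" and w: "Lres u k w w' u"
  shows "k * Re (ip (Lax u u') (\<lambda>x. u x - complex_of_real k * w x)) = k * Re (ip (Lax u u') u) - k\<^sup>2 * (nrm u)\<^sup>2 + k^3 * Re (ip u w)"
proof -
  have wL: "L2 w" using w by (auto simp: Lres_def)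
  have "ip (Lax u u') (\<lambda>x. u x - complex_of_real k * w x) = ip (Lax u u') u - complex_of_real k * ip (Lax u u') w"
    using Lax_L2[OF u(1)] u wL by simp
  then have "Re (ip (Lax u u') (\<lambda>x. u x - complex_of_real k * w x)) = Re (ip (Lax u u') u) - k * Re (ip (Lax u u') w)" by simp
  then show ?thesis unfolding Lax_matrix_element[OF assms] 
    by (simp only:) (simp add: algebra_simps power2_eq_square power3_eq_cube)
qed

lemma Lax_resolvent_upper:
  assumes u: "H1 u u'" "hardy u" "\<And>x. cmod (u x) \<le> B" and k: "k > B\<^sup>2" and w: "Lres u k w w' u"
  shows "k * Re (ip (Lax u u') (\<lambda>x. u x - complex_of_real k * w x)) \<le> k / (k - B\<^sup>2) * (nrm (Lax u u'))\<^sup>2"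
proof -
  let ?y = "\<lambda>x. u x - complex_of_real k * w x" and ?q = "Lax u u'"
  note y = Lax_Lres[OF u(1,2) w]
  have yL: "L2 ?y" using y by (auto simp: Lres_def)
  have k0: "k > 0" using k zero_le_power2[of B] by linarith
  have "Re (ip ?q ?y) \<le> cmod (ip ?q ?y)" by (rule complex_Re_le_cmod)
  also have "\<dots> \<le> nrm ?q * nrm ?y" by (rule cauchy_schwarz[OF Lax_L2[OF u(1)] yL])
  also have "\<dots> \<le> nrm ?q * (nrm ?q / (k - B\<^sup>2))"
    using Lres_bound[OF u(1,3) k y] k by (intro mult_left_mono) (auto simp: field_simps)
  finally have "k * Re (ip ?q ?y) \<le> k * (nrm ?q * (nrm ?q / (k - B\<^sup>2)))" using k0 by (intro mult_left_mono) auto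
  then show ?thesis by (simp add: power2_eq_square)
qed

lemma Lax_resolvent_lower:
  assumes u: "H1 u u'" "hardy u" "\<And>x. cmod (u x) \<le> B" and k: "k > B\<^sup>2" and w: "Lres u k w w' u" and h: "H1 h h'" "hardy h"
  shows "2 * Re (ip (Lax u u') h) - (nrm h)\<^sup>2 - nrm h' * nrm h / k \<le> k * Re (ip (Lax u u') (\<lambda>x. u x - complex_of_real k * w x))"
proof -
  let ?y = "\<lambda>x. u x - complex_of_real k * w x" and ?q = "Lax u u'"
  note y = Lax_Lres[OF u(1,2) w]
  have k0: "k > 0" using k zero_le_power2[of B] by linarith
  \<comment> \<open>For large \<open>k\<close> the resolvent acts like division by \<open>k\<close>,
    so \<open>h / k\<close> is the natural trial function.\<close>
  let ?v = "\<lambda>x. complex_of_real (1 / k) * h x" and ?v' = "\<lambda>x. complex_of_real (1 / k) * h' x"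
  have v: "H1 ?v ?v'" "hardy ?v" by (rule H1_cmult[OF h(1)], rule hardy_cmult[OF h(2)])
  have n: "nrm ?v = nrm h / k" "nrm ?v' = nrm h' / k" using k0 by (simp_all only: nrm_scale norm_of_real) simp_all
  have "2 * Re (ip ?q ?v) - qform u k ?v ?v' \<le> Re (ip ?q ?y)"
    by (rule Lres_variational[OF u(1,3) _ y v]) (use k in simp)
  moreover have "qform u k ?v ?v' \<le> nrm ?v' * nrm ?v + k * (nrm ?v)\<^sup>2" by (rule qform_upper[OF v(1)])
  moreover have "Re (ip ?q ?v) = Re (ip ?q h) / k" by (simp only: ip_cmult_right) simp
  ultimately have "2 * (Re (ip ?q h) / k) - (nrm h' / k * (nrm h / k) + k * (nrm h / k)\<^sup>2) \<le> Re (ip ?q ?y)"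
    unfolding n by linarith
  then have "k * (2 * (Re (ip ?q h) / k) - (nrm h' / k * (nrm h / k) + k * (nrm h / k)\<^sup>2)) \<le> k * Re (ip ?q ?y)"
    using k0 by (intro mult_left_mono) auto
  moreover have "k * (2 * (Re (ip ?q h) / k) - (nrm h' / k * (nrm h / k) + k * (nrm h / k)\<^sup>2)) = 2 * Re (ip ?q h) - (nrm h)\<^sup>2 - nrm h' * nrm h / k"
    using k0 by (simp add: field_simps power2_eq_square)
  ultimately show ?thesis by simp
qed

text \<open>Truncation in frequency preserves the half-line support and makes the inverse transform
  an H1 function.\<close>

lemma hardy_H1_dense:
  assumes "hardy q"
  obtains h h' where "\<And>n::nat. H1 (h n) (h' n)" "\<And>n. hardy (h n)" "(\<lambda>n. nrm (\<lambda>x. h n x - q x)) \<longlonglongrightarrow> 0"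
proof -
  have qL: "L2 q" using assms by simp
  note F = FT[OF qL] and FL = FT_L2[OF qL]
  have mb: "L2 (\<lambda>\<xi>. \<i> * complex_of_real \<xi> * trunc n (FT q) \<xi>)" for n
  proof -
    have "L2 (\<lambda>\<xi>. (\<i> * complex_of_real \<xi> * indicator {-real n..real n} \<xi>) * FT q \<xi>)"
    proof (rule L2_bounded_mult(1)[OF FL])
      show "cmod (\<i> * complex_of_real \<xi> * indicator {-real n..real n} \<xi>) \<le> real n" for \<xi>
        by (auto simp: indicator_def norm_mult)
    qed measurable
    then show ?thesis by (simp add: trunc_def mult.assoc)
  qed
  have "\<exists>h h'. H1 h h' \<and> fourier_L2 h (trunc n (FT q))" for n
  proof -
    note I = Fourier_inversion[OF trunc(2)[OF FL, of n]]
    from H1_rep_of_transform[OF I mb Fourier_inversion[OF mb]] obtain h where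
      h: "H1 h (\<lambda>x. FT (\<lambda>\<xi>. \<i> * complex_of_real \<xi> * trunc n (FT q) \<xi>) (- x))" "AE x in lborel. FT (trunc n (FT q)) (- x) = h x" .
    have "fourier_L2 h (trunc n (FT q))"
      by (rule fourier_L2_cong_AE[OF I H1_measurable(1)[OF h(1)] h(2)]) (use L2_measurable[OF trunc(2)[OF FL]] in auto)
    with h show ?thesis by blast
  qed
  then obtain h h' where h: "\<And>n. H1 (h n) (h' n)" "\<And>n. fourier_L2 (h n) (trunc n (FT q))" by metis
  have "hardy (h n)" for n
  proof (rule hardyI[OF h(2)])
    show "AE \<xi> in lborel. \<xi> < 0 \<longrightarrow> trunc n (FT q) \<xi> = 0"
      using hardy_FT[OF assms] by eventually_elim (auto simp: trunc_def)
  qed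
  moreover have "nrm (\<lambda>x. h n x - q x) = nrm (\<lambda>\<xi>. trunc n (FT q) \<xi> - FT q \<xi>)" for n
    using fourier_L2_nrm[OF fourier_L2_diff[OF h(2) F]] by simp
  ultimately show ?thesis by (intro that[of h h']) (use h(1) trunc_tendsto[OF FL] in simp_all)
qed

lemma affine_bounded_zero:
  fixes p m C K :: real
  assumes "\<And>k. k \<ge> K \<Longrightarrow> \<bar>k * p - k\<^sup>2 * m\<bar> \<le> C" shows "p = 0" "m = 0"
proof -
  have ev: "eventually (\<lambda>n. real n \<ge> max K 1) sequentially"
    using filterlim_real_sequentially unfolding filterlim_at_top by blast
  have l: "(\<lambda>n. c / real n) \<longlonglongrightarrow> 0" for c
    using tendsto_divide_0[OF tendsto_const filterlim_at_top_imp_at_infinity[OF filterlim_real_sequentially]] .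
  have "(\<lambda>n. m) \<longlonglongrightarrow> 0"
  proof (rule Lim_null_comparison)
    show "(\<lambda>n. (\<bar>C\<bar> + \<bar>p\<bar>) / real n) \<longlonglongrightarrow> 0" by (rule l)
    show "\<forall>\<^sub>F n in sequentially. norm m \<le> (\<bar>C\<bar> + \<bar>p\<bar>) / real n"
      using ev
    proof eventually_elim
      case (elim n)
      define k where "k = real n"
      have k: "k \<ge> K" "k \<ge> 1" using elim by (auto simp: k_def)
      have "k * \<bar>m\<bar> * k = \<bar>k\<^sup>2 * m\<bar>" using k by (simp add: abs_mult power2_eq_square)
      also have "\<dots> \<le> C + \<bar>k * p\<bar>" using assms[OF k(1)] by linarith
      also have "\<dots> = C + k * \<bar>p\<bar>" using k by (simp add: abs_mult)
      also have "\<dots> \<le> k * (\<bar>C\<bar> + \<bar>p\<bar>)"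
      proof -
        have "C \<le> 1 * \<bar>C\<bar>" by simp
        also have "\<dots> \<le> k * \<bar>C\<bar>" using k by (intro mult_right_mono) auto
        finally show ?thesis by (simp add: distrib_left)
      qed
      finally have "k * (\<bar>m\<bar> * k) \<le> k * (\<bar>C\<bar> + \<bar>p\<bar>)" by (simp add: mult.assoc)
      then have "\<bar>m\<bar> * k \<le> \<bar>C\<bar> + \<bar>p\<bar>" using k by simp
      then show ?case using k by (simp add: k_def field_simps)
    qed
  qed
  then show m: "m = 0" using LIMSEQ_unique tendsto_const by blast
  have "(\<lambda>n. p) \<longlonglongrightarrow> 0"
  proof (rule Lim_null_comparison)
    show "(\<lambda>n. C / real n) \<longlonglongrightarrow> 0" by (rule l)
    show "\<forall>\<^sub>F n in sequentially. norm p \<le> C / real n"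
      using ev
    proof eventually_elim
      case (elim n)
      then have "real n * \<bar>p\<bar> \<le> C" using assms[of "real n"] m by (simp add: abs_mult)
      then show ?case using elim by (simp add: field_simps)
    qed
  qed
  then show "p = 0" using LIMSEQ_unique tendsto_const by blast
qed

text \<open>\<open>X k\<close> and \<open>Y k\<close> are \<open>k\<close> times the resolvent
  matrix elements at \<open>Lax u u'\<close> and \<open>Lax v v'\<close>, and are bounded in
  \<open>k\<close>. Since the matrix elements at \<open>u\<close> and \<open>v\<close> agree, the
  expansion leaves a polynomial in \<open>k\<close> for their difference; boundedness forces it to
  vanish, and its quadratic coefficient is the mass difference. With \<open>X k = Y k\<close>, the
  lower bound for one and the upper bound for the other give the inequality of norms in the
  limit.\<close>

theorem energy_le_of_resolvent_eq:
  assumes u: "H1 u u'" "hardy u" "\<And>x. cmod (u x) \<le> B" and v: "H1 v v'" "hardy v" "\<And>x. cmod (v x) \<le> B"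
    and eq: "\<And>k w w' z z'. k \<ge> 2 * B\<^sup>2 + 1 \<Longrightarrow> Lres u k w w' u \<Longrightarrow> Lres v k z z' v \<Longrightarrow> Re (ip u w) = Re (ip v z)"
  shows "nrm u = nrm v" "nrm (Lax u u') \<le> nrm (Lax v v')"
proof -
  have B2: "B\<^sup>2 \<ge> 0" by simp
  \<comment> \<open>Above this level the resolvents exist, and \<open>k / (k - B\<^sup>2)\<close> is
    at most 2, which makes \<open>X\<close> and \<open>Y\<close> uniformly bounded.\<close>
  define K where "K = 2 * B\<^sup>2 + 1"
  have K: "k > B\<^sup>2" "k \<ge> 2 * B\<^sup>2" "k > 0" if "k \<ge> K" for k using that B2 unfolding K_def by linarith+
  have "\<exists>w w'. Lres u k w w' u" if "k \<ge> K" for k using Lres_exists[OF u K(2,3)[OF that] u(2)] by blast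
  then obtain w w' where w: "\<And>k. k \<ge> K \<Longrightarrow> Lres u k (w k) (w' k) u" by metis
  have "\<exists>z z'. Lres v k z z' v" if "k \<ge> K" for k using Lres_exists[OF v K(2,3)[OF that] v(2)] by blast
  then obtain z z' where z: "\<And>k. k \<ge> K \<Longrightarrow> Lres v k (z k) (z' k) v" by metis
  define X where "X k = k * Re (ip (Lax u u') (\<lambda>x. u x - complex_of_real k * w k x))" for k
  define Y where "Y k = k * Re (ip (Lax v v') (\<lambda>x. v x - complex_of_real k * z k x))" for k
  \<comment> \<open>The zero trial function shows that \<open>X\<close> and \<open>Y\<close> are
    nonnegative.\<close>
  have z0: "H1 (\<lambda>x. 0) (\<lambda>x. 0)" "hardy (\<lambda>x. 0)" using hardy_cmult[OF u(2), of 0] by (auto simp: H1_def)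
  have ip0: "ip f (\<lambda>x. 0) = 0" for f by (simp add: ip_def)
  have X0: "X k \<ge> 0" and Y0: "Y k \<ge> 0" if "k \<ge> K" for k
    using Lax_resolvent_lower[OF u K(1)[OF that] w[OF that] z0] Lax_resolvent_lower[OF v K(1)[OF that] z[OF that] z0] 
    by (auto simp: X_def Y_def ip0)
  have kb: "k / (k - B\<^sup>2) \<le> 2" if "k \<ge> K" for k using K[OF that] by (simp add: field_simps)
  have X1: "X k \<le> 2 * (nrm (Lax u u'))\<^sup>2" and Y1: "Y k \<le> 2 * (nrm (Lax v v'))\<^sup>2" if "k \<ge> K" for k
    using Lax_resolvent_upper[OF u K(1)[OF that] w[OF that]] Lax_resolvent_upper[OF v K(1)[OF that] z[OF that]]
      mult_right_mono[OF kb[OF that], of "(nrm (Lax u u'))\<^sup>2"] mult_right_mono[OF kb[OF that], of "(nrm (Lax v v'))\<^sup>2"]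
    unfolding X_def Y_def by (auto intro: order_trans)
  define p where "p = Re (ip (Lax u u') u) - Re (ip (Lax v v') v)"
  define m where "m = (nrm u)\<^sup>2 - (nrm v)\<^sup>2"
  have XY: "X k - Y k = k * p - k\<^sup>2 * m" if "k \<ge> K" for k
    unfolding X_def Y_def Lax_resolvent_expansion[OF u(1,2) w[OF that]] Lax_resolvent_expansion[OF v(1,2) z[OF that]]
    using eq[OF that[unfolded K_def] w[OF that] z[OF that]] by (simp add: p_def m_def algebra_simps)
  have pm: "p = 0" "m = 0"
  proof -
    have "\<bar>k * p - k\<^sup>2 * m\<bar> \<le> 2 * (nrm (Lax u u'))\<^sup>2 + 2 * (nrm (Lax v v'))\<^sup>2" if "k \<ge> K" for k
      using XY[OF that] X0[OF that] X1[OF that] Y0[OF that] Y1[OF that] by linarith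
    from affine_bounded_zero[OF this] show "p = 0" "m = 0" by auto
  qed
  then have "(nrm u)\<^sup>2 = (nrm v)\<^sup>2" by (simp add: m_def)
  then show "nrm u = nrm v" by (rule power2_eq_imp_eq) auto
  have XY: "X k = Y k" if "k \<ge> K" for k using XY[OF that] pm by simp
  let ?q = "Lax u u'"
  \<comment> \<open>An H1 trial function is needed for the term with \<open>h'\<close> to disappear
    in the limit. Density of such functions then allows \<open>h\<close> to approach
    \<open>Lax u u'\<close> itself, where the left side becomes its squared norm.\<close>
  have key: "2 * Re (ip ?q h) - (nrm h)\<^sup>2 \<le> (nrm (Lax v v'))\<^sup>2" if h: "H1 h h'" "hardy h" for h h'
  proof (rule LIMSEQ_le)
    have inf: "filterlim (\<lambda>n. K + real n) at_top sequentially"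
      by (rule filterlim_tendsto_add_at_top[OF tendsto_const filterlim_real_sequentially])
    have "(\<lambda>n. nrm h' * nrm h / (K + real n)) \<longlonglongrightarrow> 0"
      by (rule tendsto_divide_0[OF tendsto_const filterlim_at_top_imp_at_infinity[OF inf]])
    from tendsto_diff[OF tendsto_const this]
    show "(\<lambda>n. 2 * Re (ip ?q h) - (nrm h)\<^sup>2 - nrm h' * nrm h / (K + real n)) \<longlonglongrightarrow> 2 * Re (ip ?q h) - (nrm h)\<^sup>2" by simp
    have "(\<lambda>n. 1 + B\<^sup>2 / (K - B\<^sup>2 + real n)) \<longlonglongrightarrow> 1 + 0"
      by (intro tendsto_add tendsto_const tendsto_divide_0[OF tendsto_const filterlim_at_top_imp_at_infinity] 
            filterlim_tendsto_add_at_top[OF tendsto_const filterlim_real_sequentially])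
    moreover have "1 + B\<^sup>2 / (K - B\<^sup>2 + real n) = (K + real n) / (K + real n - B\<^sup>2)" for n
      using K(1)[of "K + real n"] by (simp add: field_simps)
    ultimately have "(\<lambda>n. (K + real n) / (K + real n - B\<^sup>2)) \<longlonglongrightarrow> 1" by simp
    from tendsto_mult[OF this tendsto_const]
    show "(\<lambda>n. (K + real n) / (K + real n - B\<^sup>2) * (nrm (Lax v v'))\<^sup>2) \<longlonglongrightarrow> (nrm (Lax v v'))\<^sup>2" by simp
    have "2 * Re (ip ?q h) - (nrm h)\<^sup>2 - nrm h' * nrm h / k \<le> k / (k - B\<^sup>2) * (nrm (Lax v v'))\<^sup>2" if k: "k \<ge> K" for k
    proof -
      have "2 * Re (ip ?q h) - (nrm h)\<^sup>2 - nrm h' * nrm h / k \<le> X k"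
        unfolding X_def by (rule Lax_resolvent_lower[OF u K(1)[OF k] w[OF k] h])
      also have "\<dots> = Y k" by (rule XY[OF k])
      also have "\<dots> \<le> k / (k - B\<^sup>2) * (nrm (Lax v v'))\<^sup>2"
        unfolding Y_def by (rule Lax_resolvent_upper[OF v K(1)[OF k] z[OF k]])
      finally show ?thesis .
    qed
    then show "\<exists>N. \<forall>n\<ge>N. 2 * Re (ip ?q h) - (nrm h)\<^sup>2 - nrm h' * nrm h / (K + real n) \<le> (K + real n) / (K + real n - B\<^sup>2) * (nrm (Lax v v'))\<^sup>2"
      by simp
  qed
  have qL: "L2 ?q" by (rule Lax_L2[OF u(1)])
  from hardy_H1_dense[OF Lax_hardy[OF u(1,2)]] obtain h h' where h: "\<And>n::nat. H1 (h n) (h' n)" "\<And>n. hardy (h n)" "(\<lambda>n. nrm (\<lambda>x. h n x - ?q x)) \<longlonglongrightarrow> 0" by blast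
  have hL: "L2 (h n)" for n using h(2) by simp
  have "(nrm ?q)\<^sup>2 \<le> (nrm (Lax v v'))\<^sup>2"
  proof (rule LIMSEQ_le_const2)
    have z: "(\<lambda>n. nrm (\<lambda>x. ?q x - ?q x)) \<longlonglongrightarrow> 0" by simp
    have "(\<lambda>n. 2 * Re (ip ?q (h n)) - (nrm (h n))\<^sup>2) \<longlonglongrightarrow> 2 * Re (ip ?q ?q) - (nrm ?q)\<^sup>2"
      by (intro tendsto_diff tendsto_mult tendsto_const tendsto_Re tendsto_power ip_tendsto nrm_tendsto qL hL h(3) z)
    then show "(\<lambda>n. 2 * Re (ip ?q (h n)) - (nrm (h n))\<^sup>2) \<longlonglongrightarrow> (nrm ?q)\<^sup>2" by (simp add: Re_ip_self)
    show "\<exists>N. \<forall>n\<ge>N. 2 * Re (ip ?q (h n)) - (nrm (h n))\<^sup>2 \<le> (nrm (Lax v v'))\<^sup>2" using key[OF h(1,2)] by blast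
  qed
  then show "nrm ?q \<le> nrm (Lax v v')" by (rule power2_le_imp_le) simp
qed

text \<open>A solution in terms of H1 representatives, with the weak identity extended from test
  functions to all of H1. The extension matters because the function \<open>\<psi>\<close> of
  \<open>resolvent_increment\<close> is merely in H1.\<close>

definition flow :: "real set \<Rightarrow> (real \<Rightarrow> real \<Rightarrow> complex) \<Rightarrow> (real \<Rightarrow> real \<Rightarrow> complex) \<Rightarrow> bool" where
  "flow I U U' \<longleftrightarrow> is_interval I \<and> open I \<and> 0 \<in> I \<and> (\<forall>t\<in>I. H1 (U t) (U' t) \<and> hardy (U t)) \<and>
     (\<forall>t\<in>I. ((\<lambda>s. nrm (\<lambda>x. U s x - U t x)) \<longlongrightarrow> 0) (at t within I) \<and> ((\<lambda>s. nrm (\<lambda>x. U' s x - U' t x)) \<longlongrightarrow> 0) (at t within I)) \<and>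
     (\<forall>\<phi> \<phi>'. H1 \<phi> \<phi>' \<longrightarrow> (\<forall>t\<in>I. ip (U t) \<phi> - ip (U 0) \<phi> = (LBINT s=0..t. flux (U s) (U' s) \<phi> \<phi>')))"

section \<open>Regularity in time of the flux\<close>

lemma nrm_H1_mult:
  assumes "H1 f f'" "L2 h" shows "nrm (\<lambda>x. f x * h x) \<le> (nrm f + nrm f') * nrm h" "nrm (\<lambda>x. h x * f x) \<le> (nrm f + nrm f') * nrm h"
  using nrm_bounded_mult[OF assms(2) H1_measurable(1)[OF assms(1)] H1_sup_bound[OF assms(1)]] by auto

lemma nrm_rho_deriv_le:
  assumes u: "H1 u u'" and v: "L2 v'"
  shows "nrm (\<lambda>x. v' x * cnj (u x) + u x * cnj (v' x)) \<le> 2 * (nrm u + nrm u') * nrm v'"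
proof -
  note uc = H1_cnj[OF u] and vc = L2_cnj[OF v]
  have "nrm (\<lambda>x. v' x * cnj (u x) + u x * cnj (v' x)) \<le> nrm (\<lambda>x. v' x * cnj (u x)) + nrm (\<lambda>x. u x * cnj (v' x))"
    by (rule nrm_triangle[OF L2_mult_H1(2)[OF uc v] L2_mult_H1(1)[OF u vc]])
  also have "\<dots> \<le> (nrm u + nrm u') * nrm v' + (nrm u + nrm u') * nrm v'"
    by (rule add_mono[OF nrm_H1_mult(2)[OF uc v, unfolded nrm_cnj] nrm_H1_mult(1)[OF u vc, unfolded nrm_cnj]])
  finally show ?thesis by (simp add: algebra_simps)
qed

lemma rho_deriv_L2: "H1 u u' \<Longrightarrow> L2 (rho_deriv u u')"
  using H1_L2(2)[OF rho_H1] .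

lemma nrm_rho_deriv: "H1 u u' \<Longrightarrow> nrm (rho_deriv u u') \<le> 2 * (nrm u + nrm u') * nrm u'"
  using nrm_rho_deriv_le[of u u' u'] H1_L2(2) unfolding rho_deriv_def[abs_def] by blast

lemma nrm_rho_deriv_diff:
  assumes u: "H1 u u'" and v: "H1 v v'"
  shows "nrm (\<lambda>x. rho_deriv u u' x - rho_deriv v v' x) \<le> 2 * (nrm u + nrm u' + (nrm v + nrm v')) * (nrm (\<lambda>x. u x - v x) + nrm (\<lambda>x. u' x - v' x))"
proof -
  let ?a = "nrm u + nrm u'" and ?b = "nrm v + nrm v'" and ?d = "nrm (\<lambda>x. u x - v x) + nrm (\<lambda>x. u' x - v' x)"
  let ?f = "\<lambda>x. (u' x - v' x) * cnj (u x) + u x * cnj (u' x - v' x)"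
  let ?g = "\<lambda>x. v' x * cnj (u x - v x) + (u x - v x) * cnj (v' x)"
  note L = H1_L2[OF u] H1_L2[OF v]
  note duv = H1_diff[OF u v]
  have dL: "L2 (\<lambda>x. u' x - v' x)" using L by auto
  have fL: "L2 ?f" by (intro L2_add L2_mult_H1(2)[OF H1_cnj[OF u]] L2_mult_H1(1)[OF u] L2_cnj dL)
  have gL: "L2 ?g" by (intro L2_add L2_mult_H1(2)[OF H1_cnj[OF duv]] L2_mult_H1(1)[OF duv] L2_cnj L)
  have "(\<lambda>x. rho_deriv u u' x - rho_deriv v v' x) = (\<lambda>x. ?f x + ?g x)"
    by (auto simp: rho_deriv_def algebra_simps)
  then have "nrm (\<lambda>x. rho_deriv u u' x - rho_deriv v v' x) \<le> nrm ?f + nrm ?g" using nrm_triangle[OF fL gL] by simp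
  also have "nrm ?f \<le> 2 * ?a * nrm (\<lambda>x. u' x - v' x)" by (rule nrm_rho_deriv_le[OF u dL])
  also have "\<dots> \<le> 2 * ?a * ?d" by (intro mult_left_mono) auto
  also have "nrm ?g \<le> 2 * ?d * nrm v'" by (rule nrm_rho_deriv_le[OF duv L(4)])
  also have "\<dots> \<le> 2 * ?d * ?b" by (intro mult_left_mono) auto
  finally show ?thesis by (simp add: algebra_simps)
qed

definition nonlin :: "(real \<Rightarrow> complex) \<Rightarrow> (real \<Rightarrow> complex) \<Rightarrow> real \<Rightarrow> complex" where
  "nonlin u u' x = u x * Pr (rho_deriv u u') x"

lemma nonlin_L2: "H1 u u' \<Longrightarrow> L2 (nonlin u u')"
  unfolding nonlin_def[abs_def] using L2_mult_H1(1) Pr_L2[OF rho_deriv_L2] by blast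

lemma flux_nonlin: "flux u u' \<psi> \<psi>' = - \<i> * ip u' \<psi>' + 2 * ip (nonlin u u') \<psi>"
  by (simp add: flux_def nonlin_def[abs_def])

lemma nrm_nonlin_diff:
  assumes u: "H1 u u'" and v: "H1 v v'"
  defines "a \<equiv> nrm u + nrm u'" and "b \<equiv> nrm v + nrm v'" and "d \<equiv> nrm (\<lambda>x. u x - v x) + nrm (\<lambda>x. u' x - v' x)"
  shows "nrm (\<lambda>x. nonlin u u' x - nonlin v v' x) \<le> d * (2 * a * a) + b * (2 * (a + b) * d)"
proof -
  note R = rho_deriv_L2[OF u] rho_deriv_L2[OF v]
  note PR = Pr_L2[OF R(1)] Pr_L2[OF R(2)]
  note duv = H1_diff[OF u v]
  have pos: "a \<ge> 0" "b \<ge> 0" "d \<ge> 0" by (auto simp: a_def b_def d_def)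
  have PD: "L2 (\<lambda>x. Pr (rho_deriv u u') x - Pr (rho_deriv v v') x)" by (intro L2_diff PR)
  have 1: "nrm (Pr (rho_deriv u u')) \<le> 2 * a * a"
  proof -
    have "nrm (Pr (rho_deriv u u')) \<le> 2 * a * nrm u'" using nrm_Pr[OF R(1)] nrm_rho_deriv[OF u] by (simp add: a_def)
    also have "\<dots> \<le> 2 * a * a" by (intro mult_left_mono) (auto simp: a_def)
    finally show ?thesis .
  qed
  have 2: "nrm (\<lambda>x. Pr (rho_deriv u u') x - Pr (rho_deriv v v') x) \<le> 2 * (a + b) * d"
  proof -
    have "nrm (\<lambda>x. Pr (rho_deriv u u') x - Pr (rho_deriv v v') x) = nrm (Pr (\<lambda>x. rho_deriv u u' x - rho_deriv v v' x))"
    proof (rule nrm_cong_AE[symmetric])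
      show "AE x in lborel. Pr (\<lambda>x. rho_deriv u u' x - rho_deriv v v' x) x = Pr (rho_deriv u u') x - Pr (rho_deriv v v') x" by (rule Pr_diff[OF R])
    qed (use L2_measurable[OF PD] L2_measurable[OF Pr_L2[OF L2_diff[OF R]]] in auto)
    also have "\<dots> \<le> nrm (\<lambda>x. rho_deriv u u' x - rho_deriv v v' x)" by (rule nrm_Pr[OF L2_diff[OF R]])
    also have "\<dots> \<le> 2 * (a + b) * d" unfolding a_def b_def d_def by (rule nrm_rho_deriv_diff[OF u v])
    finally show ?thesis .
  qed
  have "(\<lambda>x. nonlin u u' x - nonlin v v' x) = (\<lambda>x. (u x - v x) * Pr (rho_deriv u u') x + v x * (Pr (rho_deriv u u') x - Pr (rho_deriv v v') x))"
    by (auto simp: nonlin_def algebra_simps)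
  then have "nrm (\<lambda>x. nonlin u u' x - nonlin v v' x) \<le> nrm (\<lambda>x. (u x - v x) * Pr (rho_deriv u u') x) + nrm (\<lambda>x. v x * (Pr (rho_deriv u u') x - Pr (rho_deriv v v') x))"
    using nrm_triangle[OF L2_mult_H1(1)[OF duv PR(1)] L2_mult_H1(1)[OF v PD]] by simp
  also have "nrm (\<lambda>x. (u x - v x) * Pr (rho_deriv u u') x) \<le> d * nrm (Pr (rho_deriv u u'))"
    unfolding d_def by (rule nrm_H1_mult(1)[OF duv PR(1)])
  also have "\<dots> \<le> d * (2 * a * a)" using 1 pos by (intro mult_left_mono)
  also have "nrm (\<lambda>x. v x * (Pr (rho_deriv u u') x - Pr (rho_deriv v v') x)) \<le> b * nrm (\<lambda>x. Pr (rho_deriv u u') x - Pr (rho_deriv v v') x)"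
    unfolding b_def by (rule nrm_H1_mult(1)[OF v PD])
  also have "\<dots> \<le> b * (2 * (a + b) * d)" using 2 pos by (intro mult_left_mono)
  finally show ?thesis by simp
qed

text \<open>Local boundedness of the H1 norm provides uniform constants on compact time intervals,
  and continuity of the flux lets the integrated weak form be differentiated.\<close>

lemma continuity_in_time:
  assumes H: "\<forall>t\<in>I. H1 (U t) (U' t)"
    and c: "\<forall>t\<in>I. ((\<lambda>s. nrm (\<lambda>x. U s x - U t x)) \<longlongrightarrow> 0) (at t within I) \<and> ((\<lambda>s. nrm (\<lambda>x. U' s x - U' t x)) \<longlongrightarrow> 0) (at t within I)"
  shows "continuous_on I (\<lambda>s. nrm (U s) + nrm (U' s))"
    "H1 \<phi> \<phi>' \<Longrightarrow> continuous_on I (\<lambda>s. flux (U s) (U' s) \<phi> \<phi>')"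
proof -
  have ev: "\<forall>\<^sub>F s in at t within I. s \<in> I" for t by (simp add: eventually_at_filter)
  have n1: "((\<lambda>s. nrm (U s)) \<longlongrightarrow> nrm (U t)) (at t within I)" if t: "t \<in> I" for t
  proof -
    have "((\<lambda>s. nrm (U s) - nrm (U t)) \<longlongrightarrow> 0) (at t within I)"
    proof (rule Lim_null_comparison)
      show "\<forall>\<^sub>F s in at t within I. norm (nrm (U s) - nrm (U t)) \<le> nrm (\<lambda>x. U s x - U t x)"
        using ev by eventually_elim (use H t in \<open>auto intro!: nrm_triangle_rev dest: H1_L2\<close>)
    qed (use c t in auto)
    then show ?thesis by (simp add: LIM_zero_iff)
  qed
  have n2: "((\<lambda>s. nrm (U' s)) \<longlongrightarrow> nrm (U' t)) (at t within I)" if t: "t \<in> I" for t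
  proof -
    have "((\<lambda>s. nrm (U' s) - nrm (U' t)) \<longlongrightarrow> 0) (at t within I)"
    proof (rule Lim_null_comparison)
      show "\<forall>\<^sub>F s in at t within I. norm (nrm (U' s) - nrm (U' t)) \<le> nrm (\<lambda>x. U' s x - U' t x)"
        using ev by eventually_elim (use H t in \<open>auto intro!: nrm_triangle_rev dest: H1_L2\<close>)
    qed (use c t in auto)
    then show ?thesis by (simp add: LIM_zero_iff)
  qed
  show "continuous_on I (\<lambda>s. nrm (U s) + nrm (U' s))"
    unfolding continuous_on_def by (intro ballI tendsto_add n1 n2)
  assume \<phi>: "H1 \<phi> \<phi>'"
  note \<phi>L = H1_L2[OF \<phi>]
  show "continuous_on I (\<lambda>s. flux (U s) (U' s) \<phi> \<phi>')"
    unfolding continuous_on_def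
  proof
    fix t assume t: "t \<in> I"
    have Ht: "H1 (U t) (U' t)" using H t by auto
    define a where "a s = nrm (U s) + nrm (U' s)" for s
    define d where "d s = nrm (\<lambda>x. U s x - U t x) + nrm (\<lambda>x. U' s x - U' t x)" for s
    have at: "(a \<longlongrightarrow> a t) (at t within I)" unfolding a_def by (intro tendsto_add n1 n2 t)
    have dt: "(d \<longlongrightarrow> 0) (at t within I)" using c t tendsto_add[of _ 0 _ _ 0] unfolding d_def by fastforce
    have z: "((\<lambda>s. nrm (\<lambda>x. U' s x - U' t x) * nrm \<phi>' + 2 * ((d s * (2 * a s * a s) + a t * (2 * (a s + a t) * d s)) * nrm \<phi>)) \<longlongrightarrow> 
       0 * nrm \<phi>' + 2 * ((0 * (2 * a t * a t) + a t * (2 * (a t + a t) * 0)) * nrm \<phi>)) (at t within I)"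
      by (intro tendsto_add tendsto_mult tendsto_const at dt) (use c t in auto)
    have "((\<lambda>s. flux (U s) (U' s) \<phi> \<phi>' - flux (U t) (U' t) \<phi> \<phi>') \<longlongrightarrow> 0) (at t within I)"
    proof (rule Lim_null_comparison)
      show "((\<lambda>s. nrm (\<lambda>x. U' s x - U' t x) * nrm \<phi>' + 2 * ((d s * (2 * a s * a s) + a t * (2 * (a s + a t) * d s)) * nrm \<phi>)) \<longlongrightarrow> 0) (at t within I)"
        using z by simp
      show "\<forall>\<^sub>F s in at t within I. norm (flux (U s) (U' s) \<phi> \<phi>' - flux (U t) (U' t) \<phi> \<phi>') 
         \<le> nrm (\<lambda>x. U' s x - U' t x) * nrm \<phi>' + 2 * ((d s * (2 * a s * a s) + a t * (2 * (a s + a t) * d s)) * nrm \<phi>)"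
        using ev
      proof eventually_elim
        case (elim s)
        then have Hs: "H1 (U s) (U' s)" using H by auto
        note L = H1_L2[OF Hs] H1_L2[OF Ht] nonlin_L2[OF Hs] nonlin_L2[OF Ht]
        let ?D = "\<lambda>x. nonlin (U s) (U' s) x - nonlin (U t) (U' t) x"
        have "flux (U s) (U' s) \<phi> \<phi>' - flux (U t) (U' t) \<phi> \<phi>' = - \<i> * ip (\<lambda>x. U' s x - U' t x) \<phi>' + 2 * ip ?D \<phi>"
          unfolding flux_nonlin using L \<phi>L by (simp add: algebra_simps)
        also have "norm \<dots> \<le> norm (- \<i> * ip (\<lambda>x. U' s x - U' t x) \<phi>') + norm (2 * ip ?D \<phi>)" by (rule norm_triangle_ineq)
        also have "\<dots> = norm (ip (\<lambda>x. U' s x - U' t x) \<phi>') + 2 * norm (ip ?D \<phi>)" unfolding norm_mult by simp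
        also have "norm (ip (\<lambda>x. U' s x - U' t x) \<phi>') \<le> nrm (\<lambda>x. U' s x - U' t x) * nrm \<phi>'"
          by (rule cauchy_schwarz[OF L2_diff[OF L(2,4)] \<phi>L(2)])
        also have "norm (ip ?D \<phi>) \<le> nrm ?D * nrm \<phi>" by (rule cauchy_schwarz[OF L2_diff[OF L(5,6)] \<phi>L(1)])
        also have "nrm ?D * nrm \<phi> \<le> (d s * (2 * a s * a s) + a t * (2 * (a s + a t) * d s)) * nrm \<phi>"
          unfolding a_def d_def by (rule mult_right_mono[OF nrm_nonlin_diff[OF Hs Ht]]) simp
        finally show ?case by simp
      qed
    qed
    then show "((\<lambda>s. flux (U s) (U' s) \<phi> \<phi>') \<longlongrightarrow> flux (U t) (U' t) \<phi> \<phi>') (at t within I)" by (simp add: LIM_zero_iff)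
  qed
qed

lemma is_interval_Icc_subset: 
  fixes I :: "real set"
  assumes "is_interval I" "a \<in> I" "b \<in> I" shows "{a..b} \<subseteq> I"
proof
  fix x assume "x \<in> {a..b}" then show "x \<in> I" using mem_is_interval_1_I[OF assms, of x] by simp
qed

lemma open_interval_extend:
  fixes I :: "real set"
  assumes "open I" "is_interval I" "x \<in> I" "y \<in> I" "x \<le> y"
  obtains a b where "a < x" "y < b" "{a..b} \<subseteq> I"
proof -
  obtain e1 where e1: "e1 > 0" "ball x e1 \<subseteq> I" using assms openE by blast
  obtain e2 where e2: "e2 > 0" "ball y e2 \<subseteq> I" using assms openE by blast
  have 1: "x - e1 / 2 \<in> I" using e1 by (intro subsetD[OF e1(2)]) (auto simp: dist_real_def)
  have 2: "y + e2 / 2 \<in> I" using e2 by (intro subsetD[OF e2(2)]) (auto simp: dist_real_def)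
  have "{x - e1 / 2..y + e2 / 2} \<subseteq> I"
    by (rule is_interval_Icc_subset[OF assms(2) 1 2])
  then show ?thesis using that[of "x - e1 / 2" "y + e2 / 2"] e1(1) e2(1) by simp
qed

lemma flow_has_derivative:
  assumes f: "flow I U U'" and \<phi>: "H1 \<phi> \<phi>'" and t: "t \<in> I"
  shows "((\<lambda>t. ip (U t) \<phi>) has_vector_derivative flux (U t) (U' t) \<phi> \<phi>') (at t)"
proof -
  have I: "is_interval I" "open I" "0 \<in> I" using f by (auto simp: flow_def)
  have c: "continuous_on I (\<lambda>s. flux (U s) (U' s) \<phi> \<phi>')"
    by (rule continuity_in_time(2)[OF _ _ \<phi>]) (use f in \<open>auto simp: flow_def\<close>)
  have mm: "min 0 t \<in> I" "max 0 t \<in> I" "min 0 t \<le> max 0 t" using I t by (auto simp: min_def max_def)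
  \<comment> \<open>The interval reaches strictly beyond both 0 and \<open>t\<close>, so the
    derivative at \<open>t\<close> is two-sided.\<close>
  from open_interval_extend[OF I(2,1) mm] obtain a b where ab: "a < min 0 t" "max 0 t < b" "{a..b} \<subseteq> I" .
  let ?F = "\<lambda>s. flux (U s) (U' s) \<phi> \<phi>'"
  have "((\<lambda>u. LBINT y=ereal 0..ereal u. ?F y) has_vector_derivative ?F t) (at t within {a..b})"
    by (rule interval_integral_FTC2) (use ab c in \<open>auto intro: continuous_on_subset\<close>)
  moreover have "at t within {a..b} = at t" using ab by (intro at_within_interior) auto
  ultimately have "((\<lambda>u. LBINT y=ereal 0..ereal u. ?F y) has_vector_derivative ?F t) (at t)" by simp
  then have "((\<lambda>u. ip (U 0) \<phi> + (LBINT y=ereal 0..ereal u. ?F y)) has_vector_derivative 0 + ?F t) (at t)"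
    by (intro has_vector_derivative_add has_vector_derivative_const)
  then have d: "((\<lambda>u. ip (U 0) \<phi> + (LBINT y=ereal 0..ereal u. ?F y)) has_vector_derivative ?F t) (at t)" by simp
  show ?thesis
  proof (rule has_vector_derivative_transform_within_open[OF d I(2) t])
    fix u assume "u \<in> I"
    then have "ip (U u) \<phi> - ip (U 0) \<phi> = (LBINT s=0..u. ?F s)" using f \<phi> unfolding flow_def by blast
    then show "ip (U 0) \<phi> + (LBINT y=ereal 0..ereal u. ?F y) = ip (U u) \<phi>" by (simp add: zero_ereal_def algebra_simps)
  qed
qed

section \<open>Constancy of the matrix element along the flow\<close>

lemma Lres_ip_unique:
  assumes u: "H1 u u'" "\<And>x. cmod (u x) \<le> B" and k: "k \<ge> B\<^sup>2" and w: "Lres u k w w' f" and v: "Lres u k v v' f"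
  shows "Re (ip f w) = Re (ip f v)"
proof (rule antisym)
  have w': "H1 w w'" "hardy w" and v': "H1 v v'" "hardy v" using w v by (auto simp: Lres_def)
  show "Re (ip f w) \<le> Re (ip f v)"
    using Lres_variational[OF u k v w'] Lres_qform[OF u(1) w] by simp
  show "Re (ip f v) \<le> Re (ip f w)"
    using Lres_variational[OF u k w v'] Lres_qform[OF u(1) v] by simp
qed

text \<open>For each base time \<open>s\<close> the increment of \<open>g\<close> is bounded below
  by a pairing with \<open>\<psi> s\<close>. With \<open>\<psi> s\<close> held fixed this pairing is
  differentiable at \<open>s\<close>, and its derivative has vanishing real part; this is exactly
  the Dini hypothesis. The uniform bound \<open>C\<close> gives continuity of
  \<open>g\<close>.\<close>

lemma resolvent_element_conserved:
  assumes f: "flow I U U'" and ab: "a \<le> b" "{a..b} \<subseteq> I" and M: "\<And>s. s \<in> {a..b} \<Longrightarrow> nrm (U s) + nrm (U' s) \<le> M"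
    and k: "k \<ge> 2 * M\<^sup>2 + 1" and W: "\<And>s. s \<in> {a..b} \<Longrightarrow> Lres (U s) k (W s) (W' s) (U s)"
  shows "Re (ip (U a) (W a)) = Re (ip (U b) (W b))"
proof -
  have H: "H1 (U s) (U' s)" "hardy (U s)" if "s \<in> {a..b}" for s using f ab that by (auto simp: flow_def)
  have B: "cmod (U s x) \<le> M" if "s \<in> {a..b}" for s x
    using H1_sup_bound[OF H(1)[OF that]] M[OF that] order_trans by blast
  have nM: "nrm (U s) \<le> M" if "s \<in> {a..b}" for s using M[OF that] nrm_nonneg[of "U' s"] by linarith
  have k1: "k \<ge> M\<^sup>2 + 1" using k zero_le_power2[of M] by linarith
  define C where "C = M + (2 + k + M\<^sup>2) * M * (M * M)"
  define g where "g s = Re (ip (U s) (W s))" for s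
  have ex: "\<exists>\<psi> \<psi>'. H1 \<psi> \<psi>' \<and> Re (flux (U s) (U' s) \<psi> \<psi>') = 0 \<and> nrm \<psi> \<le> C \<and> (\<forall>t\<in>{a..b}. g t - g s \<ge> 2 * Re (ip (\<lambda>x. U t x - U s x) \<psi>))" 
    if s: "s \<in> {a..b}" for s
  proof -
    from resolvent_increment[OF H[OF s] B[OF s] k1 W[OF s] nM[OF s]] obtain \<psi> \<psi>' where p: "H1 \<psi> \<psi>'" "Re (flux (U s) (U' s) \<psi> \<psi>') = 0" 
      "nrm \<psi> \<le> M + (2 + k + M\<^sup>2) * M * (M * M)"
      "\<And>v v' z z'. H1 v v' \<Longrightarrow> (\<And>x. cmod (v x) \<le> M) \<Longrightarrow> Lres v k z z' v \<Longrightarrow>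
       Re (ip v z) - Re (ip (U s) (W s)) \<ge> 2 * Re (ip (\<lambda>x. v x - U s x) \<psi>)" by blast
    have "\<forall>t\<in>{a..b}. g t - g s \<ge> 2 * Re (ip (\<lambda>x. U t x - U s x) \<psi>)"
      unfolding g_def using p(4)[OF H(1) B W] by blast
    then show ?thesis using p(1-3) unfolding C_def by blast
  qed
  \<comment> \<open>The function and its derivative are packed into a pair so that both come from
    one choice over time.\<close>
  let ?P = "\<lambda>s p. H1 (fst p) (snd p) \<and> Re (flux (U s) (U' s) (fst p) (snd p)) = 0 \<and> nrm (fst p) \<le> C \<and> (\<forall>t\<in>{a..b}. g t - g s \<ge> 2 * Re (ip (\<lambda>x. U t x - U s x) (fst p)))"
  have "\<forall>s\<in>{a..b}. \<exists>p. ?P s p"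
  proof
    fix s assume "s \<in> {a..b}"
    from ex[OF this] obtain \<psi> \<psi>' where q: "H1 \<psi> \<psi>' \<and> Re (flux (U s) (U' s) \<psi> \<psi>') = 0 \<and> nrm \<psi> \<le> C \<and> (\<forall>t\<in>{a..b}. g t - g s \<ge> 2 * Re (ip (\<lambda>x. U t x - U s x) \<psi>))"
      by (elim exE that)
    show "\<exists>p. ?P s p" by (rule exI[of _ "(\<psi>, \<psi>')"]) (unfold fst_conv snd_conv, rule q)
  qed
  from bchoice[OF this] obtain p where p: "\<forall>s\<in>{a..b}. ?P s (p s)" by blast
  define \<psi> where "\<psi> s = fst (p s)" for s
  define \<psi>' where "\<psi>' s = snd (p s)" for s
  have \<psi>: "\<And>s. s \<in> {a..b} \<Longrightarrow> H1 (\<psi> s) (\<psi>' s)" "\<And>s. s \<in> {a..b} \<Longrightarrow> Re (flux (U s) (U' s) (\<psi> s) (\<psi>' s)) = 0"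
     "\<And>s. s \<in> {a..b} \<Longrightarrow> nrm (\<psi> s) \<le> C" "\<And>s t. s \<in> {a..b} \<Longrightarrow> t \<in> {a..b} \<Longrightarrow> g t - g s \<ge> 2 * Re (ip (\<lambda>x. U t x - U s x) (\<psi> s))"
    using p by (simp_all add: \<psi>_def \<psi>'_def)
  \<comment> \<open>Using the increment bound with base \<open>s\<close> and again with base
    \<open>t\<close> bounds the increment from both sides.\<close>
  have lip: "\<bar>g t - g s\<bar> \<le> 2 * C * nrm (\<lambda>x. U t x - U s x)" if st: "s \<in> {a..b}" "t \<in> {a..b}" for s t
  proof -
    have *: "\<bar>Re (ip (\<lambda>x. U t x - U s x) (\<psi> r))\<bar> \<le> C * nrm (\<lambda>x. U t x - U s x)" if st: "s \<in> {a..b}" "t \<in> {a..b}" "r \<in> {a..b}" for s t r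
    proof -
      have "\<bar>Re (ip (\<lambda>x. U t x - U s x) (\<psi> r))\<bar> \<le> cmod (ip (\<lambda>x. U t x - U s x) (\<psi> r))" by (rule abs_Re_le_cmod)
      also have "\<dots> \<le> nrm (\<lambda>x. U t x - U s x) * nrm (\<psi> r)" 
        by (rule cauchy_schwarz) (use H(2) st H1_L2(1)[OF \<psi>(1)] in auto)
      also have "\<dots> \<le> nrm (\<lambda>x. U t x - U s x) * C" using \<psi>(3)[OF st(3)] by (intro mult_left_mono) auto
      finally show ?thesis by (simp add: mult.commute)
    qed
    have "g t - g s \<ge> - (2 * (C * nrm (\<lambda>x. U t x - U s x)))" using \<psi>(4)[OF st] *[OF st st(1)] by linarith
    moreover have "g s - g t \<ge> - (2 * (C * nrm (\<lambda>x. U s x - U t x)))" using \<psi>(4)[OF st(2,1)] *[OF st(2,1) st(2)] by linarith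
    ultimately show ?thesis by (simp add: nrm_minus_commute[of "U s"] abs_le_iff)
  qed
  have "g a = g b"
  proof (rule Dini_constant[OF ab(1)])
    show "continuous_on {a..b} g"
      unfolding continuous_on_def
    proof
      fix t assume t: "t \<in> {a..b}"
      have "((\<lambda>s. nrm (\<lambda>x. U s x - U t x)) \<longlongrightarrow> 0) (at t within I)" using f ab t by (auto simp: flow_def)
      then have "((\<lambda>s. nrm (\<lambda>x. U s x - U t x)) \<longlongrightarrow> 0) (at t within {a..b})" using ab(2) by (rule tendsto_within_subset)
      then have z: "((\<lambda>s. 2 * C * nrm (\<lambda>x. U s x - U t x)) \<longlongrightarrow> 2 * C * 0) (at t within {a..b})" by (intro tendsto_mult tendsto_const)
      have "((\<lambda>s. g s - g t) \<longlongrightarrow> 0) (at t within {a..b})"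
      proof (rule Lim_null_comparison)
        show "((\<lambda>s. 2 * C * nrm (\<lambda>x. U s x - U t x)) \<longlongrightarrow> 0) (at t within {a..b})" using z by simp
        show "\<forall>\<^sub>F s in at t within {a..b}. norm (g s - g t) \<le> 2 * C * nrm (\<lambda>x. U s x - U t x)"
          unfolding eventually_at_filter using lip[OF t] by (intro always_eventually) auto
      qed
      then show "(g \<longlongrightarrow> g t) (at t within {a..b})" by (simp add: LIM_zero_iff)
    qed
    fix s e :: real assume s: "s \<in> {a..b}" and e: "e > 0"
    have sI: "s \<in> I" using s ab by auto
    have "((\<lambda>t. ip (U t) (\<psi> s)) has_derivative (\<lambda>h. h *\<^sub>R flux (U s) (U' s) (\<psi> s) (\<psi>' s))) (at s)"
      using flow_has_derivative[OF f \<psi>(1)[OF s] sI] by (simp add: has_vector_derivative_def)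
    moreover have "e / 2 > 0" using e by simp
    ultimately obtain d where d: "d > 0" "\<And>t. norm (t - s) < d \<Longrightarrow> norm (ip (U t) (\<psi> s) - ip (U s) (\<psi> s) - (t - s) *\<^sub>R flux (U s) (U' s) (\<psi> s) (\<psi>' s)) \<le> e / 2 * norm (t - s)"
      unfolding has_derivative_at_alt by blast
    show "\<exists>d>0. \<forall>t\<in>{a..b}. \<bar>t - s\<bar> < d \<longrightarrow> - e * \<bar>t - s\<bar> \<le> g t - g s"
    proof (intro exI[of _ d] conjI ballI impI d(1))
      fix t assume t: "t \<in> {a..b}" "\<bar>t - s\<bar> < d"
      let ?r = "ip (U t) (\<psi> s) - ip (U s) (\<psi> s) - (t - s) *\<^sub>R flux (U s) (U' s) (\<psi> s) (\<psi>' s)"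
      have "Re (ip (\<lambda>x. U t x - U s x) (\<psi> s)) = Re (ip (U t) (\<psi> s) - ip (U s) (\<psi> s))"
        using H(2) t(1) s H1_L2(1)[OF \<psi>(1)[OF s]] by simp
      also have "\<dots> = Re ?r" using \<psi>(2)[OF s] by simp
      also have "\<dots> \<ge> - (e / 2 * \<bar>t - s\<bar>)" using d(2)[of t] t(2) abs_Re_le_cmod[of ?r] by simp
      finally have "2 * Re (ip (\<lambda>x. U t x - U s x) (\<psi> s)) \<ge> - e * \<bar>t - s\<bar>" by simp
      with \<psi>(4)[OF s t(1)] show "- e * \<bar>t - s\<bar> \<le> g t - g s" by linarith
    qed
  qed
  then show ?thesis by (simp add: g_def)
qed

theorem flow_conservation:
  assumes f: "flow I U U'" and t: "t \<in> I"
  shows "nrm (U t) = nrm (U 0)" "nrm (Lax (U t) (U' t)) \<le> nrm (Lax (U 0) (U' 0))"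
proof -
  have I: "is_interval I" "open I" "0 \<in> I" using f by (auto simp: flow_def)
  \<comment> \<open>Ordering 0 and \<open>t\<close> treats positive and negative times
    together.\<close>
  define a where "a = min 0 t"
  define b where "b = max 0 t"
  have ab: "a \<le> b" by (auto simp: a_def b_def)
  have "a \<in> I" "b \<in> I" using I t by (auto simp: a_def b_def min_def max_def)
  then have abI: "{a..b} \<subseteq> I" by (rule is_interval_Icc_subset[OF I(1)])
  have c: "continuous_on {a..b} (\<lambda>s. nrm (U s) + nrm (U' s))"
    by (rule continuous_on_subset[OF continuity_in_time(1) abI]) (use f in \<open>auto simp: flow_def\<close>)
  have "bounded ((\<lambda>s. nrm (U s) + nrm (U' s)) ` {a..b})" by (intro compact_imp_bounded compact_continuous_image c compact_Icc)
  then obtain M where M: "\<And>s. s \<in> {a..b} \<Longrightarrow> nrm (U s) + nrm (U' s) \<le> M"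
    unfolding bounded_iff by (metis abs_le_D1 imageI real_norm_def)
  have H: "H1 (U s) (U' s)" "hardy (U s)" if "s \<in> {a..b}" for s using f abI that by (auto simp: flow_def)
  have B: "cmod (U s x) \<le> M" if "s \<in> {a..b}" for s x
    using H1_sup_bound[OF H(1)[OF that]] M[OF that] order_trans by blast
  have m: "t \<in> {a..b}" "0 \<in> {a..b}" by (auto simp: a_def b_def)
  have eq: "Re (ip (U t) w) = Re (ip (U 0) z)" if k: "k \<ge> 2 * M\<^sup>2 + 1" and w: "Lres (U t) k w w' (U t)" and z: "Lres (U 0) k z z' (U 0)" for k w w' z z'
  proof -
    have k2: "k \<ge> 2 * M\<^sup>2" "k > 0" "k \<ge> M\<^sup>2" using k zero_le_power2[of M] by linarith+
    have "\<exists>w w'. Lres (U s) k w w' (U s)" if "s \<in> {a..b}" for s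
      using Lres_exists[OF H[OF that] B[OF that] k2(1,2) H(2)[OF that]] by blast
    then obtain W W' where W: "\<And>s. s \<in> {a..b} \<Longrightarrow> Lres (U s) k (W s) (W' s) (U s)" by metis
    have "Re (ip (U a) (W a)) = Re (ip (U b) (W b))"
      by (rule resolvent_element_conserved[OF f ab abI M k W])
    then have "Re (ip (U t) (W t)) = Re (ip (U 0) (W 0))" by (cases "t \<le> 0") (auto simp: a_def b_def)
    moreover have "Re (ip (U t) (W t)) = Re (ip (U t) w)" by (rule Lres_ip_unique[OF H(1)[OF m(1)] B[OF m(1)] k2(3) W[OF m(1)] w])
    moreover have "Re (ip (U 0) (W 0)) = Re (ip (U 0) z)" by (rule Lres_ip_unique[OF H(1)[OF m(2)] B[OF m(2)] k2(3) W[OF m(2)] z])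
    ultimately show ?thesis by simp
  qed
  show "nrm (U t) = nrm (U 0)" "nrm (Lax (U t) (U' t)) \<le> nrm (Lax (U 0) (U' 0))"
    by (rule energy_le_of_resolvent_eq[OF H[OF m(1)] B[OF m(1)] H[OF m(2)] B[OF m(2)] eq]; assumption)+
qed

subsection \<open>Density of test functions\<close>

definition smooth :: "(real \<Rightarrow> complex) \<Rightarrow> bool" where
  "smooth f \<longleftrightarrow> (\<exists>D. D 0 = f \<and> (\<forall>(k::nat) x. (D k has_vector_derivative D (Suc k) x) (at x)))"

text \<open>A coinductive criterion: a class of functions closed under differentiation consists of
  smooth functions. It serves for products, for the flat exponentials and for band-limited
  functions.\<close>

lemma smoothI_invariant:
  assumes f: "f \<in> S" and S: "\<And>f. f \<in> S \<Longrightarrow> \<exists>f'\<in>S. \<forall>x. (f has_vector_derivative f' x) (at x)"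
  shows "smooth f"
proof -
  obtain d where d: "\<And>f. f \<in> S \<Longrightarrow> d f \<in> S \<and> (\<forall>x. (f has_vector_derivative d f x) (at x))"
    using S by metis
  have "(d ^^ k) f \<in> S" for k by (induction k) (use f d in auto)
  then show ?thesis unfolding smooth_def using d by (intro exI[of _ "\<lambda>k. (d ^^ k) f"]) auto
qed

lemma smooth_derivE:
  assumes "smooth f" obtains f' where "smooth f'" "\<And>x. (f has_vector_derivative f' x) (at x)"
proof -
  obtain D where D: "D 0 = f" "\<And>k x. (D k has_vector_derivative D (Suc k) x) (at x)"
    using assms by (auto simp: smooth_def)
  have "smooth (D 1)" unfolding smooth_def
    by (rule exI[of _ "\<lambda>k. D (Suc k)"]) (use D in auto)
  then show ?thesis using that[of "D 1"] D(2)[of 0] unfolding D(1) One_nat_def by blast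
qed

text \<open>Products of smooth functions are not visibly closed under differentiation, but sums of
  such products are, by the Leibniz rule.\<close>

inductive_set prod_span :: "(real \<Rightarrow> complex) set" where
  prod: "smooth f \<Longrightarrow> smooth g \<Longrightarrow> (\<lambda>x. f x * g x) \<in> prod_span"
| add: "f \<in> prod_span \<Longrightarrow> g \<in> prod_span \<Longrightarrow> (\<lambda>x. f x + g x) \<in> prod_span"

lemma smooth_mult:
  assumes "smooth f" "smooth g" shows "smooth (\<lambda>x. f x * g x)"
proof (rule smoothI_invariant[where S=prod_span])
  show "(\<lambda>x. f x * g x) \<in> prod_span" using assms by (rule prod_span.prod)
  fix h assume "h \<in> prod_span"
  then show "\<exists>h'\<in>prod_span. \<forall>x. (h has_vector_derivative h' x) (at x)"
  proof induction
    case (prod f g)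
    obtain f' where f': "smooth f'" "\<And>x. (f has_vector_derivative f' x) (at x)" using smooth_derivE[OF prod(1)] by blast
    obtain g' where g': "smooth g'" "\<And>x. (g has_vector_derivative g' x) (at x)" using smooth_derivE[OF prod(2)] by blast
    show ?case
      by (rule bexI[where x="\<lambda>x. f x * g' x + f' x * g x"])
         (use f' g' prod in \<open>auto intro!: has_vector_derivative_mult prod_span.intros\<close>)
  next
    case (add f g)
    then obtain f' g' where "f' \<in> prod_span" "\<forall>x. (f has_vector_derivative f' x) (at x)"
      "g' \<in> prod_span" "\<forall>x. (g has_vector_derivative g' x) (at x)" by blast
    then show ?case by (intro bexI[where x="\<lambda>x. f' x + g' x"]) (auto intro!: has_vector_derivative_add prod_span.intros)
  qed
qed

lemma smooth_affine:
  assumes "smooth f" shows "smooth (\<lambda>x. f (a + m * x))"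
proof -
  obtain D where D: "D 0 = f" "\<And>k x. (D k has_vector_derivative D (Suc k) x) (at x)"
    using assms by (auto simp: smooth_def)
  let ?D = "\<lambda>k x. complex_of_real (m ^ k) * D k (a + m * x)"
  have "(?D k has_vector_derivative ?D (Suc k) x) (at x)" for k x
  proof -
    have 0: "((\<lambda>x. a + m * x) has_vector_derivative m) (at x)" by (auto intro!: derivative_eq_intros simp: has_vector_derivative_def)
    have "(D k \<circ> (\<lambda>x. a + m * x) has_vector_derivative m *\<^sub>R D (Suc k) (a + m * x)) (at x)"
      by (rule vector_diff_chain_at[OF 0 D(2)])
    then have "((\<lambda>x. complex_of_real (m ^ k) * D k (a + m * x)) has_vector_derivative complex_of_real (m ^ k) * (m *\<^sub>R D (Suc k) (a + m * x))) (at x)"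
      by (intro has_vector_derivative_mult_right) (simp add: o_def)
    then show ?thesis by (simp add: scaleR_conv_of_real mult.assoc mult.left_commute)
  qed
  then show ?thesis unfolding smooth_def using D(1) by (intro exI[of _ ?D]) auto
qed

text \<open>The flat functions at 0, with a polynomial in \<open>1 / x\<close> as prefactor.
  Differentiation stays in the family and replaces \<open>p\<close> by the square of the variable
  times \<open>p - pderiv p\<close>.\<close>

definition exp_poly :: "real poly \<Rightarrow> real \<Rightarrow> complex" where
  "exp_poly p x = complex_of_real (if x > 0 then poly p (1 / x) * exp (- (1 / x)) else 0)"

lemma poly_exp_tendsto_0: "((\<lambda>y::real. poly p y * exp (- y)) \<longlongrightarrow> 0) at_top"
proof -
  have "((\<lambda>y::real. \<Sum>i\<le>degree p. coeff p i * (y ^ i / exp y)) \<longlongrightarrow> (\<Sum>i\<le>degree p. coeff p i * 0)) at_top"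
    by (intro tendsto_sum tendsto_mult tendsto_const tendsto_power_div_exp_0)
  then show ?thesis by (simp add: poly_altdef exp_minus divide_inverse sum_distrib_right mult.assoc)
qed

text \<open>Dividing by \<open>x\<close> multiplies the polynomial by its variable, so the
  difference quotient at 0 belongs to the same family and is killed by the exponential.\<close>

lemma exp_poly_at_0: "((\<lambda>x. exp_poly p x / complex_of_real x) \<longlongrightarrow> 0) (at 0)"
proof -
  have r: "((\<lambda>x. poly (pCons 0 p) (inverse x) * exp (- (inverse x))) \<longlongrightarrow> 0) (at_right (0::real))"
    by (rule filterlim_compose[OF poly_exp_tendsto_0 filterlim_inverse_at_top_right])
  have "((\<lambda>x. (if x > 0 then poly (pCons 0 p) (inverse x) * exp (- (inverse x)) else 0)) \<longlongrightarrow> 0) (at (0::real))"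
  proof (rule filterlim_split_at)
    show "((\<lambda>x. (if x > 0 then poly (pCons 0 p) (inverse x) * exp (- (inverse x)) else 0)) \<longlongrightarrow> 0) (at_left (0::real))"
      by (rule tendsto_eventually) (auto simp: eventually_at_filter)
    show "((\<lambda>x. (if x > 0 then poly (pCons 0 p) (inverse x) * exp (- (inverse x)) else 0)) \<longlongrightarrow> 0) (at_right (0::real))"
      by (rule Lim_transform_eventually[OF r]) (auto simp: eventually_at_filter)
  qed
  then have "((\<lambda>x. complex_of_real (if x > 0 then poly (pCons 0 p) (inverse x) * exp (- (inverse x)) else 0)) \<longlongrightarrow> complex_of_real 0) (at (0::real))"
    by (rule tendsto_of_real)
  moreover have "(\<lambda>x. complex_of_real (if x > 0 then poly (pCons 0 p) (inverse x) * exp (- (inverse x)) else 0)) = (\<lambda>x. exp_poly p x / complex_of_real x)"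
    by (auto simp: exp_poly_def fun_eq_iff field_simps)
  ultimately show ?thesis by simp
qed

lemma exp_poly_deriv:
  "(exp_poly p has_vector_derivative exp_poly (pCons 0 (pCons 0 (p - pderiv p))) x) (at x)" 
proof -
  let ?q = "pCons 0 (pCons 0 (p - pderiv p))"
  consider "x > 0" | "x < 0" | "x = 0" by linarith
  then show ?thesis
  proof cases
    case 1
    have "((\<lambda>x. poly p (1 / x) * exp (- (1 / x))) has_real_derivative poly ?q (1 / x) * exp (- (1 / x))) (at x)"
      using 1 by (auto intro!: derivative_eq_intros DERIV_chain2[OF poly_DERIV] simp: field_simps power2_eq_square)
    then have "((\<lambda>x. complex_of_real (poly p (1 / x) * exp (- (1 / x)))) has_vector_derivative complex_of_real (poly ?q (1 / x) * exp (- (1 / x)))) (at x)"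
      by (intro has_vector_derivative_of_real) (simp add: has_real_derivative_iff_has_vector_derivative)
    then have "(exp_poly p has_vector_derivative complex_of_real (poly ?q (1 / x) * exp (- (1 / x)))) (at x)"
      by (rule has_vector_derivative_transform_within_open[where S="{0<..}"]) (use 1 in \<open>auto simp: exp_poly_def\<close>)
    then show ?thesis using 1 by (simp add: exp_poly_def)
  next
    case 2
    have "((\<lambda>x. 0) has_vector_derivative (0::complex)) (at x)" by simp
    then have "(exp_poly p has_vector_derivative 0) (at x)"
      by (rule has_vector_derivative_transform_within_open[where S="{..<0}"]) (use 2 in \<open>auto simp: exp_poly_def\<close>)
    then show ?thesis using 2 by (simp add: exp_poly_def)
  next
    case 3
    have "(exp_poly p has_vector_derivative 0) (at 0)"
      unfolding has_vector_derivative_def has_derivative_at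
    proof (intro conjI)
      have "((\<lambda>h. norm (exp_poly p h / complex_of_real h)) \<longlongrightarrow> 0) (at 0)"
        using exp_poly_at_0 tendsto_norm_zero by blast
      moreover have "norm (exp_poly p h / complex_of_real h) = norm (exp_poly p (0 + h) - exp_poly p 0 - h *\<^sub>R 0) / norm h" for h
        by (simp add: exp_poly_def[of _ 0] norm_divide)
      ultimately show "(\<lambda>h. norm (exp_poly p (0 + h) - exp_poly p 0 - h *\<^sub>R 0) / norm h) \<midarrow>0\<rightarrow> 0" by simp
    qed simp
    then show ?thesis using 3 by (simp add: exp_poly_def[of _ 0])
  qed
qed

lemma smooth_exp_poly: "smooth (exp_poly p)"
  by (rule smoothI_invariant[where S="range exp_poly"]) (use exp_poly_deriv in auto)

lemma smooth_continuous: "smooth f \<Longrightarrow> continuous_on S f"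
  by (metis smooth_derivE continuous_at_imp_continuous_on has_vector_derivative_continuous)

lemma continuous_compact_support_bounded:
  fixes f :: "real \<Rightarrow> complex"
  assumes "continuous_on {-R..R} f" "\<And>x. \<bar>x\<bar> > R \<Longrightarrow> f x = 0" 
  obtains B where "B \<ge> 0" "\<And>x. cmod (f x) \<le> B"
proof -
  have "bounded (f ` {-R..R})" using assms(1) by (intro compact_imp_bounded compact_continuous_image) auto
  then obtain B where B: "\<And>x. x \<in> {-R..R} \<Longrightarrow> cmod (f x) \<le> B" unfolding bounded_iff by (metis imageI)
  have "cmod (f x) \<le> \<bar>B\<bar>" for x
  proof (cases "\<bar>x\<bar> > R")
    case False 
    then have "x \<in> {-R..R}" by auto
    then show ?thesis using B[of x] by linarith
  qed (simp add: assms(2))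
  then show ?thesis using that[of "\<bar>B\<bar>"] by auto
qed

lemma bump_function:
  obtains b b' B where "smooth b" "b 0 = 1" "\<forall>x. \<bar>x\<bar> > 1 \<longrightarrow> b x = 0" "\<forall>x. cmod (b x) \<le> B"
    "smooth b'" "\<forall>x. (b has_vector_derivative b' x) (at x)" "\<forall>x. cmod (b' x) \<le> B" "B \<ge> 0"
proof -
  define c where "c = exp_poly 1 (1 + 1 * 0) * exp_poly 1 (1 + (-1) * 0)"
  \<comment> \<open>The third factor is the constant \<open>1 / Re c\<close>, written as a value of
    \<open>exp_poly\<close> at 1 so that smoothness and the normalisation at 0 come from the same
    three constructions.\<close>
  define b where "b = (\<lambda>x. (exp_poly 1 (1 + 1 * x) * exp_poly 1 (1 + (-1) * x)) * exp_poly [:1 / Re c * exp 1:] (1 + 0 * x))"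
  have c: "c = complex_of_real (exp (-1) * exp (-1))" by (simp add: c_def exp_poly_def)
  have s: "smooth b" unfolding b_def by (intro smooth_mult smooth_affine smooth_exp_poly)
  have 1: "b 0 = 1" unfolding b_def using c 
    by (simp add: exp_poly_def flip: exp_add of_real_mult) 
  have 0: "b x = 0" if "\<bar>x\<bar> > 1" for x using that by (auto simp: b_def exp_poly_def)
  obtain b' where b': "smooth b'" "\<And>x. (b has_vector_derivative b' x) (at x)" using smooth_derivE[OF s] by blast
  have 2: "b' x = 0" if "\<bar>x\<bar> > 1" for x
  proof -
    have "((\<lambda>_. 0) has_vector_derivative b' x) (at x)"
      by (rule has_vector_derivative_transform_within_open[OF b'(2), where S="{y. 1 < \<bar>y\<bar>}"])
         (use that 0 in \<open>auto intro!: open_Collect_less continuous_intros\<close>)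
    then show ?thesis using vector_derivative_unique_at[of "\<lambda>_. 0" 0 x "b' x"] by simp
  qed
  obtain B1 where B1: "B1 \<ge> 0" "\<And>x. cmod (b x) \<le> B1" 
    using continuous_compact_support_bounded[OF smooth_continuous[OF s] 0] by blast
  obtain B2 where B2: "B2 \<ge> 0" "\<And>x. cmod (b' x) \<le> B2" 
    using continuous_compact_support_bounded[OF smooth_continuous[OF b'(1)] 2] by blast
  show ?thesis
    by (rule that[of b "max B1 B2" b']) (use s 1 0 b' B1 B2 in \<open>auto simp: le_max_iff_disj\<close>)
qed

section \<open>Band-limited approximation and density of test functions\<close>

lemma H1_of_C1:
  assumes "\<And>x. (f has_vector_derivative f' x) (at x)" "continuous_on UNIV f'" "L2 f" "L2 f'"
  shows "H1 f f'"
  unfolding H1_def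
proof (intro conjI assms(3,4) allI impI)
  fix a b :: real assume ab: "a \<le> b"
  have "(f' has_integral f b - f a) {a..b}"
    by (rule fundamental_theorem_of_calculus[OF ab]) (use assms(1) has_vector_derivative_at_within in blast)
  moreover have "(f' has_integral (LINT x:{a..b}|lborel. f' x)) {a..b}"
    using set_borel_integral_eq_integral[OF L2_set_integrable[OF assms(4), of a b]] by (metis integrable_integral)
  ultimately show "f b - f a = (LINT x:{a..b}|lborel. f' x)" by (rule has_integral_unique)
qed

lemma H1_has_vector_derivative:
  assumes f: "H1 f f'" and c: "continuous_on UNIV f'"
  shows "(f has_vector_derivative f' x) (at x)"
proof -
  have c': "continuous_on {x - 1..x + 1} f'" using c continuous_on_subset by blast
  have "((\<lambda>y. integral {x - 1..y} f') has_vector_derivative f' x) (at x within {x - 1..x + 1})"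
    by (rule integral_has_vector_derivative[OF c']) auto
  moreover have "at x within {x - 1..x + 1} = at x" by (intro at_within_interior) auto
  ultimately have "((\<lambda>y. f (x - 1) + integral {x - 1..y} f') has_vector_derivative 0 + f' x) (at x)"
    by (intro has_vector_derivative_add has_vector_derivative_const) simp
  then have d: "((\<lambda>y. f (x - 1) + integral {x - 1..y} f') has_vector_derivative f' x) (at x)" by simp
  show ?thesis
  proof (rule has_vector_derivative_transform_within_open[OF d, where S="{x - 1<..}"])
    fix y assume "y \<in> {x - 1<..}"
    then have "f y - f (x - 1) = (LINT x:{x - 1..y}|lborel. f' x)" using H1_diff_eq[OF f] by simp
    also have "\<dots> = integral {x - 1..y} f'" 
      by (rule set_borel_integral_eq_integral(2)) (rule L2_set_integrable[OF H1_L2(2)[OF f]])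
    finally show "f (x - 1) + integral {x - 1..y} f' = f y" by (simp add: algebra_simps)
  qed auto
qed

lemma bandlimited_H1:
  assumes F: "L2 F" "\<And>\<xi>. \<bar>\<xi>\<bar> > n \<Longrightarrow> F \<xi> = 0"
  shows "L2 (\<lambda>\<xi>. \<i> * complex_of_real \<xi> * F \<xi>)" "fourier_L2 (\<lambda>x. Fhat F (- x)) F" 
    "H1 (\<lambda>x. Fhat F (- x)) (\<lambda>x. Fhat (\<lambda>\<xi>. \<i> * complex_of_real \<xi> * F \<xi>) (- x))"
proof -
  have int: "integrable lborel F" if "L2 F" "\<And>\<xi>. \<bar>\<xi>\<bar> > n \<Longrightarrow> F \<xi> = 0" for F
  proof -
    have "(\<lambda>x. indicator {-n..n} x * F x) = F" using that(2) by (force simp: indicator_def fun_eq_iff)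
    then show ?thesis using trunc_integrable[OF that(1), of "-n" n] by simp
  qed
  have [measurable]: "F \<in> borel_measurable borel" using F(1) by (rule L2_measurable)
  have "L2 (\<lambda>\<xi>. (indicator {-n..n} \<xi> * (\<i> * complex_of_real \<xi>)) * F \<xi>)"
    by (rule L2_bounded_mult(1)[OF F(1), where B="\<bar>n\<bar>"]) (auto simp: norm_mult indicator_def)
  moreover have "(\<lambda>\<xi>. (indicator {-n..n} \<xi> * (\<i> * complex_of_real \<xi>)) * F \<xi>) = (\<lambda>\<xi>. \<i> * complex_of_real \<xi> * F \<xi>)"
    using F(2) by (force simp: indicator_def fun_eq_iff)
  ultimately show L: "L2 (\<lambda>\<xi>. \<i> * complex_of_real \<xi> * F \<xi>)" by simp
  show "fourier_L2 (\<lambda>x. Fhat F (- x)) F" by (rule fourier_L2_of_integrable_transform[OF int[OF F] F(1)])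
  show "H1 (\<lambda>x. Fhat F (- x)) (\<lambda>x. Fhat (\<lambda>\<xi>. \<i> * complex_of_real \<xi> * F \<xi>) (- x))"
    by (rule H1_of_transform[OF F(1) L fourier_L2_of_integrable_transform[OF int[OF L] L]]) (simp add: F(2))
qed

lemma bandlimited_smooth:
  assumes F: "L2 F" "\<And>\<xi>. \<bar>\<xi>\<bar> > n \<Longrightarrow> F \<xi> = 0"
  shows "smooth (\<lambda>x. Fhat F (- x))"
proof (rule smoothI_invariant[where S="{f. \<exists>F. L2 F \<and> (\<forall>\<xi>. \<bar>\<xi>\<bar> > n \<longrightarrow> F \<xi> = 0) \<and> f = (\<lambda>x. Fhat F (- x))}"])
  show "(\<lambda>x. Fhat F (- x)) \<in> {f. \<exists>F. L2 F \<and> (\<forall>\<xi>. \<bar>\<xi>\<bar> > n \<longrightarrow> F \<xi> = 0) \<and> f = (\<lambda>x. Fhat F (- x))}" using F by blast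
  fix f assume "f \<in> {f. \<exists>F. L2 F \<and> (\<forall>\<xi>. \<bar>\<xi>\<bar> > n \<longrightarrow> F \<xi> = 0) \<and> f = (\<lambda>x. Fhat F (- x))}"
  then obtain F where F: "L2 F" "\<And>\<xi>. \<bar>\<xi>\<bar> > n \<Longrightarrow> F \<xi> = 0" "f = (\<lambda>x. Fhat F (- x))" by blast
  let ?G = "\<lambda>\<xi>. \<i> * complex_of_real \<xi> * F \<xi>"
  have G: "L2 ?G" "\<And>\<xi>. \<bar>\<xi>\<bar> > n \<Longrightarrow> ?G \<xi> = 0" using bandlimited_H1(1)[OF F(1,2)] F(2) by auto
  have "(f has_vector_derivative Fhat ?G (- x)) (at x)" for x unfolding F(3)
    by (rule H1_has_vector_derivative[OF bandlimited_H1(3)[OF F(1,2)] H1_continuous_on[OF bandlimited_H1(3)[OF G]]])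
  then show "\<exists>f'\<in>{f. \<exists>F. L2 F \<and> (\<forall>\<xi>. \<bar>\<xi>\<bar> > n \<longrightarrow> F \<xi> = 0) \<and> f = (\<lambda>x. Fhat F (- x))}. \<forall>x. (f has_vector_derivative f' x) (at x)"
    using G by (intro bexI[where x="\<lambda>x. Fhat ?G (- x)"]) auto
qed

lemma H1_smooth_approx:
  assumes \<phi>: "H1 \<phi> \<phi>'" and e: "e > 0"
  obtains p p' where "smooth p" "H1 p p'" "\<And>x. (p has_vector_derivative p' x) (at x)" "continuous_on UNIV p'"
    "nrm (\<lambda>x. p x - \<phi> x) < e" "nrm (\<lambda>x. p' x - \<phi>' x) < e"
proof -
  obtain F where F: "fourier_L2 \<phi> F" using FT[OF H1_L2(1)[OF \<phi>]] by blast
  note F' = H1_FT[OF \<phi> F]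
  let ?G = "\<lambda>\<xi>. \<i> * complex_of_real \<xi> * F \<xi>"
  note L = fourier_L2_L2(2)[OF F] fourier_L2_L2(2)[OF F']
  have "\<forall>\<^sub>F n in sequentially. nrm (\<lambda>x. trunc n F x - F x) < e" "\<forall>\<^sub>F n in sequentially. nrm (\<lambda>x. trunc n ?G x - ?G x) < e"
    using order_tendstoD(2)[OF trunc_tendsto[OF L(1)] e] order_tendstoD(2)[OF trunc_tendsto[OF L(2)] e] by auto
  then have "\<forall>\<^sub>F n in sequentially. nrm (\<lambda>x. trunc n F x - F x) < e \<and> nrm (\<lambda>x. trunc n ?G x - ?G x) < e"
    by (rule eventually_conj)
  then obtain n where n: "nrm (\<lambda>x. trunc n F x - F x) < e" "nrm (\<lambda>x. trunc n ?G x - ?G x) < e"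
    using eventually_happens'[OF sequentially_bot] by blast
  have T: "L2 (trunc n F)" "\<And>\<xi>. \<bar>\<xi>\<bar> > real n \<Longrightarrow> trunc n F \<xi> = 0" using L(1) by (auto simp: trunc_def indicator_def)
  have eq: "trunc n ?G = (\<lambda>\<xi>. \<i> * complex_of_real \<xi> * trunc n F \<xi>)" by (auto simp: trunc_def fun_eq_iff)
  note B = bandlimited_H1[OF T]
  have T': "L2 (trunc n ?G)" "\<And>\<xi>. \<bar>\<xi>\<bar> > real n \<Longrightarrow> trunc n ?G \<xi> = 0" using L(2) by (auto simp: trunc_def indicator_def)
  note B' = bandlimited_H1[OF T']
  have c: "continuous_on UNIV (\<lambda>x. Fhat (trunc n ?G) (- x))" by (rule H1_continuous_on[OF B'(3)])
  have H: "H1 (\<lambda>x. Fhat (trunc n F) (- x)) (\<lambda>x. Fhat (trunc n ?G) (- x))" using B(3) unfolding eq .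
  show ?thesis
  proof (rule that[OF bandlimited_smooth[OF T] H H1_has_vector_derivative[OF H c] c])
    show "nrm (\<lambda>x. Fhat (trunc n F) (- x) - \<phi> x) < e"
      using fourier_L2_nrm[OF fourier_L2_diff[OF B(2) F]] n(1) by simp
    show "nrm (\<lambda>x. Fhat (trunc n ?G) (- x) - \<phi>' x) < e"
      using fourier_L2_nrm[OF fourier_L2_diff[OF B'(2) F']] n(2) by simp
  qed (use T in auto)
qed

text \<open>Band limiting makes an H1 function smooth but spreads its support. A dilated bump cuts
  the support off; the derivative falling on the cutoff costs a factor \<open>m n\<close>, which
  tends to 0.\<close>

theorem test_functions_dense:
  assumes \<phi>: "H1 \<phi> \<phi>'" and e: "e > 0"
  obtains D where "test_derivs D" "H1 (D 0) (D 1)" "H1 (D 1) (D 2)" "nrm (\<lambda>x. D 0 x - \<phi> x) < e" "nrm (\<lambda>x. D 1 x - \<phi>' x) < e"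
proof -
  obtain p p' where p: "smooth p" "H1 p p'" "\<And>x. (p has_vector_derivative p' x) (at x)" "continuous_on UNIV p'"
    "nrm (\<lambda>x. p x - \<phi> x) < e / 2" "nrm (\<lambda>x. p' x - \<phi>' x) < e / 2"
    by (rule H1_smooth_approx[OF \<phi> half_gt_zero[OF e]]) (rule that; simp)
  obtain b b' B where bump: "smooth b" "b 0 = 1" "\<forall>x. \<bar>x\<bar> > 1 \<longrightarrow> b x = 0" "\<forall>x. cmod (b x) \<le> B"
    "smooth b'" "\<forall>x. (b has_vector_derivative b' x) (at x)" "\<forall>x. cmod (b' x) \<le> B" "B \<ge> 0" by (rule bump_function)
  note b = bump[rule_format]
  have [measurable]: "p \<in> borel_measurable borel" "p' \<in> borel_measurable borel" using H1_measurable[OF p(2)] by auto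
  have [measurable]: "b \<in> borel_measurable borel" "b' \<in> borel_measurable borel" 
    by (intro borel_measurable_continuous_onI smooth_continuous b)+
  note L = H1_L2[OF p(2)] H1_L2[OF \<phi>]
  define m where "m n = inverse (real (Suc n))" for n
  have m: "m n > 0" for n by (simp add: m_def)
  have m0: "m \<longlonglongrightarrow> 0" unfolding m_def by (rule LIMSEQ_inverse_real_of_nat)
  have lim: "(\<lambda>n. nrm (\<lambda>x. b (m n * x) * f x - f x)) \<longlonglongrightarrow> 0" if [measurable]: "L2 f" for f
  proof (rule nrm_dominated_convergence(1))
    show "L2 (\<lambda>x. complex_of_real B * f x)" using that by simp
    show "AE x in lborel. cmod (b (m n * x) * f x) \<le> cmod (complex_of_real B * f x)" for n
      using b(4,8) by (auto simp: norm_mult intro!: mult_right_mono)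
    have "(\<lambda>n. b (m n * x) * f x) \<longlonglongrightarrow> b (0 * x) * f x" for x
    proof (intro tendsto_mult tendsto_const)
      have "isCont b (0 * x)" using b(6) has_vector_derivative_continuous by blast
      then show "(\<lambda>n. b (m n * x)) \<longlonglongrightarrow> b (0 * x)" by (rule isCont_tendsto_compose) (intro tendsto_mult tendsto_const m0)
    qed
    then show "AE x in lborel. (\<lambda>n. b (m n * x) * f x) \<longlonglongrightarrow> f x" using b(2) by simp
  qed (use that in \<open>auto dest: L2_measurable\<close>)
  have e4: "e / 4 > 0" using e by simp
  have "(\<lambda>n. m n * (B * nrm p)) \<longlonglongrightarrow> 0 * (B * nrm p)" by (intro tendsto_mult m0 tendsto_const)
  then have "(\<lambda>n. m n * (B * nrm p)) \<longlonglongrightarrow> 0" by simp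
  from order_tendstoD(2)[OF this e4] order_tendstoD(2)[OF lim[OF L(1)] e4] order_tendstoD(2)[OF lim[OF L(2)] e4]
  have "\<forall>\<^sub>F n in sequentially. m n * (B * nrm p) < e / 4 \<and> nrm (\<lambda>x. b (m n * x) * p x - p x) < e / 4
    \<and> nrm (\<lambda>x. b (m n * x) * p' x - p' x) < e / 4" by eventually_elim auto
  then obtain n where n: "m n * (B * nrm p) < e / 4" "nrm (\<lambda>x. b (m n * x) * p x - p x) < e / 4"
    "nrm (\<lambda>x. b (m n * x) * p' x - p' x) < e / 4"
    using eventually_happens'[OF sequentially_bot] by blast
  have sq: "smooth (\<lambda>x. b (m n * x) * p x)" using smooth_mult[OF smooth_affine[OF b(1), of 0 "m n"] p(1)] by simp
  then obtain D where D: "D 0 = (\<lambda>x. b (m n * x) * p x)" "\<And>k x. (D k has_vector_derivative D (Suc k) x) (at x)"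
    by (auto simp: smooth_def)
  have supp: "{x. D 0 x \<noteq> 0} \<subseteq> {-(1 / m n)..1 / m n}"
  proof
    fix x assume "x \<in> {x. D 0 x \<noteq> 0}"
    then have "\<not> \<bar>m n * x\<bar> > 1" using b(3) D(1) by auto
    then have "m n * \<bar>x\<bar> \<le> 1" using m[of n] by (simp add: abs_mult not_less)
    then have "\<bar>x\<bar> \<le> 1 / m n" using m[of n] by (simp add: pos_le_divide_eq mult.commute)
    then show "x \<in> {-(1 / m n)..1 / m n}" by auto
  qed
  have T: "test_derivs D" unfolding test_derivs_def using D(2) bounded_subset[OF bounded_closed_interval supp] by simp
  \<comment> \<open>All derivatives inherit the support, which makes each of them bounded and
    square-integrable.\<close>
  have z: "D k x = 0" if "\<bar>x\<bar> > 1 / m n" for k x using that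
  proof (induction k arbitrary: x)
    case 0 
    then have "x \<notin> {-(1 / m n)..1 / m n}" by auto
    then show ?case using supp by auto
  next
    case (Suc k)
    have "((\<lambda>_. 0) has_vector_derivative D (Suc k) x) (at x)"
      by (rule has_vector_derivative_transform_within_open[OF D(2), where S="{y. 1 / m n < \<bar>y\<bar>}"])
         (use Suc in \<open>auto intro!: open_Collect_less continuous_intros\<close>)
    then show ?case using vector_derivative_unique_at[of "\<lambda>_. 0" 0 x "D (Suc k) x"] by simp
  qed
  have cD: "continuous_on S (D k)" for S k
    by (intro continuous_at_imp_continuous_on ballI has_vector_derivative_continuous[OF D(2)])
  have LD: "L2 (D k)" for k
  proof -
    obtain C where C: "\<And>x. cmod (D k x) \<le> C" by (rule continuous_compact_support_bounded[of "1 / m n" "D k", OF cD z]) (assumption, rule that)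
    have "L2 (\<lambda>x. D k x * (1 * indicator {-(1 / m n)..1 / m n} x))"
      by (rule L2_bounded_mult(1)[OF L2_const_on_interval _ C]) (intro borel_measurable_continuous_onI cD)
    moreover have "(\<lambda>x. D k x * (1 * indicator {-(1 / m n)..1 / m n} x)) = D k"
    proof
      fix x show "D k x * (1 * indicator {-(1 / m n)..1 / m n} x) = D k x"
        using z[of x k] by (cases "x \<in> {-(1 / m n)..1 / m n}") auto
    qed
    ultimately show ?thesis by simp
  qed
  have HD: "H1 (D k) (D (Suc k))" for k by (rule H1_of_C1[OF D(2) cD LD LD])
  have D1: "D 1 x = b (m n * x) * p' x + complex_of_real (m n) * b' (m n * x) * p x" for x
  proof -
    have 0: "((\<lambda>x. m n * x) has_vector_derivative m n) (at x)" by (auto intro!: derivative_eq_intros simp: has_vector_derivative_def)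
    have "((\<lambda>x. b (m n * x)) has_vector_derivative m n *\<^sub>R b' (m n * x)) (at x)"
      using vector_diff_chain_at[OF 0 b(6)] by (simp add: o_def)
    then have "(D 0 has_vector_derivative b (m n * x) * p' x + m n *\<^sub>R b' (m n * x) * p x) (at x)"
      unfolding D(1) by (intro has_vector_derivative_mult p(3))
    then show ?thesis using vector_derivative_unique_at[OF D(2)[of 0 x]] by (simp add: scaleR_conv_of_real)
  qed
  have e0: "nrm (\<lambda>x. D 0 x - \<phi> x) < e"
  proof -
    have "nrm (\<lambda>x. D 0 x - \<phi> x) \<le> nrm (\<lambda>x. D 0 x - p x) + nrm (\<lambda>x. p x - \<phi> x)" by (rule nrm_triangle3[OF LD L(1,3)])
    then show ?thesis using n(2) p(5) e D(1) by simp
  qed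
  have Lb: "L2 (\<lambda>x. b (m n * x) * p' x)" "L2 (\<lambda>x. b' (m n * x) * p x)"
    by (rule L2_bounded_mult(1)[OF _ _ b(4)] L2_bounded_mult(1)[OF _ _ b(7)]; use L in simp)+
  have "nrm (\<lambda>x. D 1 x - p' x) = nrm (\<lambda>x. (b (m n * x) * p' x - p' x) + complex_of_real (m n) * (b' (m n * x) * p x))"
    unfolding D1 by (simp add: algebra_simps)
  also have "\<dots> \<le> nrm (\<lambda>x. b (m n * x) * p' x - p' x) + nrm (\<lambda>x. complex_of_real (m n) * (b' (m n * x) * p x))"
    by (rule nrm_triangle) (use L Lb in auto)
  also have "nrm (\<lambda>x. complex_of_real (m n) * (b' (m n * x) * p x)) = m n * nrm (\<lambda>x. b' (m n * x) * p x)"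
    using m[of n] by (subst nrm_scale) simp
  also have "\<dots> \<le> m n * (B * nrm p)"
    using m[of n] nrm_bounded_mult(1)[OF L(1) _ b(7), of "\<lambda>x. m n * x"] by (intro mult_left_mono) auto
  finally have "nrm (\<lambda>x. D 1 x - p' x) < e / 2" using n by simp
  moreover have "nrm (\<lambda>x. D 1 x - \<phi>' x) \<le> nrm (\<lambda>x. D 1 x - p' x) + nrm (\<lambda>x. p' x - \<phi>' x)" by (rule nrm_triangle3[OF LD L(2,4)])
  ultimately have e1: "nrm (\<lambda>x. D 1 x - \<phi>' x) < e" using p(6) by simp
  show ?thesis using that[OF T _ _ e0 e1] HD[of 0] HD[of 1] by (simp add: numeral_2_eq_2)
qed

subsection \<open>Weak solutions\<close>

lemma interval_integral_diff_bound:
  fixes f g :: "real \<Rightarrow> complex"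
  assumes c: "continuous_on {min 0 t..max 0 t} f" "continuous_on {min 0 t..max 0 t} g"
    and b: "\<And>s. s \<in> {min 0 t..max 0 t} \<Longrightarrow> cmod (f s - g s) \<le> C"
  shows "cmod ((LBINT s=0..t. f s) - (LBINT s=0..t. g s)) \<le> C * \<bar>t\<bar>"
proof -
  define a where "a = min 0 t"
  define d where "d = max 0 t"
  have ad: "a \<le> d" by (simp add: a_def d_def)
  have c': "continuous_on {a..d} f" "continuous_on {a..d} g" using c by (simp_all add: a_def d_def)
  have eq: "(LBINT s=a..d. f s) = integral {a..d} f" if "continuous_on {a..d} f" for f :: "real \<Rightarrow> complex"
    by (rule interval_integral_eq_integral[OF ad borel_integrable_atLeastAtMost'[OF that]])
  have "(LBINT s=a..d. f s) - (LBINT s=a..d. g s) = integral {a..d} (\<lambda>s. f s - g s)"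
    unfolding eq[OF c'(1)] eq[OF c'(2)] using c' by (intro integral_diff[symmetric] integrable_continuous_interval)
  also have "cmod \<dots> \<le> C * (d - a)"
    by (rule integral_bound[OF ad]) (use c' b in \<open>auto simp: a_def d_def intro!: continuous_intros\<close>)
  finally have *: "cmod ((LBINT s=a..d. f s) - (LBINT s=a..d. g s)) \<le> C * (d - a)" .
  show ?thesis
  proof (cases "t \<ge> 0")
    case True then show ?thesis using * by (simp add: a_def d_def zero_ereal_def)
  next
    case False
    then show ?thesis using * norm_minus_commute
      by (simp add: a_def d_def zero_ereal_def interval_integral_endpoints_reverse[of "ereal 0" "ereal t"] norm_minus_commute)
  qed
qed

text \<open>\<open>pairing\<close> is bilinear whereas \<open>ip\<close> conjugates its second
  argument, hence the conjugated test function. One of the two derivatives on the test function is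
  moved back to \<open>U\<close>.\<close>

lemma weak_form_test_function:
  assumes u: "L2 u" "H1 U U'" "AE x in lborel. u x = U x" and D: "H1 (D 0) (D 1)" "H1 (D 1) (D (2::nat))"
  shows "pairing u (D 0) = ip U (\<lambda>x. cnj (D 0 x))"
    "\<i> * pairing u (D 2) + 2 * pairing (\<lambda>x. u x * Pi_plus_dx (\<lambda>y. complex_of_real ((cmod (u y))\<^sup>2)) x) (D 0)
     = flux U U' (\<lambda>x. cnj (D 0 x)) (\<lambda>x. cnj (D 1 x))"
proof -
  have [measurable]: "u \<in> borel_measurable borel" "U \<in> borel_measurable borel" "U' \<in> borel_measurable borel" 
     "D 0 \<in> borel_measurable borel" "D 1 \<in> borel_measurable borel" "D 2 \<in> borel_measurable borel"
    using H1_measurable[OF u(2)] H1_measurable[OF D(1)] H1_measurable[OF D(2)] L2_measurable[OF u(1)] by auto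
  have p: "pairing u \<phi> = ip U (\<lambda>x. cnj (\<phi> x))" if [measurable]: "\<phi> \<in> borel_measurable borel" for \<phi>
    unfolding pairing_def ip_def by (rule integral_cong_AE) (use u(3) in auto)
  show "pairing u (D 0) = ip U (\<lambda>x. cnj (D 0 x))" by (rule p) simp
  have sq: "complex_of_real ((cmod z)\<^sup>2) = z * cnj z" for z by (rule complex_norm_square)
  have rho: "L2 (\<lambda>y. complex_of_real ((cmod (u y))\<^sup>2))" 
    "AE y in lborel. complex_of_real ((cmod (u y))\<^sup>2) = U y * cnj (U y)"
  proof -
    show *: "AE y in lborel. complex_of_real ((cmod (u y))\<^sup>2) = U y * cnj (U y)" using u(3) by eventually_elim (simp only: sq)
    then show "L2 (\<lambda>y. complex_of_real ((cmod (u y))\<^sup>2))"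
      by (intro L2_cong_AE[OF H1_L2(1)[OF rho_H1[OF u(2)]]]) (auto elim: eventually_mono)
  qed
  note Pi = Pi_plus_dx_eq[OF rho(1) rho_H1[OF u(2)] rho(2)]
  have [measurable]: "Pr (rho_deriv U U') \<in> borel_measurable borel"
    using Pr_L2[OF rho_deriv_L2[OF u(2)]] by (rule L2_measurable)
  have "pairing (\<lambda>x. u x * P x) (D 0) = ip (\<lambda>x. U x * Pr (rho_deriv U U') x) (\<lambda>x. cnj (D 0 x))"
    if [measurable]: "P \<in> borel_measurable borel" and P: "AE x in lborel. P x = Pr (rho_deriv U U') x" for P
    unfolding pairing_def ip_def by (rule integral_cong_AE) (use u(3) P in auto)
  note this[OF L2_measurable[OF Pi(1)] Pi(2)]
  moreover have "ip U' (\<lambda>x. cnj (D 1 x)) = - ip U (\<lambda>x. cnj (D 2 x))" by (rule ip_H1[OF u(2) H1_cnj[OF D(2)]])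
  ultimately show "\<i> * pairing u (D 2) + 2 * pairing (\<lambda>x. u x * Pi_plus_dx (\<lambda>y. complex_of_real ((cmod (u y))\<^sup>2)) x) (D 0)
     = flux U U' (\<lambda>x. cnj (D 0 x)) (\<lambda>x. cnj (D 1 x))"
    by (simp add: flux_def p)
qed

text \<open>The term \<open>M\<close> comes from \<open>u'\<close>. The nonlinearity is at most
  \<open>2 * M^3\<close>, and doubles because of its coefficient in the flux.\<close>

lemma flux_diff_bound:
  assumes u: "H1 u u'" "nrm u + nrm u' \<le> M" and \<phi>: "H1 \<phi> \<phi>'" and \<psi>: "H1 \<psi> \<psi>'" 
    and e: "nrm (\<lambda>x. \<phi> x - \<psi> x) \<le> e" "nrm (\<lambda>x. \<phi>' x - \<psi>' x) \<le> e"
  shows "cmod (flux u u' \<phi> \<phi>' - flux u u' \<psi> \<psi>') \<le> (M + 4 * M^3) * e"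
proof -
  note L = H1_L2[OF u(1)] H1_L2[OF \<phi>] H1_L2[OF \<psi>] nonlin_L2[OF u(1)]
  have M: "nrm u' \<le> M" "0 \<le> M" using u(2) nrm_nonneg[of u] nrm_nonneg[of u'] by linarith+
  have e0: "0 \<le> e" using e(1) nrm_nonneg order_trans by blast
  have "nrm (nonlin u u') \<le> (nrm u + nrm u') * nrm (Pr (rho_deriv u u'))"
    unfolding nonlin_def by (rule nrm_H1_mult(1)[OF u(1)]) (rule Pr_L2[OF rho_deriv_L2[OF u(1)]])
  also have "\<dots> \<le> M * (2 * M * M)"
  proof (rule mult_mono)
    have "nrm (Pr (rho_deriv u u')) \<le> 2 * (nrm u + nrm u') * nrm u'"
      using nrm_Pr[OF rho_deriv_L2[OF u(1)]] nrm_rho_deriv[OF u(1)] by linarith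
    also have "\<dots> \<le> 2 * M * M" by (intro mult_mono) (use u(2) M in auto)
    finally show "nrm (Pr (rho_deriv u u')) \<le> 2 * M * M" .
  qed (use u(2) M in auto)
  finally have N: "nrm (nonlin u u') \<le> 2 * M^3" by (simp add: power3_eq_cube)
  have "flux u u' \<phi> \<phi>' - flux u u' \<psi> \<psi>' = - \<i> * ip u' (\<lambda>x. \<phi>' x - \<psi>' x) + 2 * ip (nonlin u u') (\<lambda>x. \<phi> x - \<psi> x)"
    unfolding flux_nonlin using L by (simp add: algebra_simps)
  also have "cmod \<dots> \<le> cmod (- \<i> * ip u' (\<lambda>x. \<phi>' x - \<psi>' x)) + cmod (2 * ip (nonlin u u') (\<lambda>x. \<phi> x - \<psi> x))" by (rule norm_triangle_ineq)
  also have "\<dots> = cmod (ip u' (\<lambda>x. \<phi>' x - \<psi>' x)) + 2 * cmod (ip (nonlin u u') (\<lambda>x. \<phi> x - \<psi> x))" by (simp add: norm_mult)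
  also have "\<dots> \<le> M * e + 2 * (2 * M^3 * e)"
  proof (intro add_mono mult_left_mono)
    have "cmod (ip u' (\<lambda>x. \<phi>' x - \<psi>' x)) \<le> nrm u' * nrm (\<lambda>x. \<phi>' x - \<psi>' x)" using L by (intro cauchy_schwarz) auto
    also have "\<dots> \<le> M * e" by (intro mult_mono) (use e M in auto)
    finally show "cmod (ip u' (\<lambda>x. \<phi>' x - \<psi>' x)) \<le> M * e" .
    have "cmod (ip (nonlin u u') (\<lambda>x. \<phi> x - \<psi> x)) \<le> nrm (nonlin u u') * nrm (\<lambda>x. \<phi> x - \<psi> x)" using L by (intro cauchy_schwarz) auto
    also have "\<dots> \<le> 2 * M^3 * e" by (intro mult_mono) (use e M N in auto)
    finally show "cmod (ip (nonlin u u') (\<lambda>x. \<phi> x - \<psi> x)) \<le> 2 * M^3 * e" .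
  qed simp
  finally show ?thesis by (simp add: algebra_simps)
qed

text \<open>Both sides of the weak identity depend continuously on the test function in the H1 norm,
  uniformly over the times between 0 and \<open>t\<close>; density then passes from test functions
  to H1.\<close>

theorem is_solution_flow:
  assumes "is_solution I u"
  obtains U U' where "flow I U U'" "\<And>t. t \<in> I \<Longrightarrow> L2 (u t) \<and> (AE x in lborel. u t x = U t x)"
proof -
  have I: "is_interval I" "open I" "0 \<in> I" using assms by (auto simp: is_solution_def)
  have "\<exists>g g'. L2 (u t) \<and> H1 g g' \<and> (AE x in lborel. u t x = g x)" if "t \<in> I" for t
    using that assms in_Hs_1_rep[of "u t"] unfolding is_solution_def in_Hs_plus_def by metis
  then obtain U U' where U: "\<And>t. t \<in> I \<Longrightarrow> L2 (u t) \<and> H1 (U t) (U' t) \<and> (AE x in lborel. u t x = U t x)" by metis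
  have H: "H1 (U t) (U' t)" and Lu: "L2 (u t)" and ae: "AE x in lborel. u t x = U t x" if "t \<in> I" for t using U[OF that] by auto
  have hardy: "hardy (U t)" if t: "t \<in> I" for t
  proof (rule hardy_cong_AE[OF _ _ ae[OF t]])
    have "in_Hs_plus 1 (u t)" using assms t by (simp add: is_solution_def)
    then show "hardy (u t)" using Lu[OF t] by (simp add: in_Hs_plus_def hardy_def)
    show "U t \<in> borel_measurable borel" using H1_measurable[OF H[OF t]] by simp
  qed
  have cont: "((\<lambda>s. nrm (\<lambda>x. U s x - U t x)) \<longlongrightarrow> 0) (at t within I) \<and> ((\<lambda>s. nrm (\<lambda>x. U' s x - U' t x)) \<longlongrightarrow> 0) (at t within I)" if t: "t \<in> I" for t
  proof -
    have lim: "((\<lambda>s. Hs_norm 1 (\<lambda>x. u s x - u t x)) \<longlongrightarrow> 0) (at t within I)" using assms t by (auto simp: is_solution_def)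
    have b: "nrm (\<lambda>x. U s x - U t x) \<le> Hs_norm 1 (\<lambda>x. u s x - u t x) \<and> nrm (\<lambda>x. U' s x - U' t x) \<le> Hs_norm 1 (\<lambda>x. u s x - u t x)" if s: "s \<in> I" for s
    proof -
      have "(Hs_norm 1 (\<lambda>x. u s x - u t x))\<^sup>2 = (nrm (\<lambda>x. U s x - U t x))\<^sup>2 + (nrm (\<lambda>x. U' s x - U' t x))\<^sup>2"
      proof (rule Hs_norm_H1(1))
        show "AE x in lborel. u s x - u t x = U s x - U t x" using ae[OF s] ae[OF t] by eventually_elim simp
      qed (use Lu[OF s] Lu[OF t] H1_diff[OF H[OF s] H[OF t]] in auto)
      then have "(nrm (\<lambda>x. U s x - U t x))\<^sup>2 \<le> (Hs_norm 1 (\<lambda>x. u s x - u t x))\<^sup>2"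
        "(nrm (\<lambda>x. U' s x - U' t x))\<^sup>2 \<le> (Hs_norm 1 (\<lambda>x. u s x - u t x))\<^sup>2" by simp_all
      then show ?thesis using power2_le_imp_le[OF _ Hs_norm_nonneg] by blast
    qed
    show ?thesis
    proof (intro conjI Lim_null_comparison[OF _ lim])
      show "\<forall>\<^sub>F s in at t within I. norm (nrm (\<lambda>x. U s x - U t x)) \<le> Hs_norm 1 (\<lambda>x. u s x - u t x)"
        unfolding eventually_at_filter by (intro always_eventually) (simp add: b)
      show "\<forall>\<^sub>F s in at t within I. norm (nrm (\<lambda>x. U' s x - U' t x)) \<le> Hs_norm 1 (\<lambda>x. u s x - u t x)"
        unfolding eventually_at_filter by (intro always_eventually) (simp add: b)
    qed
  qed
  have weak: "ip (U t) \<phi> - ip (U 0) \<phi> = (LBINT s=0..t. flux (U s) (U' s) \<phi> \<phi>')" if \<phi>: "H1 \<phi> \<phi>'" and t: "t \<in> I" for \<phi> \<phi>' t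
  proof -
    define a where "a = min 0 t"
    define b where "b = max 0 t"
    have "a \<in> I" "b \<in> I" using I t by (auto simp: a_def b_def min_def max_def)
    then have abI: "{a..b} \<subseteq> I" by (rule is_interval_Icc_subset[OF I(1)])
    have m: "t \<in> {a..b}" "0 \<in> {a..b}" by (auto simp: a_def b_def)
    have cH: "\<forall>t\<in>I. H1 (U t) (U' t)" using H by blast
    have cc: "\<forall>t\<in>I. ((\<lambda>s. nrm (\<lambda>x. U s x - U t x)) \<longlongrightarrow> 0) (at t within I) \<and> ((\<lambda>s. nrm (\<lambda>x. U' s x - U' t x)) \<longlongrightarrow> 0) (at t within I)"
      using cont by blast
    have "continuous_on {a..b} (\<lambda>s. nrm (U s) + nrm (U' s))"
      by (rule continuous_on_subset[OF continuity_in_time(1)[OF cH cc] abI])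
    then have "bounded ((\<lambda>s. nrm (U s) + nrm (U' s)) ` {a..b})" by (intro compact_imp_bounded compact_continuous_image compact_Icc)
    then obtain M where M: "\<And>s. s \<in> {a..b} \<Longrightarrow> nrm (U s) + nrm (U' s) \<le> M"
      unfolding bounded_iff by (metis abs_le_D1 imageI real_norm_def)
    have M0: "0 \<le> M" using M[OF m(1)] nrm_nonneg[of "U t"] nrm_nonneg[of "U' t"] by linarith
    \<comment> \<open>Two pairings contribute \<open>M\<close> each and the time integral
      contributes the flux constant times the length; the final 1 makes \<open>K\<close>
      positive.\<close>
    define K where "K = 2 * M + (M + 4 * M^3) * \<bar>t\<bar> + 1"
    have K: "K > 0" unfolding K_def using M0 by (simp add: add_nonneg_pos)
    let ?d = "ip (U t) \<phi> - ip (U 0) \<phi> - (LBINT s=0..t. flux (U s) (U' s) \<phi> \<phi>')"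
    have "cmod ?d \<le> 0 + \<delta>" if "\<delta> > 0" for \<delta>
    proof -
      define e where "e = \<delta> / K"
      have e: "e > 0" using that K by (simp add: e_def)
      \<comment> \<open>The conjugate of \<open>\<phi>\<close> is approximated, since the weak form
        of the equation uses the bilinear pairing.\<close>
      obtain D where D: "test_derivs D" "H1 (D 0) (D 1)" "H1 (D 1) (D 2)" "nrm (\<lambda>x. D 0 x - cnj (\<phi> x)) < e" "nrm (\<lambda>x. D 1 x - cnj (\<phi>' x)) < e"
        by (rule test_functions_dense[OF H1_cnj[OF \<phi>] e])
      let ?\<psi> = "\<lambda>x. cnj (D 0 x)" and ?\<psi>' = "\<lambda>x. cnj (D 1 x)"
      have \<psi>: "H1 ?\<psi> ?\<psi>'" by (rule H1_cnj[OF D(2)])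
      have d: "nrm (\<lambda>x. \<phi> x - ?\<psi> x) \<le> e" "nrm (\<lambda>x. \<phi>' x - ?\<psi>' x) \<le> e"
        using D(4,5) nrm_cnj[of "\<lambda>x. \<phi> x - ?\<psi> x"] nrm_cnj[of "\<lambda>x. \<phi>' x - ?\<psi>' x"]
          nrm_minus_commute[of "\<lambda>x. cnj (\<phi> x)" "D 0"] nrm_minus_commute[of "\<lambda>x. cnj (\<phi>' x)" "D 1"] by simp_all
      have "pairing (u t) (D 0) - pairing (u 0) (D 0) =
        (LBINT s=0..t. \<i> * pairing (u s) (D 2) +
            2 * pairing (\<lambda>x. u s x * Pi_plus_dx (\<lambda>y. complex_of_real ((cmod (u s y))\<^sup>2)) x) (D 0))"
        using assms D(1) t unfolding is_solution_def by blast
      also have "\<dots> = (LBINT s=0..t. flux (U s) (U' s) ?\<psi> ?\<psi>')"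
      proof (rule interval_integral_cong)
        fix s assume "s \<in> einterval (min 0 (ereal t)) (max 0 (ereal t))"
        then have "s \<in> {a..b}" by (auto simp: einterval_iff a_def b_def min_def max_def zero_ereal_def split: if_splits)
        then have s: "s \<in> I" using abI by auto
        show "\<i> * pairing (u s) (D 2) + 2 * pairing (\<lambda>x. u s x * Pi_plus_dx (\<lambda>y. complex_of_real ((cmod (u s y))\<^sup>2)) x) (D 0)
          = flux (U s) (U' s) ?\<psi> ?\<psi>'"
          by (rule weak_form_test_function(2)[OF Lu[OF s] H[OF s] ae[OF s] D(2,3)])
      qed
      also have "pairing (u t) (D 0) = ip (U t) ?\<psi>" by (rule weak_form_test_function(1)[OF Lu[OF t] H[OF t] ae[OF t] D(2,3)])
      also have "pairing (u 0) (D 0) = ip (U 0) ?\<psi>" by (rule weak_form_test_function(1)[OF Lu[OF I(3)] H[OF I(3)] ae[OF I(3)] D(2,3)])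
      finally have w: "ip (U t) ?\<psi> - ip (U 0) ?\<psi> = (LBINT s=0..t. flux (U s) (U' s) ?\<psi> ?\<psi>')" .
      have i: "cmod (ip (U s) \<phi> - ip (U s) ?\<psi>) \<le> M * e" if s: "s \<in> {a..b}" for s
      proof -
        have sI: "s \<in> I" using s abI by auto
        have "cmod (ip (U s) \<phi> - ip (U s) ?\<psi>) = cmod (ip (U s) (\<lambda>x. \<phi> x - ?\<psi> x))"
          using H1_L2(1)[OF H[OF sI]] H1_L2(1)[OF \<phi>] H1_L2(1)[OF \<psi>] by simp
        also have "\<dots> \<le> nrm (U s) * nrm (\<lambda>x. \<phi> x - ?\<psi> x)"
          using H1_L2(1)[OF H[OF sI]] H1_L2(1)[OF \<phi>] H1_L2(1)[OF \<psi>] by (intro cauchy_schwarz) auto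
        also have "\<dots> \<le> M * e"
        proof (rule mult_mono)
          show "nrm (U s) \<le> M" using M[OF s] nrm_nonneg[of "U' s"] by linarith
        qed (use d(1) M0 in auto)
        finally show ?thesis .
      qed
      have j: "cmod ((LBINT s=0..t. flux (U s) (U' s) \<phi> \<phi>') - (LBINT s=0..t. flux (U s) (U' s) ?\<psi> ?\<psi>')) \<le> (M + 4 * M^3) * e * \<bar>t\<bar>"
      proof (rule interval_integral_diff_bound; fold a_def b_def)
        show "continuous_on {a..b} (\<lambda>s. flux (U s) (U' s) \<phi> \<phi>')"
          by (rule continuous_on_subset[OF continuity_in_time(2)[OF cH cc \<phi>] abI])
        show "continuous_on {a..b} (\<lambda>s. flux (U s) (U' s) ?\<psi> ?\<psi>')"
          by (rule continuous_on_subset[OF continuity_in_time(2)[OF cH cc \<psi>] abI])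
        fix s assume s: "s \<in> {a..b}"
        then have sI: "s \<in> I" using abI by auto
        show "cmod (flux (U s) (U' s) \<phi> \<phi>' - flux (U s) (U' s) ?\<psi> ?\<psi>') \<le> (M + 4 * M^3) * e"
          by (rule flux_diff_bound[OF H[OF sI] M[OF s] \<phi> \<psi> d])
      qed
      have "?d = (ip (U t) \<phi> - ip (U t) ?\<psi>) - (ip (U 0) \<phi> - ip (U 0) ?\<psi>)
         - ((LBINT s=0..t. flux (U s) (U' s) \<phi> \<phi>') - (LBINT s=0..t. flux (U s) (U' s) ?\<psi> ?\<psi>'))"
        using w by (simp add: algebra_simps)
      also have "cmod \<dots> \<le> M * e + M * e + (M + 4 * M^3) * e * \<bar>t\<bar>"
        by (rule order_trans[OF norm_triangle_ineq4 add_mono[OF order_trans[OF norm_triangle_ineq4 add_mono[OF i[OF m(1)] i[OF m(2)]]] j]])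
      also have "\<dots> = (K - 1) * e" by (simp add: K_def algebra_simps)
      also have "\<dots> \<le> K * e" using e by simp
      also have "\<dots> = \<delta>" using K by (simp add: e_def)
      finally show ?thesis by simp
    qed
    then have "cmod ?d \<le> 0" by (rule field_le_epsilon)
    then show ?thesis by simp
  qed
  have "flow I U U'" unfolding flow_def using I H hardy cont weak by blast
  then show ?thesis using that U by blast
qed

subsection \<open>The ground state\<close>

text \<open>The Szego projection of \<open>Q * cnj Q\<close>.\<close>

definition gQ :: "real \<Rightarrow> complex" where
  "gQ x = \<i> / (complex_of_real x + \<i>)"

lemma Q_denominator_ne_0[simp]: "complex_of_real x + \<i> \<noteq> 0" "complex_of_real x - \<i> \<noteq> 0"
  by (auto simp: complex_eq_iff)

lemma Q_eq_gQ: "Q x = - \<i> * complex_of_real (sqrt 2) * gQ x"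
  by (simp add: Q_def gQ_def field_simps)

lemma gQ_add_cnj: "gQ x + cnj (gQ x) = Q x * cnj (Q x)"
proof -
  have s: "complex_of_real (sqrt 2) * complex_of_real (sqrt 2) = 2" by (simp flip: of_real_mult)
  have "gQ x + cnj (gQ x) = \<i> / (complex_of_real x + \<i>) + (- \<i>) / (complex_of_real x - \<i>)"
    by (simp add: gQ_def)
  also have "\<dots> = (\<i> * (complex_of_real x - \<i>) + (- \<i>) * (complex_of_real x + \<i>)) / ((complex_of_real x + \<i>) * (complex_of_real x - \<i>))"
    by (rule add_frac_eq) (rule Q_denominator_ne_0)+
  also have "\<i> * (complex_of_real x - \<i>) + (- \<i>) * (complex_of_real x + \<i>) = complex_of_real (sqrt 2) * complex_of_real (sqrt 2)"
    unfolding s by (simp add: algebra_simps)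
  also have "\<dots> / ((complex_of_real x + \<i>) * (complex_of_real x - \<i>)) = Q x * cnj (Q x)"
    by (simp add: Q_def)
  finally show ?thesis .
qed

lemma cmod_gQ_le: "cmod (gQ x) \<le> 1"
proof -
  have "1 \<le> cmod (complex_of_real x + \<i>)"
    using abs_Im_le_cmod[of "complex_of_real x + \<i>"] by simp
  then show ?thesis by (simp add: gQ_def norm_divide)
qed

lemma cmod_Q_le: "cmod (Q x) \<le> 2"
proof -
  have "sqrt 2 * cmod (gQ x) \<le> 2 * 1" by (intro mult_mono cmod_gQ_le) (auto simp: real_le_lsqrt)
  then show ?thesis by (simp add: Q_eq_gQ norm_mult)
qed

lemma gQ_deriv: "(gQ has_vector_derivative \<i> * gQ x * gQ x) (at x)"
proof -
  have d: "((\<lambda>x. complex_of_real x + \<i>) has_vector_derivative 1 + 0) (at x)"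
    by (intro has_vector_derivative_add has_vector_derivative_const)
       (use has_vector_derivative_of_real[OF DERIV_ident] in simp)
  have "((\<lambda>z. \<i> / z) has_field_derivative - \<i> / (complex_of_real x + \<i>)\<^sup>2) (at (complex_of_real x + \<i>))"
    by (auto intro!: derivative_eq_intros simp: power2_eq_square)
  from field_vector_diff_chain_at[OF d this] show ?thesis 
    by (simp add: o_def gQ_def[abs_def] power2_eq_square)
qed

lemma gQ_continuous: "continuous_on S gQ"
  by (intro continuous_at_imp_continuous_on ballI has_vector_derivative_continuous[OF gQ_deriv])

lemma gQ_laplace:
  "(LINT \<xi>|lborel. exp (\<i> * complex_of_real (x * \<xi>)) * complex_of_real (indicator {0<..} \<xi> * exp (- \<xi>))) = gQ x"
proof -
  define w where "w = \<i> * complex_of_real x - 1"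
  have w: "w \<noteq> 0" by (auto simp: w_def complex_eq_iff)
  have w0: "exp (w * complex_of_real \<xi>) = exp (\<i> * complex_of_real (x * \<xi>)) * complex_of_real (exp (- \<xi>))" for \<xi>
    unfolding w_def by (simp add: exp_of_real[symmetric] exp_add[symmetric] algebra_simps)
  have rw: "Re w = - 1" by (simp add: w_def)
  have nw: "cmod (exp (w * complex_of_real \<xi>)) = exp (- \<xi>)" for \<xi>
    by (simp add: w_def norm_exp_eq_Re)
  have d: "((\<lambda>\<xi>. exp (w * complex_of_real \<xi>) / w) has_vector_derivative exp (w * complex_of_real \<xi>)) (at \<xi>)" for \<xi>
  proof -
    have 1: "((\<lambda>\<xi>. complex_of_real \<xi>) has_vector_derivative 1) (at \<xi>)"
      using has_vector_derivative_of_real[OF DERIV_ident] by simp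
    have 2: "((\<lambda>z. exp (w * z) / w) has_field_derivative exp (w * complex_of_real \<xi>)) (at (complex_of_real \<xi>))"
      using w by (auto intro!: derivative_eq_intros)
    show ?thesis using field_vector_diff_chain_at[OF 1 2] by (simp add: o_def)
  qed
  have "(LBINT \<xi>=0..\<infinity>. exp (w * complex_of_real \<xi>)) = 0 - 1 / w"
  proof (rule interval_integral_FTC_integrable)
    show "((\<lambda>\<xi>. exp (w * complex_of_real \<xi>) / w) has_vector_derivative exp (w * complex_of_real \<xi>)) (at \<xi>)" for \<xi> by (rule d)
    show "isCont (\<lambda>\<xi>. exp (w * complex_of_real \<xi>)) \<xi>" for \<xi> by (intro continuous_intros)
    have "set_integrable lborel {0<..} (\<lambda>\<xi>. exp (- (\<xi> * 1)) :: real)" by (rule integrable_I0i_exp_mscale) simp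
    then have "set_integrable lborel {0<..} (\<lambda>\<xi>. exp (w * complex_of_real \<xi>))"
      unfolding set_integrable_def
      by (rule Bochner_Integration.integrable_bound) (auto simp: nw rw indicator_def intro!: borel_measurable_continuous_onI continuous_intros)
    moreover have "einterval 0 \<infinity> = {0<..}" by (auto simp: einterval_iff)
    ultimately show "set_integrable lborel (einterval 0 \<infinity>) (\<lambda>\<xi>. exp (w * complex_of_real \<xi>))" by simp
    have "((\<lambda>\<xi>. exp (w * complex_of_real \<xi>) / w) \<longlongrightarrow> exp (w * complex_of_real 0) / w) (at_right 0)"
      by (intro tendsto_intros) (use w in auto)
    then show "(((\<lambda>\<xi>. exp (w * complex_of_real \<xi>) / w) \<circ> real_of_ereal) \<longlongrightarrow> 1 / w) (at_right 0)"
      by (simp add: zero_ereal_def ereal_tendsto_simps)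
    have "((\<lambda>\<xi>. exp (- \<xi>)) \<longlongrightarrow> (0::real)) at_top"
      by (rule filterlim_compose[OF exp_at_bot filterlim_uminus_at_bot_at_top])
    then have "((\<lambda>\<xi>. exp (w * complex_of_real \<xi>)) \<longlongrightarrow> 0) at_top"
      by (rule Lim_null_comparison[rotated]) (simp add: nw rw)
    then have "((\<lambda>\<xi>. exp (w * complex_of_real \<xi>) / w) \<longlongrightarrow> 0 / w) at_top"
      by (intro tendsto_divide tendsto_const w)
    then show "(((\<lambda>\<xi>. exp (w * complex_of_real \<xi>) / w) \<circ> real_of_ereal) \<longlongrightarrow> 0) (at_left \<infinity>)"
      by (simp add: ereal_tendsto_simps)
  qed simp
  moreover have "(LBINT \<xi>=0..\<infinity>. exp (w * complex_of_real \<xi>)) = (LINT \<xi>|lborel. exp (\<i> * complex_of_real (x * \<xi>)) * complex_of_real (indicator {0<..} \<xi> * exp (- \<xi>)))"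
    unfolding interval_lebesgue_integral_0_infty set_lebesgue_integral_def w0
    by (intro Bochner_Integration.integral_cong) (auto simp: indicator_def)
  moreover have "- 1 / w = gQ x"
  proof -
    have "w = \<i> * (complex_of_real x + \<i>)" by (simp add: w_def algebra_simps)
    moreover have "\<i> * (\<i> * z) = - 1 * z" for z by (simp add: mult.assoc[symmetric])
    ultimately have "- 1 * (complex_of_real x + \<i>) = \<i> * w" by (simp only:)
    then show ?thesis unfolding gQ_def using w by (subst frac_eq_eq) simp_all
  qed
  ultimately show ?thesis by simp
qed

text \<open>Inverting the Laplace integral shows that the transform of \<open>gQ\<close> is an
  exponential on the positive half-line. This gives the Hardy property, and the norm of
  \<open>gQ\<close> determines the mass of \<open>Q\<close>.\<close>

lemma gQ_fourier:
  defines "F \<equiv> \<lambda>\<xi>. complex_of_real (sqrt (2 * pi) * (indicator {0<..} \<xi> * exp (- \<xi>)))"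
  shows "fourier_L2 gQ F" "(nrm gQ)\<^sup>2 = pi"
proof -
  have i1: "integrable lborel (\<lambda>\<xi>. indicator {0<..} \<xi> * exp (- \<xi>) :: real)"
    using integrable_I0i_exp_mscale[of 1] by (simp add: set_integrable_def)
  have i2: "has_bochner_integral lborel (\<lambda>\<xi>. indicator {0<..} \<xi> * exp (- (\<xi> * 2)) :: real) (1 / 2)"
    using integrable_I0i_exp_mscale[of 2] LBINT_I0i_exp_mscale[of 2]
    by (simp add: has_bochner_integral_iff set_integrable_def interval_lebesgue_integral_0_infty set_lebesgue_integral_def)
  have F1: "integrable lborel F" unfolding F_def using i1 by (intro integrable_of_real integrable_mult_right)
  have sq: "(cmod (F \<xi>))\<^sup>2 = 2 * pi * (indicator {0<..} \<xi> * exp (- (\<xi> * 2)))" for \<xi>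
  proof (cases "\<xi> > 0")
    case True
    have "(exp (- \<xi>))\<^sup>2 = exp (- (\<xi> * 2))" by (simp add: power2_eq_square exp_add[symmetric])
    then show ?thesis using True by (simp add: F_def norm_mult power_mult_distrib)
  qed (simp add: F_def)
  have F2: "L2 F" unfolding L2_def sq using i2 F1 by (auto simp: has_bochner_integral_iff)
  have "Fhat F (- x) = gQ x" for x
  proof -
    have e: "exp (- \<i> * complex_of_real (- x * \<xi>)) = exp (\<i> * complex_of_real (x * \<xi>))" for \<xi> by simp
    have "Fhat F (- x) = complex_of_real (1 / sqrt (2 * pi)) * (LINT \<xi>|lborel. complex_of_real (sqrt (2 * pi)) *
       (exp (\<i> * complex_of_real (x * \<xi>)) * complex_of_real (indicator {0<..} \<xi> * exp (- \<xi>))))"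
      unfolding Fhat_def F_def e of_real_mult[of "sqrt (2 * pi)"] by (simp only: mult.left_commute)
    also have "\<dots> = complex_of_real (1 / sqrt (2 * pi)) * (complex_of_real (sqrt (2 * pi)) * gQ x)"
      by (simp only: integral_mult_right_zero gQ_laplace)
    also have "\<dots> = complex_of_real (1 / sqrt (2 * pi) * sqrt (2 * pi)) * gQ x" by (simp only: of_real_mult mult.assoc)
    also have "\<dots> = gQ x" by simp
    finally show ?thesis .
  qed
  then show *: "fourier_L2 gQ F" using fourier_L2_of_integrable_transform[OF F1 F2] by simp
  have "(nrm F)\<^sup>2 = 2 * pi * (1 / 2)"
    unfolding nrm_sq sq using i2 by (simp add: has_bochner_integral_iff)
  then show "(nrm gQ)\<^sup>2 = pi" using fourier_L2_nrm[OF *] by simp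
qed

lemma gQ_hardy: "hardy gQ"
  by (rule hardyI[OF gQ_fourier(1)]) simp

lemma gQ_H1: "H1 gQ (\<lambda>x. \<i> * gQ x * gQ x)"
proof (rule H1_of_C1[OF gQ_deriv])
  have L: "L2 gQ" using gQ_hardy by simp
  then show "L2 gQ" .
  have "L2 (\<lambda>x. gQ x * gQ x)" by (rule L2_bounded_mult(1)[OF L L2_measurable[OF L] cmod_gQ_le])
  then show "L2 (\<lambda>x. \<i> * gQ x * gQ x)" using L2_cmult[of _ \<i>] by (simp add: mult.assoc)
qed (intro continuous_intros gQ_continuous)

text \<open>The derivative of \<open>Q\<close>, in the form dictated by the first-order
  system.\<close>

definition dQ :: "real \<Rightarrow> complex" where
  "dQ x = \<i> * gQ x * Q x"

lemma Q_H1: "H1 Q dQ"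
proof -
  have "Q = (\<lambda>x. - \<i> * complex_of_real (sqrt 2) * gQ x)" by (rule ext) (rule Q_eq_gQ)
  moreover have "dQ = (\<lambda>x. - \<i> * complex_of_real (sqrt 2) * (\<i> * gQ x * gQ x))" by (auto simp: dQ_def Q_eq_gQ)
  ultimately show ?thesis using H1_cmult[OF gQ_H1, of "- \<i> * complex_of_real (sqrt 2)"] by (simp only:)
qed

lemma nrm_Q: "(nrm Q)\<^sup>2 = 2 * pi"
proof -
  have "Q = (\<lambda>x. (- \<i> * complex_of_real (sqrt 2)) * gQ x)" by (rule ext) (rule Q_eq_gQ)
  then have "nrm Q = sqrt 2 * nrm gQ" using nrm_scale[of "- \<i> * complex_of_real (sqrt 2)" gQ] by (simp add: norm_mult)
  then show ?thesis using gQ_fourier(2) by (simp add: power_mult_distrib)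
qed

subsection \<open>Stability of the first-order system\<close>

text \<open>The pair \<^term>\<open>(Q, gQ)\<close> solves \<^term>\<open>v' = \<i> * g * v\<close>, \<^term>\<open>g' = \<i> * g * g\<close>. 
  For general \<^term>\<open>v\<close>, \<^term>\<open>g\<close> is the Szego projection of \<^term>\<open>v * cnj v\<close>.\<close>

definition szego_pair :: "(real \<Rightarrow> complex) \<Rightarrow> (real \<Rightarrow> complex) \<Rightarrow> (real \<Rightarrow> complex) \<Rightarrow> (real \<Rightarrow> complex) \<Rightarrow> bool" where
  "szego_pair v v' g g' \<longleftrightarrow> H1 v v' \<and> H1 g g' \<and> hardy g \<and> (\<forall>x. g x + cnj (g x) = v x * cnj (v x))"

definition residual :: "(real \<Rightarrow> complex) \<Rightarrow> (real \<Rightarrow> complex) \<Rightarrow> (real \<Rightarrow> complex) \<Rightarrow> real \<Rightarrow> complex" where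
  "residual v v' g x = v' x - \<i> * g x * v x"

lemma szego_pair_Q: "szego_pair Q dQ gQ (\<lambda>x. \<i> * gQ x * gQ x)"
  using Q_H1 gQ_H1 gQ_hardy gQ_add_cnj by (simp add: szego_pair_def)

lemma residual_L2:
  assumes "szego_pair v v' g g'" shows "L2 (residual v v' g)"
proof -
  have H: "H1 v v'" "H1 g g'" using assms by (auto simp: szego_pair_def)
  show ?thesis unfolding residual_def
    using L2_diff[OF H1_L2(2)[OF H(1)] L2_cmult[OF L2_mult_H1(1)[OF H(2) H1_L2(1)[OF H(1)]], of \<i>]] by (simp add: mult.assoc)
qed

text \<open>\<open>d\<close> and \<open>cnj d\<close> are orthogonal, so the squared norm of their
  sum is twice that of \<open>d\<close>.\<close>

lemma nrm_hardy_le_real_part: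
  assumes "hardy d" shows "nrm d \<le> nrm (\<lambda>x. d x + cnj (d x))"
proof -
  have "(nrm (\<lambda>x. d x + cnj (d x)))\<^sup>2 = 2 * (nrm d)\<^sup>2"
    using assms nrm_add_sq[of d "\<lambda>x. cnj (d x)"] hardy_ip_cnj[OF assms assms] by simp
  then have "(nrm d)\<^sup>2 \<le> (nrm (\<lambda>x. d x + cnj (d x)))\<^sup>2" by simp
  then show ?thesis by (rule power2_le_imp_le) simp
qed

text \<open>The defect \<open>g' - \<i> * g * g\<close> is Hardy, so its real part suffices.
  Differentiating \<open>g + cnj g = v * cnj v\<close> and inserting
  \<open>v' = \<i> * g * v\<close> plus the residual, the quadratic terms in \<open>g\<close> cancel
  and only products of \<open>v\<close> with the residual remain.\<close>

lemma riccati_defect: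
  assumes p: "szego_pair v v' g g'" and B: "\<And>x. cmod (v x) \<le> B"
  shows "L2 (\<lambda>x. g' x - \<i> * g x * g x)" "nrm (\<lambda>x. g' x - \<i> * g x * g x) \<le> 2 * B * nrm (residual v v' g)"
proof -
  have H: "H1 v v'" "H1 g g'" "hardy g" and sum: "\<And>x. g x + cnj (g x) = v x * cnj (v x)" using p by (auto simp: szego_pair_def)
  let ?h = "\<lambda>x. g' x - \<i> * g x * g x" and ?r = "residual v v' g"
  note r = residual_L2[OF p]
  have "hardy (\<lambda>x. g' x - \<i> * (g x * g x))"
    by (intro hardy_diff hardy_cmult hardy_mult_H1(1)[OF H(3) H(3) H(2)] hardy_deriv[OF H(3,2)])
  then have h: "hardy ?h" by (simp add: mult.assoc)
  then show hL: "L2 ?h" by simp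
  have "(\<lambda>x. g x + cnj (g x)) = (\<lambda>x. v x * cnj (v x))" using sum by auto
  then have ae: "AE x in lborel. g' x + cnj (g' x) = rho_deriv v v' x"
    using H1_deriv_unique[OF H1_add[OF H(2) H1_cnj[OF H(2)]]] rho_H1[OF H(1)] by simp
  have ae': "AE x in lborel. ?h x + cnj (?h x) = cnj (v x) * ?r x + v x * cnj (?r x)"
    using ae
  proof eventually_elim
    case (elim x)
    have "\<i> * g x * (v x * cnj (v x)) - \<i> * cnj (g x) * (v x * cnj (v x)) = \<i> * g x * g x - \<i> * cnj (g x) * cnj (g x)"
      by (simp add: sum[symmetric] algebra_simps)
    then show ?case using elim by (simp add: residual_def rho_deriv_def algebra_simps)
  qed
  have vm: "v \<in> borel_measurable borel" "(\<lambda>x. cnj (v x)) \<in> borel_measurable borel" using H1_measurable[OF H(1)] by auto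
  have L: "L2 (\<lambda>x. cnj (v x) * ?r x)" "L2 (\<lambda>x. v x * cnj (?r x))"
    using L2_bounded_mult(1)[OF r vm(2), of B] L2_bounded_mult(1)[OF L2_cnj[OF r] vm(1), of B] B by auto
  have "nrm ?h \<le> nrm (\<lambda>x. ?h x + cnj (?h x))" by (rule nrm_hardy_le_real_part[OF h])
  also have "\<dots> = nrm (\<lambda>x. cnj (v x) * ?r x + v x * cnj (?r x))"
    by (rule nrm_cong_AE[OF _ _ ae']) (intro L2_measurable L2_add L2_cnj hL L)+
  also have "\<dots> \<le> nrm (\<lambda>x. cnj (v x) * ?r x) + nrm (\<lambda>x. v x * cnj (?r x))" by (rule nrm_triangle[OF L])
  also have "\<dots> \<le> B * nrm ?r + B * nrm (\<lambda>x. cnj (?r x))"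
    using nrm_bounded_mult(1)[OF r vm(2), of B] nrm_bounded_mult(1)[OF L2_cnj[OF r] vm(1), of B] B by (intro add_mono) auto
  finally show "nrm ?h \<le> 2 * B * nrm ?r" by simp
qed

text \<open>The difference of the two projections is Hardy, and twice its real part is
  \<open>v * cnj v - w * cnj w\<close>.\<close>

lemma szego_pair_diff:
  assumes p: "szego_pair v v' g g'" "szego_pair w w' f f'" and B: "\<And>x. cmod (v x) \<le> B" "\<And>x. cmod (w x) \<le> C"
  shows "nrm (\<lambda>x. g x - f x) \<le> (B + C) * nrm (\<lambda>x. v x - w x)"
proof -
  have H: "H1 v v'" "H1 g g'" "hardy g" "H1 w w'" "H1 f f'" "hardy f" 
    and sum: "\<And>x. g x + cnj (g x) = v x * cnj (v x)" "\<And>x. f x + cnj (f x) = w x * cnj (w x)" using p by (auto simp: szego_pair_def)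
  have L: "L2 (\<lambda>x. v x - w x)" using H1_L2(1)[OF H(1)] H1_L2(1)[OF H(4)] by auto
  have m: "v \<in> borel_measurable borel" "(\<lambda>x. cnj (w x)) \<in> borel_measurable borel" using H1_measurable[OF H(1)] H1_measurable[OF H(4)] by auto
  have L': "L2 (\<lambda>x. v x * cnj (v x - w x))" "L2 (\<lambda>x. cnj (w x) * (v x - w x))"
    using L2_bounded_mult(1)[OF L2_cnj[OF L] m(1) B(1)] L2_bounded_mult(1)[OF L m(2), of C] B(2) by auto
  have "nrm (\<lambda>x. g x - f x) \<le> nrm (\<lambda>x. (g x - f x) + cnj (g x - f x))"
    by (rule nrm_hardy_le_real_part[OF hardy_diff[OF H(3,6)]])
  also have "(\<lambda>x. (g x - f x) + cnj (g x - f x)) = (\<lambda>x. v x * cnj (v x - w x) + cnj (w x) * (v x - w x))"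
  proof
    fix x show "(g x - f x) + cnj (g x - f x) = v x * cnj (v x - w x) + cnj (w x) * (v x - w x)"
      using sum[of x] by (simp add: algebra_simps)
  qed
  also have "nrm \<dots> \<le> nrm (\<lambda>x. v x * cnj (v x - w x)) + nrm (\<lambda>x. cnj (w x) * (v x - w x))" by (rule nrm_triangle[OF L'])
  also have "\<dots> \<le> B * nrm (\<lambda>x. cnj (v x - w x)) + C * nrm (\<lambda>x. v x - w x)"
    using nrm_bounded_mult(1)[OF L2_cnj[OF L] m(1) B(1)] nrm_bounded_mult(1)[OF L m(2), of C] B(2) by (intro add_mono) auto
  also have "nrm (\<lambda>x. cnj (v x - w x)) = nrm (\<lambda>x. v x - w x)" by (rule nrm_cnj)
  finally show ?thesis by (simp add: algebra_simps)
qed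

text \<open>The residual vanishes at \<open>Q\<close>, so what is estimated is the change of the
  product \<open>g * v\<close> from its value at \<open>Q\<close>.\<close>

lemma residual_vs_deriv:
  assumes p: "szego_pair v v' g g'" and B: "\<And>x. cmod (v x) \<le> B" "\<And>x. cmod (g x) \<le> G"
  shows "nrm (\<lambda>x. residual v v' g x - (v' x - dQ x)) \<le> (G + 2 * (B + 2)) * nrm (\<lambda>x. v x - Q x)"
proof -
  have H: "H1 v v'" "H1 g g'" using p by (auto simp: szego_pair_def)
  have L: "L2 (\<lambda>x. v x - Q x)" "L2 (\<lambda>x. g x - gQ x)" using H1_L2(1)[OF H(1)] H1_L2(1)[OF Q_H1] H1_L2(1)[OF H(2)] H1_L2(1)[OF gQ_H1] by auto
  have m: "g \<in> borel_measurable borel" "Q \<in> borel_measurable borel" using H1_measurable[OF H(2)] H1_measurable[OF Q_H1] by auto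
  have eq: "(\<lambda>x. residual v v' g x - (v' x - dQ x)) = (\<lambda>x. - \<i> * (g x * (v x - Q x) + Q x * (g x - gQ x)))"
    by (auto simp: residual_def dQ_def algebra_simps)
  have "nrm (\<lambda>x. residual v v' g x - (v' x - dQ x)) = nrm (\<lambda>x. g x * (v x - Q x) + Q x * (g x - gQ x))"
    unfolding eq nrm_scale by simp
  also have "\<dots> \<le> nrm (\<lambda>x. g x * (v x - Q x)) + nrm (\<lambda>x. Q x * (g x - gQ x))"
    by (rule nrm_triangle[OF L2_bounded_mult(1)[OF L(1) m(1) B(2)] L2_bounded_mult(1)[OF L(2) m(2) cmod_Q_le]])
  also have "\<dots> \<le> G * nrm (\<lambda>x. v x - Q x) + 2 * nrm (\<lambda>x. g x - gQ x)"
    by (rule add_mono[OF nrm_bounded_mult(1)[OF L(1) m(1) B(2)] nrm_bounded_mult(1)[OF L(2) m(2) cmod_Q_le]])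
  also have "\<dots> \<le> G * nrm (\<lambda>x. v x - Q x) + 2 * ((B + 2) * nrm (\<lambda>x. v x - Q x))"
    using szego_pair_diff[OF p szego_pair_Q B(1) cmod_Q_le] by (intro add_left_mono mult_left_mono) auto
  finally show ?thesis by (simp add: algebra_simps)
qed

text \<open>The maximum of \<^term>\<open>cmod (f x)\<close> against the weight \<^term>\<open>exp (2 * G * \<bar>x - p\<bar>)\<close> 
  absorbs the integral term.\<close>

lemma H1_gronwall:
  assumes f: "H1 f f'" "f p = 0" and S: "S \<ge> 0" and G: "G > 0"
    and ode: "AE x in lborel. cmod (f' x) \<le> G * cmod (f x) + k x"
    and k: "set_integrable lborel {p - S..p + S} k" "\<And>x. 0 \<le> k x" "(LINT x:{p - S..p + S}|lborel. k x) \<le> K"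
    and x: "\<bar>x - p\<bar> \<le> S"
  shows "cmod (f x) \<le> 2 * K * exp (2 * G * S)"
proof -
  have cont: "continuous_on A f" for A by (rule H1_continuous_on[OF f(1)])
  let ?J = "{p - S..p + S}"
  \<comment> \<open>The rate is twice \<open>G\<close>, so that integrating \<open>G\<close> times
    the weight returns only half of its end value; that half can be absorbed on the left.\<close>
  define m where "m x = cmod (f x) * exp (- (2 * G * \<bar>x - p\<bar>))" for x
  have "continuous_on ?J m" unfolding m_def by (intro continuous_intros cont)
  then obtain y where y: "y \<in> ?J" "\<And>x. x \<in> ?J \<Longrightarrow> m x \<le> m y"
    using continuous_attains_sup[of ?J m] S by auto
  have bd: "cmod (f x) \<le> m y * exp (2 * G * \<bar>x - p\<bar>)" if "x \<in> ?J" for x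
    using y(2)[OF that] by (simp add: m_def exp_minus field_simps)
  have m0: "0 \<le> m y" by (simp add: m_def)
  define a where "a = min y p"
  define b where "b = max y p"
  have ab: "a \<le> b" "{a..b} \<subseteq> ?J" using y(1) S by (auto simp: a_def b_def)
  have H: "((\<lambda>x. exp (2 * G * \<bar>x - p\<bar>)) has_integral (exp (2 * G * \<bar>y - p\<bar>) - 1) / (2 * G)) {a..b}"
  proof (cases "p \<le> y")
    case True
    have "((\<lambda>x. exp (2 * G * (x - p))) has_integral exp (2 * G * (y - p)) / (2 * G) - exp (2 * G * (p - p)) / (2 * G)) {p..y}"
      by (rule fundamental_theorem_of_calculus[OF True])
         (use G in \<open>auto intro!: derivative_eq_intros simp flip: has_real_derivative_iff_has_vector_derivative\<close>)
    then have "((\<lambda>x. exp (2 * G * \<bar>x - p\<bar>)) has_integral exp (2 * G * (y - p)) / (2 * G) - exp (2 * G * (p - p)) / (2 * G)) {p..y}"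
      by (rule has_integral_eq[rotated]) simp
    then show ?thesis using True by (simp add: a_def b_def diff_divide_distrib)
  next
    case False
    have "((\<lambda>x. exp (2 * G * (p - x))) has_integral - exp (2 * G * (p - p)) / (2 * G) - - exp (2 * G * (p - y)) / (2 * G)) {y..p}"
      by (rule fundamental_theorem_of_calculus)
         (use G False in \<open>auto intro!: derivative_eq_intros simp flip: has_real_derivative_iff_has_vector_derivative\<close>)
    then have "((\<lambda>x. exp (2 * G * \<bar>x - p\<bar>)) has_integral - exp (2 * G * (p - p)) / (2 * G) - - exp (2 * G * (p - y)) / (2 * G)) {y..p}"
      by (rule has_integral_eq[rotated]) simp
    then show ?thesis using False by (simp add: a_def b_def diff_divide_distrib)
  qed
  have wint: "set_integrable lborel {a..b} (\<lambda>x. exp (2 * G * \<bar>x - p\<bar>))"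
    by (rule borel_integrable_atLeastAtMost') (intro continuous_intros)
  then have wI: "(LINT x:{a..b}|lborel. exp (2 * G * \<bar>x - p\<bar>)) = (exp (2 * G * \<bar>y - p\<bar>) - 1) / (2 * G)"
    using set_borel_integral_eq_integral(2)[OF wint] H by (simp add: integral_unique)
  have kint: "set_integrable lborel {a..b} k" by (rule set_integrable_subset[OF k(1) _ ab(2)]) simp
  have kI: "(LINT x:{a..b}|lborel. k x) \<le> K"
  proof -
    have "(LINT x:{a..b}|lborel. k x) \<le> (LINT x:?J|lborel. k x)"
      using k(1) kint unfolding set_lebesgue_integral_def set_integrable_def
      by (intro integral_mono) (use k(2) ab(2) in \<open>auto simp: indicator_def\<close>)
    then show ?thesis using k(3) by linarith
  qed
  have "cmod (f y) = cmod (f b - f a)" using f(2) by (auto simp: a_def b_def min_def max_def norm_minus_commute)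
  also have "\<dots> = cmod (LINT x:{a..b}|lborel. f' x)" using H1_diff_eq[OF f(1) ab(1)] by simp
  also have "\<dots> \<le> (LINT x:{a..b}|lborel. cmod (f' x))"
    by (rule set_integral_norm_bound[OF L2_set_integrable[OF H1_L2(2)[OF f(1)]]])
  also have "\<dots> \<le> (LINT x:{a..b}|lborel. (G * m y) * exp (2 * G * \<bar>x - p\<bar>) + k x)"
  proof (rule set_integral_mono_AE)
    show "set_integrable lborel {a..b} (\<lambda>x. cmod (f' x))"
      by (rule set_integrable_norm[OF L2_set_integrable[OF H1_L2(2)[OF f(1)]]])
    show "set_integrable lborel {a..b} (\<lambda>x. (G * m y) * exp (2 * G * \<bar>x - p\<bar>) + k x)"
      by (intro set_integral_add(1) kint set_integrable_mult_right wint)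
    show "AE x\<in>{a..b} in lborel. cmod (f' x) \<le> (G * m y) * exp (2 * G * \<bar>x - p\<bar>) + k x"
      using ode
    proof eventually_elim
      case (elim x)
      show ?case
      proof
        assume "x \<in> {a..b}"
        then have "G * cmod (f x) \<le> G * (m y * exp (2 * G * \<bar>x - p\<bar>))" using bd ab(2) G by (intro mult_left_mono) auto
        then show "cmod (f' x) \<le> (G * m y) * exp (2 * G * \<bar>x - p\<bar>) + k x" using elim by (simp add: mult.assoc)
      qed
    qed
  qed
  also have "\<dots> = G * m y * ((exp (2 * G * \<bar>y - p\<bar>) - 1) / (2 * G)) + (LINT x:{a..b}|lborel. k x)"
    using wint kint wI by (simp add: set_integral_add)
  also have "\<dots> \<le> m y * (exp (2 * G * \<bar>y - p\<bar>) - 1) / 2 + K" using kI G by simp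
  finally have 1: "cmod (f y) \<le> m y * (exp (2 * G * \<bar>y - p\<bar>) - 1) / 2 + K" .
  have 2: "cmod (f y) = m y * exp (2 * G * \<bar>y - p\<bar>)" by (simp add: m_def exp_minus field_simps)
  have K0: "0 \<le> K" 
  proof -
    have "0 \<le> (LINT x:?J|lborel. k x)" unfolding set_lebesgue_integral_def using k(2) by (intro Bochner_Integration.integral_nonneg) auto
    then show ?thesis using k(3) by linarith
  qed
  have "m y \<le> m y * exp (2 * G * \<bar>y - p\<bar>)" using m0 G mult_left_mono[of 1 "exp (2 * G * \<bar>y - p\<bar>)" "m y"] by simp
  then have "m y \<le> cmod (f y)" unfolding 2 .
  moreover have "m y * (exp (2 * G * \<bar>y - p\<bar>) - 1) / 2 = (cmod (f y) - m y) / 2" unfolding 2 by (simp only: right_diff_distrib mult_1_right)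
  then have "cmod (f y) \<le> (cmod (f y) - m y) / 2 + K" using 1 by (simp only:)
  ultimately have mK: "m y \<le> 2 * K" using m0 by (simp add: field_simps)
  have "cmod (f x) \<le> m y * exp (2 * G * \<bar>x - p\<bar>)" using bd x by (auto simp: abs_le_iff)
  also have "\<dots> \<le> 2 * K * exp (2 * G * S)" using mK m0 x G K0 by (intro mult_mono) auto
  finally show ?thesis .
qed

text \<open>The equation for \<open>g - gQ\<close> is closed up to the Riccati defect, so it is
  estimated before \<open>v - Q\<close>. The latter satisfies a linear equation in which the
  difference of the \<open>g\<close> components acts as a forcing term.\<close>

lemma szego_pair_pointwise:
  assumes R: "R \<ge> 0" "P \<ge> 0" and B: "B \<ge> 0" and G: "G \<ge> 0"
  obtains K where "K \<ge> 0" "\<And>v v' g g' p x. szego_pair v v' g g' \<Longrightarrow> (\<And>x. cmod (v x) \<le> B) \<Longrightarrow> (\<And>x. cmod (g x) \<le> G)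
     \<Longrightarrow> \<bar>p\<bar> \<le> P \<Longrightarrow> g p = gQ p \<Longrightarrow> v p = Q p \<Longrightarrow> \<bar>x\<bar> \<le> R \<Longrightarrow> cmod (v x - Q x) \<le> K * nrm (residual v v' g)"
proof -
  \<comment> \<open>An interval of this radius about \<open>p\<close> contains all of
    \<open>[-R, R]\<close>, whatever the position of \<open>p\<close>.\<close>
  define S where "S = R + P"
  define E where "E = exp (2 * (G + 1) * S)"
  define D where "D = 2 * (sqrt (2 * S) * (2 * B)) * E"
  define K where "K = 2 * (2 * S * (2 * D) + sqrt (2 * S)) * E"
  have S: "S \<ge> 0" using R by (simp add: S_def)
  have D: "D \<ge> 0" using B S by (simp add: D_def E_def)
  have K: "K \<ge> 0" using D S by (simp add: K_def E_def)
  show ?thesis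
  proof (rule that[OF K])
    fix v v' g g' p x
    assume sp: "szego_pair v v' g g'" and vB: "\<And>x. cmod (v x) \<le> B" and gG: "\<And>x. cmod (g x) \<le> G"
      and p: "\<bar>p\<bar> \<le> P" "g p = gQ p" "v p = Q p" and x: "\<bar>x\<bar> \<le> R"
    have H: "H1 v v'" "H1 g g'" using sp by (auto simp: szego_pair_def)
    define e where "e = nrm (residual v v' g)"
    have e0: "e \<ge> 0" by (simp add: e_def)
    note h = riccati_defect[OF sp vB]
    note r = residual_L2[OF sp]
    have kb: "(LINT x:{p - S..p + S}|lborel. cmod (f x)) \<le> sqrt (2 * S) * nrm f" if "L2 f" for f
      using L2_set_integral_bound(2)[OF that, of "p - S" "p + S"] S by simp
    have d: "cmod (g y - gQ y) \<le> D * e" if y: "\<bar>y - p\<bar> \<le> S" for y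
    proof -
      have "cmod (g y - gQ y) \<le> 2 * (sqrt (2 * S) * (2 * B * e)) * exp (2 * (G + 1) * S)"
      proof (rule H1_gronwall[OF H1_diff[OF H(2) gQ_H1] _ S, where p=p and k="\<lambda>x. cmod (g' x - \<i> * g x * g x)"])
        show "AE x in lborel. cmod (g' x - \<i> * gQ x * gQ x) \<le> (G + 1) * cmod (g x - gQ x) + cmod (g' x - \<i> * g x * g x)"
        proof (rule AE_I2)
          fix x 
          have "g' x - \<i> * gQ x * gQ x = \<i> * (g x + gQ x) * (g x - gQ x) + (g' x - \<i> * g x * g x)" by (simp add: algebra_simps)
          also have "cmod \<dots> \<le> cmod (\<i> * (g x + gQ x) * (g x - gQ x)) + cmod (g' x - \<i> * g x * g x)" by (rule norm_triangle_ineq)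
          also have "cmod (\<i> * (g x + gQ x) * (g x - gQ x)) \<le> (G + 1) * cmod (g x - gQ x)"
            unfolding norm_mult using norm_triangle_ineq[of "g x" "gQ x"] gG[of x] cmod_gQ_le[of x] by (intro mult_right_mono) auto
          finally show "cmod (g' x - \<i> * gQ x * gQ x) \<le> (G + 1) * cmod (g x - gQ x) + cmod (g' x - \<i> * g x * g x)" by simp
        qed
        show "(LINT x:{p - S..p + S}|lborel. cmod (g' x - \<i> * g x * g x)) \<le> sqrt (2 * S) * (2 * B * e)"
          using kb[OF h(1)] h(2) S unfolding e_def by (meson mult_left_mono order_trans real_sqrt_ge_zero mult_nonneg_nonneg zero_le_numeral)
        show "set_integrable lborel {p - S..p + S} (\<lambda>x. cmod (g' x - \<i> * g x * g x))"
          by (rule set_integrable_norm[OF L2_set_integrable[OF h(1)]])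
      qed (use p G y in auto)
      then show ?thesis by (simp only: D_def E_def mult_ac)
    qed
    have xp: "\<bar>x - p\<bar> \<le> S" using x p(1) by (simp add: S_def)
    have "cmod (v x - Q x) \<le> 2 * ((2 * S * (2 * D) + sqrt (2 * S)) * e) * exp (2 * (G + 1) * S)"
    proof (rule H1_gronwall[OF H1_diff[OF H(1) Q_H1] _ S, where p=p and k="\<lambda>x. 2 * cmod (g x - gQ x) + cmod (residual v v' g x)"])
      show "AE x in lborel. cmod (v' x - dQ x) \<le> (G + 1) * cmod (v x - Q x) + (2 * cmod (g x - gQ x) + cmod (residual v v' g x))"
      proof (rule AE_I2)
        fix x
        have "v' x - dQ x = \<i> * g x * (v x - Q x) + (\<i> * (g x - gQ x) * Q x + residual v v' g x)"
          by (simp add: residual_def dQ_def algebra_simps)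
        also have "cmod \<dots> \<le> cmod (\<i> * g x * (v x - Q x)) + (cmod (\<i> * (g x - gQ x) * Q x) + cmod (residual v v' g x))"
          by (intro order_trans[OF norm_triangle_ineq] add_left_mono norm_triangle_ineq)
        also have "cmod (\<i> * g x * (v x - Q x)) \<le> (G + 1) * cmod (v x - Q x)"
          unfolding norm_mult using gG[of x] by (intro mult_right_mono) auto
        also have "cmod (\<i> * (g x - gQ x) * Q x) \<le> 2 * cmod (g x - gQ x)"
          unfolding norm_mult using mult_left_mono[OF cmod_Q_le[of x], of "cmod (g x - gQ x)"] by simp
        finally show "cmod (v' x - dQ x) \<le> (G + 1) * cmod (v x - Q x) + (2 * cmod (g x - gQ x) + cmod (residual v v' g x))" by simp
      qed
      have i1: "set_integrable lborel {p - S..p + S} (\<lambda>x. 2 * cmod (g x - gQ x))"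
        by (intro borel_integrable_atLeastAtMost' continuous_intros gQ_continuous H1_continuous_on[OF H(2)])
      have i2: "set_integrable lborel {p - S..p + S} (\<lambda>x. cmod (residual v v' g x))"
        by (rule set_integrable_norm[OF L2_set_integrable[OF r]])
      show "set_integrable lborel {p - S..p + S} (\<lambda>x. 2 * cmod (g x - gQ x) + cmod (residual v v' g x))"
        by (rule set_integral_add(1)[OF i1 i2])
      have "(LINT x:{p - S..p + S}|lborel. 2 * cmod (g x - gQ x)) \<le> (LINT x:{p - S..p + S}|lborel. 2 * (D * e))"
      proof (rule set_integral_mono[OF i1])
        show "set_integrable lborel {p - S..p + S} (\<lambda>x. 2 * (D * e))" by (intro borel_integrable_atLeastAtMost' continuous_intros)
        fix y assume "y \<in> {p - S..p + S}"
        then show "2 * cmod (g y - gQ y) \<le> 2 * (D * e)" using d[of y] by (auto simp: abs_le_iff)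
      qed
      also have "\<dots> = 2 * S * (2 * (D * e))" using S by (simp add: set_lebesgue_integral_def)
      finally show "(LINT x:{p - S..p + S}|lborel. 2 * cmod (g x - gQ x) + cmod (residual v v' g x)) \<le> (2 * S * (2 * D) + sqrt (2 * S)) * e"
        using set_integral_add(2)[OF i1 i2] kb[OF r] by (simp add: e_def algebra_simps)
    qed (use p G xp in auto)
    then show "cmod (v x - Q x) \<le> K * nrm (residual v v' g)" by (simp add: K_def E_def e_def algebra_simps)
  qed
qed

text \<open>The squared norm of \<open>v - Q\<close> is the mass difference minus twice the real
  part of \<open>ip (v - Q) Q\<close>. The inner product needs control of \<open>v\<close> only
  where \<open>Q\<close> has mass: pointwise closeness covers a bounded interval, and outside it the
  tail of \<open>Q\<close> is small.\<close>

theorem szego_pair_L2_close: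
  assumes \<epsilon>: "\<epsilon> > 0" and P: "P \<ge> 0" and B: "B \<ge> 0" and G: "G \<ge> 0"
  obtains \<delta> where "\<delta> > 0" "\<And>v v' g g' p. szego_pair v v' g g' \<Longrightarrow> (\<And>x. cmod (v x) \<le> B) \<Longrightarrow> (\<And>x. cmod (g x) \<le> G)
     \<Longrightarrow> \<bar>p\<bar> \<le> P \<Longrightarrow> g p = gQ p \<Longrightarrow> v p = Q p \<Longrightarrow> nrm (residual v v' g) < \<delta> \<Longrightarrow> (nrm v)\<^sup>2 < 2 * pi + \<delta> \<Longrightarrow> nrm (\<lambda>x. v x - Q x) < \<epsilon>"
proof -
  have LQ: "L2 Q" using Q_H1 by (rule H1_L2)
  define M where "M = nrm Q + sqrt (2 * pi + 1)"
  have M: "M > 0" unfolding M_def by (intro add_nonneg_pos) (auto intro: add_pos_pos)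
  have "0 < \<epsilon>\<^sup>2 / (8 * M)" using M \<epsilon> by simp
  from order_tendstoD(2)[OF L2_trunc_tendsto[OF LQ filterlim_real_sequentially] this]
  obtain n :: nat where n: "nrm (\<lambda>x. indicator {- real n..real n} x * Q x - Q x) < \<epsilon>\<^sup>2 / (8 * M)"
    using eventually_happens'[OF sequentially_bot] by blast
  define R where "R = real n"
  obtain K where K: "K \<ge> 0" "\<And>v v' g g' p x. szego_pair v v' g g' \<Longrightarrow> (\<And>x. cmod (v x) \<le> B) \<Longrightarrow> (\<And>x. cmod (g x) \<le> G)
     \<Longrightarrow> \<bar>p\<bar> \<le> P \<Longrightarrow> g p = gQ p \<Longrightarrow> v p = Q p \<Longrightarrow> \<bar>x\<bar> \<le> R \<Longrightarrow> cmod (v x - Q x) \<le> K * nrm (residual v v' g)"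
    using szego_pair_pointwise[of R P B G] P B G by (auto simp: R_def)
  define C where "C = K * sqrt (2 * R) * nrm Q"
  have C: "C \<ge> 0" using K(1) by (simp add: C_def R_def)
  \<comment> \<open>The small mass excess contributes \<open>\<delta>\<close>, the bounded interval
    twice \<open>C * \<delta>\<close>, and the tail a quarter of the squared tolerance.\<close>
  define \<delta> where "\<delta> = min 1 (\<epsilon>\<^sup>2 / (4 * (1 + 2 * C)))"
  have \<delta>: "\<delta> > 0" "\<delta> \<le> 1" "\<delta> * (1 + 2 * C) \<le> \<epsilon>\<^sup>2 / 4"
  proof -
    show "\<delta> > 0" using \<epsilon> C by (auto simp: \<delta>_def intro!: divide_pos_pos add_pos_nonneg)
    have "\<delta> * (1 + 2 * C) \<le> \<epsilon>\<^sup>2 / (4 * (1 + 2 * C)) * (1 + 2 * C)" using C by (intro mult_right_mono) (auto simp: \<delta>_def)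
    also have "\<dots> = \<epsilon>\<^sup>2 / 4" using C by (simp add: field_simps)
    finally show "\<delta> * (1 + 2 * C) \<le> \<epsilon>\<^sup>2 / 4" .
  qed (simp add: \<delta>_def)
  show ?thesis
  proof (rule that[OF \<delta>(1)])
    fix v v' g g' p
    assume sp: "szego_pair v v' g g'" and vB: "\<And>x. cmod (v x) \<le> B" and gG: "\<And>x. cmod (g x) \<le> G"
      and p: "\<bar>p\<bar> \<le> P" "g p = gQ p" "v p = Q p" and small: "nrm (residual v v' g) < \<delta>" "(nrm v)\<^sup>2 < 2 * pi + \<delta>"
    have Lv: "L2 v" using sp by (auto simp: szego_pair_def H1_def)
    let ?d = "\<lambda>x. v x - Q x" and ?i = "\<lambda>x. indicator {- R..R} x :: complex"
    have Ld: "L2 ?d" using Lv LQ by simp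
    have LT: "L2 (\<lambda>x. ?i x * Q x)" "L2 (\<lambda>x. ?i x * ?d x)" by (rule L2_trunc[OF LQ] L2_trunc[OF Ld])+
    have near: "nrm (\<lambda>x. ?i x * ?d x) \<le> K * \<delta> * sqrt (2 * R)"
    proof -
      have n1: "nrm (\<lambda>x. 1 * ?i x) \<le> sqrt (2 * R)"
      proof -
        have "(LINT x|lborel. (cmod (1 * ?i x))\<^sup>2) = (LINT x|lborel. indicator {-R..R} x)"
          by (intro Bochner_Integration.integral_cong) (auto simp: indicator_def)
        then show ?thesis by (simp add: nrm_def R_def)
      qed
      have "nrm (\<lambda>x. ?i x * ?d x) \<le> (K * \<delta>) * nrm (\<lambda>x. 1 * ?i x)"
      proof (rule nrm_mono[OF L2_const_on_interval L2_measurable[OF LT(2)]])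
        show "AE x in lborel. cmod (?i x * ?d x) \<le> K * \<delta> * cmod (1 * ?i x)"
        proof (rule AE_I2)
          fix x show "cmod (?i x * ?d x) \<le> K * \<delta> * cmod (1 * ?i x)"
          proof (cases "x \<in> {-R..R}")
            case True
            then have "cmod (?d x) \<le> K * nrm (residual v v' g)" by (intro K(2)[OF sp vB gG p]) auto
            also have "\<dots> \<le> K * \<delta>" using small(1) K(1) by (intro mult_left_mono) auto
            finally show ?thesis using True by simp
          qed simp
        qed
      qed (use K(1) \<delta>(1) in auto)
      also have "\<dots> \<le> K * \<delta> * sqrt (2 * R)" using n1 K(1) \<delta>(1) by (intro mult_left_mono) auto
      finally show ?thesis .
    qed
    have nv: "nrm v \<le> sqrt (2 * pi + 1)" using small(2) \<delta>(2) by (intro real_le_rsqrt) auto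
    have nd: "nrm ?d \<le> M" using nrm_triangle_diff[OF Lv LQ] nv by (simp add: M_def)
    have "ip ?d Q = ip ?d (\<lambda>x. ?i x * Q x) - ip ?d (\<lambda>x. ?i x * Q x - Q x)" using Ld LT(1) LQ by simp
    also have "ip ?d (\<lambda>x. ?i x * Q x) = ip (\<lambda>x. ?i x * ?d x) Q"
      unfolding ip_def by (intro Bochner_Integration.integral_cong) (auto simp: indicator_def)
    finally have "cmod (ip ?d Q) \<le> cmod (ip (\<lambda>x. ?i x * ?d x) Q) + cmod (ip ?d (\<lambda>x. ?i x * Q x - Q x))"
      by (metis norm_triangle_ineq4)
    also have "\<dots> \<le> K * \<delta> * sqrt (2 * R) * nrm Q + M * (\<epsilon>\<^sup>2 / (8 * M))"
    proof (rule add_mono)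
      have "cmod (ip (\<lambda>x. ?i x * ?d x) Q) \<le> nrm (\<lambda>x. ?i x * ?d x) * nrm Q" by (rule cauchy_schwarz[OF LT(2) LQ])
      also have "\<dots> \<le> K * \<delta> * sqrt (2 * R) * nrm Q" by (rule mult_right_mono[OF near]) simp
      finally show "cmod (ip (\<lambda>x. ?i x * ?d x) Q) \<le> K * \<delta> * sqrt (2 * R) * nrm Q" .
      have "cmod (ip ?d (\<lambda>x. ?i x * Q x - Q x)) \<le> nrm ?d * nrm (\<lambda>x. ?i x * Q x - Q x)" by (rule cauchy_schwarz[OF Ld L2_diff[OF LT(1) LQ]])
      also have "\<dots> \<le> M * (\<epsilon>\<^sup>2 / (8 * M))" using nd n M unfolding R_def by (intro mult_mono) auto
      finally show "cmod (ip ?d (\<lambda>x. ?i x * Q x - Q x)) \<le> M * (\<epsilon>\<^sup>2 / (8 * M))" .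
    qed
    also have "\<dots> = C * \<delta> + \<epsilon>\<^sup>2 / 8" using M by (simp add: C_def)
    finally have ipb: "cmod (ip ?d Q) \<le> C * \<delta> + \<epsilon>\<^sup>2 / 8" .
    have "(nrm v)\<^sup>2 = (nrm (\<lambda>x. ?d x + Q x))\<^sup>2" by simp
    also have "\<dots> = (nrm ?d)\<^sup>2 + 2 * Re (ip ?d Q) + (nrm Q)\<^sup>2" by (rule nrm_add_sq[OF Ld LQ])
    finally have "(nrm ?d)\<^sup>2 = (nrm v)\<^sup>2 - 2 * pi - 2 * Re (ip ?d Q)" by (simp add: nrm_Q)
    also have "\<dots> < \<delta> + 2 * (C * \<delta> + \<epsilon>\<^sup>2 / 8)" 
    proof -
      have "a - 2 * pi - 2 * b < \<delta> + 2 * c" if "a < 2 * pi + \<delta>" "- b \<le> c" for a b c :: real using that by linarith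
      from this[OF small(2) abs_le_D2[OF order_trans[OF abs_Re_le_cmod ipb]]] show ?thesis .
    qed
    also have "\<dots> = \<delta> * (1 + 2 * C) + \<epsilon>\<^sup>2 / 4" by (simp add: algebra_simps)
    also have "\<dots> \<le> \<epsilon>\<^sup>2" using \<delta>(3) zero_le_power2[of \<epsilon>] by linarith
    finally show "nrm ?d < \<epsilon>" by (rule power2_less_imp_less) (use \<epsilon> in simp)
  qed
qed

subsection \<open>Symmetries\<close>

text \<open>Obtained from the modulation rule applied to the transform itself, read back through
  inversion.\<close>

lemma fourier_L2_shift:
  assumes f: "fourier_L2 f F"
  shows "fourier_L2 (\<lambda>x. f (x + s)) (\<lambda>\<xi>. exp (\<i> * complex_of_real (s * \<xi>)) * F \<xi>)"
proof -
  let ?H = "\<lambda>\<xi>. exp (\<i> * complex_of_real (s * \<xi>)) * F \<xi>"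
  note L = fourier_L2_L2[OF f]
  note FF = FT[OF L(2)]
  have HL: "L2 ?H" by (rule L2_modulate[OF L(2)])
  have "AE x in lborel. FT F (- x) = f x" by (rule L2_eq_of_transform_eq[OF Fourier_inversion[OF L(2)] f]) simp
  then have 1: "AE x in lborel. FT F (- (s + 1 * x)) = f (s + 1 * x)" by (rule AE_lborel_affine) simp
  have "AE \<xi> in lborel. FT ?H \<xi> = FT F (\<xi> - s)" by (rule FT_eqI[OF fourier_L2_modulate[OF FF]])
  then have "AE x in lborel. FT ?H (- x) = FT F (- x - s)" by (rule AE_lborel_reflect)
  with 1 have "AE x in lborel. FT ?H (- x) = f (x + s)"
    by eventually_elim (simp add: algebra_simps)
  then show ?thesis
    by (rule fourier_L2_cong_AE[OF Fourier_inversion[OF HL], rotated]) (use L2_shift[OF L(1)] HL in \<open>auto dest: L2_measurable\<close>)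
qed

lemma hardy_affine:
  assumes "hardy f" "b > 0" shows "hardy (\<lambda>x. f (b * x + s))"
proof (rule hardyI[OF fourier_L2_dilate[OF fourier_L2_shift[OF FT] assms(2)]])
  show "L2 f" using assms(1) by simp
  have "AE \<xi> in lborel. 0 + (1 / b) * \<xi> < 0 \<longrightarrow> FT f (0 + (1 / b) * \<xi>) = 0"
    by (rule AE_lborel_affine[OF hardy_FT[OF assms(1)]]) (use assms(2) in simp)
  then show "AE \<xi> in lborel. \<xi> < 0 \<longrightarrow> complex_of_real (1 / b) * (exp (\<i> * complex_of_real (s * (\<xi> / b))) * FT f (\<xi> / b)) = 0"
    by eventually_elim (use assms(2) in \<open>auto simp: divide_less_0_iff\<close>)
qed

lemma L2_affine:
  assumes "b > 0" shows "L2 f \<Longrightarrow> L2 (\<lambda>x. f (b * x + s))" "nrm (\<lambda>x. f (b * x + s)) = nrm f / sqrt b"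
  using L2_dilate(1)[OF assms L2_shift, of f s] L2_dilate(2)[OF assms, of "\<lambda>x. f (x + s)"] by simp_all

lemma H1_affine:
  assumes f: "H1 f f'" and b: "b > 0" shows "H1 (\<lambda>x. f (b * x + s)) (\<lambda>x. complex_of_real b * f' (b * x + s))"
  unfolding H1_def
proof (intro conjI allI impI)
  show "L2 (\<lambda>x. f (b * x + s))" "L2 (\<lambda>x. complex_of_real b * f' (b * x + s))"
    using L2_affine(1)[OF b] H1_L2[OF f] by auto
  fix p q :: real assume "p \<le> q"
  then have "b * p + s \<le> b * q + s" using b by simp
  then have "f (b * q + s) - f (b * p + s) = (LINT x|lborel. indicator {b * p + s..b * q + s} x *\<^sub>R f' x)"
    using H1_diff_eq[OF f] by (simp add: set_lebesgue_integral_def)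
  also have "\<dots> = \<bar>b\<bar> *\<^sub>R (LINT x|lborel. indicator {b * p + s..b * q + s} (s + b * x) *\<^sub>R f' (s + b * x))"
    by (rule lborel_integral_real_affine) (use b in simp)
  also have "\<dots> = complex_of_real b * (LINT x|lborel. indicator {p..q} x *\<^sub>R f' (b * x + s))"
  proof -
    have "(indicator {b * p + s..b * q + s} (s + b * x) :: real) = indicator {p..q} x" for x
      using b by (auto simp: indicator_def)
    then show ?thesis using b by (simp add: scaleR_conv_of_real add.commute)
  qed
  also have "\<dots> = (LINT x:{p..q}|lborel. complex_of_real b * f' (b * x + s))"
    unfolding set_lebesgue_integral_def integral_mult_right_zero[symmetric] by simp
  finally show "f (b * q + s) - f (b * p + s) = (LINT x:{p..q}|lborel. complex_of_real b * f' (b * x + s))" .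
qed

text \<open>Scaling, translation and phase are symmetries of the first-order system. The mass is
  invariant, while the residual picks up the factor \<open>b\<close>, so smallness survives only as
  long as \<open>b\<close> is bounded.\<close>

lemma szego_pair_rescale:
  fixes s :: real
  assumes p: "szego_pair u u' g g'" and b: "b > 0" and c: "cmod c = 1"
  defines "v \<equiv> \<lambda>x. c * complex_of_real (sqrt b) * u (b * x + s)"
    and "v' \<equiv> \<lambda>x. c * complex_of_real (sqrt b) * (complex_of_real b * u' (b * x + s))"
    and "f \<equiv> \<lambda>x. complex_of_real b * g (b * x + s)"
    and "f' \<equiv> \<lambda>x. complex_of_real b * (complex_of_real b * g' (b * x + s))"
  shows "szego_pair v v' f f'" "nrm v = nrm u" "nrm (residual v v' f) = b * nrm (residual u u' g)"
proof -
  have H: "H1 u u'" "H1 g g'" "hardy g" and sum: "\<And>x. g x + cnj (g x) = u x * cnj (u x)" using p by (auto simp: szego_pair_def)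
  have cc: "c * cnj c = 1" using c by (simp add: complex_norm_square[symmetric])
  have bb: "complex_of_real (sqrt b) * complex_of_real (sqrt b) = complex_of_real b" using b by (simp flip: of_real_mult)
  show "szego_pair v v' f f'" unfolding szego_pair_def
  proof (intro conjI allI)
    show "H1 v v'" unfolding v_def v'_def by (intro H1_cmult H1_affine H b)
    show "H1 f f'" unfolding f_def f'_def by (intro H1_cmult H1_affine H b)
    show "hardy f" unfolding f_def by (intro hardy_cmult hardy_affine H b)
    fix x
    have "f x + cnj (f x) = complex_of_real b * (u (b * x + s) * cnj (u (b * x + s)))"
      unfolding f_def sum[symmetric] by (simp add: algebra_simps)
    also have "\<dots> = (c * cnj c) * (complex_of_real (sqrt b) * complex_of_real (sqrt b)) * (u (b * x + s) * cnj (u (b * x + s)))"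
      unfolding cc bb by simp
    also have "\<dots> = v x * cnj (v x)" by (simp add: v_def mult_ac)
    finally show "f x + cnj (f x) = v x * cnj (v x)" .
  qed
  have "nrm v = cmod (c * complex_of_real (sqrt b)) * (nrm u / sqrt b)"
    unfolding v_def nrm_scale L2_affine(2)[OF b] ..
  then show "nrm v = nrm u" using b c by (simp add: norm_mult)
  have "residual v v' f = (\<lambda>x. (c * complex_of_real (sqrt b) * complex_of_real b) * residual u u' g (b * x + s))"
    by (auto simp: residual_def v_def v'_def f_def algebra_simps)
  then have "nrm (residual v v' f) = cmod (c * complex_of_real (sqrt b) * complex_of_real b) * (nrm (residual u u' g) / sqrt b)"
    using nrm_scale[of "c * complex_of_real (sqrt b) * complex_of_real b"] L2_affine(2)[OF b, of "residual u u' g" s] by simp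
  then show "nrm (residual v v' f) = b * nrm (residual u u' g)" using b c by (simp add: norm_mult)
qed

lemma szego_pair_bounds:
  assumes p: "szego_pair u u' g g'" and B: "\<And>x. cmod (u x) \<le> B"
  shows "nrm g \<le> B * nrm u" "nrm g' \<le> 2 * B * nrm u'"
proof -
  have H: "H1 u u'" "H1 g g'" "hardy g" and sum: "\<And>x. g x + cnj (g x) = u x * cnj (u x)" using p by (auto simp: szego_pair_def)
  note L = H1_L2[OF H(1)]
  have m: "u \<in> borel_measurable borel" "(\<lambda>x. cnj (u x)) \<in> borel_measurable borel" using H1_measurable[OF H(1)] by auto
  have B': "\<And>x. cmod (cnj (u x)) \<le> B" using B by simp
  have eq: "(\<lambda>x. g x + cnj (g x)) = (\<lambda>x. u x * cnj (u x))" using sum by auto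
  have "nrm g \<le> nrm (\<lambda>x. u x * cnj (u x))" using nrm_hardy_le_real_part[OF H(3)] eq by simp
  also have "\<dots> \<le> B * nrm (\<lambda>x. cnj (u x))" by (rule nrm_bounded_mult(1)[OF L2_cnj[OF L(1)] m(1) B])
  finally show "nrm g \<le> B * nrm u" by simp
  have ae: "AE x in lborel. g' x + cnj (g' x) = rho_deriv u u' x"
    using H1_deriv_unique[OF H1_add[OF H(2) H1_cnj[OF H(2)]]] rho_H1[OF H(1)] eq by simp
  have "nrm g' \<le> nrm (\<lambda>x. g' x + cnj (g' x))" by (rule nrm_hardy_le_real_part[OF hardy_deriv[OF H(3,2)]])
  also have "\<dots> = nrm (rho_deriv u u')"
    by (rule nrm_cong_AE[OF _ _ ae]) (use H1_measurable[OF H(2)] L2_measurable[OF rho_deriv_L2[OF H(1)]] in auto)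
  also have "\<dots> \<le> nrm (\<lambda>x. u' x * cnj (u x)) + nrm (\<lambda>x. u x * cnj (u' x))"
    unfolding rho_deriv_def by (rule nrm_triangle[OF L2_bounded_mult(2)[OF L(2) m(2) B'] L2_bounded_mult(1)[OF L2_cnj[OF L(2)] m(1) B]])
  also have "\<dots> \<le> B * nrm u' + B * nrm (\<lambda>x. cnj (u' x))"
    by (rule add_mono[OF nrm_bounded_mult(2)[OF L(2) m(2) B'] nrm_bounded_mult(1)[OF L2_cnj[OF L(2)] m(1) B]])
  finally show "nrm g' \<le> 2 * B * nrm u'" by simp
qed

text \<open>Both bounds come from the product form of the sup estimate. For \<open>g\<close> it
  yields 72 times the square of \<open>nrm u'\<close>, and 81 is the next square.\<close>

lemma szego_pair_sup_bounds:
  assumes p: "szego_pair u u' g g'" and m: "nrm u \<le> 3"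
  shows "(cmod (u x))\<^sup>2 \<le> 6 * nrm u'" "cmod (g x) \<le> 9 * nrm u'"
proof -
  have H: "H1 u u'" "H1 g g'" using p by (auto simp: szego_pair_def)
  have u: "(cmod (u x))\<^sup>2 \<le> 6 * nrm u'" for x
    using H1_sup_bound_sq[OF H(1), of x] mult_right_mono[OF m nrm_nonneg[of u']] by linarith
  then show "(cmod (u x))\<^sup>2 \<le> 6 * nrm u'" .
  define B where "B = sqrt (6 * nrm u')"
  have BB: "B * B = 6 * nrm u'" by (simp add: B_def)
  have B0: "B \<ge> 0" by (simp add: B_def)
  have B: "cmod (u x) \<le> B" for x unfolding B_def by (rule real_le_rsqrt) (rule u)
  note gb = szego_pair_bounds[OF p B]
  have "(cmod (g x))\<^sup>2 \<le> 2 * nrm g * nrm g'" by (rule H1_sup_bound_sq[OF H(2)])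
  also have "\<dots> \<le> 2 * (B * 3) * (2 * B * nrm u')"
    using gb mult_left_mono[OF m B0] B0 by (intro mult_mono) auto
  also have "\<dots> = 12 * (B * B) * nrm u'" by simp
  also have "\<dots> = 72 * (nrm u' * nrm u')" unfolding BB by simp
  also have "\<dots> \<le> (9 * nrm u')\<^sup>2" by (simp add: power2_eq_square)
  finally show "cmod (g x) \<le> 9 * nrm u'" by (rule power2_le_imp_le) simp
qed

text \<open>If \<open>u\<close> were small everywhere, \<open>u'\<close> would be the residual plus
  a small product \<open>u * g\<close>, with norm at most \<open>1/2 + 3/7\<close> of
  \<open>nrm u'\<close>. Since this sum is below 1, \<open>u\<close> is large somewhere.\<close>

lemma szego_pair_concentration:
  assumes p: "szego_pair u u' g g'" and m: "nrm u \<le> 3" and N: "nrm u' > 0" and r: "nrm (residual u u' g) \<le> nrm u' / 2"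
  obtains x where "(cmod (u x))\<^sup>2 > nrm u' / 7"
proof (rule ccontr)
  assume "\<not> thesis"
  then have "\<And>x. (cmod (u x))\<^sup>2 \<le> nrm u' / 7" using that by (metis not_le)
  define B where "B = sqrt (nrm u' / 7)"
  have BB: "B * B = nrm u' / 7" by (simp add: B_def)
  have B0: "B \<ge> 0" by (simp add: B_def)
  have B: "cmod (u x) \<le> B" for x unfolding B_def by (rule real_le_rsqrt) fact
  have H: "H1 u u'" "H1 g g'" using p by (auto simp: szego_pair_def)
  note L = H1_L2(1)[OF H(2)] residual_L2[OF p]
  have um: "u \<in> borel_measurable borel" using H1_measurable[OF H(1)] by simp
  have L': "L2 (\<lambda>x. \<i> * (u x * g x))" by (rule L2_cmult[OF L2_bounded_mult(1)[OF L(1) um B]])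
  have "u' = (\<lambda>x. residual u u' g x + \<i> * (u x * g x))" by (auto simp: residual_def)
  then have "nrm u' \<le> nrm (residual u u' g) + nrm (\<lambda>x. \<i> * (u x * g x))" using nrm_triangle[OF L(2) L'] by simp
  also have "nrm (\<lambda>x. \<i> * (u x * g x)) = nrm (\<lambda>x. u x * g x)" unfolding nrm_scale by simp
  also have "\<dots> \<le> B * nrm g" by (rule nrm_bounded_mult(1)[OF L(1) um B])
  also have "\<dots> \<le> B * (B * 3)" using szego_pair_bounds(1)[OF p B] mult_left_mono[OF m B0] B0 by (intro mult_left_mono) auto
  also have "\<dots> = 3 * nrm u' / 7" using BB by simp
  finally show False using r N by simp
qed

text \<open>The reciprocal of \<open>gQ q\<close> is \<open>1 - \<i> * q\<close>, so a complex
  number with positive real part becomes a value of \<open>gQ\<close> after multiplication by a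
  suitable \<open>b > 0\<close>. Here the real part of \<open>g x\<close> is half the squared
  modulus of \<open>u x\<close>, and concentration makes it comparable to \<open>nrm u'\<close>;
  this bounds \<open>b\<close> and \<open>q\<close>.\<close>

lemma szego_pair_normalise:
  assumes p: "szego_pair u u' g g'" and m: "nrm u \<le> 3" and N: "nrm u' > 0" and r: "nrm (residual u u' g) \<le> nrm u' / 2"
  obtains b s \<theta> q where "b > 0" "b \<le> 14 / nrm u'" "\<bar>q\<bar> \<le> 126" "complex_of_real b * g (b * q + s) = gQ q"
    "exp (\<i> * complex_of_real \<theta>) * complex_of_real (sqrt b) * u (b * q + s) = Q q"
proof -
  obtain x where x: "(cmod (u x))\<^sup>2 > nrm u' / 7" by (rule szego_pair_concentration[OF p m N r])
  have sum: "\<And>x. g x + cnj (g x) = u x * cnj (u x)" using p by (auto simp: szego_pair_def)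
  define \<alpha> where "\<alpha> = Re (g x)"
  define \<beta> where "\<beta> = Im (g x)"
  have gx: "g x = Complex \<alpha> \<beta>" by (simp add: \<alpha>_def \<beta>_def)
  have "complex_of_real (2 * Re (g x)) = complex_of_real ((cmod (u x))\<^sup>2)"
    using sum[of x] by (simp add: complex_add_cnj complex_norm_square[symmetric] del: of_real_mult)
  then have au: "2 * \<alpha> = (cmod (u x))\<^sup>2" unfolding \<alpha>_def by (simp only: of_real_eq_iff)
  have \<alpha>: "\<alpha> > nrm u' / 14" using x au by simp
  have \<alpha>0: "\<alpha> > 0" using \<alpha> N by (meson divide_pos_pos less_trans zero_less_numeral)
  define n where "n = \<alpha>\<^sup>2 + \<beta>\<^sup>2"
  have n: "n > 0" "\<alpha>\<^sup>2 \<le> n" using \<alpha>0 by (auto simp: n_def add_pos_nonneg)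
  \<comment> \<open>Read off from the reciprocal of \<open>g x\<close>, which is
    \<open>(\<alpha> - \<i> * \<beta>) / n\<close>. The bound 126 for \<open>q\<close> is the
    quotient of \<open>9 * nrm u'\<close> and \<open>nrm u' / 14\<close>.\<close>
  define b where "b = \<alpha> / n"
  define q where "q = \<beta> / \<alpha>"
  define s where "s = x - b * q"
  have b: "b > 0" using \<alpha>0 n by (simp add: b_def)
  have xq: "b * q + s = x" by (simp add: s_def)
  have "b \<le> 1 / \<alpha>" using n \<alpha>0 by (simp add: b_def field_simps power2_eq_square)
  also have "\<dots> \<le> 14 / nrm u'" using \<alpha> \<alpha>0 N by (simp add: field_simps)
  finally have b14: "b \<le> 14 / nrm u'" .
  have "\<bar>\<beta>\<bar> \<le> cmod (g x)" unfolding \<beta>_def by (rule abs_Im_le_cmod)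
  also have "\<dots> \<le> 9 * nrm u'" by (rule szego_pair_sup_bounds(2)[OF p m])
  also have "\<dots> \<le> 126 * \<alpha>" using \<alpha> by simp
  finally have q: "\<bar>q\<bar> \<le> 126" using \<alpha>0 by (simp add: q_def abs_divide field_simps)
  have qi: "complex_of_real b * g x * (complex_of_real q + \<i>) = \<i>"
  proof -
    have "b * (\<alpha> * q) - b * \<beta> = 0" using \<alpha>0 by (simp add: q_def)
    moreover have "b * (\<alpha> + \<beta> * q) = 1"
    proof -
      have "\<alpha> + \<beta> * q = n / \<alpha>" using \<alpha>0 by (simp add: q_def n_def field_simps power2_eq_square)
      then show ?thesis using n \<alpha>0 by (simp add: b_def)
    qed
    ultimately show ?thesis unfolding gx by (simp add: complex_eq_iff algebra_simps)
  qed
  then have gq: "complex_of_real b * g x = gQ q"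
    unfolding gQ_def by (simp add: nonzero_eq_divide_eq)
  \<comment> \<open>Once the \<open>g\<close> components agree at the point, so do the moduli,
    because both pairs satisfy the same real part relation; a phase adjusts the rest.\<close>
  have "complex_of_real ((cmod (Q q))\<^sup>2) = gQ q + cnj (gQ q)" by (simp add: gQ_add_cnj complex_norm_square del: of_real_power)
  also have "\<dots> = complex_of_real b * (g x + cnj (g x))" unfolding gq[symmetric] by (simp add: algebra_simps)
  also have "\<dots> = complex_of_real (b * (cmod (u x))\<^sup>2)" unfolding sum by (simp add: complex_norm_square del: of_real_power)
  finally have Qu: "(cmod (Q q))\<^sup>2 = b * (cmod (u x))\<^sup>2" by (simp only: of_real_eq_iff)
  let ?z = "complex_of_real (sqrt b) * u x"
  have "(cmod ?z)\<^sup>2 = (cmod (Q q))\<^sup>2" using b Qu by (simp add: norm_mult power_mult_distrib)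
  then have zQ: "cmod ?z = cmod (Q q)" by (simp add: power2_eq_iff_nonneg)
  have z0: "?z \<noteq> 0" using b au \<alpha>0 by auto
  then have "cmod ?z \<noteq> 0" unfolding norm_eq_zero .
  then have "cmod (Q q / ?z) = 1" unfolding norm_divide zQ by simp
  then obtain \<theta> where \<theta>: "Q q / ?z = exp (\<i> * complex_of_real \<theta>)" using complex_norm_eq_1_exp[of "Q q / ?z"] by (metis)
  have "exp (\<i> * complex_of_real \<theta>) * complex_of_real (sqrt b) * u x = Q q"
    unfolding \<theta>[symmetric] mult.assoc using z0 by simp
  then show ?thesis using that[OF b b14 q, of s \<theta>] gq unfolding xq by blast
qed

text \<open>The lower bound \<open>c\<close> enters through \<open>b \<le> 14 / nrm u'\<close>: it
  keeps the rescaled residual below \<open>14 / c\<close> times the original one. Without it a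
  spread-out profile with small residual could be magnified.\<close>

theorem szego_pair_orbital_stability:
  assumes \<epsilon>: "\<epsilon> > 0" and c: "c > 0"
  obtains \<delta> where "\<delta> > 0" "\<delta> \<le> 1" "\<And>u u' g g'. szego_pair u u' g g' \<Longrightarrow> nrm u' \<ge> c \<Longrightarrow> (nrm u)\<^sup>2 < 2 * pi + \<delta> \<Longrightarrow> nrm (residual u u' g) < \<delta> \<Longrightarrow>
     \<exists>b s \<theta>. b > 0 \<and> nrm (\<lambda>x. exp (\<i> * complex_of_real \<theta>) * complex_of_real (sqrt b) * u (b * x + s) - Q x) < \<epsilon>
       \<and> nrm (\<lambda>x. exp (\<i> * complex_of_real \<theta>) * complex_of_real (sqrt b) * (complex_of_real b * u' (b * x + s)) - dQ x) < \<epsilon>"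
proof -
  \<comment> \<open>\<open>residual_vs_deriv\<close> with the bounds 10 and 126 has constant
    \<open>126 + 2 * (10 + 2) = 150\<close>, and 150/400 is below one half; the other half is left
    for the residual.\<close>
  define \<epsilon>1 where "\<epsilon>1 = \<epsilon> / 400"
  have \<epsilon>1: "\<epsilon>1 > 0" using \<epsilon> by (simp add: \<epsilon>1_def)
  obtain \<delta>1 where \<delta>1: "\<delta>1 > 0" "\<And>v v' g g' p. szego_pair v v' g g' \<Longrightarrow> (\<And>x. cmod (v x) \<le> 10) \<Longrightarrow> (\<And>x. cmod (g x) \<le> 126)
     \<Longrightarrow> \<bar>p\<bar> \<le> 126 \<Longrightarrow> g p = gQ p \<Longrightarrow> v p = Q p \<Longrightarrow> nrm (residual v v' g) < \<delta>1 \<Longrightarrow> (nrm v)\<^sup>2 < 2 * pi + \<delta>1 \<Longrightarrow> nrm (\<lambda>x. v x - Q x) < \<epsilon>1"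
    using szego_pair_L2_close[OF \<epsilon>1, of 126 10 126] by auto
  \<comment> \<open>In order: mass below 9, the concentration lemma, the mass condition for
    closeness, and after rescaling by at most \<open>14 / c\<close> a residual below
    \<open>\<delta>1\<close> and below half of \<epsilon>.\<close>
  define \<delta> where "\<delta> = Min {1, c / 2, \<delta>1, c * \<delta>1 / 14, c * \<epsilon> / 28}"
  have \<delta>: "\<delta> > 0" "\<delta> \<le> 1" "\<delta> \<le> c / 2" "\<delta> \<le> \<delta>1" "\<delta> \<le> c * \<delta>1 / 14" "\<delta> \<le> c * \<epsilon> / 28"
    unfolding \<delta>_def using c \<delta>1(1) \<epsilon> by auto
  show ?thesis
  proof (rule that[OF \<delta>(1,2)])
    fix u u' g g'
    assume p: "szego_pair u u' g g'" and N: "nrm u' \<ge> c" and m: "(nrm u)\<^sup>2 < 2 * pi + \<delta>" and r: "nrm (residual u u' g) < \<delta>"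
    have N0: "nrm u' > 0" using N c by linarith
    have "(nrm u)\<^sup>2 \<le> 3\<^sup>2" using m \<delta>(2) pi_less_4 by simp
    then have m3: "nrm u \<le> 3" by (rule power2_le_imp_le) simp
    have r2: "nrm (residual u u' g) \<le> nrm u' / 2" using r \<delta>(3) N by linarith
    obtain b s \<theta> q where b: "b > 0" "b \<le> 14 / nrm u'" and q: "\<bar>q\<bar> \<le> 126" "complex_of_real b * g (b * q + s) = gQ q"
      "exp (\<i> * complex_of_real \<theta>) * complex_of_real (sqrt b) * u (b * q + s) = Q q"
      by (rule szego_pair_normalise[OF p m3 N0 r2])
    let ?c = "exp (\<i> * complex_of_real \<theta>)"
    define v where "v = (\<lambda>x. ?c * complex_of_real (sqrt b) * u (b * x + s))"
    define v' where "v' = (\<lambda>x. ?c * complex_of_real (sqrt b) * (complex_of_real b * u' (b * x + s)))"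
    define f where "f = (\<lambda>x. complex_of_real b * g (b * x + s))"
    define f' where "f' = (\<lambda>x. complex_of_real b * (complex_of_real b * g' (b * x + s)))"
    note S = szego_pair_rescale[OF p b(1), of ?c s, folded v_def v'_def f_def f'_def, simplified]
    have bN: "b * nrm u' \<le> 14" using b(2) N0 by (simp add: field_simps)
    have vB: "cmod (v x) \<le> 10" for x
    proof -
      have "(cmod (v x))\<^sup>2 = b * (cmod (u (b * x + s)))\<^sup>2" using b(1) by (simp add: v_def norm_mult power_mult_distrib)
      also have "\<dots> \<le> b * (6 * nrm u')" using szego_pair_sup_bounds(1)[OF p m3] b(1) by (intro mult_left_mono) auto
      also have "\<dots> \<le> 10\<^sup>2" using bN by simp
      finally show ?thesis by (rule power2_le_imp_le) simp
    qed
    have fG: "cmod (f x) \<le> 126" for x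
    proof -
      have "cmod (f x) = b * cmod (g (b * x + s))" using b(1) by (simp add: f_def norm_mult)
      also have "\<dots> \<le> b * (9 * nrm u')" using szego_pair_sup_bounds(2)[OF p m3] b(1) by (intro mult_left_mono) auto
      also have "\<dots> \<le> 126" using bN by simp
      finally show ?thesis .
    qed
    have rb: "nrm (residual v v' f) * c \<le> 14 * nrm (residual u u' g)"
    proof -
      have "nrm (residual v v' f) * c \<le> b * nrm (residual u u' g) * nrm u'"
        unfolding S(3) using N b(1) c by (intro mult_left_mono) auto
      also have "\<dots> = (b * nrm u') * nrm (residual u u' g)" by simp
      also have "\<dots> \<le> 14 * nrm (residual u u' g)" using bN by (intro mult_right_mono) auto
      finally show ?thesis .
    qed
    have r1: "nrm (residual v v' f) < \<delta>1" "nrm (residual v v' f) < \<epsilon> / 2"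
    proof -
      have "nrm (residual v v' f) * c < \<delta>1 * c" using rb r \<delta>(5) by (simp add: mult.commute)
      then show "nrm (residual v v' f) < \<delta>1" using c by simp
      have "nrm (residual v v' f) * c < \<epsilon> / 2 * c" using rb r \<delta>(6) by (simp add: mult.commute)
      then show "nrm (residual v v' f) < \<epsilon> / 2" using c by simp
    qed
    have L: "nrm (\<lambda>x. v x - Q x) < \<epsilon>1"
      by (rule \<delta>1(2)[OF S(1) vB fG q(1) _ _ r1(1)]) (use q m S(2) \<delta>(4) in \<open>auto simp: v_def f_def\<close>)
    have Hv: "H1 v v'" using S(1) by (simp add: szego_pair_def)
    have "nrm (\<lambda>x. v' x - dQ x) \<le> nrm (residual v v' f) + nrm (\<lambda>x. residual v v' f x - (v' x - dQ x))"
      using nrm_triangle_diff[OF residual_L2[OF S(1)] L2_diff[OF residual_L2[OF S(1)] L2_diff[OF H1_L2(2)[OF Hv] H1_L2(2)[OF Q_H1]]]] by simp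
    moreover have "nrm (\<lambda>x. residual v v' f x - (v' x - dQ x)) \<le> (126 + 2 * (10 + 2)) * nrm (\<lambda>x. v x - Q x)"
      by (rule residual_vs_deriv[OF S(1) vB fG])
    moreover have "400 * nrm (\<lambda>x. v x - Q x) < \<epsilon>" "2 * nrm (residual v v' f) < \<epsilon>" using L r1(2) by (simp_all add: \<epsilon>1_def)
    moreover have "a < \<epsilon>" if "a \<le> p + q" "q \<le> (126 + 2 * (10 + 2)) * r" "400 * r < \<epsilon>" "2 * p < \<epsilon>" for a p q r :: real
      using that \<epsilon> by simp
    ultimately have "nrm (\<lambda>x. v' x - dQ x) < \<epsilon>" by blast
    moreover have "nrm (\<lambda>x. v x - Q x) < \<epsilon>" using L \<epsilon> by (simp add: \<epsilon>1_def)
    ultimately show "\<exists>b s \<theta>. b > 0 \<and> nrm (\<lambda>x. exp (\<i> * complex_of_real \<theta>) * complex_of_real (sqrt b) * u (b * x + s) - Q x) < \<epsilon>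
       \<and> nrm (\<lambda>x. exp (\<i> * complex_of_real \<theta>) * complex_of_real (sqrt b) * (complex_of_real b * u' (b * x + s)) - dQ x) < \<epsilon>"
      using b(1) unfolding v_def v'_def by blast
  qed
qed

subsection \<open>Orbital stability\<close>

lemma nrm_Lax_residual:
  assumes u: "H1 u u'" "hardy u"
  obtains g g' where "szego_pair u u' g g'" "nrm (Lax u u') = nrm (residual u u' g)"
proof -
  obtain s where s: "H1 s (Pr (rho_deriv u u'))" "hardy s" "AE x in lborel. Pr (\<lambda>x. u x * cnj (u x)) x = s x"
    "\<And>x. s x + cnj (s x) = u x * cnj (u x)" by (rule rho_rep[OF u(1)]) (rule that, assumption+)
  have p: "szego_pair u u' s (Pr (rho_deriv u u'))" using s u by (simp add: szego_pair_def)
  have "AE x in lborel. Lax u u' x = - \<i> * residual u u' s x"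
    using s(3)
  proof eventually_elim
    case (elim x)
    have "Lax u u' x = - \<i> * u' x - u x * Pr (\<lambda>x. u x * cnj (u x)) x" by (simp add: Lax_def Tu_def mult.commute)
    also have "\<dots> = - \<i> * u' x - u x * s x" unfolding elim ..
    also have "\<dots> = - \<i> * residual u u' s x" by (simp add: residual_def algebra_simps)
    finally show ?case .
  qed
  then have "nrm (Lax u u') = nrm (\<lambda>x. - \<i> * residual u u' s x)"
    by (rule nrm_cong_AE[rotated 2]) (intro L2_measurable Lax_L2[OF u(1)] L2_cmult residual_L2[OF p])+
  also have "\<dots> = nrm (residual u u' s)" unfolding nrm_scale by simp
  finally show ?thesis using that p by blast
qed

text \<open>Continuity of residual and mass at \<open>Q\<close>, where the residual is 0 and the
  mass \<open>2 * pi\<close>; the bound is linear in the distance.\<close>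

lemma residual_near_Q:
  assumes p: "szego_pair u u' g g'" and d: "nrm (\<lambda>x. u x - Q x) \<le> d" "nrm (\<lambda>x. u' x - dQ x) \<le> d" "d \<le> 1"
  defines "M \<equiv> nrm Q + nrm dQ + 2"
  shows "nrm (residual u u' g) \<le> (1 + 3 * M\<^sup>2 + 2 * (M + 2)) * d" "(nrm u)\<^sup>2 \<le> 2 * pi + 2 * M * d"
proof -
  have H: "H1 u u'" "H1 g g'" using p by (auto simp: szego_pair_def)
  note L = H1_L2[OF H(1)] H1_L2[OF Q_H1]
  have un: "nrm u \<le> nrm Q + d" "nrm u' \<le> nrm dQ + d"
    using nrm_triangle_rev[OF L(1,3)] nrm_triangle_rev[OF L(2,4)] d by linarith+
  have M: "nrm u \<le> M" "nrm u' \<le> M" "nrm u + nrm u' \<le> M" "0 \<le> M" "nrm Q + d \<le> M"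
    using un d nrm_nonneg[of u'] nrm_nonneg[of u] nrm_nonneg[of Q] nrm_nonneg[of dQ] unfolding M_def by linarith+
  have d0: "0 \<le> d" using d(1) nrm_nonneg order_trans by blast
  have B: "cmod (u x) \<le> M" for x using H1_sup_bound[OF H(1)] M(3) order_trans by blast
  have G: "cmod (g x) \<le> 3 * M\<^sup>2" for x
  proof -
    have "nrm g \<le> M * M" using szego_pair_bounds(1)[OF p B] mult_left_mono[OF M(1,4)] by linarith
    moreover have "nrm g' \<le> 2 * M * M" using szego_pair_bounds(2)[OF p B] mult_left_mono[OF M(2), of "2 * M"] M(4) by linarith
    ultimately show ?thesis using H1_sup_bound[OF H(2), of x] by (simp add: power2_eq_square)
  qed
  let ?D = "\<lambda>x. u' x - dQ x"
  have LD: "L2 ?D" using L by simp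
  note LR = residual_L2[OF p]
  have "nrm (residual u u' g) = nrm (\<lambda>x. (residual u u' g x - ?D x) + ?D x)" by simp
  also have "\<dots> \<le> nrm (\<lambda>x. residual u u' g x - ?D x) + nrm ?D" by (rule nrm_triangle[OF L2_diff[OF LR LD] LD])
  also have "\<dots> \<le> (3 * M\<^sup>2 + 2 * (M + 2)) * d + d"
  proof (rule add_mono[OF order_trans[OF residual_vs_deriv[OF p B G]] d(2)])
    show "(3 * M\<^sup>2 + 2 * (M + 2)) * nrm (\<lambda>x. u x - Q x) \<le> (3 * M\<^sup>2 + 2 * (M + 2)) * d"
      using M(4) d(1) by (intro mult_left_mono) auto
  qed
  finally show "nrm (residual u u' g) \<le> (1 + 3 * M\<^sup>2 + 2 * (M + 2)) * d" by (simp add: algebra_simps)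
  have "(nrm u)\<^sup>2 \<le> (nrm Q + d)\<^sup>2" using un(1) by (intro power_mono) auto
  also have "\<dots> = 2 * pi + (2 * nrm Q + d) * d" unfolding power2_sum nrm_Q by (simp add: power2_eq_square algebra_simps)
  also have "(2 * nrm Q + d) * d \<le> 2 * M * d" using M(5) d0 nrm_nonneg[of Q] by (intro mult_right_mono) auto
  finally show "(nrm u)\<^sup>2 \<le> 2 * pi + 2 * M * d" by simp
qed

lemma Hs_norm_diff_Q:
  assumes u: "L2 u" "H1 U U'" "AE x in lborel. u x = U x" and b: "b > 0"
  shows "(Hs_norm 1 (\<lambda>x. z * u (b * x + s) - Q x))\<^sup>2 
    = (nrm (\<lambda>x. z * U (b * x + s) - Q x))\<^sup>2 + (nrm (\<lambda>x. z * (complex_of_real b * U' (b * x + s)) - dQ x))\<^sup>2"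
proof (rule Hs_norm_H1(1))
  show "L2 (\<lambda>x. z * u (b * x + s) - Q x)"
    using L2_affine(1)[OF b u(1)] H1_L2(1)[OF Q_H1] by auto
  show "H1 (\<lambda>x. z * U (b * x + s) - Q x) (\<lambda>x. z * (complex_of_real b * U' (b * x + s)) - dQ x)"
    by (intro H1_diff H1_cmult H1_affine u b Q_H1)
  have "AE x in lborel. u (s + b * x) = U (s + b * x)" by (rule AE_lborel_affine[OF u(3)]) (use b in simp)
  then show "AE x in lborel. z * u (b * x + s) - Q x = z * U (b * x + s) - Q x"
    by eventually_elim (simp add: add.commute)
qed

theorem theorem2p1:
  fixes c :: real
  assumes "c > 0"
  shows "\<forall>\<epsilon>>0. \<exists>\<delta>>0. \<forall>u0 u I.
     in_Hs_plus 1 u0 \<and> Hs_norm 1 (\<lambda>x. u0 x - Q x) < \<delta> \<and>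
     max_solution I u \<and> u 0 = u0 \<and> (\<forall>t\<in>I. Hdot_norm 1 (u t) \<ge> c)
     \<longrightarrow> (\<forall>t\<in>I. (INF p \<in> {0<..} \<times> (UNIV :: real set) \<times> (UNIV :: real set).
            Hs_norm 1 (\<lambda>x. exp (\<i> * complex_of_real (fst (snd p))) * complex_of_real (sqrt (fst p))
                         * u t (fst p * x + snd (snd p)) - Q x)) < \<epsilon>)"
proof (intro allI impI)
  fix \<epsilon> :: real assume \<epsilon>: "\<epsilon> > 0"
  then have \<epsilon>2: "\<epsilon> / 2 > 0" by simp
  obtain \<delta>0 where \<delta>0: "\<delta>0 > 0" "\<delta>0 \<le> 1" "\<And>u u' g g'. szego_pair u u' g g' \<Longrightarrow> nrm u' \<ge> c \<Longrightarrow> (nrm u)\<^sup>2 < 2 * pi + \<delta>0 \<Longrightarrow> nrm (residual u u' g) < \<delta>0 \<Longrightarrow>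
     \<exists>b s \<theta>. b > 0 \<and> nrm (\<lambda>x. exp (\<i> * complex_of_real \<theta>) * complex_of_real (sqrt b) * u (b * x + s) - Q x) < \<epsilon> / 2
       \<and> nrm (\<lambda>x. exp (\<i> * complex_of_real \<theta>) * complex_of_real (sqrt b) * (complex_of_real b * u' (b * x + s)) - dQ x) < \<epsilon> / 2"
    by (rule szego_pair_orbital_stability[OF \<epsilon>2 assms]) (assumption | rule that | blast)+
  define M where "M = nrm Q + nrm dQ + 2"
  define C where "C = 1 + 3 * M\<^sup>2 + 2 * (M + 2)"
  have M: "M \<ge> 0" by (simp add: M_def)
  have C: "C > 0" "2 * M \<le> C" using M zero_le_power2[of M] unfolding C_def by (auto intro: add_pos_nonneg)
  \<comment> \<open>The factor 2 makes \<open>C * \<delta>\<close> strictly smaller than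
    \<open>\<delta>0\<close>, so that a nonstrict bound at time 0 becomes strict at every
    time.\<close>
  define \<delta> where "\<delta> = min 1 (\<delta>0 / (2 * C))"
  have \<delta>: "\<delta> > 0" "\<delta> \<le> 1" "C * \<delta> < \<delta>0"
  proof -
    show "\<delta> > 0" "\<delta> \<le> 1" using \<delta>0(1) C by (auto simp: \<delta>_def)
    have "C * \<delta> \<le> C * (\<delta>0 / (2 * C))" using C by (intro mult_left_mono) (auto simp: \<delta>_def)
    then show "C * \<delta> < \<delta>0" using C \<delta>0(1) by simp
  qed
  show "\<exists>\<delta>>0. \<forall>u0 u I.
     in_Hs_plus 1 u0 \<and> Hs_norm 1 (\<lambda>x. u0 x - Q x) < \<delta> \<and>
     max_solution I u \<and> u 0 = u0 \<and> (\<forall>t\<in>I. Hdot_norm 1 (u t) \<ge> c)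
     \<longrightarrow> (\<forall>t\<in>I. (INF p \<in> {0<..} \<times> (UNIV :: real set) \<times> (UNIV :: real set).
            Hs_norm 1 (\<lambda>x. exp (\<i> * complex_of_real (fst (snd p))) * complex_of_real (sqrt (fst p))
                         * u t (fst p * x + snd (snd p)) - Q x)) < \<epsilon>)"
  proof (rule exI[of _ \<delta>], intro conjI \<delta>(1) allI impI ballI, elim conjE)
    fix u0 u I t
    assume near: "Hs_norm 1 (\<lambda>x. u0 x - Q x) < \<delta>" and sol: "max_solution I u" and u0: "u 0 = u0"
      and low: "\<forall>t\<in>I. Hdot_norm 1 (u t) \<ge> c" and t: "t \<in> I"
    have "is_solution I u" using sol by (simp add: max_solution_def)
    then obtain U U' where f: "flow I U U'" and ae: "\<And>t. t \<in> I \<Longrightarrow> L2 (u t) \<and> (AE x in lborel. u t x = U t x)"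
      by (rule is_solution_flow) (rule that, assumption, iprover)
    have H: "H1 (U t) (U' t)" "hardy (U t)" and H0: "H1 (U 0) (U' 0)" "hardy (U 0)" and I0: "0 \<in> I"
      using f t by (auto simp: flow_def)
    obtain g g' where g: "szego_pair (U t) (U' t) g g'" "nrm (Lax (U t) (U' t)) = nrm (residual (U t) (U' t) g)"
      by (rule nrm_Lax_residual[OF H])
    obtain h h' where h: "szego_pair (U 0) (U' 0) h h'" "nrm (Lax (U 0) (U' 0)) = nrm (residual (U 0) (U' 0) h)"
      by (rule nrm_Lax_residual[OF H0])
    have "(Hs_norm 1 (\<lambda>x. u0 x - Q x))\<^sup>2 = (nrm (\<lambda>x. U 0 x - Q x))\<^sup>2 + (nrm (\<lambda>x. U' 0 x - dQ x))\<^sup>2"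
      using Hs_norm_diff_Q[of "u 0" "U 0" "U' 0" 1 1 0] ae[OF I0] H0(1) u0 by simp
    then have "(nrm (\<lambda>x. U 0 x - Q x))\<^sup>2 \<le> (Hs_norm 1 (\<lambda>x. u0 x - Q x))\<^sup>2" "(nrm (\<lambda>x. U' 0 x - dQ x))\<^sup>2 \<le> (Hs_norm 1 (\<lambda>x. u0 x - Q x))\<^sup>2"
      by simp_all
    then have "nrm (\<lambda>x. U 0 x - Q x) \<le> Hs_norm 1 (\<lambda>x. u0 x - Q x)" "nrm (\<lambda>x. U' 0 x - dQ x) \<le> Hs_norm 1 (\<lambda>x. u0 x - Q x)"
      using power2_le_imp_le[OF _ Hs_norm_nonneg] by blast+
    then have d: "nrm (\<lambda>x. U 0 x - Q x) \<le> \<delta>" "nrm (\<lambda>x. U' 0 x - dQ x) \<le> \<delta>" using near by linarith+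
    note n0 = residual_near_Q[OF h(1) d \<delta>(2), folded M_def, folded C_def]
    \<comment> \<open>Conservation carries both smallness conditions from time 0 to
      \<open>t\<close>; stability is then applied at time \<open>t\<close> alone, without continuity
      of the modulation parameters.\<close>
    have res: "nrm (residual (U t) (U' t) g) < \<delta>0"
      using flow_conservation(2)[OF f t] n0(1) \<delta>(3) unfolding g(2) h(2) by linarith
    have "2 * M * \<delta> \<le> C * \<delta>" using C(2) \<delta>(1) by (intro mult_right_mono) auto
    then have mass: "(nrm (U t))\<^sup>2 < 2 * pi + \<delta>0"
      using flow_conservation(1)[OF f t] n0(2) \<delta>(3) by simp
    have "Hdot_norm 1 (u t) = nrm (U' t)" using Hs_norm_H1(2) ae[OF t] H(1) by blast
    then have "c \<le> nrm (U' t)" using low t by auto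
    from \<delta>0(3)[OF g(1) this mass res] obtain b s \<theta> where b: "b > 0"
      and n: "nrm (\<lambda>x. exp (\<i> * complex_of_real \<theta>) * complex_of_real (sqrt b) * U t (b * x + s) - Q x) < \<epsilon> / 2"
       "nrm (\<lambda>x. exp (\<i> * complex_of_real \<theta>) * complex_of_real (sqrt b) * (complex_of_real b * U' t (b * x + s)) - dQ x) < \<epsilon> / 2"
      by blast
    let ?F = "\<lambda>p. Hs_norm 1 (\<lambda>x. exp (\<i> * complex_of_real (fst (snd p))) * complex_of_real (sqrt (fst p))
                         * u t (fst p * x + snd (snd p)) - Q x)"
    \<comment> \<open>Function and derivative each contribute less than half of \<epsilon>, so the
      sum of squares stays below its square.\<close>
    have "(?F (b, \<theta>, s))\<^sup>2 < (\<epsilon> / 2)\<^sup>2 + (\<epsilon> / 2)\<^sup>2"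
      unfolding fst_conv snd_conv
      using Hs_norm_diff_Q[of "u t" "U t" "U' t" b "exp (\<i> * complex_of_real \<theta>) * complex_of_real (sqrt b)" s] ae[OF t] H(1) b
        add_strict_mono[OF power_strict_mono[OF n(1) nrm_nonneg, of 2] power_strict_mono[OF n(2) nrm_nonneg, of 2]] by simp
    also have "\<dots> \<le> \<epsilon>\<^sup>2" by (simp add: power2_eq_square)
    finally have "?F (b, \<theta>, s) < \<epsilon>" by (rule power2_less_imp_less) (use \<epsilon> in simp)
    moreover have "(INF p \<in> {0<..} \<times> (UNIV :: real set) \<times> (UNIV :: real set). ?F p) \<le> ?F (b, \<theta>, s)"
      \<comment> \<open>The infimum over reals requires a lower bound of the family, which is
        0.\<close>
      by (rule cINF_lower) (use b in \<open>auto intro!: bdd_belowI[where m=0]\<close>)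
    ultimately show "(INF p \<in> {0<..} \<times> (UNIV :: real set) \<times> (UNIV :: real set). ?F p) < \<epsilon>" by linarith
  qed
qed

end
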